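(* Let $(\mathsf{S},\mu,\eta,\partial)$ be a coCartesian differential monad on a semi-additive (resp. additive) category $\mathbb{X}$, and let $(\mathsf{ALG}_{\mathsf{S}},\mathbb{T})$ be its (Rosický) tangent category of algebras. If $\mathsf{ALG}_{\mathsf{S}}$ has all reflexive coequalizers, then $(\mathsf{ALG}_{\mathsf{S}},\mathbb{T})$ has adjoint tangent structure. So $(\mathsf{ALG}_{\mathsf{S}}^{op},\mathbb{T}^\circ)$ is a (Rosický) tangent category, and there is a natural isomorphism $\tau_A:\mathsf{T}^\circ(\mathsf{S}(A),\mu_A)\to(\mathsf{S}(A\times A),\mu_{A\times A})$ which together with the free algebra functor $\mathsf{F}^{\mathsf{S}}:\mathbb{X}\to\mathsf{ALG}_{\mathsf{S}}$, $A\mapsto(\mathsf{S}(A),\mu_A)$, forms a strong (Rosický) tangent morphism $(\mathsf{F}^{\mathsf{S}},\tau):(\mathbb{X}^{op},\mathbb{B}^\circ)\to(\mathsf{ALG}_{\mathsf{S}}^{op},\mathbb{T}^\circ)$. If $\mathsf{ALG}_{\mathsf{S}}$ also has finite coproducts, then $(\mathsf{ALG}_{\mathsf{S}}^{op},\mathbb{T}^\circ)$ is a Cartesian (Rosický) tangent category, and $(\mathsf{F}^{\mathsf{S}},\tau):(\mathbb{X}^{op},\mathbb{B}^\circ)\to(\mathsf{ALG}_{\mathsf{S}}^{op},\mathbb{T}^\circ)$ is a strong Cartesian (Rosický) tangent morphism.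
   Context: **Monads.** A semi-additive category is a category with finite biproducts (written $\times$ with projections $\pi_j$ and pairing $\langle-,\dots,-\rangle$), hence enriched in commutative monoids; it is additive if homsets are abelian groups. $\mathsf{ALG}_{\mathsf{S}}$ is the Eilenberg–Moore category of $(\mathsf{S},\mu,\eta)$. A coCartesian differential monad on $\mathbb{X}$ is a monad $(\mathsf{S},\mu,\eta)$ with a natural transformation $\partial_A:\mathsf{S}(A)\to\mathsf{S}(A\times A)$ such that: [DC.1] $\mathsf{S}(\pi_1)\circ\partial_A=0$; [DC.2] $\mathsf{S}(\langle\pi_1,\pi_2,\pi_2\rangle)\circ\partial_A=\mathsf{S}(\langle\pi_1,\pi_2,0\rangle)\circ\partial_A+\mathsf{S}(\langle\pi_1,0,\pi_2\rangle)\circ\partial_A$; [DC.3] $\partial_A\circ\eta_A=\eta_{A\times A}\circ\langle0,1_A\rangle$; [DC.4] $\partial_A\circ\mu_A=\mu_{A\times A}\circ\mathsf{S}\big(\mathsf{S}(\langle1_A,0\rangle)\circ\pi_1+\partial_A\circ\pi_2\big)\circ\partial_{\mathsf{S}(A)}$; [DC.5] $\mathsf{S}(\langle\pi_1,\pi_4\rangle)\circ\partial_{A\times A}\circ\partial_A=\partial_A$; [DC.6] $\mathsf{S}(\langle\pi_1,\pi_3,\pi_2,\pi_4\rangle)\circ\partial_{A\times A}\circ\partial_A=\partial_{A\times A}\circ\partial_A$. **Tangent structures.** A tangent structure on a category consists of an endofunctor $\mathsf{T}$; a natural transformation $p_A:\mathsf{T}(A)\to A$ such that all $n$-fold pullbacks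 $\mathsf{T}_n(A)$ of $p_A$ (projections $q_j:\mathsf{T}_n(A)\to\mathsf{T}(A)$) exist and are preserved by every power $\mathsf{T}^m$; and natural transformations $s_A:\mathsf{T}_2(A)\to\mathsf{T}(A)$, $z_A:A\to\mathsf{T}(A)$, $l_A:\mathsf{T}(A)\to\mathsf{T}^2(A)$, $c_A:\mathsf{T}^2(A)\to\mathsf{T}^2(A)$ such that: (1) $(p_A,s_A,z_A)$ makes $\mathsf{T}(A)$ a commutative monoid object in the slice category over $A$; (2) $\mathsf{T}(p_A) l_A=z_A p_A$, $l_A s_A=\mathsf{T}(s_A)\langle l_Aq_1,l_Aq_2\rangle$, $l_Az_A=\mathsf{T}(z_A)z_A$; (3) $p_{\mathsf{T}(A)}c_A=\mathsf{T}(p_A)$, $c_A\mathsf{T}(s_A)=s_{\mathsf{T}(A)}\langle c_A\mathsf{T}(q_1),c_A\mathsf{T}(q_2)\rangle$, $c_A\mathsf{T}(z_A)=z_{\mathsf{T}(A)}$; (4) $c_Ac_A=1$, $c_Al_A=l_A$, $\mathsf{T}(l_A)l_A=l_{\mathsf{T}(A)}l_A$, $\mathsf{T}(c_A)c_{\mathsf{T}(A)}\mathsf{T}(c_A)=c_{\mathsf{T}(A)}\mathsf{T}(c_A)c_{\mathsf{T}(A)}$, $c_{\mathsf{T}(A)}\mathsf{T}(c_A)l_{\mathsf{T}(A)}=\mathsf{T}(l_A)c_A$; (5) $\mathsf{T}(s_A)\langle l_Aq_1,z_{\mathsf{T}(A)}q_2\rangle:\mathsf{T}_2(A)\to\mathsf{T}^2(A)$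 is an equalizer of $\mathsf{T}(p_A)$ and $z_Ap_Ap_{\mathsf{T}(A)}$. It is Rosický if moreover there is a natural $n_A:\mathsf{T}(A)\to\mathsf{T}(A)$ with $p_An_A=p_A$, $s_A\langle 1,n_A\rangle=z_Ap_A$. A (Rosický) tangent category is Cartesian if it has finite products and $\mathsf{T}$ preserves them. **The tangent structure $\mathbb{T}$ on $\mathsf{ALG}_{\mathsf{S}}$.** $\mathsf{T}(A,\alpha)=(A\times A,\langle\alpha\circ\mathsf{S}(\pi_1),\alpha\circ\mathsf{S}(\pi_1+\pi_4)\circ\partial_{A\times A}\rangle)$, $\mathsf{T}(f)=f\times f$, $p=\pi_1$, $\mathsf{T}_n(A,\alpha)$ has underlying object $A^{n+1}$ with $q_j=\langle\pi_1,\pi_{j+1}\rangle$, $s=\langle\pi_1,\pi_2+\pi_3\rangle$, $z=\langle1,0\rangle$, $l=\langle\pi_1,0,0,\pi_2\rangle$, $c=\langle\pi_1,\pi_3,\pi_2,\pi_4\rangle$ and, in the additive case, $n=\langle\pi_1,-\pi_2\rangle$. **Adjoint tangent structure.** $(\mathbb{Y},\mathbb{T})$ has adjoint tangent structure if every $\mathsf{T}_n$ has a left adjoint $\mathsf{T}^\circ_n$, with unit $\eta(n)$ and counit $\varepsilon(n)$ ($\mathsf{T}^\circ=\mathsf{T}^\circ_1$, $\eta=\eta(1)$, $\varepsilon=\varepsilon(1)$). Then $\mathbb{T}^\circ$ denotes the structure on $\mathbb{Y}^{op}$ (maps written in $\mathbb{Y}$) given by the mates of the structure maps: $p^\circ_A=p_{\mathsf{T}^\circ(A)}\circ\eta_A:A\to\mathsf{T}^\circ(A)$,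 with $n$-fold pushout $\mathsf{T}^\circ_n(A)$ and injections $q^\circ_j=\varepsilon_{\mathsf{T}^\circ_n(A)}\circ\mathsf{T}^\circ(q_j)\circ\mathsf{T}^\circ(\eta(n)_A)$; $s^\circ_A=\varepsilon_{\mathsf{T}^\circ_2(A)}\circ\mathsf{T}^\circ(s_{\mathsf{T}^\circ_2(A)})\circ\mathsf{T}^\circ(\eta(2)_A):\mathsf{T}^\circ(A)\to\mathsf{T}^\circ_2(A)$; $z^\circ_A=\varepsilon_A\circ\mathsf{T}^\circ(z_A):\mathsf{T}^\circ(A)\to A$; $l^\circ_A:{\mathsf{T}^\circ}^2(A)\to\mathsf{T}^\circ(A)$ and $c^\circ_A:{\mathsf{T}^\circ}^2(A)\to{\mathsf{T}^\circ}^2(A)$ are the mates of $l$ and $c$ under $\mathsf{T}^\circ\dashv\mathsf{T}$ and ${\mathsf{T}^\circ}^2\dashv\mathsf{T}^2$; and in the Rosický case $n^\circ_A=\varepsilon_{\mathsf{T}^\circ(A)}\circ\mathsf{T}^\circ(n_{\mathsf{T}^\circ(A)})\circ\mathsf{T}^\circ(\eta_A)$. **The structure $\mathbb{B}^\circ$ on $\mathbb{X}^{op}$** (maps written in $\mathbb{X}$): functor $\mathsf{B}(A)=A\times A$, $\mathsf{B}(f)=f\times f$; $p^{\times\circ}=\langle1,0\rangle:A\to A\times A$, with $n$-fold pushout $A^{n+1}$ and injections $q_j^{\times\circ}:A\times A\to A^{n+1}$ placing $\pi_1$ in the first and $\pi_2$ in the $(j+1)$-th component; $s^{\times\circ}=\langle\pi_1,\pi_2,\pi_2\rangle$;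 $z^{\times\circ}=\pi_1$; $l^{\times\circ}=\langle\pi_1,\pi_4\rangle$; $c^{\times\circ}=\langle\pi_1,\pi_3,\pi_2,\pi_4\rangle$; additive case $n^{\times\circ}=\langle\pi_1,-\pi_2\rangle$. **Tangent morphisms.** A tangent morphism $(\mathsf{F},\tau):(\mathbb{X},\mathbb{T})\to(\mathbb{X}',\mathbb{T}')$ is a functor $\mathsf{F}$ with a natural transformation $\tau:\mathsf{F}\mathsf{T}\Rightarrow\mathsf{T}'\mathsf{F}$ compatible with $p,s,z,l,c$ (and $n$ in the Rosický case). It is strong if $\tau$ is invertible and $\mathsf{F}$ preserves the pullbacks $\mathsf{T}_n$ and the equalizer (5), and Cartesian if $\mathsf{F}$ preserves finite products. For $(\mathsf{F}^{\mathsf{S}},\tau)$ from $(\mathbb{X}^{op},\mathbb{B}^\circ)$ to $(\mathsf{ALG}_{\mathsf{S}}^{op},\mathbb{T}^\circ)$, compatibility written in $\mathsf{ALG}_{\mathsf{S}}$, with $FA:=(\mathsf{S}(A),\mu_A)$, means: $\tau_A p^\circ_{FA}=\mathsf{S}(p^{\times\circ}_A)$; $\mathsf{S}(z^{\times\circ}_A)\tau_A=z^\circ_{FA}$; $\mathsf{S}(s^{\times\circ}_A)\tau_A=[\mathsf{S}(q_1^{\times\circ})\tau_A,\mathsf{S}(q_2^{\times\circ})\tau_A]\circ s^\circ_{FA}$ (copairing out of the pushout $\mathsf{T}^\circ_2(FA)$); $\tau_Al^\circ_{FA}=\mathsf{S}(l^{\times\circ}_A)\tau_{A\times A}\mathsf{T}^\circ(\tau_A)$;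 $\tau_{A\times A}\mathsf{T}^\circ(\tau_A)c^\circ_{FA}=\mathsf{S}(c^{\times\circ}_A)\tau_{A\times A}\mathsf{T}^\circ(\tau_A)$; and, if additive, $\tau_An^\circ_{FA}=\mathsf{S}(n^{\times\circ}_A)\tau_A$. *)

theory Defs
  imports Main
begin

section \<open>Categories\<close>

record ('o, 'm) cat =
  Obj :: "'o set"
  Arr :: "'m set"
  Dom :: "'m \<Rightarrow> 'o"
  Cod :: "'m \<Rightarrow> 'o"
  Ide :: "'o \<Rightarrow> 'm"
  Comp :: "'m \<Rightarrow> 'm \<Rightarrow> 'm"  (infixr "\<cdot>\<index>" 70)

definition Hom :: "('o, 'm, 'x) cat_scheme \<Rightarrow> 'o \<Rightarrow> 'o \<Rightarrow> 'm set" where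
  "Hom C A B = {f \<in> Arr C. Dom C f = A \<and> Cod C f = B}"

locale category =
  fixes C :: "('o, 'm, 'x) cat_scheme" (structure)
  assumes dom_obj: "f \<in> Arr C \<Longrightarrow> Dom C f \<in> Obj C"
    and cod_obj: "f \<in> Arr C \<Longrightarrow> Cod C f \<in> Obj C"
    and ide_hom: "A \<in> Obj C \<Longrightarrow> Ide C A \<in> Hom C A A"
    and comp_hom: "f \<in> Hom C A B \<Longrightarrow> g \<in> Hom C B D \<Longrightarrow> g \<cdot> f \<in> Hom C A D"
    and ide_comp: "f \<in> Hom C A B \<Longrightarrow> Ide C B \<cdot> f = f"
    and comp_ide: "f \<in> Hom C A B \<Longrightarrow> f \<cdot> Ide C A = f"
    and comp_assoc: "f \<in> Hom C A B \<Longrightarrow> g \<in> Hom C B D \<Longrightarrow> h \<in> Hom C D E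
                       \<Longrightarrow> (h \<cdot> g) \<cdot> f = h \<cdot> (g \<cdot> f)"

definition opcat :: "('o, 'm, 'x) cat_scheme \<Rightarrow> ('o, 'm) cat" where
  "opcat C = \<lparr> Obj = Obj C, Arr = Arr C, Dom = Cod C, Cod = Dom C, Ide = Ide C,
               Comp = (\<lambda>g f. f \<cdot>\<^bsub>C\<^esub> g) \<rparr>"

definition is_iso :: "('o, 'm, 'x) cat_scheme \<Rightarrow> 'm \<Rightarrow> bool" where
  "is_iso C f \<longleftrightarrow> f \<in> Arr C \<and>
     (\<exists>g \<in> Hom C (Cod C f) (Dom C f).
        g \<cdot>\<^bsub>C\<^esub> f = Ide C (Dom C f) \<and> f \<cdot>\<^bsub>C\<^esub> g = Ide C (Cod C f))"

section \<open>Functors, natural transformations, adjunctions\<close>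

record ('o, 'm, 'p, 'n) functr =
  ob :: "'o \<Rightarrow> 'p"
  ar :: "'m \<Rightarrow> 'n"

definition is_functor ::
  "('o, 'm, 'x) cat_scheme \<Rightarrow> ('p, 'n, 'y) cat_scheme \<Rightarrow> ('o, 'm, 'p, 'n) functr \<Rightarrow> bool" where
  "is_functor C D F \<longleftrightarrow> category C \<and> category D \<and>
     (\<forall>A \<in> Obj C. ob F A \<in> Obj D) \<and>
     (\<forall>A B. \<forall>f \<in> Hom C A B. ar F f \<in> Hom D (ob F A) (ob F B)) \<and>
     (\<forall>A \<in> Obj C. ar F (Ide C A) = Ide D (ob F A)) \<and>
     (\<forall>A B E. \<forall>f \<in> Hom C A B. \<forall>g \<in> Hom C B E.
        ar F (g \<cdot>\<^bsub>C\<^esub> f) = ar F g \<cdot>\<^bsub>D\<^esub> ar F f)"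

definition idF :: "('o, 'm, 'o, 'm) functr" where
  "idF = \<lparr> ob = (\<lambda>A. A), ar = (\<lambda>f. f) \<rparr>"

definition compF :: "('p, 'n, 'q, 'k) functr \<Rightarrow> ('o, 'm, 'p, 'n) functr \<Rightarrow> ('o, 'm, 'q, 'k) functr"
    (infixr "\<circ>\<^sub>F" 75) where
  "G \<circ>\<^sub>F F = \<lparr> ob = (\<lambda>A. ob G (ob F A)), ar = (\<lambda>f. ar G (ar F f)) \<rparr>"

definition powF :: "('o, 'm, 'o, 'm) functr \<Rightarrow> nat \<Rightarrow> ('o, 'm, 'o, 'm) functr" where
  "powF F m = \<lparr> ob = ob F ^^ m, ar = ar F ^^ m \<rparr>"

definition nat_trans ::
  "('o, 'm, 'x) cat_scheme \<Rightarrow> ('p, 'n, 'y) cat_scheme \<Rightarrow>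
   ('o, 'm, 'p, 'n) functr \<Rightarrow> ('o, 'm, 'p, 'n) functr \<Rightarrow> ('o \<Rightarrow> 'n) \<Rightarrow> bool" where
  "nat_trans C D F G t \<longleftrightarrow> is_functor C D F \<and> is_functor C D G \<and>
     (\<forall>A \<in> Obj C. t A \<in> Hom D (ob F A) (ob G A)) \<and>
     (\<forall>A B. \<forall>f \<in> Hom C A B. t B \<cdot>\<^bsub>D\<^esub> ar F f = ar G f \<cdot>\<^bsub>D\<^esub> t A)"

definition nat_iso ::
  "('o, 'm, 'x) cat_scheme \<Rightarrow> ('p, 'n, 'y) cat_scheme \<Rightarrow>
   ('o, 'm, 'p, 'n) functr \<Rightarrow> ('o, 'm, 'p, 'n) functr \<Rightarrow> ('o \<Rightarrow> 'n) \<Rightarrow> bool" where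
  "nat_iso C D F G t \<longleftrightarrow> nat_trans C D F G t \<and> (\<forall>A \<in> Obj C. is_iso D (t A))"

text \<open>\<open>L : C \<rightarrow> D\<close> is left adjoint to \<open>R : D \<rightarrow> C\<close>.\<close>

definition adjunction ::
  "('o, 'm, 'x) cat_scheme \<Rightarrow> ('p, 'n, 'y) cat_scheme \<Rightarrow>
   ('o, 'm, 'p, 'n) functr \<Rightarrow> ('p, 'n, 'o, 'm) functr \<Rightarrow> ('o \<Rightarrow> 'm) \<Rightarrow> ('p \<Rightarrow> 'n) \<Rightarrow> bool" where
  "adjunction C D L R \<eta> \<epsilon> \<longleftrightarrow> is_functor C D L \<and> is_functor D C R \<and>
     nat_trans C C idF (R \<circ>\<^sub>F L) \<eta> \<and> nat_trans D D (L \<circ>\<^sub>F R) idF \<epsilon> \<and>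
     (\<forall>A \<in> Obj C. \<epsilon> (ob L A) \<cdot>\<^bsub>D\<^esub> ar L (\<eta> A) = Ide D (ob L A)) \<and>
     (\<forall>B \<in> Obj D. ar R (\<epsilon> B) \<cdot>\<^bsub>C\<^esub> \<eta> (ob R B) = Ide C (ob R B))"

text \<open>
  For adjunctions \<open>L\<^sub>1 \<stileturn> R\<^sub>1\<close> (unit \<open>\<eta>\<^sub>1\<close>) and \<open>L\<^sub>2 \<stileturn> R\<^sub>2\<close> (counit \<open>\<epsilon>\<^sub>2\<close>), the mate
  \<open>L\<^sub>2 \<Rightarrow> L\<^sub>1\<close> of a natural transformation \<open>\<sigma> : R\<^sub>1 \<Rightarrow> R\<^sub>2\<close>.
\<close>

definition mate ::
  "('o, 'm, 'x) cat_scheme \<Rightarrow> ('o, 'm, 'o, 'm) functr \<Rightarrow> ('o \<Rightarrow> 'm) \<Rightarrow>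
   ('o, 'm, 'o, 'm) functr \<Rightarrow> ('o \<Rightarrow> 'm) \<Rightarrow> ('o \<Rightarrow> 'm) \<Rightarrow> 'o \<Rightarrow> 'm" where
  "mate C L\<^sub>1 \<eta>\<^sub>1 L\<^sub>2 \<epsilon>\<^sub>2 \<sigma> A = \<epsilon>\<^sub>2 (ob L\<^sub>1 A) \<cdot>\<^bsub>C\<^esub> ar L\<^sub>2 (\<sigma> (ob L\<^sub>1 A)) \<cdot>\<^bsub>C\<^esub> ar L\<^sub>2 (\<eta>\<^sub>1 A)"

section \<open>Limits\<close>

text \<open>Projections, and the members of an \<open>n\<close>-fold pullback, are numbered from \<open>1\<close>.\<close>

definition is_product ::
  "('o, 'm, 'x) cat_scheme \<Rightarrow> 'o list \<Rightarrow> 'o \<Rightarrow> (nat \<Rightarrow> 'm) \<Rightarrow> bool" where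
  "is_product C As P pr \<longleftrightarrow> set As \<subseteq> Obj C \<and> P \<in> Obj C \<and>
     (\<forall>i \<in> {1..length As}. pr i \<in> Hom C P (As ! (i - 1))) \<and>
     (\<forall>Z \<in> Obj C. \<forall>g. (\<forall>i \<in> {1..length As}. g i \<in> Hom C Z (As ! (i - 1))) \<longrightarrow>
        (\<exists>!h. h \<in> Hom C Z P \<and> (\<forall>i \<in> {1..length As}. pr i \<cdot>\<^bsub>C\<^esub> h = g i)))"

definition is_coproduct ::
  "('o, 'm, 'x) cat_scheme \<Rightarrow> 'o list \<Rightarrow> 'o \<Rightarrow> (nat \<Rightarrow> 'm) \<Rightarrow> bool" where
  "is_coproduct C As P i \<longleftrightarrow> is_product (opcat C) As P i"

definition has_finite_products :: "('o, 'm, 'x) cat_scheme \<Rightarrow> bool" where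
  "has_finite_products C \<longleftrightarrow> (\<forall>As. set As \<subseteq> Obj C \<longrightarrow> (\<exists>P pr. is_product C As P pr))"

definition has_finite_coproducts :: "('o, 'm, 'x) cat_scheme \<Rightarrow> bool" where
  "has_finite_coproducts C \<longleftrightarrow> (\<forall>As. set As \<subseteq> Obj C \<longrightarrow> (\<exists>P i. is_coproduct C As P i))"

definition preserves_finite_products ::
  "('o, 'm, 'x) cat_scheme \<Rightarrow> ('p, 'n, 'y) cat_scheme \<Rightarrow> ('o, 'm, 'p, 'n) functr \<Rightarrow> bool" where
  "preserves_finite_products C D F \<longleftrightarrow>
     (\<forall>As P pr. is_product C As P pr \<longrightarrow>
        is_product D (map (ob F) As) (ob F P) (\<lambda>i. ar F (pr i)))"

definition is_equalizer :: "('o, 'm, 'x) cat_scheme \<Rightarrow> 'm \<Rightarrow> 'm \<Rightarrow> 'm \<Rightarrow> bool" where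
  "is_equalizer C f g e \<longleftrightarrow> f \<in> Arr C \<and> g \<in> Hom C (Dom C f) (Cod C f) \<and>
     e \<in> Arr C \<and> Cod C e = Dom C f \<and> f \<cdot>\<^bsub>C\<^esub> e = g \<cdot>\<^bsub>C\<^esub> e \<and>
     (\<forall>h \<in> Arr C. Cod C h = Dom C f \<and> f \<cdot>\<^bsub>C\<^esub> h = g \<cdot>\<^bsub>C\<^esub> h \<longrightarrow>
        (\<exists>!k. k \<in> Hom C (Dom C h) (Dom C e) \<and> e \<cdot>\<^bsub>C\<^esub> k = h))"

definition is_coequalizer :: "('o, 'm, 'x) cat_scheme \<Rightarrow> 'm \<Rightarrow> 'm \<Rightarrow> 'm \<Rightarrow> bool" where
  "is_coequalizer C f g e \<longleftrightarrow> is_equalizer (opcat C) f g e"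

definition has_reflexive_coequalizers :: "('o, 'm, 'x) cat_scheme \<Rightarrow> bool" where
  "has_reflexive_coequalizers C \<longleftrightarrow>
     (\<forall>A B. \<forall>f \<in> Hom C A B. \<forall>g \<in> Hom C A B.
        (\<exists>r \<in> Hom C B A. f \<cdot>\<^bsub>C\<^esub> r = Ide C B \<and> g \<cdot>\<^bsub>C\<^esub> r = Ide C B) \<longrightarrow>
        (\<exists>e. is_coequalizer C f g e))"

text \<open>The pullback of \<open>n \<ge> 1\<close> copies of the arrow \<open>f\<close>.\<close>

definition is_nfold_pullback ::
  "('o, 'm, 'x) cat_scheme \<Rightarrow> nat \<Rightarrow> 'm \<Rightarrow> 'o \<Rightarrow> (nat \<Rightarrow> 'm) \<Rightarrow> bool" where
  "is_nfold_pullback C n f P q \<longleftrightarrow> f \<in> Arr C \<and> P \<in> Obj C \<and>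
     (\<forall>j \<in> {1..n}. q j \<in> Hom C P (Dom C f)) \<and>
     (\<forall>j \<in> {1..n}. \<forall>k \<in> {1..n}. f \<cdot>\<^bsub>C\<^esub> q j = f \<cdot>\<^bsub>C\<^esub> q k) \<and>
     (\<forall>Z \<in> Obj C. \<forall>g. (\<forall>j \<in> {1..n}. g j \<in> Hom C Z (Dom C f)) \<and>
          (\<forall>j \<in> {1..n}. \<forall>k \<in> {1..n}. f \<cdot>\<^bsub>C\<^esub> g j = f \<cdot>\<^bsub>C\<^esub> g k) \<longrightarrow>
        (\<exists>!h. h \<in> Hom C Z P \<and> (\<forall>j \<in> {1..n}. q j \<cdot>\<^bsub>C\<^esub> h = g j)))"

text \<open>The arrow \<open>\<langle>f, g\<rangle>\<close> into a (twofold) pullback with projections \<open>q\<^sub>1\<close> and \<open>q\<^sub>2\<close>.\<close>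

definition pb_pair :: "('o, 'm, 'x) cat_scheme \<Rightarrow> 'm \<Rightarrow> 'm \<Rightarrow> 'm \<Rightarrow> 'm \<Rightarrow> 'm" where
  "pb_pair C q\<^sub>1 q\<^sub>2 f g =
     (THE h. h \<in> Hom C (Dom C f) (Dom C q\<^sub>1) \<and> q\<^sub>1 \<cdot>\<^bsub>C\<^esub> h = f \<and> q\<^sub>2 \<cdot>\<^bsub>C\<^esub> h = g)"

section \<open>Semi-additive and additive categories\<close>

text \<open>
  Biproducts are given as chosen structure, one for every finite list of objects;
  the empty list gives the zero object.
\<close>

record ('o, 'm) biprod_cat = "('o, 'm) cat" +
  Bip :: "'o list \<Rightarrow> 'o"
  Prj :: "'o list \<Rightarrow> nat \<Rightarrow> 'm"
  Inj :: "'o list \<Rightarrow> nat \<Rightarrow> 'm"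

context
  fixes X :: "('o, 'm, 'x) biprod_cat_scheme" (structure)
begin

definition zero :: "'o \<Rightarrow> 'o \<Rightarrow> 'm" where
  "zero A B = (THE g. g \<in> Hom X (Bip X []) B) \<cdot> (THE f. f \<in> Hom X A (Bip X []))"

definition tup :: "'m list \<Rightarrow> 'm" where
  "tup fs = (THE h. h \<in> Hom X (Dom X (hd fs)) (Bip X (map (Cod X) fs)) \<and>
               (\<forall>i \<in> {1..length fs}. Prj X (map (Cod X) fs) i \<cdot> h = fs ! (i - 1)))"

definition codiag :: "'o \<Rightarrow> 'm" where
  "codiag B = (THE h. h \<in> Hom X (Bip X [B, B]) B \<and>
                 h \<cdot> Inj X [B, B] 1 = Ide X B \<and> h \<cdot> Inj X [B, B] 2 = Ide X B)"

end

definition add :: "('o, 'm, 'x) biprod_cat_scheme \<Rightarrow> 'm \<Rightarrow> 'm \<Rightarrow> 'm"  (infixl "\<oplus>\<index>" 65) where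
  "f \<oplus>\<^bsub>X\<^esub> g = codiag X (Cod X f) \<cdot>\<^bsub>X\<^esub> tup X [f, g]"

context
  fixes X :: "('o, 'm, 'x) biprod_cat_scheme" (structure)
begin

definition neg :: "'m \<Rightarrow> 'm" where
  "neg f = (THE g. g \<in> Hom X (Dom X f) (Cod X f) \<and> f \<oplus> g = zero X (Dom X f) (Cod X f))"

text \<open>\<open>A\<^sup>n\<close> with its projections, and the functor \<open>A \<mapsto> A\<^sup>n\<close>; \<open>A \<times> A\<close> is \<open>pw 2 A\<close>.\<close>

definition pw :: "nat \<Rightarrow> 'o \<Rightarrow> 'o" where
  "pw n A = Bip X (replicate n A)"

definition pj :: "nat \<Rightarrow> 'o \<Rightarrow> nat \<Rightarrow> 'm" where
  "pj n A j = Prj X (replicate n A) j"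

definition pwF :: "nat \<Rightarrow> ('o, 'm, 'o, 'm) functr" where
  "pwF n = \<lparr> ob = pw n, ar = (\<lambda>f. tup X (map (\<lambda>j. f \<cdot> pj n (Dom X f) j) [1..<Suc n])) \<rparr>"

text \<open>The four projections \<open>(A \<times> A) \<times> (A \<times> A) \<rightarrow> A\<close>, read from left to right.\<close>

definition pj4 :: "'o \<Rightarrow> nat \<Rightarrow> 'm" where
  "pj4 A j = pj 2 A (if j = 1 \<or> j = 3 then 1 else 2) \<cdot> pj 2 (pw 2 A) (if j \<le> 2 then 1 else 2)"

end

locale semiadditive_category = category X
  for X :: "('o, 'm, 'x) biprod_cat_scheme" (structure) +
  assumes biproduct_product: "set As \<subseteq> Obj X \<Longrightarrow> is_product X As (Bip X As) (Prj X As)"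
    and biproduct_coproduct: "set As \<subseteq> Obj X \<Longrightarrow> is_coproduct X As (Bip X As) (Inj X As)"
    and biproduct_delta:
      "set As \<subseteq> Obj X \<Longrightarrow> i \<in> {1..length As} \<Longrightarrow> j \<in> {1..length As} \<Longrightarrow>
       Prj X As j \<cdot> Inj X As i =
         (if i = j then Ide X (As ! (i - 1)) else zero X (As ! (i - 1)) (As ! (j - 1)))"

text \<open>The homsets of a semi-additive category are commutative monoids under \<open>\<oplus>\<close> and \<open>zero\<close>.\<close>

locale additive_category = semiadditive_category X
  for X :: "('o, 'm, 'x) biprod_cat_scheme" (structure) +
  assumes additive_inverse: "f \<in> Hom X A B \<Longrightarrow> \<exists>g \<in> Hom X A B. f \<oplus> g = zero X A B"

section \<open>coCartesian differential monads and their algebras\<close>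

record ('o, 'm) diff_monad =
  Fun :: "('o, 'm, 'o, 'm) functr"
  mul :: "'o \<Rightarrow> 'm"
  unt :: "'o \<Rightarrow> 'm"
  der :: "'o \<Rightarrow> 'm"

abbreviation mob :: "('o, 'm, 'x) diff_monad_scheme \<Rightarrow> 'o \<Rightarrow> 'o" where
  "mob M \<equiv> ob (Fun M)"

abbreviation mar :: "('o, 'm, 'x) diff_monad_scheme \<Rightarrow> 'm \<Rightarrow> 'm" where
  "mar M \<equiv> ar (Fun M)"

locale coCartesian_differential_monad = semiadditive_category X
  for X :: "('o, 'm, 'x) biprod_cat_scheme" (structure) +
  fixes M :: "('o, 'm) diff_monad"
  assumes mul_natural: "nat_trans X X (Fun M \<circ>\<^sub>F Fun M) (Fun M) (mul M)"
    and unt_natural: "nat_trans X X idF (Fun M) (unt M)"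
    and mul_assoc: "A \<in> Obj X \<Longrightarrow> mul M A \<cdot> mar M (mul M A) = mul M A \<cdot> mul M (mob M A)"
    and mul_unt_left: "A \<in> Obj X \<Longrightarrow> mul M A \<cdot> unt M (mob M A) = Ide X (mob M A)"
    and mul_unt_right: "A \<in> Obj X \<Longrightarrow> mul M A \<cdot> mar M (unt M A) = Ide X (mob M A)"
    and der_natural: "nat_trans X X (Fun M) (Fun M \<circ>\<^sub>F pwF X 2) (der M)"
    and DC1: "A \<in> Obj X \<Longrightarrow> mar M (pj X 2 A 1) \<cdot> der M A = zero X (mob M A) (mob M A)"
    and DC2: "A \<in> Obj X \<Longrightarrow>
      mar M (tup X [pj X 2 A 1, pj X 2 A 2, pj X 2 A 2]) \<cdot> der M A =
        (mar M (tup X [pj X 2 A 1, pj X 2 A 2, zero X (pw X 2 A) A]) \<cdot> der M A)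
        \<oplus> (mar M (tup X [pj X 2 A 1, zero X (pw X 2 A) A, pj X 2 A 2]) \<cdot> der M A)"
    and DC3: "A \<in> Obj X \<Longrightarrow>
      der M A \<cdot> unt M A = unt M (pw X 2 A) \<cdot> tup X [zero X A A, Ide X A]"
    and DC4: "A \<in> Obj X \<Longrightarrow>
      der M A \<cdot> mul M A =
        mul M (pw X 2 A)
        \<cdot> mar M ((mar M (tup X [Ide X A, zero X A A]) \<cdot> pj X 2 (mob M A) 1)
                 \<oplus> (der M A \<cdot> pj X 2 (mob M A) 2))
        \<cdot> der M (mob M A)"
    and DC5: "A \<in> Obj X \<Longrightarrow>
      mar M (tup X [pj4 X A 1, pj4 X A 4]) \<cdot> der M (pw X 2 A) \<cdot> der M A = der M A"
    and DC6: "A \<in> Obj X \<Longrightarrow>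
      mar M (tup X [tup X [pj4 X A 1, pj4 X A 3], tup X [pj4 X A 2, pj4 X A 4]])
        \<cdot> der M (pw X 2 A) \<cdot> der M A
      = der M (pw X 2 A) \<cdot> der M A"

text \<open>
  The Eilenberg--Moore category. An arrow is a triple of its source algebra, its underlying
  arrow in \<open>X\<close> and its target algebra.
\<close>

context
  fixes X :: "('o, 'm, 'x) biprod_cat_scheme" (structure)
    and M :: "('o, 'm) diff_monad"
begin

definition algebras :: "('o \<times> 'm) set" where
  "algebras = {(A, \<alpha>). A \<in> Obj X \<and> \<alpha> \<in> Hom X (mob M A) A \<and>
     \<alpha> \<cdot> unt M A = Ide X A \<and> \<alpha> \<cdot> mar M \<alpha> = \<alpha> \<cdot> mul M A}"

definition ALG :: "('o \<times> 'm, ('o \<times> 'm) \<times> 'm \<times> ('o \<times> 'm)) cat" where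
  "ALG = \<lparr> Obj = algebras,
     Arr = {(a, f, b). a \<in> algebras \<and> b \<in> algebras \<and> f \<in> Hom X (fst a) (fst b) \<and>
                       f \<cdot> snd a = snd b \<cdot> mar M f},
     Dom = (\<lambda>(a, f, b). a),
     Cod = (\<lambda>(a, f, b). b),
     Ide = (\<lambda>a. (a, Ide X (fst a), a)),
     Comp = (\<lambda>(b', g, c) (a, f, b). (a, g \<cdot> f, c)) \<rparr>"

definition freeF :: "('o, 'm, 'o \<times> 'm, ('o \<times> 'm) \<times> 'm \<times> ('o \<times> 'm)) functr" where
  "freeF = \<lparr> ob = (\<lambda>A. (mob M A, mul M A)),
     ar = (\<lambda>f. ((mob M (Dom X f), mul M (Dom X f)), mar M f, (mob M (Cod X f), mul M (Cod X f)))) \<rparr>"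

end

section \<open>Tangent categories\<close>

text \<open>
  \<open>tanTn n\<close> (for \<open>n \<ge> 1\<close>) is the chosen \<open>n\<close>-fold pullback of \<open>p\<close> as a functor, with
  projections \<open>tq n j\<close> for \<open>1 \<le> j \<le> n\<close>. The tangent functor is \<open>T = T\<^sub>1\<close>, with \<open>q\<^sub>1 = 1\<close>.
  The case \<open>n = 0\<close>, where \<open>T\<^sub>0\<close> is the identity functor, carries no information and
  \<open>tanTn 0\<close> is left unconstrained.
\<close>

record ('o, 'm) tangent =
  tanTn :: "nat \<Rightarrow> ('o, 'm, 'o, 'm) functr"
  tp :: "'o \<Rightarrow> 'm"
  tq :: "nat \<Rightarrow> nat \<Rightarrow> 'o \<Rightarrow> 'm"
  ts :: "'o \<Rightarrow> 'm"
  tz :: "'o \<Rightarrow> 'm"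
  tl :: "'o \<Rightarrow> 'm"
  tc :: "'o \<Rightarrow> 'm"

abbreviation tanT :: "('o, 'm) tangent \<Rightarrow> ('o, 'm, 'o, 'm) functr" where
  "tanT T \<equiv> tanTn T 1"

context
  fixes C :: "('o, 'm, 'x) cat_scheme" (structure)
    and T :: "('o, 'm) tangent"
begin

text \<open>\<open>\<langle>f, g\<rangle>\<close> into \<open>T\<^sub>2(A)\<close> and into \<open>T(T\<^sub>2(A))\<close>, respectively.\<close>

definition pairT2 :: "'o \<Rightarrow> 'm \<Rightarrow> 'm \<Rightarrow> 'm" where
  "pairT2 A f g = pb_pair C (tq T 2 1 A) (tq T 2 2 A) f g"

definition pairTT2 :: "'o \<Rightarrow> 'm \<Rightarrow> 'm \<Rightarrow> 'm" where
  "pairTT2 A f g = pb_pair C (ar (tanT T) (tq T 2 1 A)) (ar (tanT T) (tq T 2 2 A)) f g"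

text \<open>The arrow \<open>T\<^sub>2(A) \<rightarrow> T\<^sup>2(A)\<close> expressing the universality of the vertical lift.\<close>

definition univ_lift :: "'o \<Rightarrow> 'm" where
  "univ_lift A = ar (tanT T) (ts T A)
     \<cdot> pairTT2 A (tl T A \<cdot> tq T 2 1 A) (tz T (ob (tanT T) A) \<cdot> tq T 2 2 A)"

end

text \<open>
  Naturality of the \<open>tq\<close> says that \<open>tanTn n\<close> acts on arrows through the universal property
  of the pullbacks.
\<close>

locale tangent_category = category C
  for C :: "('o, 'm, 'x) cat_scheme" (structure) +
  fixes T :: "('o, 'm) tangent"
  assumes T_functor: "n \<ge> 1 \<Longrightarrow> is_functor C C (tanTn T n)"
    and q_natural: "j \<in> {1..n} \<Longrightarrow> nat_trans C C (tanTn T n) (tanT T) (tq T n j)"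
    and q_one: "A \<in> Obj C \<Longrightarrow> tq T 1 1 A = Ide C (ob (tanT T) A)"
    and p_natural: "nat_trans C C (tanT T) idF (tp T)"
    and s_natural: "nat_trans C C (tanTn T 2) (tanT T) (ts T)"
    and z_natural: "nat_trans C C idF (tanT T) (tz T)"
    and l_natural: "nat_trans C C (tanT T) (tanT T \<circ>\<^sub>F tanT T) (tl T)"
    and c_natural: "nat_trans C C (tanT T \<circ>\<^sub>F tanT T) (tanT T \<circ>\<^sub>F tanT T) (tc T)"
    and pullbacks: "n \<ge> 1 \<Longrightarrow> A \<in> Obj C \<Longrightarrow>
      is_nfold_pullback C n (ar (powF (tanT T) m) (tp T A))
        (ob (powF (tanT T) m) (ob (tanTn T n) A)) (\<lambda>j. ar (powF (tanT T) m) (tq T n j A))"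
    \<comment> \<open>\<open>(p, s, z)\<close> is a commutative monoid in the slice category\<close>
    and p_s: "A \<in> Obj C \<Longrightarrow> tp T A \<cdot> ts T A = tp T A \<cdot> tq T 2 1 A"
    and p_z: "A \<in> Obj C \<Longrightarrow> tp T A \<cdot> tz T A = Ide C A"
    and s_unit: "A \<in> Obj C \<Longrightarrow>
      ts T A \<cdot> pairT2 C T A (tz T A \<cdot> tp T A) (Ide C (ob (tanT T) A)) = Ide C (ob (tanT T) A)"
    and s_comm: "A \<in> Obj C \<Longrightarrow> ts T A \<cdot> pairT2 C T A (tq T 2 2 A) (tq T 2 1 A) = ts T A"
    and s_assoc: "A \<in> Obj C \<Longrightarrow>
      ts T A \<cdot> pairT2 C T A (ts T A \<cdot> pairT2 C T A (tq T 3 1 A) (tq T 3 2 A)) (tq T 3 3 A) =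
      ts T A \<cdot> pairT2 C T A (tq T 3 1 A) (ts T A \<cdot> pairT2 C T A (tq T 3 2 A) (tq T 3 3 A))"
    and l_p: "A \<in> Obj C \<Longrightarrow> ar (tanT T) (tp T A) \<cdot> tl T A = tz T A \<cdot> tp T A"
    and l_s: "A \<in> Obj C \<Longrightarrow>
      tl T A \<cdot> ts T A =
      ar (tanT T) (ts T A) \<cdot> pairTT2 C T A (tl T A \<cdot> tq T 2 1 A) (tl T A \<cdot> tq T 2 2 A)"
    and l_z: "A \<in> Obj C \<Longrightarrow> tl T A \<cdot> tz T A = ar (tanT T) (tz T A) \<cdot> tz T A"
    and c_p: "A \<in> Obj C \<Longrightarrow> tp T (ob (tanT T) A) \<cdot> tc T A = ar (tanT T) (tp T A)"
    and c_s: "A \<in> Obj C \<Longrightarrow>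
      tc T A \<cdot> ar (tanT T) (ts T A) =
      ts T (ob (tanT T) A) \<cdot> pairT2 C T (ob (tanT T) A)
        (tc T A \<cdot> ar (tanT T) (tq T 2 1 A)) (tc T A \<cdot> ar (tanT T) (tq T 2 2 A))"
    and c_z: "A \<in> Obj C \<Longrightarrow> tc T A \<cdot> ar (tanT T) (tz T A) = tz T (ob (tanT T) A)"
    and c_c: "A \<in> Obj C \<Longrightarrow> tc T A \<cdot> tc T A = Ide C (ob (tanT T) (ob (tanT T) A))"
    and c_l: "A \<in> Obj C \<Longrightarrow> tc T A \<cdot> tl T A = tl T A"
    and l_l: "A \<in> Obj C \<Longrightarrow> ar (tanT T) (tl T A) \<cdot> tl T A = tl T (ob (tanT T) A) \<cdot> tl T A"
    and c_braid: "A \<in> Obj C \<Longrightarrow>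
      ar (tanT T) (tc T A) \<cdot> tc T (ob (tanT T) A) \<cdot> ar (tanT T) (tc T A) =
      tc T (ob (tanT T) A) \<cdot> ar (tanT T) (tc T A) \<cdot> tc T (ob (tanT T) A)"
    and c_l_T: "A \<in> Obj C \<Longrightarrow>
      tc T (ob (tanT T) A) \<cdot> ar (tanT T) (tc T A) \<cdot> tl T (ob (tanT T) A) =
      ar (tanT T) (tl T A) \<cdot> tc T A"
    and universality: "A \<in> Obj C \<Longrightarrow>
      is_equalizer C (ar (tanT T) (tp T A)) (tz T A \<cdot> tp T A \<cdot> tp T (ob (tanT T) A))
        (univ_lift C T A)"

locale rosicky_tangent_category = tangent_category C T
  for C :: "('o, 'm, 'x) cat_scheme" (structure) and T +
  fixes N :: "'o \<Rightarrow> 'm"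
  assumes n_natural: "nat_trans C C (tanT T) (tanT T) N"
    and p_n: "A \<in> Obj C \<Longrightarrow> tp T A \<cdot> N A = tp T A"
    and s_n: "A \<in> Obj C \<Longrightarrow>
      ts T A \<cdot> pairT2 C T A (Ide C (ob (tanT T) A)) (N A) = tz T A \<cdot> tp T A"

definition cartesian_tangent_category ::
  "('o, 'm, 'x) cat_scheme \<Rightarrow> ('o, 'm) tangent \<Rightarrow> bool" where
  "cartesian_tangent_category C T \<longleftrightarrow> tangent_category C T \<and> has_finite_products C \<and>
     preserves_finite_products C C (tanT T)"

definition tangent_morphism ::
  "('o, 'm, 'x) cat_scheme \<Rightarrow> ('o, 'm) tangent \<Rightarrow> ('p, 'n, 'y) cat_scheme \<Rightarrow> ('p, 'n) tangent \<Rightarrow>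
   ('o, 'm, 'p, 'n) functr \<Rightarrow> ('o \<Rightarrow> 'n) \<Rightarrow> bool" where
  "tangent_morphism C T D T' F \<tau> \<longleftrightarrow>
     tangent_category C T \<and> tangent_category D T' \<and>
     nat_trans C D (F \<circ>\<^sub>F tanT T) (tanT T' \<circ>\<^sub>F F) \<tau> \<and> is_functor C D F \<and>
     (\<forall>A \<in> Obj C.
        tp T' (ob F A) \<cdot>\<^bsub>D\<^esub> \<tau> A = ar F (tp T A) \<and>
        \<tau> A \<cdot>\<^bsub>D\<^esub> ar F (ts T A) =
          ts T' (ob F A) \<cdot>\<^bsub>D\<^esub> pairT2 D T' (ob F A)
            (\<tau> A \<cdot>\<^bsub>D\<^esub> ar F (tq T 2 1 A)) (\<tau> A \<cdot>\<^bsub>D\<^esub> ar F (tq T 2 2 A)) \<and>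
        \<tau> A \<cdot>\<^bsub>D\<^esub> ar F (tz T A) = tz T' (ob F A) \<and>
        tl T' (ob F A) \<cdot>\<^bsub>D\<^esub> \<tau> A =
          ar (tanT T') (\<tau> A) \<cdot>\<^bsub>D\<^esub> \<tau> (ob (tanT T) A) \<cdot>\<^bsub>D\<^esub> ar F (tl T A) \<and>
        tc T' (ob F A) \<cdot>\<^bsub>D\<^esub> ar (tanT T') (\<tau> A) \<cdot>\<^bsub>D\<^esub> \<tau> (ob (tanT T) A) =
          ar (tanT T') (\<tau> A) \<cdot>\<^bsub>D\<^esub> \<tau> (ob (tanT T) A) \<cdot>\<^bsub>D\<^esub> ar F (tc T A))"

definition strong_tangent_morphism ::
  "('o, 'm, 'x) cat_scheme \<Rightarrow> ('o, 'm) tangent \<Rightarrow> ('p, 'n, 'y) cat_scheme \<Rightarrow> ('p, 'n) tangent \<Rightarrow>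
   ('o, 'm, 'p, 'n) functr \<Rightarrow> ('o \<Rightarrow> 'n) \<Rightarrow> bool" where
  "strong_tangent_morphism C T D T' F \<tau> \<longleftrightarrow>
     tangent_morphism C T D T' F \<tau> \<and>
     (\<forall>A \<in> Obj C. is_iso D (\<tau> A)) \<and>
     (\<forall>A \<in> Obj C. \<forall>n \<ge> 1.
        is_nfold_pullback D n (ar F (tp T A)) (ob F (ob (tanTn T n) A)) (\<lambda>j. ar F (tq T n j A))) \<and>
     (\<forall>A \<in> Obj C.
        is_equalizer D (ar F (ar (tanT T) (tp T A)))
          (ar F (tz T A \<cdot>\<^bsub>C\<^esub> tp T A \<cdot>\<^bsub>C\<^esub> tp T (ob (tanT T) A))) (ar F (univ_lift C T A)))"

definition strong_rosicky_tangent_morphism ::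
  "('o, 'm, 'x) cat_scheme \<Rightarrow> ('o, 'm) tangent \<Rightarrow> ('o \<Rightarrow> 'm) \<Rightarrow>
   ('p, 'n, 'y) cat_scheme \<Rightarrow> ('p, 'n) tangent \<Rightarrow> ('p \<Rightarrow> 'n) \<Rightarrow>
   ('o, 'm, 'p, 'n) functr \<Rightarrow> ('o \<Rightarrow> 'n) \<Rightarrow> bool" where
  "strong_rosicky_tangent_morphism C T N D T' N' F \<tau> \<longleftrightarrow>
     rosicky_tangent_category C T N \<and> rosicky_tangent_category D T' N' \<and>
     strong_tangent_morphism C T D T' F \<tau> \<and>
     (\<forall>A \<in> Obj C. N' (ob F A) \<cdot>\<^bsub>D\<^esub> \<tau> A = \<tau> A \<cdot>\<^bsub>D\<^esub> ar F (N A))"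

definition strong_cartesian_tangent_morphism ::
  "('o, 'm, 'x) cat_scheme \<Rightarrow> ('o, 'm) tangent \<Rightarrow> ('p, 'n, 'y) cat_scheme \<Rightarrow> ('p, 'n) tangent \<Rightarrow>
   ('o, 'm, 'p, 'n) functr \<Rightarrow> ('o \<Rightarrow> 'n) \<Rightarrow> bool" where
  "strong_cartesian_tangent_morphism C T D T' F \<tau> \<longleftrightarrow>
     cartesian_tangent_category C T \<and> cartesian_tangent_category D T' \<and>
     strong_tangent_morphism C T D T' F \<tau> \<and> preserves_finite_products C D F"

section \<open>Adjoint tangent structure\<close>

definition adjoint_data ::
  "('o, 'm, 'x) cat_scheme \<Rightarrow> ('o, 'm) tangent \<Rightarrow> (nat \<Rightarrow> ('o, 'm, 'o, 'm) functr) \<Rightarrow>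
   (nat \<Rightarrow> 'o \<Rightarrow> 'm) \<Rightarrow> (nat \<Rightarrow> 'o \<Rightarrow> 'm) \<Rightarrow> bool" where
  "adjoint_data C T L \<eta> \<epsilon> \<longleftrightarrow> (\<forall>n \<ge> 1. adjunction C C (L n) (tanTn T n) (\<eta> n) (\<epsilon> n))"

definition has_adjoint_tangent_structure ::
  "('o, 'm, 'x) cat_scheme \<Rightarrow> ('o, 'm) tangent \<Rightarrow> bool" where
  "has_adjoint_tangent_structure C T \<longleftrightarrow>
     tangent_category C T \<and> (\<exists>L \<eta> \<epsilon>. adjoint_data C T L \<eta> \<epsilon>)"

text \<open>
  The structure on the opposite category given by the mates; \<open>\<eta>2\<close> and \<open>\<epsilon>2\<close> are the unit and
  counit of the composite adjunction \<open>L\<^sub>1 \<circ> L\<^sub>1 \<stileturn> T \<circ> T\<close>.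
\<close>

definition adjoint_tangent ::
  "('o, 'm, 'x) cat_scheme \<Rightarrow> ('o, 'm) tangent \<Rightarrow> (nat \<Rightarrow> ('o, 'm, 'o, 'm) functr) \<Rightarrow>
   (nat \<Rightarrow> 'o \<Rightarrow> 'm) \<Rightarrow> (nat \<Rightarrow> 'o \<Rightarrow> 'm) \<Rightarrow> ('o, 'm) tangent" where
  "adjoint_tangent C T L \<eta> \<epsilon> =
    (let \<eta>2 = (\<lambda>A. ar (tanT T) (\<eta> 1 (ob (L 1) A)) \<cdot>\<^bsub>C\<^esub> \<eta> 1 A);
         \<epsilon>2 = (\<lambda>A. \<epsilon> 1 A \<cdot>\<^bsub>C\<^esub> ar (L 1) (\<epsilon> 1 (ob (tanT T) A)))
     in \<lparr> tanTn = L,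
          tp = (\<lambda>A. tp T (ob (L 1) A) \<cdot>\<^bsub>C\<^esub> \<eta> 1 A),
          tq = (\<lambda>n j. mate C (L n) (\<eta> n) (L 1) (\<epsilon> 1) (tq T n j)),
          ts = mate C (L 2) (\<eta> 2) (L 1) (\<epsilon> 1) (ts T),
          tz = (\<lambda>A. \<epsilon> 1 A \<cdot>\<^bsub>C\<^esub> ar (L 1) (tz T A)),
          tl = mate C (L 1) (\<eta> 1) (L 1 \<circ>\<^sub>F L 1) \<epsilon>2 (tl T),
          tc = mate C (L 1 \<circ>\<^sub>F L 1) \<eta>2 (L 1 \<circ>\<^sub>F L 1) \<epsilon>2 (tc T) \<rparr>)"

definition adjoint_neg ::
  "('o, 'm, 'x) cat_scheme \<Rightarrow> (nat \<Rightarrow> ('o, 'm, 'o, 'm) functr) \<Rightarrow>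
   (nat \<Rightarrow> 'o \<Rightarrow> 'm) \<Rightarrow> (nat \<Rightarrow> 'o \<Rightarrow> 'm) \<Rightarrow> ('o \<Rightarrow> 'm) \<Rightarrow> 'o \<Rightarrow> 'm" where
  "adjoint_neg C L \<eta> \<epsilon> N = mate C (L 1) (\<eta> 1) (L 1) (\<epsilon> 1) N"

section \<open>The tangent structures on algebras and on the opposite of the base category\<close>

context
  fixes X :: "('o, 'm, 'x) biprod_cat_scheme" (structure)
    and M :: "('o, 'm) diff_monad"
begin

text \<open>
  \<open>T\<^sub>n(A, \<alpha>)\<close> has underlying object \<open>A\<^sup>n\<^sup>+\<^sup>1\<close> and the unique algebra structure for which all
  \<open>q\<^sub>j = \<langle>\<pi>\<^sub>1, \<pi>\<^sub>j\<^sub>+\<^sub>1\<rangle>\<close> are algebra morphisms to \<open>T(A, \<alpha>)\<close>. For \<open>n = 1\<close>, where \<open>q\<^sub>1\<close> is the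
  identity, this is \<open>\<langle>\<alpha> S(\<pi>\<^sub>1), \<alpha> S(\<pi>\<^sub>1 + \<pi>\<^sub>4) \<partial>\<rangle>\<close>.
\<close>

definition algTn_ob :: "nat \<Rightarrow> 'o \<times> 'm \<Rightarrow> 'o \<times> 'm" where
  "algTn_ob n = (\<lambda>(A, \<alpha>).
     (pw X (Suc n) A,
      tup X ((\<alpha> \<cdot> mar M (pj X (Suc n) A 1)) #
             map (\<lambda>j. \<alpha> \<cdot> mar M (pj4 X A 1 \<oplus> pj4 X A 4) \<cdot> der M (pw X 2 A)
                      \<cdot> mar M (tup X [pj X (Suc n) A 1, pj X (Suc n) A (Suc j)]))
                 [1..<Suc n])))"

definition algTn :: "nat \<Rightarrow>
    ('o \<times> 'm, ('o \<times> 'm) \<times> 'm \<times> ('o \<times> 'm), 'o \<times> 'm, ('o \<times> 'm) \<times> 'm \<times> ('o \<times> 'm)) functr" where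
  "algTn n = \<lparr> ob = algTn_ob n,
     ar = (\<lambda>(a, f, b). (algTn_ob n a, ar (pwF X (Suc n)) f, algTn_ob n b)) \<rparr>"

definition algT :: "('o \<times> 'm, ('o \<times> 'm) \<times> 'm \<times> ('o \<times> 'm)) tangent" where
  "algT = \<lparr> tanTn = algTn,
     tp = (\<lambda>a. (algTn_ob 1 a, pj X 2 (fst a) 1, a)),
     tq = (\<lambda>n j a. (algTn_ob n a,
             tup X [pj X (Suc n) (fst a) 1, pj X (Suc n) (fst a) (Suc j)], algTn_ob 1 a)),
     ts = (\<lambda>a. (algTn_ob 2 a,
             tup X [pj X 3 (fst a) 1, pj X 3 (fst a) 2 \<oplus> pj X 3 (fst a) 3], algTn_ob 1 a)),
     tz = (\<lambda>a. (a, tup X [Ide X (fst a), zero X (fst a) (fst a)], algTn_ob 1 a)),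
     tl = (\<lambda>a. (algTn_ob 1 a,
             tup X [tup X [pj X 2 (fst a) 1, zero X (pw X 2 (fst a)) (fst a)],
                    tup X [zero X (pw X 2 (fst a)) (fst a), pj X 2 (fst a) 2]],
             algTn_ob 1 (algTn_ob 1 a))),
     tc = (\<lambda>a. (algTn_ob 1 (algTn_ob 1 a),
             tup X [tup X [pj4 X (fst a) 1, pj4 X (fst a) 3],
                    tup X [pj4 X (fst a) 2, pj4 X (fst a) 4]],
             algTn_ob 1 (algTn_ob 1 a))) \<rparr>"

definition algN :: "'o \<times> 'm \<Rightarrow> ('o \<times> 'm) \<times> 'm \<times> ('o \<times> 'm)" where
  "algN a = (algTn_ob 1 a, tup X [pj X 2 (fst a) 1, neg X (pj X 2 (fst a) 2)], algTn_ob 1 a)"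

text \<open>The structure on \<open>opcat X\<close>; all arrows are written as arrows of \<open>X\<close>.\<close>

definition opB :: "('o, 'm) tangent" where
  "opB = \<lparr> tanTn = (\<lambda>n. pwF X (Suc n)),
     tp = (\<lambda>A. tup X [Ide X A, zero X A A]),
     tq = (\<lambda>n j A. tup X (map (\<lambda>i. if i = 1 then pj X 2 A 1
                                   else if i = Suc j then pj X 2 A 2
                                   else zero X (pw X 2 A) A) [1..<Suc (Suc n)])),
     ts = (\<lambda>A. tup X [pj X 2 A 1, pj X 2 A 2, pj X 2 A 2]),
     tz = (\<lambda>A. pj X 2 A 1),
     tl = (\<lambda>A. tup X [pj4 X A 1, pj4 X A 4]),
     tc = (\<lambda>A. tup X [tup X [pj4 X A 1, pj4 X A 3], tup X [pj4 X A 2, pj4 X A 4]]) \<rparr>"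

definition opBN :: "'o \<Rightarrow> 'm" where
  "opBN A = tup X [pj X 2 A 1, neg X (pj X 2 A 2)]"

end

text \<open>For \<open>n = 1\<close> the definition of \<open>algTn_ob\<close> is the tangent functor on algebras.\<close>

lemma (in coCartesian_differential_monad) algTn_ob_1:
  assumes "(A, \<alpha>) \<in> Obj (ALG X M)"
  shows "algTn_ob X M 1 (A, \<alpha>) =
    (pw X 2 A, tup X [\<alpha> \<cdot> mar M (pj X 2 A 1),
                      \<alpha> \<cdot> mar M (pj4 X A 1 \<oplus> pj4 X A 4) \<cdot> der M (pw X 2 A)])"
proof -
  have A: "A \<in> Obj X"
    using assms by (simp add: ALG_def algebras_def)
  have prod: "is_product X [A, A] (pw X 2 A) (Prj X [A, A])"
    using biproduct_product[of "[A, A]"] A by (simp add: pw_def numeral_2_eq_2)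
  then have P: "pw X 2 A \<in> Obj X"
    by (simp add: is_product_def)
  have pj_eq: "pj X 2 A j = Prj X [A, A] j" for j
    by (simp add: pj_def numeral_2_eq_2)
  have pj_hom: "pj X 2 A j \<in> Hom X (pw X 2 A) A" if "j \<in> {1..2}" for j
  proof -
    have "pj X 2 A j \<in> Hom X (pw X 2 A) ([A, A] ! (j - 1))"
      using prod that by (auto simp: is_product_def pj_eq)
    moreover have "[A, A] ! (j - 1) = A"
      using that by (cases "j = 1") (auto simp: nth_Cons')
    ultimately show ?thesis by simp
  qed
  have dc: "Dom X (pj X 2 A j) = pw X 2 A" "Cod X (pj X 2 A j) = A" if "j \<in> {1..2}" for j
    using pj_hom[OF that] by (simp_all add: Hom_def)
  have set12: "{Suc 0..Suc (Suc 0)} = {1, 2}"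
    by auto
  have "\<exists>!h. h \<in> Hom X (pw X 2 A) (pw X 2 A) \<and>
          (\<forall>i\<in>{1..length [A, A]}. Prj X [A, A] i \<cdot> h = pj X 2 A i)"
    using prod P unfolding is_product_def pj_eq by blast
  then have uniq: "\<exists>!h. h \<in> Hom X (pw X 2 A) (pw X 2 A) \<and>
          (\<forall>i\<in>{1, 2}. Prj X [A, A] i \<cdot> h = pj X 2 A i)"
    by (simp add: set12)
  have id_proj: "\<forall>i\<in>{1, 2}. Prj X [A, A] i \<cdot> Ide X (pw X 2 A) = pj X 2 A i"
    using comp_ide[OF pj_hom] by (auto simp: pj_eq)
  have tup_id: "tup X [pj X 2 A 1, pj X 2 A 2] = Ide X (pw X 2 A)"
  proof -
    have "tup X [pj X 2 A 1, pj X 2 A 2] =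
        (THE h. h \<in> Hom X (pw X 2 A) (pw X 2 A) \<and>
           (\<forall>i\<in>{1, 2}. Prj X [A, A] i \<cdot> h = pj X 2 A i))"
      using dc[of 1] dc[of 2] by (simp add: tup_def set12 pw_def numeral_2_eq_2)
    also have "\<dots> = Ide X (pw X 2 A)"
      by (rule the1_equality[OF uniq]) (use ide_hom[OF P] id_proj in auto)
    finally show ?thesis .
  qed
  have F: "is_functor X X (Fun M)" and d: "der M (pw X 2 A) \<in> Hom X (mob M (pw X 2 A)) (mob M (pw X 2 (pw X 2 A)))"
    using der_natural P by (auto simp: nat_trans_def compF_def pwF_def)
  have "der M (pw X 2 A) \<cdot> mar M (tup X [pj X 2 A 1, pj X 2 A 2]) = der M (pw X 2 A)"
    unfolding tup_id using F P comp_ide[OF d] by (simp add: is_functor_def)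
  then show ?thesis
    by (simp add: algTn_ob_def numeral_2_eq_2)
qed

end

(*
  The structure maps of the tangent structure on algebras are those of the evident tangent
  structure A |-> A x A on the semi-additive base category, and the forgetful functor is
  faithful and creates limits, so only two things have to be checked upstairs: that the T_n(a)
  are algebras and that the structure maps are algebra morphisms. Both reduce to computing with
  the derivative  y |-> alpha S(x pi_1 + y pi_2) der  of alpha S(x), for which DC.1-DC.6 say
  that it is additive in y, unital, compatible with the multiplication, and symmetric.

  Left adjoints exist by adjoint lifting: pw (n + 1) is adjoint to itself on the base, and the
  algebra morphisms a -> T_n(b) are represented by a reflexive coequalizer of free algebras.

  All identities on the opposite side are checked after transposing along the adjunctions:
  if f^ : A -> T(B) is the transpose of f : L(A) -> B, precomposing f with the mate of a
  natural transformation means postcomposing f^ with that transformation, so the axioms of the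
  opposite structure become axioms of the original one (with T(s), T(z) exchanged for s_T, z_T
  by the flip c). The structure on the opposite of the base is the case of the self-adjunction
  of pw (n + 1), and the comparison for the free functor is the comparison of two left adjoints
  of the same functor.
*)
theory Submission
  imports Defs
begin

\<comment> \<open>Indices are the literal \<open>1\<close>; rules about it do not match once it is rewritten to \<open>Suc 0\<close>.\<close>
declare One_nat_def [simp del]

section \<open>Categories and functors\<close>

text \<open>The parallel pair of adjoint lifting is reflexive because of the unit of the monad:
  \<open>unt M\<close> induces a common section, and the unit laws of \<alpha> and of the structure
  on \<open>T\<^sub>n\<close> make it one. The obstacle on the opposite side is order. An arrow out
  of \<open>L(L(A))\<close>, transposed twice, lands in \<open>T(T(Z))\<close> with the two factors
  exchanged, so that an outer \<open>L(f)\<close> turns into a structure map at an inner object.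
  Hence each axiom is needed in a second, flipped form, and the opposite universal lift corresponds
  to the flip of the original lift. A second obstacle is one of encoding. Families of arrows are
  total functions, so two structures can agree at all objects of a category without being equal as
  records; facts are then carried over along the identity functor instead of being rewritten.
  Pushouts, coequalizers and coproducts are preserved throughout for one reason: a left adjoint
  becomes a right adjoint between opposite categories.\<close>

lemma Hom_iff: "f \<in> Hom C A B \<longleftrightarrow> f \<in> Arr C \<and> Dom C f = A \<and> Cod C f = B"
  by (simp add: Hom_def)

context category
begin

lemma dom_cod_obj [simp]: "f \<in> Arr C \<Longrightarrow> Dom C f \<in> Obj C" "f \<in> Arr C \<Longrightarrow> Cod C f \<in> Obj C"
  by (fact dom_obj cod_obj)+

lemma hom_obj: "f \<in> Hom C A B \<Longrightarrow> A \<in> Obj C" "f \<in> Hom C A B \<Longrightarrow> B \<in> Obj C"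
  by (auto simp: Hom_iff)

lemma ide_simps [simp]:
  assumes "A \<in> Obj C"
  shows "Ide C A \<in> Arr C" "Dom C (Ide C A) = A" "Cod C (Ide C A) = A"
  using ide_hom[OF assms] by (simp_all add: Hom_iff)

lemma comp_simps [simp]:
  assumes "f \<in> Arr C" "g \<in> Arr C" "Cod C f = Dom C g"
  shows "g \<cdot> f \<in> Arr C" "Dom C (g \<cdot> f) = Dom C f" "Cod C (g \<cdot> f) = Cod C g"
  using comp_hom[of f "Dom C f" "Dom C g" g "Cod C g"] assms by (simp_all add: Hom_iff)

lemma ide_comp_simps [simp]:
  "f \<in> Arr C \<Longrightarrow> Cod C f = B \<Longrightarrow> Ide C B \<cdot> f = f"
  "f \<in> Arr C \<Longrightarrow> Dom C f = A \<Longrightarrow> f \<cdot> Ide C A = f"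
  using ide_comp[of f "Dom C f" "Cod C f"] comp_ide[of f "Dom C f" "Cod C f"]
  by (auto simp: Hom_iff)

lemma assoc:
  assumes "f \<in> Arr C" "g \<in> Arr C" "h \<in> Arr C" "Cod C f = Dom C g" "Cod C g = Dom C h"
  shows "(h \<cdot> g) \<cdot> f = h \<cdot> (g \<cdot> f)"
  using comp_assoc[of f "Dom C f" "Dom C g" g "Dom C h" h "Cod C h"] assms by (simp add: Hom_iff)

lemma assoc_left:
  assumes "f \<in> Arr C" "g \<in> Arr C" "h \<in> Arr C" "Cod C f = Dom C g" "Cod C g = Dom C h"
  shows "h \<cdot> (g \<cdot> f) = (h \<cdot> g) \<cdot> f"
  using assoc[OF assms] by simp

lemma comp_extend:
  assumes "a \<cdot> b = y" "a \<in> Arr C" "b \<in> Arr C" "Cod C b = Dom C a" "x \<in> Arr C" "Cod C x = Dom C b"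
  shows "a \<cdot> (b \<cdot> x) = y \<cdot> x"
  using assms(1) assoc_left[of x b a] assms(2-6) by simp

end

section \<open>Opposites; functors and natural transformations in terms of domains and
  codomains\<close>

lemma opcat_simps [simp]:
  "Obj (opcat C) = Obj C" "Arr (opcat C) = Arr C" "Dom (opcat C) = Cod C" "Cod (opcat C) = Dom C"
  "Ide (opcat C) = Ide C" "g \<cdot>\<^bsub>opcat C\<^esub> f = f \<cdot>\<^bsub>C\<^esub> g" "Hom (opcat C) A B = Hom C B A"
  by (auto simp: opcat_def Hom_def)

lemma category_opcat: "category C \<Longrightarrow> category (opcat C)"
  by unfold_locales (auto simp: Hom_iff category.assoc category.dom_cod_obj category.comp_simps
      category.ide_comp_simps category.ide_simps)

text \<open>Replaces quantification over homsets by conditions on \<open>Dom\<close> and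
  \<open>Cod\<close>, which the simplifier can discharge.\<close>

lemma is_functor_iff:
  "is_functor C D F \<longleftrightarrow> category C \<and> category D \<and>
     (\<forall>A \<in> Obj C. ob F A \<in> Obj D \<and> ar F (Ide C A) = Ide D (ob F A)) \<and>
     (\<forall>f \<in> Arr C. ar F f \<in> Arr D \<and> Dom D (ar F f) = ob F (Dom C f) \<and>
        Cod D (ar F f) = ob F (Cod C f)) \<and>
     (\<forall>f \<in> Arr C. \<forall>g \<in> Arr C. Cod C f = Dom C g \<longrightarrow>
        ar F (g \<cdot>\<^bsub>C\<^esub> f) = ar F g \<cdot>\<^bsub>D\<^esub> ar F f)"
  unfolding is_functor_def by (auto simp: Hom_iff)

lemma functor_simps:
  assumes "is_functor C D F"
  shows "A \<in> Obj C \<Longrightarrow> ob F A \<in> Obj D" "A \<in> Obj C \<Longrightarrow> ar F (Ide C A) = Ide D (ob F A)"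
    "f \<in> Arr C \<Longrightarrow> ar F f \<in> Arr D" "f \<in> Arr C \<Longrightarrow> Dom D (ar F f) = ob F (Dom C f)"
    "f \<in> Arr C \<Longrightarrow> Cod D (ar F f) = ob F (Cod C f)"
    "f \<in> Arr C \<Longrightarrow> g \<in> Arr C \<Longrightarrow> Cod C f = Dom C g \<Longrightarrow>
      ar F (g \<cdot>\<^bsub>C\<^esub> f) = ar F g \<cdot>\<^bsub>D\<^esub> ar F f"
  using assms unfolding is_functor_iff by auto

lemma is_functor_opcat: "is_functor C D F \<Longrightarrow> is_functor (opcat C) (opcat D) F"
  by (auto simp: is_functor_iff category_opcat)

lemma functor_sel [simp]:
  "ob idF A = A" "ar idF f = f" "ob (G \<circ>\<^sub>F F) A = ob G (ob F A)" "ar (G \<circ>\<^sub>F F) f = ar G (ar F f)"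
  "ob (powF K 0) A = A" "ar (powF K 0) f = f"
  "ob (powF K (Suc m)) A = ob K (ob (powF K m) A)" "ar (powF K (Suc m)) f = ar K (ar (powF K m) f)"
  "ob (powF K 1) = ob K" "ar (powF K 1) = ar K"
  by (auto simp: idF_def compF_def powF_def One_nat_def)

lemma is_functor_idF: "category C \<Longrightarrow> is_functor C C idF"
  by (simp add: is_functor_iff)

lemma is_functor_compF: "is_functor C D F \<Longrightarrow> is_functor D E G \<Longrightarrow> is_functor C E (G \<circ>\<^sub>F F)"
  by (simp add: is_functor_iff)

lemma nat_trans_iff:
  "nat_trans C D F G t \<longleftrightarrow> is_functor C D F \<and> is_functor C D G \<and>
     (\<forall>A \<in> Obj C. t A \<in> Arr D \<and> Dom D (t A) = ob F A \<and> Cod D (t A) = ob G A) \<and>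
     (\<forall>f \<in> Arr C. t (Cod C f) \<cdot>\<^bsub>D\<^esub> ar F f = ar G f \<cdot>\<^bsub>D\<^esub> t (Dom C f))"
  unfolding nat_trans_def by (auto simp: Hom_iff)

lemma nat_trans_simps:
  assumes "nat_trans C D F G t"
  shows "A \<in> Obj C \<Longrightarrow> t A \<in> Arr D" "A \<in> Obj C \<Longrightarrow> Dom D (t A) = ob F A"
    "A \<in> Obj C \<Longrightarrow> Cod D (t A) = ob G A"
  using assms unfolding nat_trans_iff by auto

lemma nat_trans_natural:
  assumes "nat_trans C D F G t" "f \<in> Arr C" "Cod C f = B"
  shows "t B \<cdot>\<^bsub>D\<^esub> ar F f = ar G f \<cdot>\<^bsub>D\<^esub> t (Dom C f)"
  using assms unfolding nat_trans_iff by auto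

lemma nat_trans_opcat: "nat_trans C D F G t \<Longrightarrow> nat_trans (opcat C) (opcat D) G F t"
  by (auto simp: nat_trans_iff is_functor_opcat)

section \<open>Adjunctions\<close>

lemma adjunction_opcat:
  assumes "adjunction C D L R \<eta> \<epsilon>"
  shows "adjunction (opcat D) (opcat C) R L \<epsilon> \<eta>"
  using assms unfolding adjunction_def
  by (auto intro!: is_functor_opcat dest: nat_trans_opcat)

text \<open>The unit and counit have exactly the shape that \<open>adjoint_tangent\<close> uses for
  the composite adjunction, so that its \<open>tl\<close> and \<open>tc\<close> are mates along this
  one.\<close>

lemma adjunction_comp:
  assumes "adjunction C D L R \<eta> \<epsilon>" "adjunction D E L' R' \<eta>' \<epsilon>'"
  shows "adjunction C E (L' \<circ>\<^sub>F L) (R \<circ>\<^sub>F R')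
    (\<lambda>A. ar R (\<eta>' (ob L A)) \<cdot>\<^bsub>C\<^esub> \<eta> A) (\<lambda>B. \<epsilon>' B \<cdot>\<^bsub>E\<^esub> ar L' (\<epsilon> (ob R' B)))"
proof -
  have F: "is_functor C D L" "is_functor D C R" "is_functor D E L'" "is_functor E D R'"
    and n: "nat_trans C C idF (R \<circ>\<^sub>F L) \<eta>" "nat_trans D D (L \<circ>\<^sub>F R) idF \<epsilon>"
      "nat_trans D D idF (R' \<circ>\<^sub>F L') \<eta>'" "nat_trans E E (L' \<circ>\<^sub>F R') idF \<epsilon>'"
    and tri: "\<And>A. A \<in> Obj C \<Longrightarrow> \<epsilon> (ob L A) \<cdot>\<^bsub>D\<^esub> ar L (\<eta> A) = Ide D (ob L A)"
      "\<And>A. A \<in> Obj D \<Longrightarrow> \<epsilon>' (ob L' A) \<cdot>\<^bsub>E\<^esub> ar L' (\<eta>' A) = Ide E (ob L' A)"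
      "\<And>B. B \<in> Obj D \<Longrightarrow> ar R (\<epsilon> B) \<cdot>\<^bsub>C\<^esub> \<eta> (ob R B) = Ide C (ob R B)"
      "\<And>B. B \<in> Obj E \<Longrightarrow> ar R' (\<epsilon>' B) \<cdot>\<^bsub>D\<^esub> \<eta>' (ob R' B) = Ide D (ob R' B)"
    using assms unfolding adjunction_def by auto
  interpret C: category C using F(1) by (simp add: is_functor_def)
  interpret D: category D using F(1) by (simp add: is_functor_def)
  interpret E: category E using F(3) by (simp add: is_functor_def)
  note s = F[THEN functor_simps(1)] F[THEN functor_simps(2)] F[THEN functor_simps(3)]
    F[THEN functor_simps(4)] F[THEN functor_simps(5)]
    n[THEN nat_trans_simps(1), simplified] n[THEN nat_trans_simps(2), simplified]
    n[THEN nat_trans_simps(3), simplified]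
  note c = F[THEN functor_simps(6), symmetric]
  note nat = n[THEN nat_trans_natural, simplified]
  have fc: "is_functor C E (L' \<circ>\<^sub>F L)" "is_functor E C (R \<circ>\<^sub>F R')"
    using F is_functor_compF by blast+
  have 1: "nat_trans C C idF ((R \<circ>\<^sub>F R') \<circ>\<^sub>F (L' \<circ>\<^sub>F L)) (\<lambda>A. ar R (\<eta>' (ob L A)) \<cdot>\<^bsub>C\<^esub> \<eta> A)"
    unfolding nat_trans_iff
  proof (intro conjI ballI)
    fix f assume f: "f \<in> Arr C"
    have "(ar R (\<eta>' (ob L (Cod C f))) \<cdot>\<^bsub>C\<^esub> \<eta> (Cod C f)) \<cdot>\<^bsub>C\<^esub> f
       = ar R (\<eta>' (ob L (Cod C f))) \<cdot>\<^bsub>C\<^esub> ar R (ar L f) \<cdot>\<^bsub>C\<^esub> \<eta> (Dom C f)"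
      using f by (simp add: C.assoc s nat(1)[OF f])
    also have "\<dots> = (ar R (\<eta>' (ob L (Cod C f)) \<cdot>\<^bsub>D\<^esub> ar L f)) \<cdot>\<^bsub>C\<^esub> \<eta> (Dom C f)"
      using f by (simp add: C.assoc_left s c)
    also have "\<dots> = (ar R (ar R' (ar L' (ar L f)) \<cdot>\<^bsub>D\<^esub> \<eta>' (ob L (Dom C f)))) \<cdot>\<^bsub>C\<^esub> \<eta> (Dom C f)"
      using f by (simp add: s nat(3))
    also have "\<dots> = ar R (ar R' (ar L' (ar L f))) \<cdot>\<^bsub>C\<^esub> ar R (\<eta>' (ob L (Dom C f))) \<cdot>\<^bsub>C\<^esub> \<eta> (Dom C f)"
      using f by (simp add: s F[THEN functor_simps(6)] C.assoc)
    finally show "(ar R (\<eta>' (ob L (Cod C f))) \<cdot>\<^bsub>C\<^esub> \<eta> (Cod C f)) \<cdot>\<^bsub>C\<^esub> ar idF f =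
      ar ((R \<circ>\<^sub>F R') \<circ>\<^sub>F L' \<circ>\<^sub>F L) f \<cdot>\<^bsub>C\<^esub> ar R (\<eta>' (ob L (Dom C f))) \<cdot>\<^bsub>C\<^esub> \<eta> (Dom C f)" by simp
  qed (use fc F in \<open>auto simp: s intro!: is_functor_compF is_functor_idF C.category_axioms\<close>)
  have 2: "nat_trans E E ((L' \<circ>\<^sub>F L) \<circ>\<^sub>F (R \<circ>\<^sub>F R')) idF (\<lambda>B. \<epsilon>' B \<cdot>\<^bsub>E\<^esub> ar L' (\<epsilon> (ob R' B)))"
    unfolding nat_trans_iff
  proof (intro conjI ballI)
    fix f assume f: "f \<in> Arr E"
    have "(\<epsilon>' (Cod E f) \<cdot>\<^bsub>E\<^esub> ar L' (\<epsilon> (ob R' (Cod E f)))) \<cdot>\<^bsub>E\<^esub> ar L' (ar L (ar R (ar R' f)))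
      = \<epsilon>' (Cod E f) \<cdot>\<^bsub>E\<^esub> ar L' (\<epsilon> (ob R' (Cod E f)) \<cdot>\<^bsub>D\<^esub> ar L (ar R (ar R' f)))"
      using f by (simp add: E.assoc s c)
    also have "\<dots> = \<epsilon>' (Cod E f) \<cdot>\<^bsub>E\<^esub> ar L' (ar R' f \<cdot>\<^bsub>D\<^esub> \<epsilon> (ob R' (Dom E f)))"
      using f by (simp add: s nat(2))
    also have "\<dots> = (\<epsilon>' (Cod E f) \<cdot>\<^bsub>E\<^esub> ar L' (ar R' f)) \<cdot>\<^bsub>E\<^esub> ar L' (\<epsilon> (ob R' (Dom E f)))"
      using f by (simp add: s F[THEN functor_simps(6)] E.assoc)
    also have "\<dots> = f \<cdot>\<^bsub>E\<^esub> \<epsilon>' (Dom E f) \<cdot>\<^bsub>E\<^esub> ar L' (\<epsilon> (ob R' (Dom E f)))"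
      using f by (simp add: s nat(4) E.assoc)
    finally show "(\<epsilon>' (Cod E f) \<cdot>\<^bsub>E\<^esub> ar L' (\<epsilon> (ob R' (Cod E f)))) \<cdot>\<^bsub>E\<^esub> ar ((L' \<circ>\<^sub>F L) \<circ>\<^sub>F R \<circ>\<^sub>F R') f
      = ar idF f \<cdot>\<^bsub>E\<^esub> \<epsilon>' (Dom E f) \<cdot>\<^bsub>E\<^esub> ar L' (\<epsilon> (ob R' (Dom E f)))" by simp
  qed (use fc F in \<open>auto simp: s intro!: is_functor_compF is_functor_idF E.category_axioms\<close>)
  have 3: "(\<epsilon>' (ob (L' \<circ>\<^sub>F L) A) \<cdot>\<^bsub>E\<^esub> ar L' (\<epsilon> (ob R' (ob (L' \<circ>\<^sub>F L) A)))) \<cdot>\<^bsub>E\<^esub>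
      ar (L' \<circ>\<^sub>F L) (ar R (\<eta>' (ob L A)) \<cdot>\<^bsub>C\<^esub> \<eta> A) = Ide E (ob (L' \<circ>\<^sub>F L) A)"
    if A: "A \<in> Obj C" for A
  proof -
    let ?B = "ob R' (ob L' (ob L A))"
    have "ar L' (\<epsilon> ?B) \<cdot>\<^bsub>E\<^esub> ar L' (ar L (ar R (\<eta>' (ob L A)) \<cdot>\<^bsub>C\<^esub> \<eta> A))
       = ar L' ((\<epsilon> ?B \<cdot>\<^bsub>D\<^esub> ar L (ar R (\<eta>' (ob L A)))) \<cdot>\<^bsub>D\<^esub> ar L (\<eta> A))"
      using A by (simp add: s F[THEN functor_simps(6)] E.assoc D.assoc)
    \<comment> \<open>Naturality of \<epsilon> at \<open>\<eta>'\<close> moves the counit past the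
      unit of the other adjunction; what remains is one triangle identity of each.\<close>
    also have "\<epsilon> ?B \<cdot>\<^bsub>D\<^esub> ar L (ar R (\<eta>' (ob L A))) = \<eta>' (ob L A) \<cdot>\<^bsub>D\<^esub> \<epsilon> (ob L A)"
      using A nat(2)[of "\<eta>' (ob L A)" ?B] by (simp add: s)
    also have "(\<eta>' (ob L A) \<cdot>\<^bsub>D\<^esub> \<epsilon> (ob L A)) \<cdot>\<^bsub>D\<^esub> ar L (\<eta> A) = \<eta>' (ob L A)"
      using A by (simp add: s D.assoc tri)
    finally show ?thesis
      using A by (simp add: s E.assoc tri)
  qed
  have 4: "ar (R \<circ>\<^sub>F R') (\<epsilon>' B \<cdot>\<^bsub>E\<^esub> ar L' (\<epsilon> (ob R' B))) \<cdot>\<^bsub>C\<^esub>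
      ar R (\<eta>' (ob L (ob (R \<circ>\<^sub>F R') B))) \<cdot>\<^bsub>C\<^esub> \<eta> (ob (R \<circ>\<^sub>F R') B) = Ide C (ob (R \<circ>\<^sub>F R') B)"
    if B: "B \<in> Obj E" for B
  proof -
    let ?A = "ob L (ob R (ob R' B))"
    have "ar R (ar R' (\<epsilon>' B \<cdot>\<^bsub>E\<^esub> ar L' (\<epsilon> (ob R' B)))) \<cdot>\<^bsub>C\<^esub> ar R (\<eta>' ?A)
       = ar R (ar R' (\<epsilon>' B) \<cdot>\<^bsub>D\<^esub> ar R' (ar L' (\<epsilon> (ob R' B))) \<cdot>\<^bsub>D\<^esub> \<eta>' ?A)"
      using B by (simp add: s F[THEN functor_simps(6)] C.assoc)
    also have "ar R' (ar L' (\<epsilon> (ob R' B))) \<cdot>\<^bsub>D\<^esub> \<eta>' ?A = \<eta>' (ob R' B) \<cdot>\<^bsub>D\<^esub> \<epsilon> (ob R' B)"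
      using B nat(3)[of "\<epsilon> (ob R' B)" "ob R' B"] by (simp add: s)
    also have "ar R' (\<epsilon>' B) \<cdot>\<^bsub>D\<^esub> \<eta>' (ob R' B) \<cdot>\<^bsub>D\<^esub> \<epsilon> (ob R' B) = \<epsilon> (ob R' B)"
      using B by (simp add: s D.assoc_left tri)
    finally show ?thesis
      using B by (simp add: s C.assoc_left tri)
  qed
  show ?thesis
    unfolding adjunction_def using fc 1 2 3 4 by blast
qed

text \<open>The bijection of homsets: the second part recovers an arrow from its transpose, the
  third makes every arrow into a value of R a transpose. Equality of arrows out of a value of L can
  thus be tested on transposes.\<close>

lemma adjunction_transpose:
  assumes "adjunction C D L R \<eta> \<epsilon>"
  shows "A \<in> Obj C \<Longrightarrow> h \<in> Hom D (ob L A) B \<Longrightarrow> ar R h \<cdot>\<^bsub>C\<^esub> \<eta> A \<in> Hom C A (ob R B)"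
    and "A \<in> Obj C \<Longrightarrow> h \<in> Hom D (ob L A) B \<Longrightarrow> \<epsilon> B \<cdot>\<^bsub>D\<^esub> ar L (ar R h \<cdot>\<^bsub>C\<^esub> \<eta> A) = h"
    and "B \<in> Obj D \<Longrightarrow> k \<in> Hom C A (ob R B) \<Longrightarrow>
      \<epsilon> B \<cdot>\<^bsub>D\<^esub> ar L k \<in> Hom D (ob L A) B \<and> ar R (\<epsilon> B \<cdot>\<^bsub>D\<^esub> ar L k) \<cdot>\<^bsub>C\<^esub> \<eta> A = k"
proof -
  have F: "is_functor C D L" "is_functor D C R"
    and n: "nat_trans C C idF (R \<circ>\<^sub>F L) \<eta>" "nat_trans D D (L \<circ>\<^sub>F R) idF \<epsilon>"
    and tri: "\<And>A. A \<in> Obj C \<Longrightarrow> \<epsilon> (ob L A) \<cdot>\<^bsub>D\<^esub> ar L (\<eta> A) = Ide D (ob L A)"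
      "\<And>B. B \<in> Obj D \<Longrightarrow> ar R (\<epsilon> B) \<cdot>\<^bsub>C\<^esub> \<eta> (ob R B) = Ide C (ob R B)"
    using assms unfolding adjunction_def by auto
  interpret C: category C using F(1) by (simp add: is_functor_def)
  interpret D: category D using F(1) by (simp add: is_functor_def)
  note s = F[THEN functor_simps(1)] F[THEN functor_simps(2)] F[THEN functor_simps(3)]
    F[THEN functor_simps(4)] F[THEN functor_simps(5)] F[THEN functor_simps(6)]
    n[THEN nat_trans_simps(1), simplified] n[THEN nat_trans_simps(2), simplified]
    n[THEN nat_trans_simps(3), simplified]
  note nat = n[THEN nat_trans_natural, simplified]
  {
    assume A: "A \<in> Obj C" and h: "h \<in> Hom D (ob L A) B"
    have h': "h \<in> Arr D" "Dom D h = ob L A" "Cod D h = B" using h by (auto simp: Hom_iff)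
    show "ar R h \<cdot>\<^bsub>C\<^esub> \<eta> A \<in> Hom C A (ob R B)"
      using A h' by (simp add: Hom_iff s)
    have "\<epsilon> B \<cdot>\<^bsub>D\<^esub> ar L (ar R h \<cdot>\<^bsub>C\<^esub> \<eta> A) = (\<epsilon> B \<cdot>\<^bsub>D\<^esub> ar L (ar R h)) \<cdot>\<^bsub>D\<^esub> ar L (\<eta> A)"
      using A h' by (auto simp: s D.assoc)
    also have "\<dots> = h \<cdot>\<^bsub>D\<^esub> \<epsilon> (ob L A) \<cdot>\<^bsub>D\<^esub> ar L (\<eta> A)"
      using A h' nat(2)[of h B] by (simp add: s D.assoc)
    finally show "\<epsilon> B \<cdot>\<^bsub>D\<^esub> ar L (ar R h \<cdot>\<^bsub>C\<^esub> \<eta> A) = h"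
      using A h' by (simp add: tri)
  }
  {
    assume B: "B \<in> Obj D" and k: "k \<in> Hom C A (ob R B)"
    have k': "k \<in> Arr C" "Dom C k = A" "Cod C k = ob R B" "A \<in> Obj C"
      using k by (auto simp: Hom_iff)
    have "ar R (\<epsilon> B \<cdot>\<^bsub>D\<^esub> ar L k) \<cdot>\<^bsub>C\<^esub> \<eta> A = ar R (\<epsilon> B) \<cdot>\<^bsub>C\<^esub> ar R (ar L k) \<cdot>\<^bsub>C\<^esub> \<eta> A"
      using B k' by (simp add: s C.assoc)
    also have "ar R (ar L k) \<cdot>\<^bsub>C\<^esub> \<eta> A = \<eta> (ob R B) \<cdot>\<^bsub>C\<^esub> k"
      using k' nat(1)[of k "ob R B"] by simp
    also have "ar R (\<epsilon> B) \<cdot>\<^bsub>C\<^esub> \<eta> (ob R B) \<cdot>\<^bsub>C\<^esub> k = k"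
      using B k' by (simp add: s C.assoc_left tri)
    finally show "\<epsilon> B \<cdot>\<^bsub>D\<^esub> ar L k \<in> Hom D (ob L A) B \<and> ar R (\<epsilon> B \<cdot>\<^bsub>D\<^esub> ar L k) \<cdot>\<^bsub>C\<^esub> \<eta> A = k"
      using B k' by (simp add: Hom_iff s)
  }
qed

lemma adjunction_inj:
  assumes "adjunction C D L R \<eta> \<epsilon>" "A \<in> Obj C" "h \<in> Hom D (ob L A) B" "h' \<in> Hom D (ob L A) B"
    and "ar R h \<cdot>\<^bsub>C\<^esub> \<eta> A = ar R h' \<cdot>\<^bsub>C\<^esub> \<eta> A"
  shows "h = h'"
  using adjunction_transpose(2)[OF assms(1,2)] assms(3-5) by metis

lemma adjunction_ex1:
  assumes "adjunction C D L R \<eta> \<epsilon>" "B \<in> Obj D" "k \<in> Hom C A (ob R B)"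
  shows "\<exists>!h. h \<in> Hom D (ob L A) B \<and> ar R h \<cdot>\<^bsub>C\<^esub> \<eta> A = k"
proof -
  have "category C" using assms(1) by (simp add: adjunction_def is_functor_def)
  then have "A \<in> Obj C" using assms(3) category.dom_obj[of C k] by (simp add: Hom_iff)
  then show ?thesis
    using adjunction_transpose(3)[OF assms] adjunction_inj[OF assms(1)] by metis
qed

text \<open>The universal property alone determines L on arrows and the counit, both as unique
  factorizations. This form suits adjoint lifting, where the left adjoint is known only object by
  object.\<close>

lemma adjunction_of_universal_arrows:
  assumes R: "is_functor D C R"
    and L: "\<And>A. A \<in> Obj C \<Longrightarrow> l A \<in> Obj D" "\<And>A. A \<in> Obj C \<Longrightarrow> \<eta> A \<in> Hom C A (ob R (l A))"
    and U: "\<And>A B k. B \<in> Obj D \<Longrightarrow> k \<in> Hom C A (ob R B) \<Longrightarrow>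
      \<exists>!h. h \<in> Hom D (l A) B \<and> ar R h \<cdot>\<^bsub>C\<^esub> \<eta> A = k"
  shows "\<exists>L \<epsilon>. adjunction C D L R \<eta> \<epsilon>"
proof -
  interpret C: category C using R by (simp add: is_functor_def)
  interpret D: category D using R by (simp add: is_functor_def)
  note s = R[THEN functor_simps(1)] R[THEN functor_simps(2)] R[THEN functor_simps(3)]
    R[THEN functor_simps(4)] R[THEN functor_simps(5)]
  note c = R[THEN functor_simps(6)]
  have e: "\<eta> A \<in> Arr C" "Dom C (\<eta> A) = A" "Cod C (\<eta> A) = ob R (l A)" if "A \<in> Obj C" for A
    using L(2)[OF that] by (auto simp: Hom_iff)
  \<comment> \<open>\<open>sh B k\<close> is the arrow whose transpose is k; the values of L on
    arrows and the counit are both instances.\<close>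
  define sh where "sh B k = (THE h. h \<in> Hom D (l (Dom C k)) B \<and> ar R h \<cdot>\<^bsub>C\<^esub> \<eta> (Dom C k) = k)" for B k
  have sh: "sh B k \<in> Arr D" "Dom D (sh B k) = l (Dom C k)" "Cod D (sh B k) = B"
      "ar R (sh B k) \<cdot>\<^bsub>C\<^esub> \<eta> (Dom C k) = k"
    if "B \<in> Obj D" "k \<in> Arr C" "Cod C k = ob R B" for B k
    using theI'[OF U[OF that(1), of k "Dom C k"]] that(2,3) unfolding sh_def by (auto simp: Hom_iff)
  have shI: "h = sh B k" if "h \<in> Arr D" "Dom D h = l (Dom C k)" "Cod D h = B" "k \<in> Arr C"
      "Cod C k = ob R B" "ar R h \<cdot>\<^bsub>C\<^esub> \<eta> (Dom C k) = k" for h B k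
    using the1_equality[OF U, of B k "Dom C k" h] that unfolding sh_def
    by (auto simp: Hom_iff)
  define L where "L = \<lparr>ob = l, ar = (\<lambda>f. sh (l (Cod C f)) (\<eta> (Cod C f) \<cdot>\<^bsub>C\<^esub> f))\<rparr>"
  define \<epsilon> where "\<epsilon> B = sh B (Ide C (ob R B))" for B
  have Lo: "ob L A = l A" for A by (simp add: L_def)
  have La: "ar L f \<in> Arr D" "Dom D (ar L f) = l (Dom C f)" "Cod D (ar L f) = l (Cod C f)"
     "ar R (ar L f) \<cdot>\<^bsub>C\<^esub> \<eta> (Dom C f) = \<eta> (Cod C f) \<cdot>\<^bsub>C\<^esub> f" if "f \<in> Arr C" for f
    using that sh[of "l (Cod C f)" "\<eta> (Cod C f) \<cdot>\<^bsub>C\<^esub> f"] by (auto simp: L_def L(1) e)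
  have inj: "h = h'" if "h \<in> Arr D" "h' \<in> Arr D" "Dom D h = l A" "Dom D h' = l A" "Cod D h = Cod D h'"
     "ar R h \<cdot>\<^bsub>C\<^esub> \<eta> A = ar R h' \<cdot>\<^bsub>C\<^esub> \<eta> A" "A \<in> Obj C" for h h' A
  proof -
    let ?k = "ar R h \<cdot>\<^bsub>C\<^esub> \<eta> A"
    have k: "?k \<in> Arr C" "Dom C ?k = A" "Cod C ?k = ob R (Cod D h)"
      using that by (auto simp: e s)
    have "h = sh (Cod D h) ?k" using that k by (intro shI) simp_all
    moreover have "h' = sh (Cod D h) ?k" using that k by (intro shI) simp_all
    ultimately show ?thesis by simp
  qed
  have FL: "is_functor C D L"
    unfolding is_functor_iff
  proof (intro conjI ballI impI C.category_axioms D.category_axioms)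
    fix A assume A: "A \<in> Obj C"
    show "ob L A \<in> Obj D" using A by (simp add: Lo L)
    show "ar L (Ide C A) = Ide D (ob L A)"
      using A La(4)[of "Ide C A"] by (intro inj[of _ _ A]) (auto simp: Lo L La(1-3) e s)
  next
    fix f g assume f: "f \<in> Arr C" "g \<in> Arr C" "Cod C f = Dom C g"
    have "ar R (ar L g) \<cdot>\<^bsub>C\<^esub> ar R (ar L f) \<cdot>\<^bsub>C\<^esub> \<eta> (Dom C f) =
        ar R (ar L g) \<cdot>\<^bsub>C\<^esub> \<eta> (Cod C f) \<cdot>\<^bsub>C\<^esub> f" using f by (simp add: La)
    also have "\<dots> = (ar R (ar L g) \<cdot>\<^bsub>C\<^esub> \<eta> (Dom C g)) \<cdot>\<^bsub>C\<^esub> f"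
      using f by (simp add: C.assoc La(1-3) s e)
    also have "\<dots> = \<eta> (Cod C g) \<cdot>\<^bsub>C\<^esub> g \<cdot>\<^bsub>C\<^esub> f"
      using f by (simp add: C.assoc La s e)
    finally show "ar L (g \<cdot>\<^bsub>C\<^esub> f) = ar L g \<cdot>\<^bsub>D\<^esub> ar L f"
      using f La(4)[of "g \<cdot>\<^bsub>C\<^esub> f"] by (intro inj[of _ _ "Dom C f"]) (auto simp: La(1-3) e s c C.assoc)
  qed (auto simp: Lo La)
  have eps: "\<epsilon> B \<in> Arr D" "Dom D (\<epsilon> B) = l (ob R B)" "Cod D (\<epsilon> B) = B"
      "ar R (\<epsilon> B) \<cdot>\<^bsub>C\<^esub> \<eta> (ob R B) = Ide C (ob R B)" if "B \<in> Obj D" for B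
    using that sh[of B "Ide C (ob R B)"] by (auto simp: \<epsilon>_def s)
  have n1: "nat_trans C C idF (R \<circ>\<^sub>F L) \<eta>"
    unfolding nat_trans_iff using FL R La
    by (auto simp: Lo e intro!: is_functor_compF is_functor_idF C.category_axioms)
  have n2: "nat_trans D D (L \<circ>\<^sub>F R) idF \<epsilon>"
    unfolding nat_trans_iff
  proof (intro conjI ballI)
    fix f assume f: "f \<in> Arr D"
    have "ar R (\<epsilon> (Cod D f)) \<cdot>\<^bsub>C\<^esub> ar R (ar L (ar R f)) \<cdot>\<^bsub>C\<^esub> \<eta> (ob R (Dom D f)) =
       ar R (\<epsilon> (Cod D f)) \<cdot>\<^bsub>C\<^esub> \<eta> (ob R (Cod D f)) \<cdot>\<^bsub>C\<^esub> ar R f"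
      using f La(4)[of "ar R f"] by (simp add: s)
    also have "\<dots> = ar R f" using f by (simp add: C.assoc_left eps e s)
    also have "\<dots> = ar R f \<cdot>\<^bsub>C\<^esub> ar R (\<epsilon> (Dom D f)) \<cdot>\<^bsub>C\<^esub> \<eta> (ob R (Dom D f))"
      using f by (simp add: eps s)
    finally show "\<epsilon> (Cod D f) \<cdot>\<^bsub>D\<^esub> ar (L \<circ>\<^sub>F R) f = ar idF f \<cdot>\<^bsub>D\<^esub> \<epsilon> (Dom D f)"
      using f by (intro inj[of _ _ "ob R (Dom D f)"]) (auto simp: La s eps e c C.assoc)
  qed (use FL R in \<open>auto simp: eps Lo intro!: is_functor_compF is_functor_idF D.category_axioms\<close>)
  have "\<epsilon> (ob L A) \<cdot>\<^bsub>D\<^esub> ar L (\<eta> A) = Ide D (ob L A)" if A: "A \<in> Obj C" for A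
  proof -
    have "ar R (\<epsilon> (l A)) \<cdot>\<^bsub>C\<^esub> ar R (ar L (\<eta> A)) \<cdot>\<^bsub>C\<^esub> \<eta> A = ar R (\<epsilon> (l A)) \<cdot>\<^bsub>C\<^esub> \<eta> (ob R (l A)) \<cdot>\<^bsub>C\<^esub> \<eta> A"
      using A La(4)[of "\<eta> A"] by (simp add: e)
    also have "\<dots> = \<eta> A" using A by (simp add: C.assoc_left eps L(1) e s)
    finally show ?thesis
      using A by (intro inj[of _ _ A]) (auto simp: Lo La s eps e L(1) c C.assoc)
  qed
  then have "adjunction C D L R \<eta> \<epsilon>"
    unfolding adjunction_def using FL R n1 n2 eps(4) by auto
  then show ?thesis by blast
qed

text \<open>The reason is the triangle identity of the second adjunction together with naturality of
  \<sigma> at h. Keeping an arbitrary h behind the mate, instead of the identity, lets the rule act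
  inside composites.\<close>

lemma mate_transpose:
  assumes a1: "adjunction C C L\<^sub>1 R\<^sub>1 \<eta>\<^sub>1 \<epsilon>\<^sub>1" and a2: "adjunction C C L\<^sub>2 R\<^sub>2 \<eta>\<^sub>2 \<epsilon>\<^sub>2"
    and \<sigma>: "nat_trans C C R\<^sub>1 R\<^sub>2 \<sigma>" and A: "A \<in> Obj C"
  shows "mate C L\<^sub>1 \<eta>\<^sub>1 L\<^sub>2 \<epsilon>\<^sub>2 \<sigma> A \<in> Hom C (ob L\<^sub>2 A) (ob L\<^sub>1 A)"
    and "h \<in> Arr C \<Longrightarrow> Dom C h = ob L\<^sub>1 A \<Longrightarrow>
      ar R\<^sub>2 (h \<cdot>\<^bsub>C\<^esub> mate C L\<^sub>1 \<eta>\<^sub>1 L\<^sub>2 \<epsilon>\<^sub>2 \<sigma> A) \<cdot>\<^bsub>C\<^esub> \<eta>\<^sub>2 A = \<sigma> (Cod C h) \<cdot>\<^bsub>C\<^esub> (ar R\<^sub>1 h \<cdot>\<^bsub>C\<^esub> \<eta>\<^sub>1 A)"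
proof -
  have F: "is_functor C C L\<^sub>1" "is_functor C C R\<^sub>1" "is_functor C C L\<^sub>2" "is_functor C C R\<^sub>2"
    and n: "nat_trans C C idF (R\<^sub>1 \<circ>\<^sub>F L\<^sub>1) \<eta>\<^sub>1" "nat_trans C C (L\<^sub>2 \<circ>\<^sub>F R\<^sub>2) idF \<epsilon>\<^sub>2"
      "nat_trans C C idF (R\<^sub>2 \<circ>\<^sub>F L\<^sub>2) \<eta>\<^sub>2"
    using a1 a2 unfolding adjunction_def by auto
  interpret C: category C using F(1) by (simp add: is_functor_def)
  note s = F[THEN functor_simps(1)] F[THEN functor_simps(2)] F[THEN functor_simps(3)]
    F[THEN functor_simps(4)] F[THEN functor_simps(5)] F[THEN functor_simps(6)]
    n[THEN nat_trans_simps(1), simplified] n[THEN nat_trans_simps(2), simplified]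
    n[THEN nat_trans_simps(3), simplified]
    nat_trans_simps[OF \<sigma>]
  let ?m = "mate C L\<^sub>1 \<eta>\<^sub>1 L\<^sub>2 \<epsilon>\<^sub>2 \<sigma> A"
  have m: "?m = \<epsilon>\<^sub>2 (ob L\<^sub>1 A) \<cdot>\<^bsub>C\<^esub> ar L\<^sub>2 (\<sigma> (ob L\<^sub>1 A) \<cdot>\<^bsub>C\<^esub> \<eta>\<^sub>1 A)"
    using A by (simp add: mate_def s)
  have k: "\<sigma> (ob L\<^sub>1 A) \<cdot>\<^bsub>C\<^esub> \<eta>\<^sub>1 A \<in> Hom C A (ob R\<^sub>2 (ob L\<^sub>1 A))"
    using A by (simp add: Hom_iff s)
  have t: "?m \<in> Hom C (ob L\<^sub>2 A) (ob L\<^sub>1 A)" "ar R\<^sub>2 ?m \<cdot>\<^bsub>C\<^esub> \<eta>\<^sub>2 A = \<sigma> (ob L\<^sub>1 A) \<cdot>\<^bsub>C\<^esub> \<eta>\<^sub>1 A"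
    using adjunction_transpose(3)[OF a2 _ k] A by (auto simp: m s)
  show "?m \<in> Hom C (ob L\<^sub>2 A) (ob L\<^sub>1 A)" by fact
  assume h: "h \<in> Arr C" "Dom C h = ob L\<^sub>1 A"
  have m': "?m \<in> Arr C" "Dom C ?m = ob L\<^sub>2 A" "Cod C ?m = ob L\<^sub>1 A" using t by (auto simp: Hom_iff)
  have "ar R\<^sub>2 (h \<cdot>\<^bsub>C\<^esub> ?m) \<cdot>\<^bsub>C\<^esub> \<eta>\<^sub>2 A = ar R\<^sub>2 h \<cdot>\<^bsub>C\<^esub> ar R\<^sub>2 ?m \<cdot>\<^bsub>C\<^esub> \<eta>\<^sub>2 A"
    using A h m' by (simp add: s C.assoc)
  also have "\<dots> = (ar R\<^sub>2 h \<cdot>\<^bsub>C\<^esub> \<sigma> (ob L\<^sub>1 A)) \<cdot>\<^bsub>C\<^esub> \<eta>\<^sub>1 A"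
    using A h by (simp add: t s C.assoc)
  also have "ar R\<^sub>2 h \<cdot>\<^bsub>C\<^esub> \<sigma> (ob L\<^sub>1 A) = \<sigma> (Cod C h) \<cdot>\<^bsub>C\<^esub> ar R\<^sub>1 h"
    using nat_trans_natural[OF \<sigma> h(1)] h by simp
  finally show "ar R\<^sub>2 (h \<cdot>\<^bsub>C\<^esub> ?m) \<cdot>\<^bsub>C\<^esub> \<eta>\<^sub>2 A = \<sigma> (Cod C h) \<cdot>\<^bsub>C\<^esub> (ar R\<^sub>1 h \<cdot>\<^bsub>C\<^esub> \<eta>\<^sub>1 A)"
    using A h by (simp add: C.assoc s)
qed

text \<open>Both sides have the same transpose along the second adjunction, by naturality of the two
  units and of \<sigma>.\<close>

lemma mate_natural:
  assumes a1: "adjunction C C L\<^sub>1 R\<^sub>1 \<eta>\<^sub>1 \<epsilon>\<^sub>1" and a2: "adjunction C C L\<^sub>2 R\<^sub>2 \<eta>\<^sub>2 \<epsilon>\<^sub>2"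
    and \<sigma>: "nat_trans C C R\<^sub>1 R\<^sub>2 \<sigma>"
  shows "nat_trans C C L\<^sub>2 L\<^sub>1 (mate C L\<^sub>1 \<eta>\<^sub>1 L\<^sub>2 \<epsilon>\<^sub>2 \<sigma>)"
proof -
  let ?m = "mate C L\<^sub>1 \<eta>\<^sub>1 L\<^sub>2 \<epsilon>\<^sub>2 \<sigma>"
  have F: "is_functor C C L\<^sub>1" "is_functor C C R\<^sub>1" "is_functor C C L\<^sub>2" "is_functor C C R\<^sub>2"
    and n: "nat_trans C C idF (R\<^sub>1 \<circ>\<^sub>F L\<^sub>1) \<eta>\<^sub>1" "nat_trans C C idF (R\<^sub>2 \<circ>\<^sub>F L\<^sub>2) \<eta>\<^sub>2"
    using a1 a2 unfolding adjunction_def by auto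
  interpret C: category C using F(1) by (simp add: is_functor_def)
  note s = F[THEN functor_simps(1)] F[THEN functor_simps(2)] F[THEN functor_simps(3)]
    F[THEN functor_simps(4)] F[THEN functor_simps(5)] F[THEN functor_simps(6)]
    n[THEN nat_trans_simps(1), simplified] n[THEN nat_trans_simps(2), simplified]
    n[THEN nat_trans_simps(3), simplified] nat_trans_simps[OF \<sigma>]
  note nat = n[THEN nat_trans_natural, simplified]
  have m: "?m A \<in> Arr C" "Dom C (?m A) = ob L\<^sub>2 A" "Cod C (?m A) = ob L\<^sub>1 A" if "A \<in> Obj C" for A
    using mate_transpose(1)[OF a1 a2 \<sigma> that] by (auto simp: Hom_iff)
  note t = mate_transpose(2)[OF a1 a2 \<sigma>]
  have "?m (Cod C f) \<cdot>\<^bsub>C\<^esub> ar L\<^sub>2 f = ar L\<^sub>1 f \<cdot>\<^bsub>C\<^esub> ?m (Dom C f)" if f: "f \<in> Arr C" for f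
  proof (rule adjunction_inj[OF a2])
    let ?A = "Dom C f" and ?B = "Cod C f"
    have "ar R\<^sub>2 (?m ?B \<cdot>\<^bsub>C\<^esub> ar L\<^sub>2 f) \<cdot>\<^bsub>C\<^esub> \<eta>\<^sub>2 ?A = ar R\<^sub>2 (?m ?B) \<cdot>\<^bsub>C\<^esub> ar R\<^sub>2 (ar L\<^sub>2 f) \<cdot>\<^bsub>C\<^esub> \<eta>\<^sub>2 ?A"
      using f by (simp add: s m C.assoc)
    also have "\<dots> = (ar R\<^sub>2 (?m ?B) \<cdot>\<^bsub>C\<^esub> \<eta>\<^sub>2 ?B) \<cdot>\<^bsub>C\<^esub> f"
      using f nat(2)[OF f refl] by (simp add: C.assoc s m)
    also have "\<dots> = \<sigma> (ob L\<^sub>1 ?B) \<cdot>\<^bsub>C\<^esub> \<eta>\<^sub>1 ?B \<cdot>\<^bsub>C\<^esub> f"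
      using f t[of ?B "Ide C (ob L\<^sub>1 ?B)"] by (simp add: C.assoc s m)
    also have "\<dots> = ar R\<^sub>2 (ar L\<^sub>1 f \<cdot>\<^bsub>C\<^esub> ?m ?A) \<cdot>\<^bsub>C\<^esub> \<eta>\<^sub>2 ?A"
      using f t[of ?A "ar L\<^sub>1 f"] nat(1)[OF f refl] by (simp add: s)
    finally show "ar R\<^sub>2 (?m ?B \<cdot>\<^bsub>C\<^esub> ar L\<^sub>2 f) \<cdot>\<^bsub>C\<^esub> \<eta>\<^sub>2 ?A
      = ar R\<^sub>2 (ar L\<^sub>1 f \<cdot>\<^bsub>C\<^esub> ?m ?A) \<cdot>\<^bsub>C\<^esub> \<eta>\<^sub>2 ?A" .
  qed (use f in \<open>auto simp: Hom_iff s m\<close>)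
  then show ?thesis
    using F by (auto simp: nat_trans_iff m)
qed

text \<open>With the identity as its own adjoint, the opposite projection and zero section become
  mates as well.\<close>

lemma adjunction_idF: "category C \<Longrightarrow> adjunction C C idF idF (Ide C) (Ide C)"
  by (auto simp: adjunction_def nat_trans_iff is_functor_idF category.ide_simps
      category.ide_comp_simps category.dom_cod_obj is_functor_compF[of C C idF C idF])

text \<open>Naturality sees a family only at objects of the category, and the mate formulas for
  \<open>tp\<close> and \<open>tz\<close> are available only there.\<close>

lemma nat_trans_cong:
  assumes "nat_trans C D F G t" "\<And>A. A \<in> Obj C \<Longrightarrow> t' A = t A"
  shows "nat_trans C D F G t'"
proof -
  interpret category C using assms(1) by (simp add: nat_trans_def is_functor_def)
  show ?thesis using assms by (simp add: nat_trans_iff)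
qed

section \<open>Limits\<close>

text \<open>Common core of the preservation of products, pullbacks and equalizers by right adjoints.
  A cone over the image under R is transposed to a cone \<open>g'\<close> in D; \<open>ex\<close> is
  asked only for such transposes, so that each use can derive its own commutation condition for
  \<open>g'\<close>.\<close>

lemma adjunction_ex1_transfer:
  assumes adj: "adjunction C D L R \<eta> \<epsilon>" and Z: "Z \<in> Obj C" and P: "P \<in> Obj D"
    and q: "\<And>j. j \<in> J \<Longrightarrow> q j \<in> Hom D P (Q j)"
    and g: "\<And>j. j \<in> J \<Longrightarrow> g j \<in> Hom C Z (ob R (Q j))"
    and ex: "\<And>g'. (\<And>j. j \<in> J \<Longrightarrow> g' j \<in> Hom D (ob L Z) (Q j) \<and> ar R (g' j) \<cdot>\<^bsub>C\<^esub> \<eta> Z = g j) \<Longrightarrow>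
      \<exists>!h. h \<in> Hom D (ob L Z) P \<and> (\<forall>j\<in>J. q j \<cdot>\<^bsub>D\<^esub> h = g' j)"
  shows "\<exists>!k. k \<in> Hom C Z (ob R P) \<and> (\<forall>j\<in>J. ar R (q j) \<cdot>\<^bsub>C\<^esub> k = g j)"
proof -
  have F: "is_functor C D L" "is_functor D C R" and n: "nat_trans C C idF (R \<circ>\<^sub>F L) \<eta>"
    using adj unfolding adjunction_def by auto
  interpret C: category C using F(1) by (simp add: is_functor_def)
  interpret D: category D using F(1) by (simp add: is_functor_def)
  note s = F[THEN functor_simps(3)] F[THEN functor_simps(4)] F[THEN functor_simps(5)]
    F[THEN functor_simps(6)] nat_trans_simps[OF n, simplified]
  define g' where "g' j = \<epsilon> (Q j) \<cdot>\<^bsub>D\<^esub> ar L (g j)" for j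
  have g': "g' j \<in> Hom D (ob L Z) (Q j)" "ar R (g' j) \<cdot>\<^bsub>C\<^esub> \<eta> Z = g j" if "j \<in> J" for j
    using adjunction_transpose(3)[OF adj _ g[OF that]] D.hom_obj(2)[OF q[OF that]]
    unfolding g'_def by auto
  have R: "ar R (q j) \<cdot>\<^bsub>C\<^esub> ar R h \<cdot>\<^bsub>C\<^esub> \<eta> Z = g j \<longleftrightarrow> q j \<cdot>\<^bsub>D\<^esub> h = g' j"
    if "j \<in> J" "h \<in> Hom D (ob L Z) P" for h j
  proof -
    have "ar R (q j) \<cdot>\<^bsub>C\<^esub> ar R h \<cdot>\<^bsub>C\<^esub> \<eta> Z = ar R (q j \<cdot>\<^bsub>D\<^esub> h) \<cdot>\<^bsub>C\<^esub> \<eta> Z"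
      using q[OF that(1)] that(2) Z by (auto simp: Hom_iff s C.assoc)
    moreover have "q j \<cdot>\<^bsub>D\<^esub> h \<in> Hom D (ob L Z) (Q j)"
      using q[OF that(1)] that(2) by (auto simp: Hom_iff)
    ultimately show ?thesis
      using adjunction_inj[OF adj Z] g' that by metis
  qed
  obtain h where h: "h \<in> Hom D (ob L Z) P" "\<forall>j\<in>J. q j \<cdot>\<^bsub>D\<^esub> h = g' j"
    using ex[of g'] g' by blast
  show ?thesis
  proof (rule ex1I[of _ "ar R h \<cdot>\<^bsub>C\<^esub> \<eta> Z"])
    show "ar R h \<cdot>\<^bsub>C\<^esub> \<eta> Z \<in> Hom C Z (ob R P) \<and> (\<forall>j\<in>J. ar R (q j) \<cdot>\<^bsub>C\<^esub> ar R h \<cdot>\<^bsub>C\<^esub> \<eta> Z = g j)"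
      using adjunction_transpose(1)[OF adj Z h(1)] h R by blast
    fix k assume k: "k \<in> Hom C Z (ob R P) \<and> (\<forall>j\<in>J. ar R (q j) \<cdot>\<^bsub>C\<^esub> k = g j)"
    then obtain h' where h': "h' \<in> Hom D (ob L Z) P" "ar R h' \<cdot>\<^bsub>C\<^esub> \<eta> Z = k"
      using adjunction_ex1[OF adj P] by blast
    then have "\<forall>j\<in>J. q j \<cdot>\<^bsub>D\<^esub> h' = g' j"
      using R k by metis
    then have "h' = h"
      using ex[of g'] g' h h'(1) by blast
    then show "k = ar R h \<cdot>\<^bsub>C\<^esub> \<eta> Z"
      using h' by simp
  qed
qed

lemma right_adjoint_product:
  assumes adj: "adjunction C D L R \<eta> \<epsilon>" and p: "is_product D As P pr"
  shows "is_product C (map (ob R) As) (ob R P) (\<lambda>i. ar R (pr i))"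
proof -
  have R: "is_functor D C R" and L: "is_functor C D L" using adj by (auto simp: adjunction_def)
  note s = functor_simps[OF R]
  have J: "As ! (i - 1) \<in> set As" "i - 1 < length As" if "i \<in> {1..length As}" for i
    using that by (auto intro!: nth_mem)
  have P: "P \<in> Obj D" and pr: "\<And>i. i \<in> {1..length As} \<Longrightarrow> pr i \<in> Hom D P (As ! (i - 1))"
    and As: "set As \<subseteq> Obj D"
    using p unfolding is_product_def by auto
  have pr': "ar R (pr i) \<in> Hom C (ob R P) (map (ob R) As ! (i - 1))" if "i \<in> {1..length As}" for i
    using pr[OF that] J(2)[OF that] by (auto simp: Hom_iff s)
  have "\<exists>!h. h \<in> Hom C Z (ob R P) \<and> (\<forall>i\<in>{1..length As}. ar R (pr i) \<cdot>\<^bsub>C\<^esub> h = g i)"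
    if Z: "Z \<in> Obj C" and g: "\<forall>i\<in>{1..length As}. g i \<in> Hom C Z (map (ob R) As ! (i - 1))" for Z g
  proof (rule adjunction_ex1_transfer[OF adj Z P pr])
    show "g j \<in> Hom C Z (ob R (As ! (j - 1)))" if "j \<in> {1..length As}" for j
      using bspec[OF g that] J(2)[OF that] by simp
    show "\<exists>!h. h \<in> Hom D (ob L Z) P \<and> (\<forall>j\<in>{1..length As}. pr j \<cdot>\<^bsub>D\<^esub> h = g' j)"
      if "\<And>j. j \<in> {1..length As} \<Longrightarrow> g' j \<in> Hom D (ob L Z) (As ! (j - 1)) \<and> ar R (g' j) \<cdot>\<^bsub>C\<^esub> \<eta> Z = g j"
      for g'
      using p that functor_simps(1)[OF L Z] unfolding is_product_def by blast
  qed
  then show ?thesis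
    using P As pr' unfolding is_product_def by (auto simp: s)
qed

lemma nfold_pullback_ex1:
  assumes "is_nfold_pullback C n f P q" "Z \<in> Obj C"
    and "\<And>j. j \<in> {1..n} \<Longrightarrow> g j \<in> Hom C Z (Dom C f)"
    and "\<And>j k. j \<in> {1..n} \<Longrightarrow> k \<in> {1..n} \<Longrightarrow> f \<cdot>\<^bsub>C\<^esub> g j = f \<cdot>\<^bsub>C\<^esub> g k"
  shows "\<exists>!h. h \<in> Hom C Z P \<and> (\<forall>j\<in>{1..n}. q j \<cdot>\<^bsub>C\<^esub> h = g j)"
proof -
  have "\<forall>g. (\<forall>j\<in>{1..n}. g j \<in> Hom C Z (Dom C f)) \<and>
      (\<forall>j\<in>{1..n}. \<forall>k\<in>{1..n}. f \<cdot>\<^bsub>C\<^esub> g j = f \<cdot>\<^bsub>C\<^esub> g k) \<longrightarrow>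
      (\<exists>!h. h \<in> Hom C Z P \<and> (\<forall>j\<in>{1..n}. q j \<cdot>\<^bsub>C\<^esub> h = g j))"
    using assms(1,2) unfolding is_nfold_pullback_def by (elim conjE) (erule bspec)
  then show ?thesis
    using assms(3,4) by (elim allE[of _ g] mp) (intro conjI ballI)
qed

lemma nfold_pullback_simps:
  assumes "is_nfold_pullback C n f P q"
  shows "f \<in> Arr C" "P \<in> Obj C" "j \<in> {1..n} \<Longrightarrow> q j \<in> Hom C P (Dom C f)"
    "j \<in> {1..n} \<Longrightarrow> k \<in> {1..n} \<Longrightarrow> f \<cdot>\<^bsub>C\<^esub> q j = f \<cdot>\<^bsub>C\<^esub> q k"
  using assms unfolding is_nfold_pullback_def by blast+

lemma nfold_pullbackI:
  assumes "f \<in> Arr C" "P \<in> Obj C" "\<And>j. j \<in> {1..n} \<Longrightarrow> q j \<in> Hom C P (Dom C f)"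
    and "\<And>j k. j \<in> {1..n} \<Longrightarrow> k \<in> {1..n} \<Longrightarrow> f \<cdot>\<^bsub>C\<^esub> q j = f \<cdot>\<^bsub>C\<^esub> q k"
    and "\<And>Z g. Z \<in> Obj C \<Longrightarrow> (\<And>j. j \<in> {1..n} \<Longrightarrow> g j \<in> Hom C Z (Dom C f)) \<Longrightarrow>
      (\<And>j k. j \<in> {1..n} \<Longrightarrow> k \<in> {1..n} \<Longrightarrow> f \<cdot>\<^bsub>C\<^esub> g j = f \<cdot>\<^bsub>C\<^esub> g k) \<Longrightarrow>
      \<exists>!h. h \<in> Hom C Z P \<and> (\<forall>j\<in>{1..n}. q j \<cdot>\<^bsub>C\<^esub> h = g j)"
  shows "is_nfold_pullback C n f P q"
  unfolding is_nfold_pullback_def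
proof (intro conjI ballI allI impI assms(1-4))
  fix Z g
  assume "Z \<in> Obj C" "(\<forall>j \<in> {1..n}. g j \<in> Hom C Z (Dom C f)) \<and>
    (\<forall>j \<in> {1..n}. \<forall>k \<in> {1..n}. f \<cdot>\<^bsub>C\<^esub> g j = f \<cdot>\<^bsub>C\<^esub> g k)"
  then show "\<exists>!h. h \<in> Hom C Z P \<and> (\<forall>j\<in>{1..n}. q j \<cdot>\<^bsub>C\<^esub> h = g j)"
    by (intro assms(5)) blast+
qed

lemma right_adjoint_nfold_pullback:
  assumes adj: "adjunction C D L R \<eta> \<epsilon>" and p: "is_nfold_pullback D n f P q"
  shows "is_nfold_pullback C n (ar R f) (ob R P) (\<lambda>j. ar R (q j))"
proof -
  have F: "is_functor D C R" "is_functor C D L" and n: "nat_trans C C idF (R \<circ>\<^sub>F L) \<eta>"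
    using adj by (auto simp: adjunction_def)
  interpret C: category C using F(1) by (simp add: is_functor_def)
  interpret D: category D using F(1) by (simp add: is_functor_def)
  note s = functor_simps[OF F(1)] nat_trans_simps[OF n, simplified] functor_simps(1)[OF F(2)]
  have f: "f \<in> Arr D" and P: "P \<in> Obj D" and q: "\<And>j. j \<in> {1..n} \<Longrightarrow> q j \<in> Hom D P (Dom D f)"
    and eq: "\<And>j k. j \<in> {1..n} \<Longrightarrow> k \<in> {1..n} \<Longrightarrow> f \<cdot>\<^bsub>D\<^esub> q j = f \<cdot>\<^bsub>D\<^esub> q k"
    using p unfolding is_nfold_pullback_def by blast+
  have "ar R f \<cdot>\<^bsub>C\<^esub> ar R (q j) = ar R f \<cdot>\<^bsub>C\<^esub> ar R (q k)" if "j \<in> {1..n}" "k \<in> {1..n}" for j k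
    using f q[OF that(1)] q[OF that(2)] eq[OF that] by (auto simp: Hom_iff s(6)[symmetric])
  moreover have "ar R (q j) \<in> Hom C (ob R P) (Dom C (ar R f))" if "j \<in> {1..n}" for j
    using q[OF that] f by (auto simp: Hom_iff s)
  moreover have "\<exists>!h. h \<in> Hom C Z (ob R P) \<and> (\<forall>j\<in>{1..n}. ar R (q j) \<cdot>\<^bsub>C\<^esub> h = g j)"
    if Z: "Z \<in> Obj C" and g: "(\<forall>j\<in>{1..n}. g j \<in> Hom C Z (Dom C (ar R f))) \<and>
      (\<forall>j\<in>{1..n}. \<forall>k\<in>{1..n}. ar R f \<cdot>\<^bsub>C\<^esub> g j = ar R f \<cdot>\<^bsub>C\<^esub> g k)" for Z g
  proof (rule adjunction_ex1_transfer[OF adj Z P q])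
    show "g j \<in> Hom C Z (ob R (Dom D f))" if "j \<in> {1..n}" for j
      using g that f by (auto simp: s)
    fix g'
    assume g': "\<And>j. j \<in> {1..n} \<Longrightarrow> g' j \<in> Hom D (ob L Z) (Dom D f) \<and> ar R (g' j) \<cdot>\<^bsub>C\<^esub> \<eta> Z = g j"
    \<comment> \<open>Agreement over f passes through the adjunction: the transposes of the two
      composites are \<open>g j\<close> and \<open>g k\<close> followed by
      \<open>ar R f\<close>.\<close>
    have "f \<cdot>\<^bsub>D\<^esub> g' j = f \<cdot>\<^bsub>D\<^esub> g' k" if "j \<in> {1..n}" "k \<in> {1..n}" for j k
    proof (rule adjunction_inj[OF adj Z])
      have "ar R (f \<cdot>\<^bsub>D\<^esub> g' j) \<cdot>\<^bsub>C\<^esub> \<eta> Z = ar R f \<cdot>\<^bsub>C\<^esub> g j" if "j \<in> {1..n}" for j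
        using g'[OF that] f Z by (clarsimp simp: Hom_iff s C.assoc)
      then show "ar R (f \<cdot>\<^bsub>D\<^esub> g' j) \<cdot>\<^bsub>C\<^esub> \<eta> Z = ar R (f \<cdot>\<^bsub>D\<^esub> g' k) \<cdot>\<^bsub>C\<^esub> \<eta> Z"
        using that g by metis
      show "f \<cdot>\<^bsub>D\<^esub> g' j \<in> Hom D (ob L Z) (Cod D f)" "f \<cdot>\<^bsub>D\<^esub> g' k \<in> Hom D (ob L Z) (Cod D f)"
        using g'[OF that(1)] g'[OF that(2)] f by (simp_all add: Hom_iff)
    qed
    then show "\<exists>!h. h \<in> Hom D (ob L Z) P \<and> (\<forall>j\<in>{1..n}. q j \<cdot>\<^bsub>D\<^esub> h = g' j)"
      using p g' s(10)[OF Z] unfolding is_nfold_pullback_def by blast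
  qed
  ultimately show ?thesis
    unfolding is_nfold_pullback_def using s(1)[OF P] s(3)[OF f] by blast
qed

text \<open>Making the test object explicit gives the same shape as for products and pullbacks, so
  that one transfer lemma serves all three.\<close>

lemma is_equalizer_iff:
  assumes "category C"
  shows "is_equalizer C f g e \<longleftrightarrow> f \<in> Arr C \<and> g \<in> Hom C (Dom C f) (Cod C f) \<and>
     e \<in> Arr C \<and> Cod C e = Dom C f \<and> f \<cdot>\<^bsub>C\<^esub> e = g \<cdot>\<^bsub>C\<^esub> e \<and>
     (\<forall>Z \<in> Obj C. \<forall>h \<in> Hom C Z (Dom C f). f \<cdot>\<^bsub>C\<^esub> h = g \<cdot>\<^bsub>C\<^esub> h \<longrightarrow>
        (\<exists>!k. k \<in> Hom C Z (Dom C e) \<and> e \<cdot>\<^bsub>C\<^esub> k = h))"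
proof -
  have "(\<forall>h \<in> Arr C. Cod C h = Dom C f \<and> f \<cdot>\<^bsub>C\<^esub> h = g \<cdot>\<^bsub>C\<^esub> h \<longrightarrow> Q (Dom C h) h) \<longleftrightarrow>
    (\<forall>Z \<in> Obj C. \<forall>h \<in> Hom C Z (Dom C f). f \<cdot>\<^bsub>C\<^esub> h = g \<cdot>\<^bsub>C\<^esub> h \<longrightarrow> Q Z h)" for Q
    by (auto simp: Hom_iff category.dom_cod_obj[OF assms])
  from this[of "\<lambda>Z h. \<exists>!k. k \<in> Hom C Z (Dom C e) \<and> e \<cdot>\<^bsub>C\<^esub> k = h"] show ?thesis
    unfolding is_equalizer_def by simp
qed

lemma right_adjoint_equalizer:
  assumes adj: "adjunction C D L R \<eta> \<epsilon>" and p: "is_equalizer D f g e"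
  shows "is_equalizer C (ar R f) (ar R g) (ar R e)"
proof -
  have F: "is_functor D C R" "is_functor C D L" and n: "nat_trans C C idF (R \<circ>\<^sub>F L) \<eta>"
    using adj by (auto simp: adjunction_def)
  interpret C: category C using F(1) by (simp add: is_functor_def)
  interpret D: category D using F(1) by (simp add: is_functor_def)
  note s = functor_simps[OF F(1)] nat_trans_simps[OF n, simplified] functor_simps(1)[OF F(2)]
  have f: "f \<in> Arr D" "g \<in> Arr D" "Dom D g = Dom D f" "Cod D g = Cod D f"
    and e: "e \<in> Arr D" "Cod D e = Dom D f" and eq: "f \<cdot>\<^bsub>D\<^esub> e = g \<cdot>\<^bsub>D\<^esub> e"
    and ex: "\<And>Z h. Z \<in> Obj D \<Longrightarrow> h \<in> Hom D Z (Dom D f) \<Longrightarrow> f \<cdot>\<^bsub>D\<^esub> h = g \<cdot>\<^bsub>D\<^esub> h \<Longrightarrow>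
      \<exists>!k. k \<in> Hom D Z (Dom D e) \<and> e \<cdot>\<^bsub>D\<^esub> k = h"
    using p unfolding is_equalizer_iff[OF D.category_axioms] by (auto simp: Hom_iff)
  have ex': "\<exists>!k. k \<in> Hom C Z (Dom C (ar R e)) \<and> ar R e \<cdot>\<^bsub>C\<^esub> k = h"
    if Z: "Z \<in> Obj C" and h: "h \<in> Hom C Z (Dom C (ar R f))" "ar R f \<cdot>\<^bsub>C\<^esub> h = ar R g \<cdot>\<^bsub>C\<^esub> h" for Z h
  proof -
    \<comment> \<open>An equalizer is treated as a one-member family, indexed by the unit type; the
      equation of the parallel pair enters where \<open>ex\<close> is discharged.\<close>
    have "\<exists>!k. k \<in> Hom C Z (ob R (Dom D e)) \<and> (\<forall>j\<in>{()}. ar R e \<cdot>\<^bsub>C\<^esub> k = h)"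
    proof (rule adjunction_ex1_transfer[OF adj Z, where Q = "\<lambda>_. Dom D f"])
      fix g'
      assume g': "\<And>j :: unit. j \<in> {()} \<Longrightarrow> g' j \<in> Hom D (ob L Z) (Dom D f) \<and> ar R (g' j) \<cdot>\<^bsub>C\<^esub> \<eta> Z = h"
      have k: "g' () \<in> Arr D" "Dom D (g' ()) = ob L Z" "Cod D (g' ()) = Dom D f"
        "ar R (g' ()) \<cdot>\<^bsub>C\<^esub> \<eta> Z = h"
        using g' by (auto simp: Hom_iff)
      have "f \<cdot>\<^bsub>D\<^esub> g' () = g \<cdot>\<^bsub>D\<^esub> g' ()"
        by (rule adjunction_inj[OF adj Z]) (use f Z k h(2) in \<open>auto simp: Hom_iff s C.assoc\<close>)
      then show "\<exists>!h. h \<in> Hom D (ob L Z) (Dom D e) \<and> (\<forall>j\<in>{()}. e \<cdot>\<^bsub>D\<^esub> h = g' j)"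
        using ex[of "ob L Z" "g' ()"] k s(10)[OF Z] by (auto simp: Hom_iff)
    qed (use h f e in \<open>auto simp: Hom_iff s\<close>)
    then show ?thesis using e by (simp add: s)
  qed
  have "ar R f \<cdot>\<^bsub>C\<^esub> ar R e = ar R g \<cdot>\<^bsub>C\<^esub> ar R e"
    using f e eq by (simp add: s(6)[symmetric])
  then show ?thesis
    unfolding is_equalizer_iff[OF C.category_axioms]
    by (intro conjI ballI impI ex'; (assumption | use f e in \<open>simp add: Hom_iff s\<close>))
qed

section \<open>Pairing into twofold pullbacks\<close>

context category
begin

lemma pb_pair:
  assumes pb: "is_nfold_pullback C 2 f P q"
    and u: "u \<in> Arr C" "Cod C u = Dom C f" and v: "v \<in> Arr C" "Dom C v = Dom C u" "Cod C v = Dom C f"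
    and eq: "f \<cdot> u = f \<cdot> v"
  shows "pb_pair C (q 1) (q 2) u v \<in> Arr C" "Dom C (pb_pair C (q 1) (q 2) u v) = Dom C u"
    "Cod C (pb_pair C (q 1) (q 2) u v) = P"
    "q 1 \<cdot> pb_pair C (q 1) (q 2) u v = u" "q 2 \<cdot> pb_pair C (q 1) (q 2) u v = v"
proof -
  have 12: "{1..2} = {1, 2::nat}" by (auto simp: numeral_2_eq_2 One_nat_def)
  define g where "g j = (if j = 1 then u else v)" for j :: nat
  have g: "g 1 = u" "g 2 = v" by (simp_all add: g_def)
  have j: "j = 1 \<or> j = 2" if "j \<in> {1..2}" for j :: nat using that 12 by blast
  have "\<exists>!h. h \<in> Hom C (Dom C u) P \<and> (\<forall>j\<in>{1..2}. q j \<cdot> h = g j)"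
  proof (rule nfold_pullback_ex1[OF pb])
    show "g j \<in> Hom C (Dom C u) (Dom C f)" if "j \<in> {1..2}" for j
      using j[OF that] u v by (elim disjE) (simp_all add: g Hom_iff)
    show "f \<cdot> g j = f \<cdot> g k" if "j \<in> {1..2}" "k \<in> {1..2}" for j k
      using j[OF that(1)] j[OF that(2)] eq by (elim disjE) (simp_all add: g)
  qed (use u in simp)
  then have "\<exists>!h. h \<in> Hom C (Dom C u) P \<and> q 1 \<cdot> h = u \<and> q 2 \<cdot> h = v"
    unfolding 12 by (simp add: g)
  moreover have "Dom C (q 1) = P"
    using nfold_pullback_simps(3)[OF pb, of 1] by (simp add: Hom_iff)
  ultimately have "pb_pair C (q 1) (q 2) u v \<in> Hom C (Dom C u) P \<and>
      q 1 \<cdot> pb_pair C (q 1) (q 2) u v = u \<and> q 2 \<cdot> pb_pair C (q 1) (q 2) u v = v"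
    unfolding pb_pair_def by (simp only:) (rule theI')
  then show "pb_pair C (q 1) (q 2) u v \<in> Arr C" "Dom C (pb_pair C (q 1) (q 2) u v) = Dom C u"
    "Cod C (pb_pair C (q 1) (q 2) u v) = P"
    "q 1 \<cdot> pb_pair C (q 1) (q 2) u v = u" "q 2 \<cdot> pb_pair C (q 1) (q 2) u v = v"
    by (auto simp: Hom_iff)
qed

lemma nfold_pullback_ext:
  assumes pb: "is_nfold_pullback C n f P q" and "n \<ge> 1"
    and u: "u \<in> Arr C" "Cod C u = P" and v: "v \<in> Arr C" "Dom C v = Dom C u" "Cod C v = P"
    and eq: "\<And>j. 1 \<le> j \<Longrightarrow> j \<le> n \<Longrightarrow> q j \<cdot> u = q j \<cdot> v"
  shows "u = v"
proof -
  have q: "q j \<in> Arr C" "Dom C (q j) = P" "Cod C (q j) = Dom C f" if "j \<in> {1..n}" for j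
    using nfold_pullback_simps(3)[OF pb that] by (auto simp: Hom_iff)
  have "\<exists>!h. h \<in> Hom C (Dom C u) P \<and> (\<forall>j\<in>{1..n}. q j \<cdot> h = q j \<cdot> u)"
  proof (rule nfold_pullback_ex1[OF pb])
    show "q j \<cdot> u \<in> Hom C (Dom C u) (Dom C f)" if "j \<in> {1..n}" for j
      using q[OF that] u by (simp add: Hom_iff)
    show "f \<cdot> q j \<cdot> u = f \<cdot> q k \<cdot> u" if "j \<in> {1..n}" "k \<in> {1..n}" for j k
      using nfold_pullback_simps(1,4)[OF pb] q[OF that(1)] q[OF that(2)] u that
      by (metis assoc)
  qed (use u in simp)
  moreover have "u \<in> Hom C (Dom C u) P" "v \<in> Hom C (Dom C u) P"
    using u v by (auto simp: Hom_iff)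
  moreover have "\<forall>j\<in>{1..n}. q j \<cdot> v = q j \<cdot> u"
    using eq by auto
  ultimately show ?thesis by blast
qed

text \<open>Any arrow with the two components identifies the definite description; compatibility of
  u and v follows from its existence.\<close>

lemma pb_pair_eq:
  assumes pb: "is_nfold_pullback C 2 f P q" and h: "h \<in> Arr C" "Cod C h = P"
    and uv: "q 1 \<cdot> h = u" "q 2 \<cdot> h = v"
  shows "pb_pair C (q 1) (q 2) u v = h"
proof -
  have q: "q j \<in> Arr C" "Dom C (q j) = P" "Cod C (q j) = Dom C f" if "j \<in> {1..2}" for j
    using nfold_pullback_simps(3)[OF pb that] by (simp_all add: Hom_iff)
  have f: "f \<in> Arr C" "f \<cdot> q 1 = f \<cdot> q 2"
    using nfold_pullback_simps(1,4)[OF pb] by simp_all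
  have u: "u \<in> Arr C" "Dom C u = Dom C h" "Cod C u = Dom C f"
    and v: "v \<in> Arr C" "Dom C v = Dom C h" "Cod C v = Dom C f"
    using h q[of 1] q[of 2] by (simp_all flip: uv)
  have "f \<cdot> u = f \<cdot> v"
    using f h q[of 1] q[of 2] comp_extend[OF f(2), of h] by (simp add: assoc flip: uv)
  note P = pb_pair[OF pb u(1,3) v(1) v(2)[folded u(2)] v(3) this]
  show ?thesis
  proof (rule nfold_pullback_ext[OF pb])
    fix j :: nat assume "1 \<le> j" "j \<le> 2"
    then have "j = 1 \<or> j = 2" by linarith
    then show "q j \<cdot> pb_pair C (q 1) (q 2) u v = q j \<cdot> h" using P uv by auto
  qed (use P u h in simp_all)
qed

end

section \<open>Tangent categories\<close>

context tangent_category
begin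

lemma T_simps [simp]:
  assumes "1 \<le> n"
  shows "A \<in> Obj C \<Longrightarrow> ob (tanTn T n) A \<in> Obj C"
    "A \<in> Obj C \<Longrightarrow> ar (tanTn T n) (Ide C A) = Ide C (ob (tanTn T n) A)"
    "f \<in> Arr C \<Longrightarrow> ar (tanTn T n) f \<in> Arr C"
    "f \<in> Arr C \<Longrightarrow> Dom C (ar (tanTn T n) f) = ob (tanTn T n) (Dom C f)"
    "f \<in> Arr C \<Longrightarrow> Cod C (ar (tanTn T n) f) = ob (tanTn T n) (Cod C f)"
  using functor_simps[OF T_functor[OF assms]] by auto

lemma T_comp:
  assumes "1 \<le> n" "f \<in> Arr C" "g \<in> Arr C" "Cod C f = Dom C g"
  shows "ar (tanTn T n) (g \<cdot> f) = ar (tanTn T n) g \<cdot> ar (tanTn T n) f"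
  using functor_simps(6)[OF T_functor] assms by blast

lemmas structure_simps [simp] =
  nat_trans_simps[OF p_natural, simplified] nat_trans_simps[OF s_natural, simplified]
  nat_trans_simps[OF z_natural, simplified] nat_trans_simps[OF l_natural, simplified]
  nat_trans_simps[OF c_natural, simplified]

lemma q_simps [simp]:
  assumes "1 \<le> j" "j \<le> n" "A \<in> Obj C"
  shows "tq T n j A \<in> Arr C" "Dom C (tq T n j A) = ob (tanTn T n) A"
    "Cod C (tq T n j A) = ob (tanT T) A"
  using nat_trans_simps[OF q_natural, of j n A] assms by auto

section \<open>Pairing into \<open>T\<^sub>2(A)\<close> and \<open>T(T\<^sub>2(A))\<close>\<close>

lemma T2_pullback:
  "A \<in> Obj C \<Longrightarrow> is_nfold_pullback C 2 (tp T A) (ob (tanTn T 2) A) (\<lambda>j. tq T 2 j A)"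
  using pullbacks[of 2 A 0] by simp

lemma TT2_pullback:
  "A \<in> Obj C \<Longrightarrow> is_nfold_pullback C 2 (ar (tanT T) (tp T A))
     (ob (tanT T) (ob (tanTn T 2) A)) (\<lambda>j. ar (tanT T) (tq T 2 j A))"
  using pullbacks[of 2 A 1] by simp

lemma p_q:
  assumes "A \<in> Obj C" "1 \<le> j" "j \<le> n"
  shows "tp T A \<cdot> tq T n j A = tp T A \<cdot> tq T n 1 A"
proof -
  have "1 \<le> n" using assms(2,3) by linarith
  then show ?thesis
    using nfold_pullback_simps(4)[OF pullbacks[of n A 0], of j 1] assms by simp
qed

lemma pairT2_simps:
  assumes "A \<in> Obj C" "u \<in> Arr C" "Cod C u = ob (tanT T) A"
    "v \<in> Arr C" "Dom C v = Dom C u" "Cod C v = ob (tanT T) A" "tp T A \<cdot> u = tp T A \<cdot> v"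
  shows "pairT2 C T A u v \<in> Arr C" "Dom C (pairT2 C T A u v) = Dom C u"
    "Cod C (pairT2 C T A u v) = ob (tanTn T 2) A"
    "tq T 2 1 A \<cdot> pairT2 C T A u v = u" "tq T 2 2 A \<cdot> pairT2 C T A u v = v"
  using pb_pair[OF T2_pullback[OF assms(1)], of u v] assms by (simp_all add: pairT2_def)

lemma pairTT2_simps:
  assumes "A \<in> Obj C" "u \<in> Arr C" "Cod C u = ob (tanT T) (ob (tanT T) A)"
    "v \<in> Arr C" "Dom C v = Dom C u" "Cod C v = ob (tanT T) (ob (tanT T) A)"
    "ar (tanT T) (tp T A) \<cdot> u = ar (tanT T) (tp T A) \<cdot> v"
  shows "pairTT2 C T A u v \<in> Arr C" "Dom C (pairTT2 C T A u v) = Dom C u"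
    "Cod C (pairTT2 C T A u v) = ob (tanT T) (ob (tanTn T 2) A)"
    "ar (tanT T) (tq T 2 1 A) \<cdot> pairTT2 C T A u v = u"
    "ar (tanT T) (tq T 2 2 A) \<cdot> pairTT2 C T A u v = v"
  using pb_pair[OF TT2_pullback[OF assms(1)], of u v] assms by (simp_all add: pairTT2_def)

lemma Tn_ext:
  assumes "A \<in> Obj C" "1 \<le> n" "u \<in> Arr C" "Cod C u = ob (tanTn T n) A"
    "v \<in> Arr C" "Dom C v = Dom C u" "Cod C v = ob (tanTn T n) A"
    "\<And>j. 1 \<le> j \<Longrightarrow> j \<le> n \<Longrightarrow> tq T n j A \<cdot> u = tq T n j A \<cdot> v"
  shows "u = v"
  using nfold_pullback_ext[OF pullbacks[of n A 0], of u v] assms by simp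

lemma T2_ext:
  assumes "A \<in> Obj C" "u \<in> Arr C" "Cod C u = ob (tanTn T 2) A"
    "v \<in> Arr C" "Dom C v = Dom C u" "Cod C v = ob (tanTn T 2) A"
    "tq T 2 1 A \<cdot> u = tq T 2 1 A \<cdot> v" "tq T 2 2 A \<cdot> u = tq T 2 2 A \<cdot> v"
  shows "u = v"
proof (rule Tn_ext[of A 2])
  fix j :: nat assume "1 \<le> j" "j \<le> 2"
  then have "j = 1 \<or> j = 2" by linarith
  then show "tq T 2 j A \<cdot> u = tq T 2 j A \<cdot> v" using assms(7,8) by auto
qed (use assms in auto)

lemma pairT2_eq:
  assumes A: "A \<in> Obj C" and h: "h \<in> Arr C" "Cod C h = ob (tanTn T 2) A"
    and uv: "tq T 2 1 A \<cdot> h = u" "tq T 2 2 A \<cdot> h = v"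
  shows "pairT2 C T A u v = h"
proof -
  have eq: "tp T A \<cdot> u = tp T A \<cdot> v"
    using comp_extend[OF p_q[OF A, of 2 2], of h] A h by (simp add: uv[symmetric] assoc)
  have u: "u \<in> Arr C" "Dom C u = Dom C h" "Cod C u = ob (tanT T) A"
    and v: "v \<in> Arr C" "Dom C v = Dom C h" "Cod C v = ob (tanT T) A"
    using A h by (simp_all add: uv[symmetric])
  note P = pairT2_simps[OF A u(1,3) v(1) v(2)[folded u(2)] v(3) eq]
  show ?thesis
    by (rule T2_ext[OF A]) (simp_all add: P u h uv)
qed

lemma TT2_ext:
  assumes "A \<in> Obj C" "u \<in> Arr C" "Cod C u = ob (tanT T) (ob (tanTn T 2) A)"
    "v \<in> Arr C" "Dom C v = Dom C u" "Cod C v = ob (tanT T) (ob (tanTn T 2) A)"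
    "ar (tanT T) (tq T 2 1 A) \<cdot> u = ar (tanT T) (tq T 2 1 A) \<cdot> v"
    "ar (tanT T) (tq T 2 2 A) \<cdot> u = ar (tanT T) (tq T 2 2 A) \<cdot> v"
  shows "u = v"
proof (rule nfold_pullback_ext[OF TT2_pullback[OF assms(1)]])
  fix j :: nat assume "1 \<le> j" "j \<le> 2"
  then have "j = 1 \<or> j = 2" by linarith
  then show "ar (tanT T) (tq T 2 j A) \<cdot> u = ar (tanT T) (tq T 2 j A) \<cdot> v" using assms(7,8) by auto
qed (use assms in auto)

lemma pairTT2_eq:
  assumes A: "A \<in> Obj C" and h: "h \<in> Arr C" "Cod C h = ob (tanT T) (ob (tanTn T 2) A)"
    and uv: "ar (tanT T) (tq T 2 1 A) \<cdot> h = u" "ar (tanT T) (tq T 2 2 A) \<cdot> h = v"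
  shows "pairTT2 C T A u v = h"
proof -
  have "ar (tanT T) (tp T A) \<cdot> ar (tanT T) (tq T 2 2 A) = ar (tanT T) (tp T A) \<cdot> ar (tanT T) (tq T 2 1 A)"
    using A p_q[OF A, of 2 2] by (simp flip: T_comp)
  from comp_extend[OF this, of h] have eq: "ar (tanT T) (tp T A) \<cdot> u = ar (tanT T) (tp T A) \<cdot> v"
    using A h by (simp add: uv[symmetric] assoc)
  have u: "u \<in> Arr C" "Dom C u = Dom C h" "Cod C u = ob (tanT T) (ob (tanT T) A)"
    and v: "v \<in> Arr C" "Dom C v = Dom C h" "Cod C v = ob (tanT T) (ob (tanT T) A)"
    using A h by (simp_all add: uv[symmetric])
  note P = pairTT2_simps[OF A u(1,3) v(1) v(2)[folded u(2)] v(3) eq]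
  show ?thesis
    by (rule TT2_ext[OF A]) (simp_all add: P u h uv)
qed

text \<open>Since \<open>c l = l\<close>, the lift may be followed by the flip, which exchanges
  \<open>T(p)\<close> for \<open>p_T\<close>. This and the next variants are wanted because
  transposing twice reverses the order of the two factors.\<close>

lemma pT_l: "A \<in> Obj C \<Longrightarrow> tp T (ob (tanT T) A) \<cdot> tl T A = tz T A \<cdot> tp T A"
  using comp_extend[OF c_p, of A "tl T A"] by (simp add: c_l l_p)

lemma c_zT: "A \<in> Obj C \<Longrightarrow> tc T A \<cdot> tz T (ob (tanT T) A) = ar (tanT T) (tz T A)"
  using comp_extend[OF c_c, of A "ar (tanT T) (tz T A)"] by (simp add: c_z)

lemma Tp_c: "A \<in> Obj C \<Longrightarrow> ar (tanT T) (tp T A) \<cdot> tc T A = tp T (ob (tanT T) A)"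
  using assoc[OF _ _ _ _ _, of "tc T A" "tc T A" "tp T (ob (tanT T) A)"]
  by (simp add: c_c c_p[symmetric])

lemma Tp_zT: "A \<in> Obj C \<Longrightarrow> ar (tanT T) (tp T A) \<cdot> tz T (ob (tanT T) A) = tz T A \<cdot> tp T A"
  using nat_trans_natural[OF z_natural, of "tp T A" A] by simp

text \<open>Additivity of the flip, precomposed with w and with the pairing replaced by any arrow h
  that has the right components; in this form \<open>T(s)\<close> is exchanged for
  \<open>s_T\<close>.\<close>

lemma c_Ts:
  assumes A: "A \<in> Obj C" and w: "w \<in> Arr C" "Cod C w = ob (tanT T) (ob (tanTn T 2) A)"
    and h: "h \<in> Arr C" "Dom C h = Dom C w" "Cod C h = ob (tanTn T 2) (ob (tanT T) A)"
    and q: "tq T 2 1 (ob (tanT T) A) \<cdot> h = tc T A \<cdot> (ar (tanT T) (tq T 2 1 A) \<cdot> w)"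
      "tq T 2 2 (ob (tanT T) A) \<cdot> h = tc T A \<cdot> (ar (tanT T) (tq T 2 2 A) \<cdot> w)"
  shows "tc T A \<cdot> (ar (tanT T) (ts T A) \<cdot> w) = ts T (ob (tanT T) A) \<cdot> h"
proof -
  let ?P = "pairT2 C T (ob (tanT T) A) (tc T A \<cdot> ar (tanT T) (tq T 2 1 A)) (tc T A \<cdot> ar (tanT T) (tq T 2 2 A))"
  have "tp T (ob (tanT T) A) \<cdot> (tc T A \<cdot> ar (tanT T) (tq T 2 j A)) = ar (tanT T) (tp T A \<cdot> tq T 2 j A)"
    if "1 \<le> j" "j \<le> 2" for j
    using A that by (simp add: comp_extend[OF c_p] T_comp)
  then have "tp T (ob (tanT T) A) \<cdot> (tc T A \<cdot> ar (tanT T) (tq T 2 1 A)) =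
      tp T (ob (tanT T) A) \<cdot> (tc T A \<cdot> ar (tanT T) (tq T 2 2 A))"
    using p_q[OF A, of 2 2] by simp
  note P = pairT2_simps[OF _ _ _ _ _ _ this]
  have "?P \<cdot> w = h"
    by (rule T2_ext[of "ob (tanT T) A"]) (use A w h q in \<open>simp_all add: P comp_extend[OF P(4)] comp_extend[OF P(5)] assoc\<close>)
  moreover have "tc T A \<cdot> (ar (tanT T) (ts T A) \<cdot> w) = ts T (ob (tanT T) A) \<cdot> (?P \<cdot> w)"
    using A w by (simp add: comp_extend[OF c_s] P assoc)
  ultimately show ?thesis by simp
qed

text \<open>Insert the flip by \<open>c l = l\<close> and move it through
  \<open>T(s)\<close>.\<close>

lemma l_s_T:
  assumes A: "A \<in> Obj C"
    and h: "h \<in> Arr C" "Dom C h = ob (tanTn T 2) A" "Cod C h = ob (tanTn T 2) (ob (tanT T) A)"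
    and q: "tq T 2 1 (ob (tanT T) A) \<cdot> h = tl T A \<cdot> tq T 2 1 A"
      "tq T 2 2 (ob (tanT T) A) \<cdot> h = tl T A \<cdot> tq T 2 2 A"
  shows "tl T A \<cdot> ts T A = ts T (ob (tanT T) A) \<cdot> h"
proof -
  let ?g = "pairTT2 C T A (tl T A \<cdot> tq T 2 1 A) (tl T A \<cdot> tq T 2 2 A)"
  have "ar (tanT T) (tp T A) \<cdot> (tl T A \<cdot> tq T 2 1 A) = ar (tanT T) (tp T A) \<cdot> (tl T A \<cdot> tq T 2 2 A)"
    using A p_q[OF A, of 2 2] by (simp add: comp_extend[OF l_p] assoc)
  note g = pairTT2_simps[OF _ _ _ _ _ _ this]
  have "tl T A \<cdot> ts T A = tc T A \<cdot> (tl T A \<cdot> ts T A)"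
    using A by (simp add: comp_extend[OF c_l])
  also have "\<dots> = tc T A \<cdot> (ar (tanT T) (ts T A) \<cdot> ?g)"
    using A by (simp add: l_s)
  also have "\<dots> = ts T (ob (tanT T) A) \<cdot> h"
    using A h q by (intro c_Ts) (simp_all add: g comp_extend[OF c_l])
  finally show ?thesis .
qed

lemma c_sT:
  assumes A: "A \<in> Obj C"
    and k: "k \<in> Arr C" "Dom C k = ob (tanTn T 2) (ob (tanT T) A)" "Cod C k = ob (tanT T) (ob (tanTn T 2) A)"
    and q: "ar (tanT T) (tq T 2 1 A) \<cdot> k = tc T A \<cdot> tq T 2 1 (ob (tanT T) A)"
      "ar (tanT T) (tq T 2 2 A) \<cdot> k = tc T A \<cdot> tq T 2 2 (ob (tanT T) A)"
  shows "tc T A \<cdot> ts T (ob (tanT T) A) = ar (tanT T) (ts T A) \<cdot> k"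
proof -
  have "tc T A \<cdot> (ar (tanT T) (ts T A) \<cdot> k) = ts T (ob (tanT T) A) \<cdot> Ide C (Dom C k)"
    using A k q by (intro c_Ts) (simp_all add: comp_extend[OF c_c])
  then have "tc T A \<cdot> ts T (ob (tanT T) A) = tc T A \<cdot> (tc T A \<cdot> (ar (tanT T) (ts T A) \<cdot> k))"
    using A k by simp
  then show ?thesis
    using A k by (simp add: comp_extend[OF c_c])
qed

text \<open>The flip turns the universal lift into a sum formed with \<open>s_T\<close>: it fixes
  \<open>l\<close>, while \<open>z_T\<close> becomes \<open>T(z)\<close>. The opposite universal
  property is proved from this form.\<close>

lemma univ_lift_simps:
  assumes A: "A \<in> Obj C"
  shows "univ_lift C T A \<in> Arr C" "Dom C (univ_lift C T A) = ob (tanTn T 2) A"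
    "Cod C (univ_lift C T A) = ob (tanT T) (ob (tanT T) A)"
  and univ_lift_c: "h \<in> Arr C \<Longrightarrow> Dom C h = ob (tanTn T 2) A \<Longrightarrow>
      Cod C h = ob (tanTn T 2) (ob (tanT T) A) \<Longrightarrow>
      tq T 2 1 (ob (tanT T) A) \<cdot> h = tl T A \<cdot> tq T 2 1 A \<Longrightarrow>
      tq T 2 2 (ob (tanT T) A) \<cdot> h = ar (tanT T) (tz T A) \<cdot> tq T 2 2 A \<Longrightarrow>
      tc T A \<cdot> univ_lift C T A = ts T (ob (tanT T) A) \<cdot> h"
proof -
  let ?g = "pairTT2 C T A (tl T A \<cdot> tq T 2 1 A) (tz T (ob (tanT T) A) \<cdot> tq T 2 2 A)"
  have "ar (tanT T) (tp T A) \<cdot> (tl T A \<cdot> tq T 2 1 A) =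
      ar (tanT T) (tp T A) \<cdot> (tz T (ob (tanT T) A) \<cdot> tq T 2 2 A)"
    using A p_q[OF A, of 2 2] by (simp add: comp_extend[OF l_p] comp_extend[OF Tp_zT] assoc)
  note g = pairTT2_simps[OF _ _ _ _ _ _ this]
  show "univ_lift C T A \<in> Arr C" "Dom C (univ_lift C T A) = ob (tanTn T 2) A"
    "Cod C (univ_lift C T A) = ob (tanT T) (ob (tanT T) A)"
    using A by (simp_all add: univ_lift_def g)
  assume h: "h \<in> Arr C" "Dom C h = ob (tanTn T 2) A" "Cod C h = ob (tanTn T 2) (ob (tanT T) A)"
    "tq T 2 1 (ob (tanT T) A) \<cdot> h = tl T A \<cdot> tq T 2 1 A"
    "tq T 2 2 (ob (tanT T) A) \<cdot> h = ar (tanT T) (tz T A) \<cdot> tq T 2 2 A"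
  show "tc T A \<cdot> univ_lift C T A = ts T (ob (tanT T) A) \<cdot> h"
    unfolding univ_lift_def using A h
    by (intro c_Ts) (simp_all add: g comp_extend[OF c_l] comp_extend[OF c_zT])
qed

end

section \<open>The opposite tangent structure\<close>

locale adjoint_tangent_structure = tangent_category C T
  for C :: "('o, 'm, 'x) cat_scheme" (structure) and T +
  fixes L :: "nat \<Rightarrow> ('o, 'm, 'o, 'm) functr" and \<eta> :: "nat \<Rightarrow> 'o \<Rightarrow> 'm" and \<epsilon> :: "nat \<Rightarrow> 'o \<Rightarrow> 'm"
  assumes data: "adjoint_data C T L \<eta> \<epsilon>"
begin

lemma adj: "1 \<le> n \<Longrightarrow> adjunction C C (L n) (tanTn T n) (\<eta> n) (\<epsilon> n)"
  using data by (simp add: adjoint_data_def)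

lemma adj2: "adjunction C C (L 1 \<circ>\<^sub>F L 1) (tanT T \<circ>\<^sub>F tanT T)
    (\<lambda>A. ar (tanT T) (\<eta> 1 (ob (L 1) A)) \<cdot> \<eta> 1 A) (\<lambda>A. \<epsilon> 1 A \<cdot> ar (L 1) (\<epsilon> 1 (ob (tanT T) A)))"
  using adjunction_comp[OF adj adj] by simp

text \<open>A constant of its own, so that rewriting works with mates and transposes and does not
  open the record.\<close>

definition Top where "Top = adjoint_tangent C T L \<eta> \<epsilon>"

section \<open>The mates of the structure maps and their naturality\<close>

lemma tanTn_Top [simp]: "tanTn Top = L"
  by (simp add: Top_def adjoint_tangent_def Let_def)

lemma L_functor: "1 \<le> n \<Longrightarrow> is_functor C C (L n)"
  using adj by (auto simp: adjunction_def)

lemma L_simps [simp]: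
  assumes "1 \<le> n"
  shows "A \<in> Obj C \<Longrightarrow> ob (L n) A \<in> Obj C"
    "A \<in> Obj C \<Longrightarrow> ar (L n) (Ide C A) = Ide C (ob (L n) A)"
    "f \<in> Arr C \<Longrightarrow> ar (L n) f \<in> Arr C"
    "f \<in> Arr C \<Longrightarrow> Dom C (ar (L n) f) = ob (L n) (Dom C f)"
    "f \<in> Arr C \<Longrightarrow> Cod C (ar (L n) f) = ob (L n) (Cod C f)"
  using functor_simps[OF L_functor[OF assms]] by auto

lemma \<eta>_natural: "1 \<le> n \<Longrightarrow> nat_trans C C idF (tanTn T n \<circ>\<^sub>F L n) (\<eta> n)"
  using adj by (auto simp: adjunction_def)

lemma \<eta>_simps [simp]:
  assumes "1 \<le> n" "A \<in> Obj C"
  shows "\<eta> n A \<in> Arr C" "Dom C (\<eta> n A) = A" "Cod C (\<eta> n A) = ob (tanTn T n) (ob (L n) A)"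
  using nat_trans_simps[OF \<eta>_natural] assms by auto

text \<open>The projection and the zero section are written out in \<open>adjoint_tangent\<close>;
  inserting identities shows them to be mates against the identity functor.\<close>

lemma Top_mates:
  "A \<in> Obj C \<Longrightarrow> tp Top A = mate C (L 1) (\<eta> 1) idF (Ide C) (tp T) A"
  "tq Top n j = mate C (L n) (\<eta> n) (L 1) (\<epsilon> 1) (tq T n j)"
  "ts Top = mate C (L 2) (\<eta> 2) (L 1) (\<epsilon> 1) (ts T)"
  "A \<in> Obj C \<Longrightarrow> tz Top A = mate C idF (Ide C) (L 1) (\<epsilon> 1) (tz T) A"
  "tl Top = mate C (L 1) (\<eta> 1) (L 1 \<circ>\<^sub>F L 1) (\<lambda>A. \<epsilon> 1 A \<cdot> ar (L 1) (\<epsilon> 1 (ob (tanT T) A))) (tl T)"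
  "tc Top = mate C (L 1 \<circ>\<^sub>F L 1) (\<lambda>A. ar (tanT T) (\<eta> 1 (ob (L 1) A)) \<cdot> \<eta> 1 A)
     (L 1 \<circ>\<^sub>F L 1) (\<lambda>A. \<epsilon> 1 A \<cdot> ar (L 1) (\<epsilon> 1 (ob (tanT T) A))) (tc T)"
  by (simp_all add: Top_def adjoint_tangent_def Let_def mate_def)

lemma Top_natural:
  "nat_trans C C idF (L 1) (tp Top)"
  "1 \<le> j \<Longrightarrow> j \<le> n \<Longrightarrow> nat_trans C C (L 1) (L n) (tq Top n j)"
  "nat_trans C C (L 1) (L 2) (ts Top)"
  "nat_trans C C (L 1) idF (tz Top)"
  "nat_trans C C (L 1 \<circ>\<^sub>F L 1) (L 1) (tl Top)"
  "nat_trans C C (L 1 \<circ>\<^sub>F L 1) (L 1 \<circ>\<^sub>F L 1) (tc Top)"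
proof -
  note I = adjunction_idF[OF category_axioms]
  show "nat_trans C C idF (L 1) (tp Top)"
    by (rule nat_trans_cong[OF mate_natural[OF adj I p_natural]]) (simp_all add: Top_mates)
  show "nat_trans C C (L 1) (L n) (tq Top n j)" if "1 \<le> j" "j \<le> n"
    unfolding Top_mates(2) by (rule mate_natural[OF adj adj q_natural]) (use that in auto)
  show "nat_trans C C (L 1) (L 2) (ts Top)"
    unfolding Top_mates(3) by (rule mate_natural[OF adj adj s_natural]) auto
  show "nat_trans C C (L 1) idF (tz Top)"
    by (rule nat_trans_cong[OF mate_natural[OF I adj z_natural]]) (simp_all add: Top_mates)
  show "nat_trans C C (L 1 \<circ>\<^sub>F L 1) (L 1) (tl Top)"
    unfolding Top_mates(5) by (rule mate_natural[OF adj adj2 l_natural]) auto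
  show "nat_trans C C (L 1 \<circ>\<^sub>F L 1) (L 1 \<circ>\<^sub>F L 1) (tc Top)"
    unfolding Top_mates(6) by (rule mate_natural[OF adj2 adj2 c_natural])
qed

lemmas Top_simps [simp] = Top_natural(1,3-6)[THEN nat_trans_simps(1), simplified]
  Top_natural(1,3-6)[THEN nat_trans_simps(2), simplified]
  Top_natural(1,3-6)[THEN nat_trans_simps(3), simplified]
  Top_natural(2)[THEN nat_trans_simps(1)] Top_natural(2)[THEN nat_trans_simps(2)]
  Top_natural(2)[THEN nat_trans_simps(3)]

text \<open>The transpose of \<open>h : L\<^sub>n(A) \<rightarrow> Z\<close>. The object A is an
  argument because the domain of h does not determine it.\<close>

definition flat :: "nat \<Rightarrow> 'o \<Rightarrow> 'm \<Rightarrow> 'm" where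
  "flat n A h = ar (tanTn T n) h \<cdot> \<eta> n A"

lemma flat_simps [simp]:
  assumes "1 \<le> n" "A \<in> Obj C" "h \<in> Arr C" "Dom C h = ob (L n) A"
  shows "flat n A h \<in> Arr C" "Dom C (flat n A h) = A" "Cod C (flat n A h) = ob (tanTn T n) (Cod C h)"
  using assms by (simp_all add: flat_def)

lemma flat_inj:
  assumes "1 \<le> n" "A \<in> Obj C" "h \<in> Arr C" "Dom C h = ob (L n) A" "h' \<in> Arr C" "Dom C h' = ob (L n) A"
    "Cod C h' = Cod C h" "flat n A h = flat n A h'"
  shows "h = h'"
  using adjunction_inj[OF adj, of n A h "Cod C h" h'] assms by (simp add: Hom_iff flat_def)

lemma flat_surj:
  assumes "1 \<le> n" "A \<in> Obj C" "B \<in> Obj C" "k \<in> Arr C" "Dom C k = A" "Cod C k = ob (tanTn T n) B"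
  obtains h where "h \<in> Arr C" "Dom C h = ob (L n) A" "Cod C h = B" "flat n A h = k"
  using adjunction_ex1[OF adj, of n B k A] assms by (auto simp: Hom_iff flat_def)

lemma flat_comp:
  assumes "1 \<le> n" "A \<in> Obj C" "h \<in> Arr C" "Dom C h = ob (L n) A" "k \<in> Arr C" "Dom C k = Cod C h"
  shows "flat n A (k \<cdot> h) = ar (tanTn T n) k \<cdot> flat n A h"
  using assms by (simp add: flat_def T_comp assoc)

lemma flat_L:
  assumes "1 \<le> n" "g \<in> Arr C" "h \<in> Arr C" "Dom C h = ob (L n) (Cod C g)" "Dom C g = A"
  shows "flat n A (h \<cdot> ar (L n) g) = flat n (Cod C g) h \<cdot> g"
  using assms nat_trans_natural[OF \<eta>_natural, of n g "Cod C g"] by (auto simp: flat_def T_comp assoc)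

text \<open>Transposing along the composite adjunction is transposing twice, starting at
  \<open>L(A)\<close>: the left adjoint applied last is removed first.\<close>

lemma flat2:
  assumes "A \<in> Obj C" "h \<in> Arr C" "Dom C h = ob (L 1) (ob (L 1) A)"
  shows "ar (tanT T \<circ>\<^sub>F tanT T) h \<cdot> ar (tanT T) (\<eta> 1 (ob (L 1) A)) \<cdot> \<eta> 1 A = flat 1 A (flat 1 (ob (L 1) A) h)"
  using assms by (simp add: flat_def T_comp assoc)

text \<open>The dictionary between the two structures, with an arbitrary arrow h behind the
  structure map. \<open>comp_p\<close> has no transposition on its left because that mate is taken
  against the identity functor; \<open>tl\<close> and \<open>tc\<close> start at
  \<open>L(L(A))\<close> and are transposed twice.\<close>

lemma flat_structure:
  assumes A: "A \<in> Obj C"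
  shows comp_p: "h \<in> Arr C \<Longrightarrow> Dom C h = ob (L 1) A \<Longrightarrow> h \<cdot> tp Top A = tp T (Cod C h) \<cdot> flat 1 A h"
    and flat_q: "1 \<le> j \<Longrightarrow> j \<le> n \<Longrightarrow> h \<in> Arr C \<Longrightarrow> Dom C h = ob (L n) A \<Longrightarrow>
      flat 1 A (h \<cdot> tq Top n j A) = tq T n j (Cod C h) \<cdot> flat n A h"
    and flat_s: "h \<in> Arr C \<Longrightarrow> Dom C h = ob (L 2) A \<Longrightarrow>
      flat 1 A (h \<cdot> ts Top A) = ts T (Cod C h) \<cdot> flat 2 A h"
    and flat_z: "h \<in> Arr C \<Longrightarrow> Dom C h = A \<Longrightarrow> flat 1 A (h \<cdot> tz Top A) = tz T (Cod C h) \<cdot> h"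
    and flat_l: "h \<in> Arr C \<Longrightarrow> Dom C h = ob (L 1) A \<Longrightarrow>
      flat 1 A (flat 1 (ob (L 1) A) (h \<cdot> tl Top A)) = tl T (Cod C h) \<cdot> flat 1 A h"
    and flat_c: "h \<in> Arr C \<Longrightarrow> Dom C h = ob (L 1) (ob (L 1) A) \<Longrightarrow>
      flat 1 A (flat 1 (ob (L 1) A) (h \<cdot> tc Top A)) =
      tc T (Cod C h) \<cdot> flat 1 A (flat 1 (ob (L 1) A) h)"
proof -
  note I = adjunction_idF[OF category_axioms]
  show "h \<cdot> tp Top A = tp T (Cod C h) \<cdot> flat 1 A h" if h: "h \<in> Arr C" "Dom C h = ob (L 1) A"
    using mate_transpose(2)[OF adj[of 1] I p_natural A, simplified, OF h] A h
    by (simp add: Top_mates(1)[OF A, symmetric] flat_def assoc)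
  show "flat 1 A (h \<cdot> tq Top n j A) = tq T n j (Cod C h) \<cdot> flat n A h"
    if "1 \<le> j" "j \<le> n" and h: "h \<in> Arr C" "Dom C h = ob (L n) A"
    using mate_transpose(2)[OF adj[of n] adj[of 1] q_natural A h] that
    by (simp add: Top_mates(2)[symmetric] flat_def)
  show "flat 1 A (h \<cdot> ts Top A) = ts T (Cod C h) \<cdot> flat 2 A h" if h: "h \<in> Arr C" "Dom C h = ob (L 2) A"
    using mate_transpose(2)[OF adj[of 2] adj[of 1] s_natural A h]
    by (simp add: Top_mates(3)[symmetric] flat_def)
  show "flat 1 A (h \<cdot> tz Top A) = tz T (Cod C h) \<cdot> h" if h: "h \<in> Arr C" "Dom C h = A"
    using mate_transpose(2)[OF I adj[of 1] z_natural A, simplified, OF h] A h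
    by (simp add: Top_mates(4)[OF A, symmetric] flat_def)
  show "flat 1 A (flat 1 (ob (L 1) A) (h \<cdot> tl Top A)) = tl T (Cod C h) \<cdot> flat 1 A h"
    if h: "h \<in> Arr C" "Dom C h = ob (L 1) A"
    using mate_transpose(2)[OF adj[of 1] adj2 l_natural A h] A h
    by (simp only: Top_mates(5)[symmetric] flat2 flat_def comp_simps Top_simps le_refl)
  show "flat 1 A (flat 1 (ob (L 1) A) (h \<cdot> tc Top A)) =
      tc T (Cod C h) \<cdot> flat 1 A (flat 1 (ob (L 1) A) h)"
    if h: "h \<in> Arr C" "Dom C h = ob (L 1) (ob (L 1) A)"
    using mate_transpose(2)[OF adj2 adj2 c_natural A, simplified, OF h] A h
    by (simp add: Top_mates(6)[symmetric] flat2[simplified])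
qed

lemma flat_Ide [simp]: "1 \<le> n \<Longrightarrow> A \<in> Obj C \<Longrightarrow> flat n A (Ide C (ob (L n) A)) = \<eta> n A"
  by (simp add: flat_def)

text \<open>The dictionary for an identity h, whose transpose is the unit.\<close>

lemma flat_bare:
  assumes A: "A \<in> Obj C"
  shows "tp Top A = tp T (ob (L 1) A) \<cdot> \<eta> 1 A"
    and "1 \<le> j \<Longrightarrow> j \<le> n \<Longrightarrow> flat 1 A (tq Top n j A) = tq T n j (ob (L n) A) \<cdot> \<eta> n A"
    and "flat 1 A (ts Top A) = ts T (ob (L 2) A) \<cdot> \<eta> 2 A"
    and "flat 1 A (tz Top A) = tz T A"
    and "flat 1 A (flat 1 (ob (L 1) A) (tl Top A)) = tl T (ob (L 1) A) \<cdot> \<eta> 1 A"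
    and "flat 1 A (flat 1 (ob (L 1) A) (tc Top A)) =
      tc T (ob (L 1) (ob (L 1) A)) \<cdot> flat 1 A (\<eta> 1 (ob (L 1) A))"
  using comp_p[OF A, of "Ide C (ob (L 1) A)"] flat_q[OF A, of j n "Ide C (ob (L n) A)"]
    flat_s[OF A, of "Ide C (ob (L 2) A)"] flat_z[OF A, of "Ide C A"]
    flat_l[OF A, of "Ide C (ob (L 1) A)"] flat_c[OF A, of "Ide C (ob (L 1) (ob (L 1) A))"] A
  by simp_all

lemma flat_L_bare: "1 \<le> n \<Longrightarrow> g \<in> Arr C \<Longrightarrow> Dom C g = A \<Longrightarrow> flat n A (ar (L n) g) = \<eta> n (Cod C g) \<cdot> g"
  using flat_L[of n g "Ide C (ob (L n) (Cod C g))" A] by (simp add: flat_Ide)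

lemma flat2_inj:
  assumes "A \<in> Obj C" "u \<in> Arr C" "Dom C u = ob (L 1) (ob (L 1) A)" "v \<in> Arr C" "Dom C v = Dom C u"
    "Cod C v = Cod C u" "flat 1 A (flat 1 (ob (L 1) A) u) = flat 1 A (flat 1 (ob (L 1) A) v)"
  shows "u = v"
  by (rule flat_inj[of 1 "ob (L 1) A"]; (rule flat_inj[of 1 A])?) (use assms in simp_all)

lemma flat3_inj:
  assumes "A \<in> Obj C" "u \<in> Arr C" "Dom C u = ob (L 1) (ob (L 1) (ob (L 1) A))"
    "v \<in> Arr C" "Dom C v = Dom C u" "Cod C v = Cod C u"
    "flat 1 A (flat 1 (ob (L 1) A) (flat 1 (ob (L 1) (ob (L 1) A)) u)) =
     flat 1 A (flat 1 (ob (L 1) A) (flat 1 (ob (L 1) (ob (L 1) A)) v))"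
  shows "u = v"
  by (rule flat_inj[of 1 "ob (L 1) (ob (L 1) A)"]; (rule flat2_inj[of A])?) (use assms in simp_all)

text \<open>Arrows \<open>L\<^sub>n(A) \<rightarrow> Z\<close> are arrows
  \<open>A \<rightarrow> T\<^sub>n(Z)\<close>, that is, n arrows \<open>A \<rightarrow> T(Z)\<close>
  with the same projection to Z; transposed back, n arrows \<open>L(A) \<rightarrow> Z\<close> that
  agree after the opposite projection. So the left adjoint of \<open>T\<^sub>n\<close> is itself the
  pushout.\<close>

lemma Top_pushout:
  assumes A: "A \<in> Obj C" and n: "1 \<le> n"
  shows "is_nfold_pullback (opcat C) n (tp Top A) (ob (L n) A) (\<lambda>j. tq Top n j A)"
proof (rule nfold_pullbackI; (unfold opcat_simps)?)
  show "tp Top A \<in> Arr C" "ob (L n) A \<in> Obj C" using A n by simp_all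
  show "tq Top n j A \<in> Hom C (Cod C (tp Top A)) (ob (L n) A)" if "j \<in> {1..n}" for j
    using A n that by (simp add: Hom_iff)
  have "tq Top n j A \<cdot> tp Top A = tp T (ob (L n) A) \<cdot> tq T n 1 (ob (L n) A) \<cdot> \<eta> n A"
    if "1 \<le> j" "j \<le> n" for j
    using A n that by (simp add: comp_p flat_bare(2) comp_extend[OF p_q[OF _ that]] assoc)
  then show "tq Top n j A \<cdot> tp Top A = tq Top n k A \<cdot> tp Top A" if "j \<in> {1..n}" "k \<in> {1..n}" for j k
    using that by simp
  fix Z g
  assume Z: "Z \<in> Obj C" and g: "\<And>j. j \<in> {1..n} \<Longrightarrow> g j \<in> Hom C (Cod C (tp Top A)) Z"
    and eq: "\<And>j k. j \<in> {1..n} \<Longrightarrow> k \<in> {1..n} \<Longrightarrow> g j \<cdot> tp Top A = g k \<cdot> tp Top A"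
  have g': "g j \<in> Arr C" "Dom C (g j) = ob (L 1) A" "Cod C (g j) = Z" if "j \<in> {1..n}" for j
    using g[OF that] A by (auto simp: Hom_iff)
  have "\<exists>!h. h \<in> Hom C A (ob (tanTn T n) Z) \<and> (\<forall>j\<in>{1..n}. tq T n j Z \<cdot> h = flat 1 A (g j))"
  proof (rule nfold_pullback_ex1[OF pullbacks[of n Z 0, simplified, OF n Z]])
    show "flat 1 A (g j) \<in> Hom C A (Dom C (tp T Z))" if "j \<in> {1..n}" for j
      using g'[OF that] A Z by (simp add: Hom_iff)
    show "tp T Z \<cdot> flat 1 A (g j) = tp T Z \<cdot> flat 1 A (g k)" if "j \<in> {1..n}" "k \<in> {1..n}" for j k
      using eq[OF that] g'[OF that(1)] g'[OF that(2)] A by (simp add: comp_p)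
  qed (fact A)
  then obtain x where x0: "x \<in> Hom C A (ob (tanTn T n) Z) \<and> (\<forall>j\<in>{1..n}. tq T n j Z \<cdot> x = flat 1 A (g j))"
      and unique: "\<And>y. y \<in> Hom C A (ob (tanTn T n) Z) \<and>
        (\<forall>j\<in>{1..n}. tq T n j Z \<cdot> y = flat 1 A (g j)) \<Longrightarrow> y = x"
    by (rule ex1E) (rule that, assumption, erule allE, erule mp)
  have x: "x \<in> Arr C" "Dom C x = A" "Cod C x = ob (tanTn T n) Z"
      and xq: "\<And>j. j \<in> {1..n} \<Longrightarrow> tq T n j Z \<cdot> x = flat 1 A (g j)"
    using x0 by (simp_all add: Hom_iff)
  obtain h where h: "h \<in> Arr C" "Dom C h = ob (L n) A" "Cod C h = Z" "flat n A h = x"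
    using flat_surj[OF n A Z x] .
  \<comment> \<open>The jth injection corresponds to the jth projection of the transpose; existence
    and uniqueness of the copairing are read off from here.\<close>
  have iff: "h' \<cdot> tq Top n j A = g j \<longleftrightarrow> tq T n j Z \<cdot> flat n A h' = flat 1 A (g j)"
    if "h' \<in> Arr C" "Dom C h' = ob (L n) A" "Cod C h' = Z" "j \<in> {1..n}" for h' j
  proof
    assume "tq T n j Z \<cdot> flat n A h' = flat 1 A (g j)"
    note eq1 = this
    show "h' \<cdot> tq Top n j A = g j"
      by (rule flat_inj[of 1 A]) (use eq1 that g'[OF that(4)] A n in \<open>simp_all add: flat_q\<close>)
  qed (use that A in \<open>auto simp flip: flat_q\<close>)
  show "\<exists>!h. h \<in> Hom C (ob (L n) A) Z \<and> (\<forall>j\<in>{1..n}. h \<cdot> tq Top n j A = g j)"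
  proof (rule ex1I[of _ h])
    show "h \<in> Hom C (ob (L n) A) Z \<and> (\<forall>j\<in>{1..n}. h \<cdot> tq Top n j A = g j)"
      using h xq by (simp add: Hom_iff iff del: atLeastAtMost_iff)
    fix h' assume h': "h' \<in> Hom C (ob (L n) A) Z \<and> (\<forall>j\<in>{1..n}. h' \<cdot> tq Top n j A = g j)"
    then have h1: "h' \<in> Arr C" "Dom C h' = ob (L n) A" "Cod C h' = Z"
      and "\<And>j. j \<in> {1..n} \<Longrightarrow> h' \<cdot> tq Top n j A = g j"
      by (simp_all add: Hom_iff)
    then have "tq T n j Z \<cdot> flat n A h' = flat 1 A (g j)" if "j \<in> {1..n}" for j
      using iff[OF h1 that] that by blast
    moreover have "flat n A h' \<in> Hom C A (ob (tanTn T n) Z)"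
      using h1 A n by (simp add: Hom_iff)
    ultimately have fx: "flat n A h' = x"
      using unique by blast
    show "h' = h"
      by (rule flat_inj[of n A]) (use fx h h1 A n in simp_all)
  qed
qed

text \<open>On the opposite category L is a right adjoint, so each application of it preserves the
  pushouts.\<close>

lemma Top_pushouts:
  assumes A: "A \<in> Obj C" and n: "1 \<le> n"
  shows "is_nfold_pullback (opcat C) n (ar (powF (L 1) m) (tp Top A))
      (ob (powF (L 1) m) (ob (L n) A)) (\<lambda>j. ar (powF (L 1) m) (tq Top n j A))"
proof (induction m)
  case 0
  then show ?case using Top_pushout[OF assms] by simp
next
  case (Suc m)
  then show ?case
    using right_adjoint_nfold_pullback[OF adjunction_opcat[OF adj[of 1]]] by simp
qed

section \<open>Copairing in the opposite structure\<close>

lemma op_pair_simps: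
  assumes A: "A \<in> Obj C" and u: "u \<in> Arr C" "Dom C u = ob (L 1) A"
    and v: "v \<in> Arr C" "Dom C v = ob (L 1) A" "Cod C v = Cod C u" and eq: "u \<cdot> tp Top A = v \<cdot> tp Top A"
  shows "pairT2 (opcat C) Top A u v \<in> Arr C" "Dom C (pairT2 (opcat C) Top A u v) = ob (L 2) A"
    "Cod C (pairT2 (opcat C) Top A u v) = Cod C u"
    "pairT2 (opcat C) Top A u v \<cdot> tq Top 2 1 A = u" "pairT2 (opcat C) Top A u v \<cdot> tq Top 2 2 A = v"
  using category.pb_pair[OF category_opcat[OF category_axioms] Top_pushout[OF A, of 2], of u v] assms
  by (simp_all add: pairT2_def)

text \<open>The transpose of a copairing is the pairing of the transposes. The pairing P is a
  premise, so a use exhibits it and checks two components; compatibility of u and v then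
  follows.\<close>

lemma op_pair:
  assumes A: "A \<in> Obj C" and u: "u \<in> Arr C" "Dom C u = ob (L 1) A"
    and v: "v \<in> Arr C" "Dom C v = ob (L 1) A" "Cod C v = Cod C u"
    and P: "P \<in> Arr C" "Dom C P = A" "Cod C P = ob (tanTn T 2) (Cod C u)"
    and q: "tq T 2 1 (Cod C u) \<cdot> P = flat 1 A u" "tq T 2 2 (Cod C u) \<cdot> P = flat 1 A v"
  shows "pairT2 (opcat C) Top A u v \<in> Arr C" "Dom C (pairT2 (opcat C) Top A u v) = ob (L 2) A"
    "Cod C (pairT2 (opcat C) Top A u v) = Cod C u"
    "flat 2 A (pairT2 (opcat C) Top A u v) = P"
proof -
  have "tp T (Cod C u) \<cdot> flat 1 A u = tp T (Cod C u) \<cdot> flat 1 A v"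
    using comp_extend[OF p_q[of "Cod C u" 2 2], of P] P u by (simp add: q[symmetric] assoc)
  then have eq: "u \<cdot> tp Top A = v \<cdot> tp Top A"
    using A u v by (simp add: comp_p)
  note k = op_pair_simps[OF A u v eq]
  show "pairT2 (opcat C) Top A u v \<in> Arr C" "Dom C (pairT2 (opcat C) Top A u v) = ob (L 2) A"
    "Cod C (pairT2 (opcat C) Top A u v) = Cod C u" by fact+
  show "flat 2 A (pairT2 (opcat C) Top A u v) = P"
    by (rule T2_ext[of "Cod C u"])
      (use A u P k(1-3) flat_q[OF A _ _ k(1,2), of 1] flat_q[OF A _ _ k(1,2), of 2]
        in \<open>simp_all add: q k(4,5)\<close>)
qed

text \<open>Out of \<open>L(L\<^sub>2(A))\<close> the outer L is transposed first, so the result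
  lands in \<open>T\<^sub>2(T(Z))\<close> and not in \<open>T(T\<^sub>2(Z))\<close>. Hence the
  opposite of an axiom with \<open>T(s)\<close> is an equation with \<open>s_T\<close>.\<close>

lemma op_TTpair:
  assumes A: "A \<in> Obj C" and u: "u \<in> Arr C" "Dom C u = ob (L 1) (ob (L 1) A)"
    and v: "v \<in> Arr C" "Dom C v = ob (L 1) (ob (L 1) A)" "Cod C v = Cod C u"
    and P: "P \<in> Arr C" "Dom C P = A" "Cod C P = ob (tanTn T 2) (ob (tanT T) (Cod C u))"
    and q: "tq T 2 1 (ob (tanT T) (Cod C u)) \<cdot> P = flat 1 A (flat 1 (ob (L 1) A) u)"
      "tq T 2 2 (ob (tanT T) (Cod C u)) \<cdot> P = flat 1 A (flat 1 (ob (L 1) A) v)"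
  shows "pairTT2 (opcat C) Top A u v \<in> Arr C"
    "Dom C (pairTT2 (opcat C) Top A u v) = ob (L 1) (ob (L 2) A)"
    "Cod C (pairTT2 (opcat C) Top A u v) = Cod C u"
    "flat 2 A (flat 1 (ob (L 2) A) (pairTT2 (opcat C) Top A u v)) = P"
    "pairTT2 (opcat C) Top A u v \<cdot> ar (L 1) (tq Top 2 1 A) = u"
    "pairTT2 (opcat C) Top A u v \<cdot> ar (L 1) (tq Top 2 2 A) = v"
proof -
  let ?B = "ob (tanT T) (Cod C u)"
  have "tp T ?B \<cdot> flat 1 A (flat 1 (ob (L 1) A) u) = tp T ?B \<cdot> flat 1 A (flat 1 (ob (L 1) A) v)"
    using comp_extend[OF p_q[of ?B 2 2], of P] P u by (simp add: q[symmetric] assoc)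
  note eq2 = this
  have eq: "u \<cdot> ar (L 1) (tp Top A) = v \<cdot> ar (L 1) (tp Top A)"
    by (rule flat_inj[of 1 A]) (use eq2 A u v in \<open>simp_all add: flat_L comp_p\<close>)
  have pb: "is_nfold_pullback (opcat C) 2 (ar (L 1) (tp Top A))
      (ob (L 1) (ob (L 2) A)) (\<lambda>j. ar (L 1) (tq Top 2 j A))"
    using Top_pushouts[OF A, of 2 1] by simp
  have k: "pairTT2 (opcat C) Top A u v \<in> Arr C"
    "Dom C (pairTT2 (opcat C) Top A u v) = ob (L 1) (ob (L 2) A)"
    "Cod C (pairTT2 (opcat C) Top A u v) = Cod C u"
    "pairTT2 (opcat C) Top A u v \<cdot> ar (L 1) (tq Top 2 1 A) = u"
    "pairTT2 (opcat C) Top A u v \<cdot> ar (L 1) (tq Top 2 2 A) = v"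
    using category.pb_pair[OF category_opcat[OF category_axioms] pb, of u v] A u v eq
    by (simp_all add: pairTT2_def)
  show "pairTT2 (opcat C) Top A u v \<in> Arr C"
    "Dom C (pairTT2 (opcat C) Top A u v) = ob (L 1) (ob (L 2) A)"
    "Cod C (pairTT2 (opcat C) Top A u v) = Cod C u"
    "pairTT2 (opcat C) Top A u v \<cdot> ar (L 1) (tq Top 2 1 A) = u"
    "pairTT2 (opcat C) Top A u v \<cdot> ar (L 1) (tq Top 2 2 A) = v" by fact+
  let ?k = "flat 1 (ob (L 2) A) (pairTT2 (opcat C) Top A u v)"
  have "tq T 2 j ?B \<cdot> flat 2 A ?k = flat 1 A (flat 1 (ob (L 1) A) (pairTT2 (opcat C) Top A u v \<cdot> ar (L 1) (tq Top 2 j A)))"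
    if "1 \<le> j" "j \<le> 2" for j
    using A u k(1-3) that by (simp add: flat_q flat_L)
  note eq3 = this
  show "flat 2 A ?k = P"
    by (rule T2_ext[of ?B]) (use eq3 A u P k(1-3) in \<open>simp_all add: q k(4,5)\<close>)
qed

text \<open>The copairing transposes to the pairing \<open>\<langle>z p, 1\<rangle>\<close> after
  the unit of the adjunction, and the equation becomes the unit law of \<open>s\<close> at
  \<open>L(A)\<close>.\<close>

lemma Top_s_unit:
  assumes A: "A \<in> Obj C"
  shows "pairT2 (opcat C) Top A (tp Top A \<cdot> tz Top A) (Ide C (ob (L 1) A)) \<cdot> ts Top A = Ide C (ob (L 1) A)"
proof -
  let ?B = "ob (L 1) A"
  let ?P = "pairT2 C T ?B (tz T ?B \<cdot> tp T ?B) (Ide C (ob (tanT T) ?B))"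
  have "tp T ?B \<cdot> (tz T ?B \<cdot> tp T ?B) = tp T ?B \<cdot> Ide C (ob (tanT T) ?B)"
    using A by (simp add: comp_extend[OF p_z])
  note P = pairT2_simps[OF _ _ _ _ _ _ this]
  have "flat 1 A (tp Top A \<cdot> tz Top A) = tz T ?B \<cdot> tp Top A"
    using A by (simp add: flat_z)
  then have fz: "flat 1 A (tp Top A \<cdot> tz Top A) = tz T ?B \<cdot> (tp T ?B \<cdot> \<eta> 1 A)"
    using A by (simp add: flat_bare(1))
  have k: "flat 2 A (pairT2 (opcat C) Top A (tp Top A \<cdot> tz Top A) (Ide C ?B)) = ?P \<cdot> \<eta> 1 A"
    "pairT2 (opcat C) Top A (tp Top A \<cdot> tz Top A) (Ide C ?B) \<in> Arr C"
    "Dom C (pairT2 (opcat C) Top A (tp Top A \<cdot> tz Top A) (Ide C ?B)) = ob (L 2) A"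
    "Cod C (pairT2 (opcat C) Top A (tp Top A \<cdot> tz Top A) (Ide C ?B)) = ?B"
    using op_pair[OF A, of "tp Top A \<cdot> tz Top A" "Ide C ?B" "?P \<cdot> \<eta> 1 A"] A
    by (simp_all add: P comp_extend[OF P(4)] comp_extend[OF P(5)] fz assoc)
  show ?thesis
    by (rule flat_inj[of 1 A]) (use A k in \<open>simp_all add: flat_s P comp_extend[OF s_unit]\<close>)
qed

lemma Top_s_comm:
  assumes A: "A \<in> Obj C"
  shows "pairT2 (opcat C) Top A (tq Top 2 2 A) (tq Top 2 1 A) \<cdot> ts Top A = ts Top A"
proof -
  let ?B = "ob (L 2) A"
  let ?P = "pairT2 C T ?B (tq T 2 2 ?B) (tq T 2 1 ?B)"
  have "tp T ?B \<cdot> tq T 2 2 ?B = tp T ?B \<cdot> tq T 2 1 ?B"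
    using A by (intro p_q) simp_all
  note P = pairT2_simps[OF _ _ _ _ _ _ this]
  have k: "flat 2 A (pairT2 (opcat C) Top A (tq Top 2 2 A) (tq Top 2 1 A)) = ?P \<cdot> \<eta> 2 A"
    "pairT2 (opcat C) Top A (tq Top 2 2 A) (tq Top 2 1 A) \<in> Arr C"
    "Dom C (pairT2 (opcat C) Top A (tq Top 2 2 A) (tq Top 2 1 A)) = ob (L 2) A"
    "Cod C (pairT2 (opcat C) Top A (tq Top 2 2 A) (tq Top 2 1 A)) = ?B"
    using op_pair[OF A, of "tq Top 2 2 A" "tq Top 2 1 A" "?P \<cdot> \<eta> 2 A"] A
    by (simp_all add: P comp_extend[OF P(4)] comp_extend[OF P(5)] flat_bare)
  show ?thesis
    by (rule flat_inj[of 1 A]) (use A k in \<open>simp_all add: flat_s flat_bare P comp_extend[OF s_comm]\<close>)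
qed

lemma Top_s_assoc:
  assumes A: "A \<in> Obj C"
  shows "pairT2 (opcat C) Top A
      (pairT2 (opcat C) Top A (tq Top 3 1 A) (tq Top 3 2 A) \<cdot> ts Top A) (tq Top 3 3 A) \<cdot> ts Top A =
    pairT2 (opcat C) Top A
      (tq Top 3 1 A) (pairT2 (opcat C) Top A (tq Top 3 2 A) (tq Top 3 3 A) \<cdot> ts Top A) \<cdot> ts Top A"
proof -
  let ?B = "ob (L 3) A"
  have pq: "tp T ?B \<cdot> tq T 3 j ?B = tp T ?B \<cdot> tq T 3 i ?B" if "1 \<le> j" "j \<le> 3" "1 \<le> i" "i \<le> 3" for i j
    using p_q[of ?B j 3] p_q[of ?B i 3] A that by simp
  \<comment> \<open>\<open>R i j\<close> pairs two projections of \<open>T\<^sub>3\<close>. Its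
    counterpart \<open>K i j\<close> on the opposite side has \<open>R i j\<close> after the unit as
    transpose, so nested copairings turn into nested pairings.\<close>
  define R where "R i j = pairT2 C T ?B (tq T 3 i ?B) (tq T 3 j ?B)" for i j
  have R: "R i j \<in> Arr C" "Dom C (R i j) = ob (tanTn T 3) ?B" "Cod C (R i j) = ob (tanTn T 2) ?B"
    "tq T 2 1 ?B \<cdot> R i j = tq T 3 i ?B" "tq T 2 2 ?B \<cdot> R i j = tq T 3 j ?B"
    if "1 \<le> i" "i \<le> 3" "1 \<le> j" "j \<le> 3" for i j
    using pairT2_simps[OF _ _ _ _ _ _ pq[of i j]] A that by (simp_all add: R_def)
  define K where "K i j = pairT2 (opcat C) Top A (tq Top 3 i A) (tq Top 3 j A)" for i j
  have K: "flat 2 A (K i j) = R i j \<cdot> \<eta> 3 A" "K i j \<in> Arr C" "Dom C (K i j) = ob (L 2) A" "Cod C (K i j) = ?B"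
    if "1 \<le> i" "i \<le> 3" "1 \<le> j" "j \<le> 3" for i j
    using op_pair[OF A, of "tq Top 3 i A" "tq Top 3 j A" "R i j \<cdot> \<eta> 3 A"] A that
    by (simp_all add: R comp_extend[OF R(4)] comp_extend[OF R(5)] flat_bare K_def)
  have ps: "tp T ?B \<cdot> (ts T ?B \<cdot> R i j) = tp T ?B \<cdot> tq T 3 i ?B" if "1 \<le> i" "i \<le> 3" "1 \<le> j" "j \<le> 3" for i j
    using A that by (simp add: comp_extend[OF p_s] R assoc)
  let ?Q1 = "pairT2 C T ?B (ts T ?B \<cdot> R 1 2) (tq T 3 3 ?B)"
  let ?Q2 = "pairT2 C T ?B (tq T 3 1 ?B) (ts T ?B \<cdot> R 2 3)"
  have "tp T ?B \<cdot> (ts T ?B \<cdot> R 1 2) = tp T ?B \<cdot> tq T 3 3 ?B" using ps[of 1 2] pq[of 1 3] by simp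
  note Q1 = pairT2_simps[OF _ _ _ _ _ _ this]
  have "tp T ?B \<cdot> tq T 3 1 ?B = tp T ?B \<cdot> (ts T ?B \<cdot> R 2 3)" using ps[of 2 3] pq[of 1 2] by simp
  note Q2 = pairT2_simps[OF _ _ _ _ _ _ this]
  let ?K1 = "pairT2 (opcat C) Top A (K 1 2 \<cdot> ts Top A) (tq Top 3 3 A)"
  let ?K2 = "pairT2 (opcat C) Top A (tq Top 3 1 A) (K 2 3 \<cdot> ts Top A)"
  have K1: "flat 2 A ?K1 = ?Q1 \<cdot> \<eta> 3 A" "?K1 \<in> Arr C" "Dom C ?K1 = ob (L 2) A" "Cod C ?K1 = ?B"
    using op_pair[OF A, of "K 1 2 \<cdot> ts Top A" "tq Top 3 3 A" "?Q1 \<cdot> \<eta> 3 A"] A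
    by (simp_all add: R K Q1 comp_extend[OF Q1(4)] comp_extend[OF Q1(5)] flat_bare flat_s assoc)
  have K2: "flat 2 A ?K2 = ?Q2 \<cdot> \<eta> 3 A" "?K2 \<in> Arr C" "Dom C ?K2 = ob (L 2) A" "Cod C ?K2 = ?B"
    using op_pair[OF A, of "tq Top 3 1 A" "K 2 3 \<cdot> ts Top A" "?Q2 \<cdot> \<eta> 3 A"] A
    by (simp_all add: R K Q2 comp_extend[OF Q2(4)] comp_extend[OF Q2(5)] flat_bare flat_s assoc)
  have "ts T ?B \<cdot> ?Q1 = ts T ?B \<cdot> ?Q2"
    using s_assoc[of ?B] A by (simp add: R_def)
  from comp_extend[OF this, of "\<eta> 3 A"] have "ts T ?B \<cdot> (?Q1 \<cdot> \<eta> 3 A) = ts T ?B \<cdot> (?Q2 \<cdot> \<eta> 3 A)"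
    using A by (simp add: Q1 Q2 R assoc)
  note eq4 = this
  have "?K1 \<cdot> ts Top A = ?K2 \<cdot> ts Top A"
    by (rule flat_inj[of 1 A]) (use eq4 A in \<open>simp_all add: flat_s K1 K2\<close>)
  then show ?thesis by (simp add: K_def)
qed

text \<open>Transposes to additivity of the lift with \<open>s_T\<close> in place of
  \<open>T(s)\<close>, which is \<open>l_s_T\<close>.\<close>

lemma Top_l_s:
  assumes A: "A \<in> Obj C"
  shows "ts Top A \<cdot> tl Top A =
    pairTT2 (opcat C) Top A (tq Top 2 1 A \<cdot> tl Top A) (tq Top 2 2 A \<cdot> tl Top A) \<cdot> ar (L 1) (ts Top A)"
proof -
  let ?B = "ob (L 2) A"
  let ?H = "pairT2 C T (ob (tanT T) ?B) (tl T ?B \<cdot> tq T 2 1 ?B) (tl T ?B \<cdot> tq T 2 2 ?B)"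
  let ?k = "pairTT2 (opcat C) Top A (tq Top 2 1 A \<cdot> tl Top A) (tq Top 2 2 A \<cdot> tl Top A)"
  have "tp T (ob (tanT T) ?B) \<cdot> (tl T ?B \<cdot> tq T 2 1 ?B) = tp T (ob (tanT T) ?B) \<cdot> (tl T ?B \<cdot> tq T 2 2 ?B)"
    using A p_q[of ?B 2 2] by (simp add: comp_extend[OF pT_l] assoc)
  note H = pairT2_simps[OF _ _ _ _ _ _ this]
  have k: "?k \<in> Arr C" "Dom C ?k = ob (L 1) ?B" "Cod C ?k = ?B" "flat 2 A (flat 1 ?B ?k) = ?H \<cdot> \<eta> 2 A"
    using op_TTpair[OF A, of "tq Top 2 1 A \<cdot> tl Top A" "tq Top 2 2 A \<cdot> tl Top A" "?H \<cdot> \<eta> 2 A"] A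
    by (simp_all add: H comp_extend[OF H(4)] comp_extend[OF H(5)] flat_l flat_bare assoc)
  have "tl T ?B \<cdot> ts T ?B = ts T (ob (tanT T) ?B) \<cdot> ?H"
    by (rule l_s_T) (use A in \<open>simp_all add: H\<close>)
  note eq5 = comp_extend[OF this, of "\<eta> 2 A"]
  show ?thesis
    by (rule flat2_inj[of A]) (use eq5 A in \<open>simp_all add: k flat_L flat_s flat_l flat_bare H assoc\<close>)
qed

text \<open>Transposes to additivity of the flip with the two additions exchanged, which is
  \<open>c_sT\<close>. Here the copairing starts at \<open>L\<^sub>2(L(A))\<close>, so its double
  transpose lands in \<open>T(T\<^sub>2(Z))\<close>.\<close>

lemma Top_c_s:
  assumes A: "A \<in> Obj C"
  shows "ar (L 1) (ts Top A) \<cdot> tc Top A =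
    pairT2 (opcat C) Top (ob (L 1) A) (ar (L 1) (tq Top 2 1 A) \<cdot> tc Top A) (ar (L 1) (tq Top 2 2 A) \<cdot> tc Top A)
      \<cdot> ts Top (ob (L 1) A)"
proof -
  let ?B = "ob (L 1) (ob (L 2) A)" and ?LA = "ob (L 1) A"
  \<comment> \<open>The double transpose of the identity of \<open>L(L\<^sub>2(A))\<close>; the
    transposed arrows below are structure maps applied to it.\<close>
  define E where "E = flat 2 A (\<eta> 1 (ob (L 2) A))"
  have E: "E \<in> Arr C" "Dom C E = A" "Cod C E = ob (tanTn T 2) (ob (tanT T) ?B)"
    using A by (simp_all add: E_def)
  define u where "u j = ar (L 1) (tq Top 2 j A) \<cdot> tc Top A" for j
  have u: "u j \<in> Arr C" "Dom C (u j) = ob (L 1) ?LA" "Cod C (u j) = ?B"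
    "flat 1 A (flat 1 ?LA (u j)) = tc T ?B \<cdot> (tq T 2 j (ob (tanT T) ?B) \<cdot> E)" if "1 \<le> j" "j \<le> 2" for j
    using A that by (simp_all add: u_def flat_c flat_L_bare flat_q E_def)
  have up: "flat 1 A (u j \<cdot> tp Top ?LA) = tp T (ob (tanT T) ?B) \<cdot> (tq T 2 1 (ob (tanT T) ?B) \<cdot> E)"
    if "1 \<le> j" "j \<le> 2" for j
    using A that E by (simp add: comp_p u flat_comp comp_extend[OF Tp_c] comp_extend[OF p_q[OF _ that]] assoc)
  have eq: "u 1 \<cdot> tp Top ?LA = u 2 \<cdot> tp Top ?LA"
    by (rule flat_inj[of 1 A]) (use A in \<open>simp_all add: u up\<close>)
  let ?k = "pairT2 (opcat C) Top ?LA (u 1) (u 2)"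
  have k: "?k \<in> Arr C" "Dom C ?k = ob (L 2) ?LA" "Cod C ?k = ?B"
    "?k \<cdot> tq Top 2 1 ?LA = u 1" "?k \<cdot> tq Top 2 2 ?LA = u 2"
    using op_pair_simps[OF _ _ _ _ _ _ eq] A by (simp_all add: u)
  \<comment> \<open>The arrow \<open>T\<^sub>2(T(B)) \<rightarrow> T(T\<^sub>2(B))\<close> induced
    by the flip; it carries E to the double transpose of the copairing.\<close>
  let ?m = "pairTT2 C T ?B (tc T ?B \<cdot> tq T 2 1 (ob (tanT T) ?B)) (tc T ?B \<cdot> tq T 2 2 (ob (tanT T) ?B))"
  have "ar (tanT T) (tp T ?B) \<cdot> (tc T ?B \<cdot> tq T 2 1 (ob (tanT T) ?B)) =
      ar (tanT T) (tp T ?B) \<cdot> (tc T ?B \<cdot> tq T 2 2 (ob (tanT T) ?B))"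
    using A p_q[of "ob (tanT T) ?B" 2 2] by (simp add: comp_extend[OF Tp_c])
  note k0 = pairTT2_simps[OF _ _ _ _ _ _ this]
  have "ar (tanT T) (tq T 2 j ?B) \<cdot> flat 1 A (flat 2 ?LA ?k) = flat 1 A (flat 1 ?LA (?k \<cdot> tq Top 2 j ?LA))"
    if "1 \<le> j" "j \<le> 2" for j
    using A that k(1-3) by (simp add: flat_q flat_comp[where k = "tq T 2 j ?B"])
  note eq6 = this
  have K: "flat 1 A (flat 2 ?LA ?k) = ?m \<cdot> E"
    by (rule TT2_ext[of ?B])
      (use eq6 A E in \<open>simp_all add: k u k0 comp_extend[OF k0(4)] comp_extend[OF k0(5)] assoc\<close>)
  have "tc T ?B \<cdot> ts T (ob (tanT T) ?B) = ar (tanT T) (ts T ?B) \<cdot> ?m"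
    by (rule c_sT) (use A in \<open>simp_all add: k0\<close>)
  note eq7 = comp_extend[OF this, of E]
  have "ar (L 1) (ts Top A) \<cdot> tc Top A = ?k \<cdot> ts Top ?LA"
    by (rule flat2_inj[of A])
      (use eq7 A in \<open>simp_all add: E_def[symmetric] E k(1-3) K k0 flat_c flat_s flat_L_bare flat_comp[where k = "ts T ?B"] assoc\<close>)
  then show ?thesis by (simp add: u_def)
qed

section \<open>Axioms without copairings\<close>

lemma Top_q_one: "A \<in> Obj C \<Longrightarrow> tq Top 1 1 A = Ide C (ob (L 1) A)"
  by (rule flat_inj[of 1 A]) (simp_all add: flat_bare(2) q_one)

lemma Top_p_s: "A \<in> Obj C \<Longrightarrow> ts Top A \<cdot> tp Top A = tq Top 2 1 A \<cdot> tp Top A"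
  by (simp add: comp_p flat_bare(2,3) comp_extend[OF p_s] assoc)

lemma Top_p_z: "A \<in> Obj C \<Longrightarrow> tz Top A \<cdot> tp Top A = Ide C A"
  by (simp add: comp_p flat_bare(4) p_z)

lemma Top_l_p:
  assumes A: "A \<in> Obj C"
  shows "tl Top A \<cdot> ar (L 1) (tp Top A) = tp Top A \<cdot> tz Top A"
proof (rule flat_inj[of 1 A])
  have "flat 1 A (tl Top A \<cdot> ar (L 1) (tp Top A)) =
      tp T (ob (tanT T) (ob (L 1) A)) \<cdot> (tl T (ob (L 1) A) \<cdot> \<eta> 1 A)"
    using A by (simp add: flat_L comp_p flat_bare(5))
  also have "\<dots> = tz T (ob (L 1) A) \<cdot> tp Top A"
    using A by (simp add: comp_extend[OF pT_l] flat_bare(1) assoc)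
  also have "\<dots> = flat 1 A (tp Top A \<cdot> tz Top A)"
    using A by (simp add: flat_z)
  finally show "flat 1 A (tl Top A \<cdot> ar (L 1) (tp Top A)) = flat 1 A (tp Top A \<cdot> tz Top A)" .
qed (use A in simp_all)

lemma Top_l_z:
  assumes A: "A \<in> Obj C"
  shows "tz Top A \<cdot> tl Top A = tz Top A \<cdot> ar (L 1) (tz Top A)"
proof (rule flat2_inj[OF A])
  \<comment> \<open>By naturality of z, \<open>T(z) z = z_T z\<close>, so the original axiom is
    already of the flipped kind.\<close>
  have "tl T A \<cdot> tz T A = tz T (ob (tanT T) A) \<cdot> tz T A"
    using A nat_trans_natural[OF z_natural, of "tz T A" "ob (tanT T) A"] by (simp add: l_z)
  then show "flat 1 A (flat 1 (ob (L 1) A) (tz Top A \<cdot> tl Top A)) =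
      flat 1 A (flat 1 (ob (L 1) A) (tz Top A \<cdot> ar (L 1) (tz Top A)))"
    using A by (simp add: flat_l flat_L flat_z flat_bare(4))
qed (use A in simp_all)

text \<open>Transposes to \<open>T(p) c = p_T\<close>, the flipped form of the axiom.\<close>

lemma Top_c_p:
  assumes A: "A \<in> Obj C"
  shows "tc Top A \<cdot> tp Top (ob (L 1) A) = ar (L 1) (tp Top A)"
proof (rule flat_inj[of 1 A])
  let ?B = "ob (L 1) (ob (L 1) A)"
  have "flat 1 A (tc Top A \<cdot> tp Top (ob (L 1) A)) = ar (tanT T) (tp T ?B) \<cdot> flat 1 A (flat 1 (ob (L 1) A) (tc Top A))"
    using A by (simp add: comp_p flat_comp[where k = "tp T ?B"])
  also have "\<dots> = flat 1 A (ar (L 1) (tp Top A))"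
    using A by (simp add: flat_bare(6) comp_extend[OF Tp_c] flat_L_bare comp_p)
  finally show "flat 1 A (tc Top A \<cdot> tp Top (ob (L 1) A)) = flat 1 A (ar (L 1) (tp Top A))" .
qed (use A in simp_all)

lemma Top_c_z:
  assumes A: "A \<in> Obj C"
  shows "ar (L 1) (tz Top A) \<cdot> tc Top A = tz Top (ob (L 1) A)"
proof (rule flat2_inj[OF A])
  have "flat 1 A (flat 1 (ob (L 1) A) (tz Top (ob (L 1) A))) = ar (tanT T) (tz T (ob (L 1) A)) \<cdot> \<eta> 1 A"
    using A by (simp add: flat_bare(4)) (simp add: flat_def)
  then show "flat 1 A (flat 1 (ob (L 1) A) (ar (L 1) (tz Top A) \<cdot> tc Top A)) =
      flat 1 A (flat 1 (ob (L 1) A) (tz Top (ob (L 1) A)))"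
    using A by (simp add: flat_c flat_L_bare flat_z comp_extend[OF c_zT])
qed (use A in simp_all)

lemma Top_c_c:
  assumes A: "A \<in> Obj C"
  shows "tc Top A \<cdot> tc Top A = Ide C (ob (L 1) (ob (L 1) A))"
  by (rule flat2_inj[OF A]) (use A in \<open>simp_all add: flat_c flat_bare(6) comp_extend[OF c_c]\<close>)

lemma Top_c_l:
  assumes A: "A \<in> Obj C"
  shows "tl Top A \<cdot> tc Top A = tl Top A"
  by (rule flat2_inj[OF A]) (use A in \<open>simp_all add: flat_c flat_bare(5) comp_extend[OF c_l]\<close>)

lemma Top_l_l:
  assumes A: "A \<in> Obj C"
  shows "tl Top A \<cdot> ar (L 1) (tl Top A) = tl Top A \<cdot> tl Top (ob (L 1) A)"
proof (rule flat3_inj[OF A])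
  let ?B = "ob (L 1) A"
  have "flat 1 A (flat 1 ?B (flat 1 (ob (L 1) ?B) (tl Top A \<cdot> tl Top ?B))) =
     ar (tanT T) (tl T ?B) \<cdot> flat 1 A (flat 1 ?B (tl Top A))"
    using A by (simp add: flat_l flat_comp[where k = "tl T ?B"])
  also have "\<dots> = flat 1 A (flat 1 ?B (flat 1 (ob (L 1) ?B) (tl Top A \<cdot> ar (L 1) (tl Top A))))"
    using A by (simp add: flat_L flat_l flat_bare(5) comp_extend[OF l_l] assoc)
  finally show "flat 1 A (flat 1 ?B (flat 1 (ob (L 1) ?B) (tl Top A \<cdot> ar (L 1) (tl Top A)))) =
     flat 1 A (flat 1 ?B (flat 1 (ob (L 1) ?B) (tl Top A \<cdot> tl Top ?B)))" by simp
qed (use A in simp_all)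

text \<open>Three transpositions exchange \<open>T(c)\<close> and \<open>c_T\<close>, so the two
  sides of the braid identity trade places.\<close>

lemma Top_c_braid:
  assumes A: "A \<in> Obj C"
  shows "(ar (L 1) (tc Top A) \<cdot> tc Top (ob (L 1) A)) \<cdot> ar (L 1) (tc Top A) =
    (tc Top (ob (L 1) A) \<cdot> ar (L 1) (tc Top A)) \<cdot> tc Top (ob (L 1) A)"
proof (rule flat3_inj[OF A])
  let ?LA = "ob (L 1) A"
  let ?LLA = "ob (L 1) ?LA"
  let ?B = "ob (L 1) ?LLA"
  let ?E = "flat 1 A (flat 1 ?LA (\<eta> 1 ?LLA))"
  have E: "?E \<in> Arr C" "Dom C ?E = A" "Cod C ?E = ob (tanT T) (ob (tanT T) (ob (tanT T) ?B))"
    using A by simp_all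
  have "ar (tanT T) (tc T ?B) \<cdot> (tc T (ob (tanT T) ?B) \<cdot> (ar (tanT T) (tc T ?B) \<cdot> ?E)) =
      (ar (tanT T) (tc T ?B) \<cdot> (tc T (ob (tanT T) ?B) \<cdot> ar (tanT T) (tc T ?B))) \<cdot> ?E"
    using A E by (simp add: assoc)
  also have "\<dots> = tc T (ob (tanT T) ?B) \<cdot> (ar (tanT T) (tc T ?B) \<cdot> (tc T (ob (tanT T) ?B) \<cdot> ?E))"
    using A E by (simp only: c_braid[of ?B] L_simps le_refl) (simp add: assoc)
  finally have braid: "ar (tanT T) (tc T ?B) \<cdot> (tc T (ob (tanT T) ?B) \<cdot> (ar (tanT T) (tc T ?B) \<cdot> ?E)) =
    tc T (ob (tanT T) ?B) \<cdot> (ar (tanT T) (tc T ?B) \<cdot> (tc T (ob (tanT T) ?B) \<cdot> ?E))" .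
  show "flat 1 A (flat 1 ?LA (flat 1 ?LLA ((ar (L 1) (tc Top A) \<cdot> tc Top ?LA) \<cdot> ar (L 1) (tc Top A)))) =
    flat 1 A (flat 1 ?LA (flat 1 ?LLA ((tc Top ?LA \<cdot> ar (L 1) (tc Top A)) \<cdot> tc Top ?LA)))"
    using A by (simp add: flat_L flat_L_bare flat_c flat_bare(6) flat_comp[where k = "tc T ?B"] braid)
qed (use A in simp_all)

text \<open>Transposes to \<open>T(c) c_T T(l) = l_T c\<close>, the original identity solved for its
  other side by cancelling the involutions.\<close>

lemma Top_c_l_T:
  assumes A: "A \<in> Obj C"
  shows "(tl Top (ob (L 1) A) \<cdot> ar (L 1) (tc Top A)) \<cdot> tc Top (ob (L 1) A) = tc Top A \<cdot> ar (L 1) (tl Top A)"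
proof (rule flat3_inj[OF A])
  let ?LA = "ob (L 1) A"
  let ?B = "ob (L 1) ?LA"
  let ?TB = "ob (tanT T) ?B"
  let ?E = "flat 1 A (\<eta> 1 ?LA)"
  have E: "?E \<in> Arr C" "Dom C ?E = A" "Cod C ?E = ob (tanT T) ?TB"
    using A by simp_all
  have Tcc: "ar (tanT T) (tc T ?B) \<cdot> ar (tanT T) (tc T ?B) = Ide C (ob (tanT T) (ob (tanT T) ?TB))"
    using A by (simp add: T_comp[symmetric] c_c)
  have "ar (tanT T) (tl T ?B) \<cdot> ?E = ar (tanT T) (tl T ?B) \<cdot> (tc T ?B \<cdot> (tc T ?B \<cdot> ?E))"
    using A E by (simp add: comp_extend[OF c_c])
  also have "\<dots> = tc T ?TB \<cdot> (ar (tanT T) (tc T ?B) \<cdot> (tl T ?TB \<cdot> (tc T ?B \<cdot> ?E)))"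
    using A E by (simp add: comp_extend[OF c_l_T[symmetric]] assoc)
  finally have "ar (tanT T) (tc T ?B) \<cdot> (tc T ?TB \<cdot> (ar (tanT T) (tl T ?B) \<cdot> ?E)) = tl T ?TB \<cdot> (tc T ?B \<cdot> ?E)"
    using A E by (simp add: comp_extend[OF c_c] comp_extend[OF Tcc])
  then show "flat 1 A (flat 1 ?LA (flat 1 ?B ((tl Top ?LA \<cdot> ar (L 1) (tc Top A)) \<cdot> tc Top ?LA))) =
    flat 1 A (flat 1 ?LA (flat 1 ?B (tc Top A \<cdot> ar (L 1) (tl Top A))))"
    using A by (simp add: flat_L flat_c flat_l flat_bare(5,6) flat_comp[where k = "tc T ?B"]
      flat_comp[where k = "tl T ?B"])
qed (use A in simp_all)

text \<open>\<open>W h\<close> is the double transpose of h. Arrows out of \<open>L(L(A))\<close>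
  that coequalize the opposite pair correspond, through \<open>c W h\<close>, to arrows equalized by
  the original pair, and factorizations through the opposite lift to factorizations through the
  original one. The flip in \<open>c W h\<close> repairs the order reversed by transposing
  twice.\<close>

lemma Top_universality:
  assumes A: "A \<in> Obj C"
  shows "is_equalizer (opcat C) (ar (L 1) (tp Top A)) ((tp Top (ob (L 1) A) \<cdot> tp Top A) \<cdot> tz Top A)
    (univ_lift (opcat C) Top A)"
proof -
  let ?LA = "ob (L 1) A" and ?B = "ob (L 2) A"
  let ?LLA = "ob (L 1) ?LA"
  define W where "W h = flat 1 A (flat 1 ?LA h)" for h
  have W: "W h \<in> Arr C" "Dom C (W h) = A" "Cod C (W h) = ob (tanT T) (ob (tanT T) (Cod C h))"
    if "h \<in> Arr C" "Dom C h = ?LLA" for h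
    using A that by (simp_all add: W_def)
  let ?f = "ar (L 1) (tp Top A)" and ?g = "(tp Top ?LA \<cdot> tp Top A) \<cdot> tz Top A"
  \<comment> \<open>The two transposes are \<open>p_T W h\<close> and \<open>z p T(p) W h\<close>;
    the identities \<open>p_T = T(p) c\<close> and \<open>T(p) = p_T c\<close> bring them to the
    original pair at \<open>c W h\<close>.\<close>
  have fg: "h \<cdot> ?f = h \<cdot> ?g \<longleftrightarrow> ar (tanT T) (tp T Z) \<cdot> (tc T Z \<cdot> W h) =
      (tz T Z \<cdot> tp T Z \<cdot> tp T (ob (tanT T) Z)) \<cdot> (tc T Z \<cdot> W h)"
    if h: "h \<in> Arr C" "Dom C h = ?LLA" "Cod C h = Z" for h Z
  proof -
    have Z: "Z \<in> Obj C" using h by auto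
    have 1: "flat 1 A (h \<cdot> ?f) = ar (tanT T) (tp T Z) \<cdot> (tc T Z \<cdot> W h)"
      using A Z h W[OF h(1,2)] by (simp add: flat_L comp_p comp_extend[OF Tp_c]) (simp add: W_def)
    have "h \<cdot> ?g = ((h \<cdot> tp Top ?LA) \<cdot> tp Top A) \<cdot> tz Top A"
      using A h by (simp add: assoc)
    then have "flat 1 A (h \<cdot> ?g) = tz T Z \<cdot> ((h \<cdot> tp Top ?LA) \<cdot> tp Top A)"
      using A h by (simp add: flat_z)
    also have "(h \<cdot> tp Top ?LA) \<cdot> tp Top A = tp T Z \<cdot> flat 1 A (h \<cdot> tp Top ?LA)"
      using A h by (simp add: comp_p[of A])
    also have "flat 1 A (h \<cdot> tp Top ?LA) = ar (tanT T) (tp T Z) \<cdot> W h"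
      using A Z h by (simp add: comp_p flat_comp[where k = "tp T Z"] W_def)
    also have "\<dots> = tp T (ob (tanT T) Z) \<cdot> (tc T Z \<cdot> W h)"
      using A Z h W[OF h(1,2)] by (simp add: comp_extend[OF c_p])
    finally have 2: "flat 1 A (h \<cdot> ?g) = (tz T Z \<cdot> tp T Z \<cdot> tp T (ob (tanT T) Z)) \<cdot> (tc T Z \<cdot> W h)"
      using Z W[OF h(1,2)] h by (simp add: assoc)
    have "h \<cdot> ?f = h \<cdot> ?g" if "flat 1 A (h \<cdot> ?f) = flat 1 A (h \<cdot> ?g)"
      by (rule flat_inj[of 1 A]) (use A h that in simp_all)
    then show ?thesis
      unfolding 1[symmetric] 2[symmetric] by auto
  qed
  \<comment> \<open>The pairing \<open>\<langle>l q\<^sub>1, T(z) q\<^sub>2\<rangle>\<close> from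
    the flipped form of the universal lift.\<close>
  define M where "M Z = pairT2 C T (ob (tanT T) Z) (tl T Z \<cdot> tq T 2 1 Z) (ar (tanT T) (tz T Z) \<cdot> tq T 2 2 Z)"
    for Z
  have M: "M Z \<in> Arr C" "Dom C (M Z) = ob (tanTn T 2) Z" "Cod C (M Z) = ob (tanTn T 2) (ob (tanT T) Z)"
    "tq T 2 1 (ob (tanT T) Z) \<cdot> M Z = tl T Z \<cdot> tq T 2 1 Z"
    "tq T 2 2 (ob (tanT T) Z) \<cdot> M Z = ar (tanT T) (tz T Z) \<cdot> tq T 2 2 Z"
    if Z: "Z \<in> Obj C" for Z
  proof -
    have pTz: "tp T (ob (tanT T) Z) \<cdot> ar (tanT T) (tz T Z) = tz T Z \<cdot> tp T Z"
      using Z nat_trans_natural[OF p_natural, of "tz T Z" "ob (tanT T) Z"] by simp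
    have "tp T (ob (tanT T) Z) \<cdot> (tl T Z \<cdot> tq T 2 1 Z) =
        tp T (ob (tanT T) Z) \<cdot> (ar (tanT T) (tz T Z) \<cdot> tq T 2 2 Z)"
      using Z p_q[of Z 2 2] by (simp add: comp_extend[OF pT_l] comp_extend[OF pTz] assoc)
    from pairT2_simps[OF _ _ _ _ _ _ this]
    show "M Z \<in> Arr C" "Dom C (M Z) = ob (tanTn T 2) Z" "Cod C (M Z) = ob (tanTn T 2) (ob (tanT T) Z)"
      "tq T 2 1 (ob (tanT T) Z) \<cdot> M Z = tl T Z \<cdot> tq T 2 1 Z"
      "tq T 2 2 (ob (tanT T) Z) \<cdot> M Z = ar (tanT T) (tz T Z) \<cdot> tq T 2 2 Z"
      using Z by (simp_all add: M_def)
  qed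
  have ul: "univ_lift C T Z = tc T Z \<cdot> (ts T (ob (tanT T) Z) \<cdot> M Z)" if Z: "Z \<in> Obj C" for Z
  proof -
    have "tc T Z \<cdot> univ_lift C T Z = ts T (ob (tanT T) Z) \<cdot> M Z"
      by (rule univ_lift_c[OF Z]) (use Z in \<open>simp_all add: M\<close>)
    then have "tc T Z \<cdot> (tc T Z \<cdot> univ_lift C T Z) = tc T Z \<cdot> (ts T (ob (tanT T) Z) \<cdot> M Z)"
      by simp
    then show ?thesis
      using Z by (simp add: comp_extend[OF c_c] univ_lift_simps)
  qed
  let ?u = "tq Top 2 1 A \<cdot> tl Top A" and ?v = "tq Top 2 2 A \<cdot> tz Top ?LA"
  let ?k = "pairTT2 (opcat C) Top A ?u ?v"
  have "flat 1 A (flat 1 ?LA ?v) = ar (tanT T) (tz T ?B) \<cdot> (tq T 2 2 ?B \<cdot> \<eta> 2 A)"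
    using A by (simp add: flat_z flat_comp[where k = "tz T ?B"] flat_bare(2))
  then have k: "?k \<in> Arr C" "Dom C ?k = ob (L 1) ?B" "Cod C ?k = ?B"
    "?k \<cdot> ar (L 1) (tq Top 2 1 A) = ?u" "?k \<cdot> ar (L 1) (tq Top 2 2 A) = ?v"
    using op_TTpair[OF A, of ?u ?v "M ?B \<cdot> \<eta> 2 A"] A
    by (simp_all add: M comp_extend[OF M(4)] comp_extend[OF M(5)] flat_l flat_bare(2) assoc)
  let ?e = "?k \<cdot> ar (L 1) (ts Top A)"
  have e: "?e \<in> Arr C" "Dom C ?e = ?LLA" "Cod C ?e = ?B"
    using A k by simp_all
  \<comment> \<open>The two universal lifts correspond: under \<open>c W\<close> the opposite lift
    followed by x becomes the original lift after the transpose of x. The components of the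
    copairing transpose to those of \<open>M\<close>.\<close>
  have eq: "tc T Z \<cdot> W (x \<cdot> ?e) = univ_lift C T Z \<cdot> flat 2 A x"
    if x: "x \<in> Arr C" "Dom C x = ?B" "Cod C x = Z" for x Z
  proof -
    have Z: "Z \<in> Obj C" using x by auto
    let ?K = "flat 2 A (flat 1 ?B (x \<cdot> ?k))"
    have q: "tq T 2 j (ob (tanT T) Z) \<cdot> ?K = flat 1 A (flat 1 ?LA (x \<cdot> (?k \<cdot> ar (L 1) (tq Top 2 j A))))"
      if "1 \<le> j" "j \<le> 2" for j
      using A x k(1-3) that by (simp add: assoc_left flat_q flat_L)
    have "tq T 2 1 (ob (tanT T) Z) \<cdot> ?K = tl T Z \<cdot> (tq T 2 1 Z \<cdot> flat 2 A x)"
      using A x q[of 1] by (simp add: k assoc_left[of "tl Top A"] flat_l flat_q)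
    moreover have "tq T 2 2 (ob (tanT T) Z) \<cdot> ?K = ar (tanT T) (tz T Z) \<cdot> (tq T 2 2 Z \<cdot> flat 2 A x)"
      using A Z x q[of 2] by (simp add: k assoc_left[of "tz Top ?LA"] flat_z flat_q
          flat_comp[where k = "tz T Z"])
    ultimately have K: "?K = M Z \<cdot> flat 2 A x"
      by - (rule T2_ext[of "ob (tanT T) Z"],
          use A Z x k(1-3) in \<open>simp_all add: M comp_extend[OF M(4)] comp_extend[OF M(5)] assoc\<close>)
    have "W (x \<cdot> ?e) = ts T (ob (tanT T) Z) \<cdot> ?K"
      using A x k(1-3) by (simp add: W_def assoc_left flat_L flat_s)
    then show ?thesis
      using A Z x by (simp add: ul K M assoc)
  qed
  \<comment> \<open>The flip is involutive and transposition is injective, so \<open>c W h\<close>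
    determines h.\<close>
  have W_inj: "h = h'" if "h \<in> Arr C" "Dom C h = ?LLA" "h' \<in> Arr C" "Dom C h' = ?LLA" "Cod C h' = Cod C h"
    "tc T (Cod C h) \<cdot> W h = tc T (Cod C h) \<cdot> W h'" for h h'
  proof (rule flat2_inj[OF A])
    let ?Z = "Cod C h"
    have "W h = tc T ?Z \<cdot> (tc T ?Z \<cdot> W h)"
      using that(1,2) A by (simp add: comp_extend[OF c_c] W)
    also have "\<dots> = W h'"
      unfolding that(6) using that(1-5) A by (simp add: comp_extend[OF c_c] W)
    finally show "flat 1 A (flat 1 ?LA h) = flat 1 A (flat 1 ?LA h')"
      by (simp only: W_def)
  qed (use that in simp_all)
  have univ: "is_equalizer C (ar (tanT T) (tp T Z)) (tz T Z \<cdot> tp T Z \<cdot> tp T (ob (tanT T) Z)) (univ_lift C T Z)"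
    if "Z \<in> Obj C" for Z using universality[OF that] .
  have "?e \<cdot> ?f = ?e \<cdot> ?g"
  proof -
    have "ar (tanT T) (tp T ?B) \<cdot> univ_lift C T ?B =
      (tz T ?B \<cdot> tp T ?B \<cdot> tp T (ob (tanT T) ?B)) \<cdot> univ_lift C T ?B"
      using univ[of ?B] A unfolding is_equalizer_def by simp
    from comp_extend[OF this, of "\<eta> 2 A"]
    have "ar (tanT T) (tp T ?B) \<cdot> (tc T ?B \<cdot> W ?e) =
      (tz T ?B \<cdot> tp T ?B \<cdot> tp T (ob (tanT T) ?B)) \<cdot> (tc T ?B \<cdot> W ?e)"
      using A eq[of "Ide C ?B" ?B] e by (simp add: univ_lift_simps assoc)
    then show ?thesis using fg[OF e] by blast
  qed
  moreover have ex: "\<exists>!x. x \<in> Hom C ?B Z \<and> x \<cdot> ?e = h"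
    if Z: "Z \<in> Obj C" and h: "h \<in> Hom C ?LLA Z" "h \<cdot> ?f = h \<cdot> ?g" for Z h
  proof -
    have h': "h \<in> Arr C" "Dom C h = ?LLA" "Cod C h = Z" using h(1) by (simp_all add: Hom_iff)
    have "tc T Z \<cdot> W h \<in> Hom C A (ob (tanT T) (ob (tanT T) Z))"
      using A Z h' by (simp add: Hom_iff W)
    then have "\<exists>!y. y \<in> Hom C A (ob (tanTn T 2) Z) \<and> univ_lift C T Z \<cdot> y = tc T Z \<cdot> W h"
      using univ[OF Z] fg[OF h'] h(2) A Z
      unfolding is_equalizer_iff[OF category_axioms] by (simp add: univ_lift_simps)
    then obtain y where y0: "y \<in> Hom C A (ob (tanTn T 2) Z)" "univ_lift C T Z \<cdot> y = tc T Z \<cdot> W h"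
      and unique: "\<And>y'. y' \<in> Hom C A (ob (tanTn T 2) Z) \<Longrightarrow> univ_lift C T Z \<cdot> y' = tc T Z \<cdot> W h \<Longrightarrow> y' = y"
      by blast
    have y: "y \<in> Arr C" "Dom C y = A" "Cod C y = ob (tanTn T 2) Z"
      using y0(1) by (simp_all add: Hom_iff)
    obtain x where x: "x \<in> Arr C" "Dom C x = ?B" "Cod C x = Z" "flat 2 A x = y"
      using flat_surj[OF _ A Z y] by auto
    show ?thesis
    proof (rule ex1I[of _ x])
      have "x \<cdot> ?e = h"
        by (rule W_inj) (use x e h' y0(2) eq[OF x(1-3)] in simp_all)
      then show "x \<in> Hom C ?B Z \<and> x \<cdot> ?e = h"
        using x by (simp add: Hom_iff)
      fix x' assume x': "x' \<in> Hom C ?B Z \<and> x' \<cdot> ?e = h"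
      then have x1: "x' \<in> Arr C" "Dom C x' = ?B" "Cod C x' = Z" by (simp_all add: Hom_iff)
      have "flat 2 A x' = y"
        by (rule unique) (use A x1 x' eq[OF x1] in \<open>simp_all add: Hom_iff\<close>)
      then show "x' = x"
        by - (rule flat_inj[of 2 A], use A x x1 in simp_all)
    qed
  qed
  moreover have "univ_lift (opcat C) Top A = ?e"
    by (simp add: univ_lift_def)
  moreover have "?f \<in> Arr C" "Cod C ?f = ?LLA" "Dom C ?f = ?LA" "?g \<in> Arr C" "Cod C ?g = ?LLA" "Dom C ?g = ?LA"
    using A by simp_all
  ultimately show ?thesis
    unfolding is_equalizer_iff[OF category_opcat[OF category_axioms]] opcat_simps
    by (intro conjI ballI impI) (simp_all add: e Hom_iff[of ?g])
qed

theorem tangent_category_Top: "tangent_category (opcat C) Top"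
proof (rule tangent_category.intro[OF category_opcat[OF category_axioms]], unfold_locales,
    unfold opcat_simps tanTn_Top)
  show "nat_trans (opcat C) (opcat C) (L n) (L 1) (tq Top n j)" if "j \<in> {1..n}" for j n
    using Top_natural(2) that by (intro nat_trans_opcat) simp
qed (rule is_functor_opcat[OF L_functor] nat_trans_opcat[OF Top_natural(1)]
  nat_trans_opcat[OF Top_natural(3)] nat_trans_opcat[OF Top_natural(4)]
  nat_trans_opcat[OF Top_natural(5)] nat_trans_opcat[OF Top_natural(6)]
  Top_pushouts Top_q_one Top_p_s Top_p_z Top_s_unit Top_s_comm
    Top_s_assoc Top_l_p Top_l_s Top_l_z Top_c_p Top_c_s
    Top_c_z Top_c_c Top_c_l Top_l_l Top_c_braid Top_c_l_T
    Top_universality; assumption)+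

text \<open>Coproducts of C are products of its opposite, and L preserves them as a left
  adjoint.\<close>

lemma cartesian_tangent_category_Top:
  assumes "has_finite_coproducts C"
  shows "cartesian_tangent_category (opcat C) Top"
proof -
  have "preserves_finite_products (opcat C) (opcat C) (L 1)"
    unfolding preserves_finite_products_def
    using right_adjoint_product[OF adjunction_opcat[OF adj[of 1]]] by simp
  then show ?thesis
    using assms tangent_category_Top
    by (simp add: cartesian_tangent_category_def has_finite_coproducts_def has_finite_products_def
        is_coproduct_def)
qed

text \<open>The negation is a mate too, so both of its laws transpose to those of N. The second part
  serves the later comparison of two adjoint structures.\<close>

lemma rosicky_tangent_category_Top:
  assumes "rosicky_tangent_category C T N"
  shows "rosicky_tangent_category (opcat C) Top (adjoint_neg C L \<eta> \<epsilon> N)"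
    and "A \<in> Obj C \<Longrightarrow> h \<in> Arr C \<Longrightarrow> Dom C h = ob (L 1) A \<Longrightarrow>
      flat 1 A (h \<cdot> adjoint_neg C L \<eta> \<epsilon> N A) = N (Cod C h) \<cdot> flat 1 A h"
proof -
  interpret N: rosicky_tangent_category C T N by fact
  let ?n = "adjoint_neg C L \<eta> \<epsilon> N"
  have N[simp]: "N A \<in> Arr C" "Dom C (N A) = ob (tanT T) A" "Cod C (N A) = ob (tanT T) A"
    if "A \<in> Obj C" for A
    using nat_trans_simps[OF N.n_natural that] by simp_all
  have nat: "nat_trans C C (L 1) (L 1) ?n"
    unfolding adjoint_neg_def using mate_natural[OF adj[of 1] adj[of 1] N.n_natural] by simp
  note n = nat_trans_simps[OF nat]
  show fn: "flat 1 A (h \<cdot> ?n A) = N (Cod C h) \<cdot> flat 1 A h"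
    if A: "A \<in> Obj C" and h: "h \<in> Arr C" "Dom C h = ob (L 1) A" for A h
    using mate_transpose(2)[OF adj[of 1] adj[of 1] N.n_natural A h] by (simp add: adjoint_neg_def flat_def)
  have fn1: "flat 1 A (?n A) = N (ob (L 1) A) \<cdot> \<eta> 1 A" if A: "A \<in> Obj C" for A
    using fn[OF A, of "Ide C (ob (L 1) A)"] A by (simp add: n)
  show "rosicky_tangent_category (opcat C) Top ?n"
  proof (rule rosicky_tangent_category.intro[OF tangent_category_Top], unfold_locales, unfold opcat_simps tanTn_Top)
    show "nat_trans (opcat C) (opcat C) (L 1) (L 1) ?n"
      using nat_trans_opcat[OF nat] .
    fix A assume A: "A \<in> Obj C"
    let ?B = "ob (L 1) A"
    show "?n A \<cdot> tp Top A = tp Top A"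
      using A by (simp add: comp_p n fn1 comp_extend[OF N.p_n]) (simp add: flat_bare(1))
    let ?P = "pairT2 C T ?B (Ide C (ob (tanT T) ?B)) (N ?B)"
    have "tp T ?B \<cdot> Ide C (ob (tanT T) ?B) = tp T ?B \<cdot> N ?B"
      using A by (simp add: N.p_n)
    note P = pairT2_simps[OF _ _ _ _ _ _ this]
    let ?k = "pairT2 (opcat C) Top A (Ide C ?B) (?n A)"
    have k: "?k \<in> Arr C" "Dom C ?k = ob (L 2) A" "Cod C ?k = ?B" "flat 2 A ?k = ?P \<cdot> \<eta> 1 A"
      using op_pair[OF A, of "Ide C ?B" "?n A" "?P \<cdot> \<eta> 1 A"] A
      by (simp_all add: P comp_extend[OF P(4)] comp_extend[OF P(5)] n fn1)
    show "?k \<cdot> ts Top A = tp Top A \<cdot> tz Top A"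
    proof (rule flat_inj[of 1 A])
      have "flat 1 A (tp Top A \<cdot> tz Top A) = tz T ?B \<cdot> tp Top A"
        using A by (simp add: flat_z)
      then show "flat 1 A (?k \<cdot> ts Top A) = flat 1 A (tp Top A \<cdot> tz Top A)"
        using A by (simp add: flat_s k P comp_extend[OF N.s_n] flat_bare(1) assoc)
    qed (use A k in simp_all)
  qed
qed

end

section \<open>Lifting tangent structures along faithful functors\<close>

text \<open>Only \<open>B\<close> is assumed to be a tangent structure; \<open>T\<close> has the
  right types and lies strictly over it. The premise \<open>lift\<close> takes the place of creation
  of limits: the candidates for the limits are given upstairs, and an arrow below lifts as soon as
  its composites with a jointly monic family of images do.\<close>

locale strict_tangent_functor = category C + D: tangent_category D B
  for C :: "('o, 'm, 'x) cat_scheme" (structure) and T :: "('o, 'm) tangent"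
    and D :: "('p, 'n, 'y) cat_scheme" and B and U +
  assumes U_functor: "is_functor C D U"
    and faithful: "f \<in> Arr C \<Longrightarrow> g \<in> Arr C \<Longrightarrow> Dom C f = Dom C g \<Longrightarrow> Cod C f = Cod C g \<Longrightarrow>
      ar U f = ar U g \<Longrightarrow> f = g"
    and lift: "\<And>(J :: nat set) P Q Z q g h. P \<in> Obj C \<Longrightarrow> Z \<in> Obj C \<Longrightarrow>
      (\<And>j. j \<in> J \<Longrightarrow> q j \<in> Hom C P Q) \<Longrightarrow> (\<And>j. j \<in> J \<Longrightarrow> g j \<in> Hom C Z Q) \<Longrightarrow>
      h \<in> Hom D (ob U Z) (ob U P) \<Longrightarrow> (\<And>j. j \<in> J \<Longrightarrow> ar U (q j) \<cdot>\<^bsub>D\<^esub> h = ar U (g j)) \<Longrightarrow>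
      (\<And>W x y. x \<in> Hom D W (ob U P) \<Longrightarrow> y \<in> Hom D W (ob U P) \<Longrightarrow>
        (\<And>j. j \<in> J \<Longrightarrow> ar U (q j) \<cdot>\<^bsub>D\<^esub> x = ar U (q j) \<cdot>\<^bsub>D\<^esub> y) \<Longrightarrow> x = y) \<Longrightarrow>
      \<exists>k \<in> Hom C Z P. ar U k = h"
    and T_hom: "1 \<le> n \<Longrightarrow> A \<in> Obj C \<Longrightarrow> ob (tanTn T n) A \<in> Obj C"
      "1 \<le> n \<Longrightarrow> f \<in> Arr C \<Longrightarrow> ar (tanTn T n) f \<in> Hom C (ob (tanTn T n) (Dom C f)) (ob (tanTn T n) (Cod C f))"
      "1 \<le> j \<Longrightarrow> j \<le> n \<Longrightarrow> A \<in> Obj C \<Longrightarrow> tq T n j A \<in> Hom C (ob (tanTn T n) A) (ob (tanT T) A)"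
      "A \<in> Obj C \<Longrightarrow> tp T A \<in> Hom C (ob (tanT T) A) A"
      "A \<in> Obj C \<Longrightarrow> ts T A \<in> Hom C (ob (tanTn T 2) A) (ob (tanT T) A)"
      "A \<in> Obj C \<Longrightarrow> tz T A \<in> Hom C A (ob (tanT T) A)"
      "A \<in> Obj C \<Longrightarrow> tl T A \<in> Hom C (ob (tanT T) A) (ob (tanT T) (ob (tanT T) A))"
      "A \<in> Obj C \<Longrightarrow> tc T A \<in> Hom C (ob (tanT T) (ob (tanT T) A)) (ob (tanT T) (ob (tanT T) A))"
    and U_T: "1 \<le> n \<Longrightarrow> A \<in> Obj C \<Longrightarrow> ob U (ob (tanTn T n) A) = ob (tanTn B n) (ob U A)"
      "1 \<le> n \<Longrightarrow> f \<in> Arr C \<Longrightarrow> ar U (ar (tanTn T n) f) = ar (tanTn B n) (ar U f)"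
      "1 \<le> j \<Longrightarrow> j \<le> n \<Longrightarrow> A \<in> Obj C \<Longrightarrow> ar U (tq T n j A) = tq B n j (ob U A)"
      "A \<in> Obj C \<Longrightarrow> ar U (tp T A) = tp B (ob U A)"
      "A \<in> Obj C \<Longrightarrow> ar U (ts T A) = ts B (ob U A)"
      "A \<in> Obj C \<Longrightarrow> ar U (tz T A) = tz B (ob U A)"
      "A \<in> Obj C \<Longrightarrow> ar U (tl T A) = tl B (ob U A)"
      "A \<in> Obj C \<Longrightarrow> ar U (tc T A) = tc B (ob U A)"
begin

lemma TU_simps [simp]:
  "1 \<le> n \<Longrightarrow> A \<in> Obj C \<Longrightarrow> ob (tanTn T n) A \<in> Obj C"
  "1 \<le> n \<Longrightarrow> f \<in> Arr C \<Longrightarrow> ar (tanTn T n) f \<in> Arr C"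
  "1 \<le> n \<Longrightarrow> f \<in> Arr C \<Longrightarrow> Dom C (ar (tanTn T n) f) = ob (tanTn T n) (Dom C f)"
  "1 \<le> n \<Longrightarrow> f \<in> Arr C \<Longrightarrow> Cod C (ar (tanTn T n) f) = ob (tanTn T n) (Cod C f)"
  "1 \<le> j \<Longrightarrow> j \<le> n \<Longrightarrow> A \<in> Obj C \<Longrightarrow> tq T n j A \<in> Arr C"
  "1 \<le> j \<Longrightarrow> j \<le> n \<Longrightarrow> A \<in> Obj C \<Longrightarrow> Dom C (tq T n j A) = ob (tanTn T n) A"
  "1 \<le> j \<Longrightarrow> j \<le> n \<Longrightarrow> A \<in> Obj C \<Longrightarrow> Cod C (tq T n j A) = ob (tanT T) A"
  "A \<in> Obj C \<Longrightarrow> tp T A \<in> Arr C" "A \<in> Obj C \<Longrightarrow> Dom C (tp T A) = ob (tanT T) A"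
  "A \<in> Obj C \<Longrightarrow> Cod C (tp T A) = A"
  "A \<in> Obj C \<Longrightarrow> ts T A \<in> Arr C" "A \<in> Obj C \<Longrightarrow> Dom C (ts T A) = ob (tanTn T 2) A"
  "A \<in> Obj C \<Longrightarrow> Cod C (ts T A) = ob (tanT T) A"
  "A \<in> Obj C \<Longrightarrow> tz T A \<in> Arr C" "A \<in> Obj C \<Longrightarrow> Dom C (tz T A) = A"
  "A \<in> Obj C \<Longrightarrow> Cod C (tz T A) = ob (tanT T) A"
  "A \<in> Obj C \<Longrightarrow> tl T A \<in> Arr C" "A \<in> Obj C \<Longrightarrow> Dom C (tl T A) = ob (tanT T) A"
  "A \<in> Obj C \<Longrightarrow> Cod C (tl T A) = ob (tanT T) (ob (tanT T) A)"
  "A \<in> Obj C \<Longrightarrow> tc T A \<in> Arr C" "A \<in> Obj C \<Longrightarrow> Dom C (tc T A) = ob (tanT T) (ob (tanT T) A)"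
  "A \<in> Obj C \<Longrightarrow> Cod C (tc T A) = ob (tanT T) (ob (tanT T) A)"
  using T_hom(1) T_hom(2)[of n f] T_hom(3)[of j n A] T_hom(4-8)[of A] by (simp_all add: Hom_iff)

lemmas U_simps [simp] = functor_simps[OF U_functor] U_T

section \<open>Functoriality and naturality by faithfulness\<close>

lemma T_functor': "1 \<le> n \<Longrightarrow> is_functor C C (tanTn T n)"
  unfolding is_functor_iff
  by (intro conjI ballI impI category_axioms faithful) (simp_all add: D.T_comp)

lemma nat_trans_lift:
  assumes b: "nat_trans D D F G b" and F: "is_functor C C F'" "is_functor C C G'"
    and t: "\<And>A. A \<in> Obj C \<Longrightarrow> t A \<in> Hom C (ob F' A) (ob G' A)" "\<And>A. A \<in> Obj C \<Longrightarrow> ar U (t A) = b (ob U A)"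
    and U: "\<And>f. f \<in> Arr C \<Longrightarrow> ar U (ar F' f) = ar F (ar U f)" "\<And>f. f \<in> Arr C \<Longrightarrow> ar U (ar G' f) = ar G (ar U f)"
  shows "nat_trans C C F' G' t"
proof -
  have t': "A \<in> Obj C \<Longrightarrow> t A \<in> Arr C" "A \<in> Obj C \<Longrightarrow> Dom C (t A) = ob F' A"
    "A \<in> Obj C \<Longrightarrow> Cod C (t A) = ob G' A" for A
    using t(1) by (simp_all add: Hom_iff)
  note s = functor_simps(3-5)[OF F(1)] functor_simps(3-5)[OF F(2)] t'
  have "t (Cod C f) \<cdot> ar F' f = ar G' f \<cdot> t (Dom C f)" if f: "f \<in> Arr C" for f
    by (rule faithful) (use f nat_trans_natural[OF b, of "ar U f"] in \<open>simp_all add: s t(2) U\<close>)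
  then show ?thesis using F by (simp add: nat_trans_iff s)
qed

lemma T_natural:
  "1 \<le> j \<Longrightarrow> j \<le> n \<Longrightarrow> nat_trans C C (tanTn T n) (tanT T) (tq T n j)"
  "nat_trans C C (tanT T) idF (tp T)"
  "nat_trans C C (tanTn T 2) (tanT T) (ts T)"
  "nat_trans C C idF (tanT T) (tz T)"
  "nat_trans C C (tanT T) (tanT T \<circ>\<^sub>F tanT T) (tl T)"
  "nat_trans C C (tanT T \<circ>\<^sub>F tanT T) (tanT T \<circ>\<^sub>F tanT T) (tc T)"
proof -
  have TT: "is_functor C C (tanT T \<circ>\<^sub>F tanT T)"
    by (rule is_functor_compF[OF T_functor' T_functor']) simp_all
  show "nat_trans C C (tanTn T n) (tanT T) (tq T n j)" if "1 \<le> j" "j \<le> n"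
    by (rule nat_trans_lift[OF D.q_natural[of j n]]) (use that T_functor' in \<open>simp_all add: Hom_iff\<close>)
qed (rule nat_trans_lift[OF D.p_natural] nat_trans_lift[OF D.s_natural] nat_trans_lift[OF D.z_natural]
    nat_trans_lift[OF D.l_natural] nat_trans_lift[OF D.c_natural];
  use T_functor' is_functor_compF[OF T_functor' T_functor'] is_functor_idF[OF category_axioms] in \<open>simp add: Hom_iff\<close>)+

lemma powF_simps:
  "A \<in> Obj C \<Longrightarrow> ob (powF (tanT T) m) A \<in> Obj C \<and> ob U (ob (powF (tanT T) m) A) = ob (powF (tanT B) m) (ob U A)"
  "f \<in> Arr C \<Longrightarrow> ar (powF (tanT T) m) f \<in> Arr C \<and>
    Dom C (ar (powF (tanT T) m) f) = ob (powF (tanT T) m) (Dom C f) \<and>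
    Cod C (ar (powF (tanT T) m) f) = ob (powF (tanT T) m) (Cod C f) \<and>
    ar U (ar (powF (tanT T) m) f) = ar (powF (tanT B) m) (ar U f)"
  by (induction m) auto

text \<open>The image is a pullback below. Its mediating arrow lifts because the projections are
  jointly monic there, and uniqueness upstairs follows by faithfulness.\<close>

lemma T_pullbacks:
  assumes n: "1 \<le> n" and A: "A \<in> Obj C"
  shows "is_nfold_pullback C n (ar (powF (tanT T) m) (tp T A))
    (ob (powF (tanT T) m) (ob (tanTn T n) A)) (\<lambda>j. ar (powF (tanT T) m) (tq T n j A))"
proof -
  let ?f = "ar (powF (tanT T) m) (tp T A)" and ?P = "ob (powF (tanT T) m) (ob (tanTn T n) A)"
    and ?q = "\<lambda>j. ar (powF (tanT T) m) (tq T n j A)" and ?R = "ob (powF (tanT T) m) (ob (tanT T) A)"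
  have f: "?f \<in> Arr C" "Dom C ?f = ?R" "Cod C ?f = ob (powF (tanT T) m) A"
    "ar U ?f = ar (powF (tanT B) m) (tp B (ob U A))"
    using powF_simps(2)[of "tp T A" m] A by simp_all
  have P: "?P \<in> Obj C" "ob U ?P = ob (powF (tanT B) m) (ob (tanTn B n) (ob U A))"
    and R: "?R \<in> Obj C" "ob U ?R = ob (powF (tanT B) m) (ob (tanT B) (ob U A))"
    using powF_simps(1)[of _ m] A n by simp_all
  have q: "?q j \<in> Arr C" "Dom C (?q j) = ?P" "Cod C (?q j) = ?R"
    "ar U (?q j) = ar (powF (tanT B) m) (tq B n j (ob U A))" if "j \<in> {1..n}" for j
    using powF_simps(2)[of "tq T n j A" m] that A by simp_all
  have "ob U A \<in> Obj D" using A by simp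
  note pb = D.pullbacks[OF n this, of m]
  show ?thesis
  proof (rule nfold_pullbackI)
    show "?f \<in> Arr C" "?P \<in> Obj C" by fact+
    show "?q j \<in> Hom C ?P (Dom C ?f)" if "j \<in> {1..n}" for j
      using q[OF that] f by (simp add: Hom_iff)
    show "?f \<cdot> ?q j = ?f \<cdot> ?q k" if jk: "j \<in> {1..n}" "k \<in> {1..n}" for j k
      by (rule faithful)
        (use f q[OF jk(1)] q[OF jk(2)] nfold_pullback_simps(4)[OF pb jk] in simp_all)
    fix Z g
    assume Z: "Z \<in> Obj C" and g: "\<And>j. j \<in> {1..n} \<Longrightarrow> g j \<in> Hom C Z (Dom C ?f)"
      and eq: "\<And>j k. j \<in> {1..n} \<Longrightarrow> k \<in> {1..n} \<Longrightarrow> ?f \<cdot> g j = ?f \<cdot> g k"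
    have g': "g j \<in> Arr C" "Dom C (g j) = Z" "Cod C (g j) = ?R" if "j \<in> {1..n}" for j
      using g[OF that] f by (simp_all add: Hom_iff)
    have "\<exists>!h. h \<in> Hom D (ob U Z) (ob (powF (tanT B) m) (ob (tanTn B n) (ob U A))) \<and>
      (\<forall>j\<in>{1..n}. ar (powF (tanT B) m) (tq B n j (ob U A)) \<cdot>\<^bsub>D\<^esub> h = ar U (g j))"
    proof (rule nfold_pullback_ex1[OF pb])
      show "ob U Z \<in> Obj D" using Z by simp
      show "ar U (g j) \<in> Hom D (ob U Z) (Dom D (ar (powF (tanT B) m) (tp B (ob U A))))" if "j \<in> {1..n}" for j
        using g'[OF that] f R by (simp add: Hom_iff flip: f(4))
      show "ar (powF (tanT B) m) (tp B (ob U A)) \<cdot>\<^bsub>D\<^esub> ar U (g j) =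
          ar (powF (tanT B) m) (tp B (ob U A)) \<cdot>\<^bsub>D\<^esub> ar U (g k)" if "j \<in> {1..n}" "k \<in> {1..n}" for j k
        using arg_cong[OF eq[OF that], of "ar U"] g'[OF that(1)] g'[OF that(2)] f by simp
    qed
    then obtain h where h0: "h \<in> Hom D (ob U Z) (ob (powF (tanT B) m) (ob (tanTn B n) (ob U A))) \<and>
      (\<forall>j\<in>{1..n}. ar (powF (tanT B) m) (tq B n j (ob U A)) \<cdot>\<^bsub>D\<^esub> h = ar U (g j))"
      by (elim ex1E) (rule that)
    have h: "h \<in> Hom D (ob U Z) (ob U ?P)"
      and hq: "\<And>j. j \<in> {1..n} \<Longrightarrow> ar U (?q j) \<cdot>\<^bsub>D\<^esub> h = ar U (g j)"
      using h0 by (simp_all only: P(2) q(4))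
    have mono: "x = y" if x: "x \<in> Hom D W (ob U ?P)" and y: "y \<in> Hom D W (ob U ?P)"
      and xy: "\<And>j. j \<in> {1..n} \<Longrightarrow> ar U (?q j) \<cdot>\<^bsub>D\<^esub> x = ar U (?q j) \<cdot>\<^bsub>D\<^esub> y" for W x y
      by (rule D.nfold_pullback_ext[OF pb n]) (use x y xy q(4) P(2) in \<open>auto simp: Hom_iff\<close>)
    have "\<exists>k \<in> Hom C Z ?P. ar U k = h"
      using lift[where J = "{1..n}" and P = ?P and Z = Z and q = ?q and g = g and Q = ?R and h = h]
        P(1) Z q g' h hq mono by (simp add: Hom_iff)
    then obtain k where k: "k \<in> Arr C" "Dom C k = Z" "Cod C k = ?P" "ar U k = h"
      by (auto simp: Hom_iff)
    show "\<exists>!h. h \<in> Hom C Z ?P \<and> (\<forall>j\<in>{1..n}. ?q j \<cdot> h = g j)"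
    proof (rule ex1I[of _ k], intro conjI ballI)
      show "k \<in> Hom C Z ?P" using k by (simp add: Hom_iff)
      show "?q j \<cdot> k = g j" if j: "j \<in> {1..n}" for j
        by (rule faithful) (use k q[OF j] g'[OF j] hq[OF j] in simp_all)
      fix k' assume k': "k' \<in> Hom C Z ?P \<and> (\<forall>j\<in>{1..n}. ?q j \<cdot> k' = g j)"
      then have k1: "k' \<in> Arr C" "Dom C k' = Z" "Cod C k' = ?P"
        and k2: "\<And>j. j \<in> {1..n} \<Longrightarrow> ?q j \<cdot> k' = g j" by (simp_all add: Hom_iff)
      have "ar U k' = ar U k"
      proof (rule mono[of _ "ob U Z"])
        show "ar U k' \<in> Hom D (ob U Z) (ob U ?P)" "ar U k \<in> Hom D (ob U Z) (ob U ?P)"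
          using k k1 h by (simp_all add: Hom_iff)
        show "ar U (?q j) \<cdot>\<^bsub>D\<^esub> ar U k' = ar U (?q j) \<cdot>\<^bsub>D\<^esub> ar U k" if j: "j \<in> {1..n}" for j
          using arg_cong[OF k2[OF j], of "ar U"] hq[OF j] k(4) k1 q(1-3)[OF j] by simp
      qed
      then show "k' = k"
        by - (rule faithful, use k k1 in simp_all)
    qed
  qed
qed

text \<open>Compatibility of u and v is asked for below, where the axioms are available; U then
  carries the pairing to the pairing.\<close>

lemma pair_simps:
  assumes A: "A \<in> Obj C" and u: "u \<in> Arr C" "Cod C u = ob (tanT T) A"
    and v: "v \<in> Arr C" "Dom C v = Dom C u" "Cod C v = ob (tanT T) A"
    and eq: "tp B (ob U A) \<cdot>\<^bsub>D\<^esub> ar U u = tp B (ob U A) \<cdot>\<^bsub>D\<^esub> ar U v"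
  shows "pairT2 C T A u v \<in> Arr C" "Dom C (pairT2 C T A u v) = Dom C u"
    "Cod C (pairT2 C T A u v) = ob (tanTn T 2) A"
    "ar U (pairT2 C T A u v) = pairT2 D B (ob U A) (ar U u) (ar U v)"
proof -
  have "tp T A \<cdot> u = tp T A \<cdot> v"
    by (rule faithful) (use A u v eq in simp_all)
  then have P: "pairT2 C T A u v \<in> Arr C" "Dom C (pairT2 C T A u v) = Dom C u"
    "Cod C (pairT2 C T A u v) = ob (tanTn T 2) A"
    "tq T 2 1 A \<cdot> pairT2 C T A u v = u" "tq T 2 2 A \<cdot> pairT2 C T A u v = v"
    using pb_pair[OF T_pullbacks[of 2 A 0, simplified], of u v] A u v by (simp_all add: pairT2_def)
  from arg_cong[OF P(4), of "ar U"] arg_cong[OF P(5), of "ar U"]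
  have "pairT2 D B (ob U A) (ar U u) (ar U v) = ar U (pairT2 C T A u v)"
    using A P(1-3) by (intro D.pairT2_eq) simp_all
  then show "pairT2 C T A u v \<in> Arr C" "Dom C (pairT2 C T A u v) = Dom C u"
    "Cod C (pairT2 C T A u v) = ob (tanTn T 2) A"
    "ar U (pairT2 C T A u v) = pairT2 D B (ob U A) (ar U u) (ar U v)"
    using P by simp_all
qed

lemma pairTT_simps:
  assumes A: "A \<in> Obj C" and u: "u \<in> Arr C" "Cod C u = ob (tanT T) (ob (tanT T) A)"
    and v: "v \<in> Arr C" "Dom C v = Dom C u" "Cod C v = ob (tanT T) (ob (tanT T) A)"
    and eq: "ar (tanT B) (tp B (ob U A)) \<cdot>\<^bsub>D\<^esub> ar U u = ar (tanT B) (tp B (ob U A)) \<cdot>\<^bsub>D\<^esub> ar U v"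
  shows "pairTT2 C T A u v \<in> Arr C" "Dom C (pairTT2 C T A u v) = Dom C u"
    "Cod C (pairTT2 C T A u v) = ob (tanT T) (ob (tanTn T 2) A)"
    "ar U (pairTT2 C T A u v) = pairTT2 D B (ob U A) (ar U u) (ar U v)"
proof -
  have "ar (tanT T) (tp T A) \<cdot> u = ar (tanT T) (tp T A) \<cdot> v"
    by (rule faithful) (use A u v eq in simp_all)
  then have P: "pairTT2 C T A u v \<in> Arr C" "Dom C (pairTT2 C T A u v) = Dom C u"
    "Cod C (pairTT2 C T A u v) = ob (tanT T) (ob (tanTn T 2) A)"
    "ar (tanT T) (tq T 2 1 A) \<cdot> pairTT2 C T A u v = u" "ar (tanT T) (tq T 2 2 A) \<cdot> pairTT2 C T A u v = v"
    using pb_pair[OF T_pullbacks[of 2 A 1, simplified], of u v] A u v by (simp_all add: pairTT2_def)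
  from arg_cong[OF P(4), of "ar U"] arg_cong[OF P(5), of "ar U"]
  have "pairTT2 D B (ob U A) (ar U u) (ar U v) = ar U (pairTT2 C T A u v)"
    using A P(1-3) by (intro D.pairTT2_eq) simp_all
  then show "pairTT2 C T A u v \<in> Arr C" "Dom C (pairTT2 C T A u v) = Dom C u"
    "Cod C (pairTT2 C T A u v) = ob (tanT T) (ob (tanTn T 2) A)"
    "ar U (pairTT2 C T A u v) = pairTT2 D B (ob U A) (ar U u) (ar U v)"
    using P by simp_all
qed

lemma univ_lift_lift:
  assumes A: "A \<in> Obj C"
  shows "univ_lift C T A \<in> Arr C" "Dom C (univ_lift C T A) = ob (tanTn T 2) A"
    "Cod C (univ_lift C T A) = ob (tanT T) (ob (tanT T) A)"
    "ar U (univ_lift C T A) = univ_lift D B (ob U A)"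
proof -
  let ?u = "tl T A \<cdot> tq T 2 1 A" and ?v = "tz T (ob (tanT T) A) \<cdot> tq T 2 2 A"
  have o: "ob U A \<in> Obj D" using A by simp
  have eq: "ar (tanT B) (tp B (ob U A)) \<cdot>\<^bsub>D\<^esub> ar U ?u = ar (tanT B) (tp B (ob U A)) \<cdot>\<^bsub>D\<^esub> ar U ?v"
    using A D.p_q[OF o, of 2 2]
    by (simp add: D.comp_extend[OF D.l_p] D.comp_extend[OF D.Tp_zT] D.assoc)
  note P = pairTT_simps[OF A _ _ _ _ _ eq]
  show "univ_lift C T A \<in> Arr C" "Dom C (univ_lift C T A) = ob (tanTn T 2) A"
    "Cod C (univ_lift C T A) = ob (tanT T) (ob (tanT T) A)"
    "ar U (univ_lift C T A) = univ_lift D B (ob U A)"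
    using A by (simp_all add: univ_lift_def P)
qed

lemma T_universality:
  assumes A: "A \<in> Obj C"
  shows "is_equalizer C (ar (tanT T) (tp T A)) (tz T A \<cdot> tp T A \<cdot> tp T (ob (tanT T) A)) (univ_lift C T A)"
proof -
  have o: "ob U A \<in> Obj D" using A by simp
  note e = univ_lift_lift[OF A]
  let ?f = "ar (tanT T) (tp T A)" and ?g = "tz T A \<cdot> tp T A \<cdot> tp T (ob (tanT T) A)" and ?e = "univ_lift C T A"
  have f: "?f \<in> Arr C" "Dom C ?f = ob (tanT T) (ob (tanT T) A)" "Cod C ?f = ob (tanT T) A"
    and g: "?g \<in> Arr C" "Dom C ?g = ob (tanT T) (ob (tanT T) A)" "Cod C ?g = ob (tanT T) A"
    using A by simp_all
  have Uf: "ar U ?f = ar (tanT B) (tp B (ob U A))"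
    and Ug: "ar U ?g = tz B (ob U A) \<cdot>\<^bsub>D\<^esub> tp B (ob U A) \<cdot>\<^bsub>D\<^esub> tp B (ob (tanT B) (ob U A))"
    using A by simp_all
  have un: "is_equalizer D (ar U ?f) (ar U ?g) (ar U ?e)"
    using D.universality[OF o] by (simp only: Uf Ug e)
  have fe: "?f \<cdot> ?e = ?g \<cdot> ?e"
  proof (rule faithful)
    have "ar U ?f \<cdot>\<^bsub>D\<^esub> ar U ?e = ar U ?g \<cdot>\<^bsub>D\<^esub> ar U ?e"
      using un unfolding is_equalizer_def by blast
    then show "ar U (?f \<cdot> ?e) = ar U (?g \<cdot> ?e)"
      using f g e(1-3) by (simp only: U_simps(6))
  qed (use f g e(1-3) in simp_all)
  have exD: "\<exists>!k. k \<in> Hom D Z (Dom D (ar U ?e)) \<and> ar U ?e \<cdot>\<^bsub>D\<^esub> k = h"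
    if "Z \<in> Obj D" "h \<in> Hom D Z (ob U (Dom C ?f))" "ar U ?f \<cdot>\<^bsub>D\<^esub> h = ar U ?g \<cdot>\<^bsub>D\<^esub> h" for Z h
    using un that f(1) unfolding is_equalizer_iff[OF D.category_axioms] by (simp only: U_simps(4))
  have Ude: "Dom D (ar U ?e) = ob U (Dom C ?e)" using e(1) by simp
  \<comment> \<open>The equalizer below is a monomorphism; with it, \<open>lift\<close> for a
    one-member index set produces the mediating arrow upstairs.\<close>
  have mono: "x = y" if x: "x \<in> Hom D W (ob U (Dom C ?e))" and y: "y \<in> Hom D W (ob U (Dom C ?e))"
    and xy: "ar U ?e \<cdot>\<^bsub>D\<^esub> x = ar U ?e \<cdot>\<^bsub>D\<^esub> y" for W x y
  proof -
    have x': "x \<in> Arr D" "Dom D x = W" "Cod D x = ob U (Dom C ?e)" using x by (simp_all add: Hom_iff)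
    have W: "W \<in> Obj D" using D.hom_obj(1)[OF x] .
    have w1: "ar U ?e \<cdot>\<^bsub>D\<^esub> x \<in> Hom D W (ob U (Dom C ?f))"
      using x' e(1-3) f by (simp add: Hom_iff del: U_T)
    have "ar U ?f \<cdot>\<^bsub>D\<^esub> ar U ?e = ar U ?g \<cdot>\<^bsub>D\<^esub> ar U ?e"
      using un unfolding is_equalizer_def by blast
    then have w2: "ar U ?f \<cdot>\<^bsub>D\<^esub> (ar U ?e \<cdot>\<^bsub>D\<^esub> x) = ar U ?g \<cdot>\<^bsub>D\<^esub> (ar U ?e \<cdot>\<^bsub>D\<^esub> x)"
      using x' e(1-3) f g by (simp del: U_T U_simps(6) e(4) add: D.assoc_left)
    have "\<And>P a b. \<exists>!x. P x \<Longrightarrow> P a \<Longrightarrow> P b \<Longrightarrow> a = b" by blast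
    from this[OF exD[OF W w1 w2]] show ?thesis
      using x y xy by (simp only: Ude) 
  qed
  show ?thesis
    unfolding is_equalizer_iff[OF category_axioms]
  proof (intro conjI ballI impI)
    fix Z h assume Z: "Z \<in> Obj C" and h: "h \<in> Hom C Z (Dom C ?f)" and fh: "?f \<cdot> h = ?g \<cdot> h"
    have h': "h \<in> Arr C" "Dom C h = Z" "Cod C h = Dom C ?f" using h by (simp_all add: Hom_iff)
    have "ar U ?f \<cdot>\<^bsub>D\<^esub> ar U h = ar U ?g \<cdot>\<^bsub>D\<^esub> ar U h"
      using arg_cong[OF fh, of "ar U"] f g h' by (simp only: U_simps(6))
    then obtain k where k: "k \<in> Hom D (ob U Z) (ob U (Dom C ?e))" "ar U ?e \<cdot>\<^bsub>D\<^esub> k = ar U h"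
      using exD[of "ob U Z" "ar U h"] Z h' unfolding Ude by (auto simp: Hom_iff simp del: U_T)
    have "\<exists>k' \<in> Hom C Z (Dom C ?e). ar U k' = k"
      by (rule lift[where J = "{0}" and q = "\<lambda>_. ?e" and g = "\<lambda>_. h" and Q = "Dom C ?f"])
        (use A Z e(1-3) f h k in \<open>auto simp: Hom_iff intro: mono\<close>)
    then obtain k' where k': "k' \<in> Arr C" "Dom C k' = Z" "Cod C k' = Dom C ?e" "ar U k' = k"
      by (auto simp: Hom_iff)
    show "\<exists>!k. k \<in> Hom C Z (Dom C ?e) \<and> ?e \<cdot> k = h"
    proof (rule ex1I[of _ k'])
      have "?e \<cdot> k' = h"
        by (rule faithful) (use k' e(1-3) h' k(2) f in simp_all)
      then show "k' \<in> Hom C Z (Dom C ?e) \<and> ?e \<cdot> k' = h"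
        using k' by (simp add: Hom_iff)
      fix y assume y: "y \<in> Hom C Z (Dom C ?e) \<and> ?e \<cdot> y = h"
      then have y': "y \<in> Arr C" "Dom C y = Z" "Cod C y = Dom C ?e" by (simp_all add: Hom_iff)
      have "ar U ?e \<cdot>\<^bsub>D\<^esub> ar U y = ar U h"
        using y y' e(1-3) by (simp only: U_simps(6)[symmetric])
      then have "ar U y = ar U k'"
        by - (rule mono[of _ "ob U Z"], use y' k' k in \<open>simp_all add: Hom_iff del: U_T\<close>)
      then show "y = k'"
        by - (rule faithful, use y' k' in simp_all)
    qed
  qed (use f g e(1-3) fe in \<open>simp_all add: Hom_iff\<close>)
qed

lemma T_s_assoc:
  assumes A: "A \<in> Obj C"
  shows "ts T A \<cdot> pairT2 C T A (ts T A \<cdot> pairT2 C T A (tq T 3 1 A) (tq T 3 2 A)) (tq T 3 3 A) =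
      ts T A \<cdot> pairT2 C T A (tq T 3 1 A) (ts T A \<cdot> pairT2 C T A (tq T 3 2 A) (tq T 3 3 A))"
proof -
  let ?a = "ob U A"
  have o: "?a \<in> Obj D" using A by simp
  have pq: "tp B ?a \<cdot>\<^bsub>D\<^esub> tq B 3 i ?a = tp B ?a \<cdot>\<^bsub>D\<^esub> tq B 3 j ?a"
    if "1 \<le> i" "i \<le> 3" "1 \<le> j" "j \<le> 3" for i j
    using D.p_q[OF o, of i 3] D.p_q[OF o, of j 3] that by simp
  define R where "R i j = pairT2 C T A (tq T 3 i A) (tq T 3 j A)" for i j
  have R: "R i j \<in> Arr C" "Dom C (R i j) = ob (tanTn T 3) A" "Cod C (R i j) = ob (tanTn T 2) A"
    "ar U (R i j) = pairT2 D B ?a (tq B 3 i ?a) (tq B 3 j ?a)"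
    if ij: "1 \<le> i" "i \<le> 3" "1 \<le> j" "j \<le> 3" for i j
    using pair_simps[OF A, of "tq T 3 i A" "tq T 3 j A"] A ij pq[OF ij] by (simp_all add: R_def)
  have ps: "tp B ?a \<cdot>\<^bsub>D\<^esub> (ts B ?a \<cdot>\<^bsub>D\<^esub> pairT2 D B ?a (tq B 3 i ?a) (tq B 3 j ?a)) = tp B ?a \<cdot>\<^bsub>D\<^esub> tq B 3 i ?a"
    if ij: "1 \<le> i" "i \<le> 3" "1 \<le> j" "j \<le> 3" for i j
    using D.pairT2_simps[OF o _ _ _ _ _ pq[OF ij]] o ij by (simp add: D.comp_extend[OF D.p_s] D.assoc)
  have e1: "tp B ?a \<cdot>\<^bsub>D\<^esub> ar U (ts T A \<cdot> R 1 2) = tp B ?a \<cdot>\<^bsub>D\<^esub> ar U (tq T 3 3 A)"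
    using A ps[of 1 2] pq[of 1 3] by (simp add: R)
  have e2: "tp B ?a \<cdot>\<^bsub>D\<^esub> ar U (tq T 3 1 A) = tp B ?a \<cdot>\<^bsub>D\<^esub> ar U (ts T A \<cdot> R 2 3)"
    using A ps[of 2 3] pq[of 1 2] by (simp add: R)
  note P1 = pair_simps[OF A _ _ _ _ _ e1] and P2 = pair_simps[OF A _ _ _ _ _ e2]
  have "ts T A \<cdot> pairT2 C T A (ts T A \<cdot> R 1 2) (tq T 3 3 A) = ts T A \<cdot> pairT2 C T A (tq T 3 1 A) (ts T A \<cdot> R 2 3)"
    by (rule faithful) (use A o D.s_assoc[OF o] in \<open>simp_all add: P1 P2 R\<close>)
  then show ?thesis by (simp add: R_def)
qed

text \<open>Faithfulness reduces each equation to its image, an axiom of \<open>B\<close>. The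
  recurring work is to check below that the two members of a pairing are compatible.\<close>

theorem tangent_category_lift: "tangent_category C T"
proof (rule tangent_category.intro[OF category_axioms], unfold_locales)
  show "nat_trans C C (tanTn T n) (tanT T) (tq T n j)" if "j \<in> {1..n}" for j n
    using T_natural(1)[of j n] that by simp
  fix A assume A: "A \<in> Obj C"
  let ?a = "ob U A"
  have o: "?a \<in> Obj D" using A by simp
  have pq: "tp B ?a \<cdot>\<^bsub>D\<^esub> tq B 2 1 ?a = tp B ?a \<cdot>\<^bsub>D\<^esub> tq B 2 2 ?a"
    using D.p_q[OF o, of 2 2] by simp
  note pq' = D.comp_extend[OF pq[symmetric]]
  show "tq T 1 1 A = Ide C (ob (tanT T) A)"
    by (rule faithful) (use A o in \<open>simp_all add: D.q_one\<close>)
  show "tp T A \<cdot> ts T A = tp T A \<cdot> tq T 2 1 A"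
    by (rule faithful) (use A o in \<open>simp_all add: D.p_s\<close>)
  show "tp T A \<cdot> tz T A = Ide C A"
    by (rule faithful) (use A o in \<open>simp_all add: D.p_z\<close>)
  have "tp B ?a \<cdot>\<^bsub>D\<^esub> ar U (tz T A \<cdot> tp T A) = tp B ?a \<cdot>\<^bsub>D\<^esub> ar U (Ide C (ob (tanT T) A))"
    using A o by (simp add: D.comp_extend[OF D.p_z])
  note P = pair_simps[OF A _ _ _ _ _ this]
  show "ts T A \<cdot> pairT2 C T A (tz T A \<cdot> tp T A) (Ide C (ob (tanT T) A)) = Ide C (ob (tanT T) A)"
    by (rule faithful) (use A o D.s_unit[OF o] in \<open>simp_all add: P\<close>)
  have "tp B ?a \<cdot>\<^bsub>D\<^esub> ar U (tq T 2 2 A) = tp B ?a \<cdot>\<^bsub>D\<^esub> ar U (tq T 2 1 A)"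
    using A pq by simp
  note P = pair_simps[OF A _ _ _ _ _ this]
  show "ts T A \<cdot> pairT2 C T A (tq T 2 2 A) (tq T 2 1 A) = ts T A"
    by (rule faithful) (use A o D.s_comm[OF o] in \<open>simp_all add: P\<close>)
  show "ts T A \<cdot> pairT2 C T A (ts T A \<cdot> pairT2 C T A (tq T 3 1 A) (tq T 3 2 A)) (tq T 3 3 A) =
      ts T A \<cdot> pairT2 C T A (tq T 3 1 A) (ts T A \<cdot> pairT2 C T A (tq T 3 2 A) (tq T 3 3 A))"
    using T_s_assoc[OF A] .
  show "ar (tanT T) (tp T A) \<cdot> tl T A = tz T A \<cdot> tp T A"
    by (rule faithful) (use A o in \<open>simp_all add: D.l_p\<close>)
  have "ar (tanT B) (tp B ?a) \<cdot>\<^bsub>D\<^esub> ar U (tl T A \<cdot> tq T 2 1 A) =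
      ar (tanT B) (tp B ?a) \<cdot>\<^bsub>D\<^esub> ar U (tl T A \<cdot> tq T 2 2 A)"
    using A o pq by (simp add: D.comp_extend[OF D.l_p] D.assoc)
  note P = pairTT_simps[OF A _ _ _ _ _ this]
  show "tl T A \<cdot> ts T A = ar (tanT T) (ts T A) \<cdot> pairTT2 C T A (tl T A \<cdot> tq T 2 1 A) (tl T A \<cdot> tq T 2 2 A)"
    by (rule faithful) (use A o D.l_s[OF o] in \<open>simp_all add: P\<close>)
  show "tl T A \<cdot> tz T A = ar (tanT T) (tz T A) \<cdot> tz T A"
    by (rule faithful) (use A o in \<open>simp_all add: D.l_z\<close>)
  show "tp T (ob (tanT T) A) \<cdot> tc T A = ar (tanT T) (tp T A)"
    by (rule faithful) (use A o in \<open>simp_all add: D.c_p\<close>)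
  have "tp B (ob U (ob (tanT T) A)) \<cdot>\<^bsub>D\<^esub> ar U (tc T A \<cdot> ar (tanT T) (tq T 2 1 A)) =
    tp B (ob U (ob (tanT T) A)) \<cdot>\<^bsub>D\<^esub> ar U (tc T A \<cdot> ar (tanT T) (tq T 2 2 A))"
    using A o pq by (simp add: D.comp_extend[OF D.c_p] D.T_comp[symmetric])
  note P = pair_simps[OF _ _ _ _ _ _ this]
  show "tc T A \<cdot> ar (tanT T) (ts T A) = ts T (ob (tanT T) A) \<cdot>
    pairT2 C T (ob (tanT T) A) (tc T A \<cdot> ar (tanT T) (tq T 2 1 A)) (tc T A \<cdot> ar (tanT T) (tq T 2 2 A))"
    by (rule faithful) (use A o D.c_s[OF o] in \<open>simp_all add: P\<close>)
  show "tc T A \<cdot> ar (tanT T) (tz T A) = tz T (ob (tanT T) A)"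
    by (rule faithful) (use A o in \<open>simp_all add: D.c_z\<close>)
  show "tc T A \<cdot> tc T A = Ide C (ob (tanT T) (ob (tanT T) A))"
    by (rule faithful) (use A o in \<open>simp_all add: D.c_c\<close>)
  show "tc T A \<cdot> tl T A = tl T A"
    by (rule faithful) (use A o in \<open>simp_all add: D.c_l\<close>)
  show "ar (tanT T) (tl T A) \<cdot> tl T A = tl T (ob (tanT T) A) \<cdot> tl T A"
    by (rule faithful) (use A o in \<open>simp_all add: D.l_l\<close>)
  show "ar (tanT T) (tc T A) \<cdot> tc T (ob (tanT T) A) \<cdot> ar (tanT T) (tc T A) =
      tc T (ob (tanT T) A) \<cdot> ar (tanT T) (tc T A) \<cdot> tc T (ob (tanT T) A)"
    by (rule faithful) (use A o in \<open>simp_all add: D.c_braid\<close>)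
  show "tc T (ob (tanT T) A) \<cdot> ar (tanT T) (tc T A) \<cdot> tl T (ob (tanT T) A) = ar (tanT T) (tl T A) \<cdot> tc T A"
    by (rule faithful) (use A o in \<open>simp_all add: D.c_l_T\<close>)
qed (rule T_functor' T_natural T_pullbacks T_universality; assumption)+

lemma rosicky_tangent_category_lift:
  assumes "rosicky_tangent_category D B N"
    and n: "\<And>A. A \<in> Obj C \<Longrightarrow> n A \<in> Hom C (ob (tanT T) A) (ob (tanT T) A)"
      "\<And>A. A \<in> Obj C \<Longrightarrow> ar U (n A) = N (ob U A)"
  shows "rosicky_tangent_category C T n"
proof (rule rosicky_tangent_category.intro[OF tangent_category_lift], unfold_locales)
  interpret N: rosicky_tangent_category D B N by fact
  show "nat_trans C C (tanT T) (tanT T) n"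
    by (rule nat_trans_lift[OF N.n_natural]) (use n T_functor' in simp_all)
  fix A assume A: "A \<in> Obj C"
  let ?a = "ob U A"
  have o: "?a \<in> Obj D" using A by simp
  have n': "n A \<in> Arr C" "Dom C (n A) = ob (tanT T) A" "Cod C (n A) = ob (tanT T) A"
    using n(1)[OF A] by (simp_all add: Hom_iff)
  show "tp T A \<cdot> n A = tp T A"
    by (rule faithful) (use A o n' in \<open>simp_all add: n(2) N.p_n\<close>)
  have "tp B ?a \<cdot>\<^bsub>D\<^esub> ar U (Ide C (ob (tanT T) A)) = tp B ?a \<cdot>\<^bsub>D\<^esub> ar U (n A)"
    using A o by (simp add: n(2) N.p_n)
  note P = pair_simps[OF A _ _ _ _ _ this]
  show "ts T A \<cdot> pairT2 C T A (Ide C (ob (tanT T) A)) (n A) = tz T A \<cdot> tp T A"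
    by (rule faithful) (use A o n' N.s_n[OF o] in \<open>simp_all add: P n(2)\<close>)
qed

end

text \<open>Structures that agree only at objects cannot be rewritten into each other as records;
  the identity functor transports the axioms instead.\<close>

lemma tangent_category_cong:
  assumes B: "tangent_category C B" and T: "tanTn T = tanTn B"
    "\<And>A. A \<in> Obj C \<Longrightarrow> tp T A = tp B A" "\<And>A. A \<in> Obj C \<Longrightarrow> ts T A = ts B A"
    "\<And>A. A \<in> Obj C \<Longrightarrow> tz T A = tz B A" "\<And>A. A \<in> Obj C \<Longrightarrow> tl T A = tl B A"
    "\<And>A. A \<in> Obj C \<Longrightarrow> tc T A = tc B A"
    "\<And>A n j. A \<in> Obj C \<Longrightarrow> 1 \<le> j \<Longrightarrow> j \<le> n \<Longrightarrow> tq T n j A = tq B n j A"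
  shows "strict_tangent_functor C T C B idF"
proof -
  interpret tangent_category C B by fact
  show ?thesis
    by (rule strict_tangent_functor.intro[OF category_axioms B], unfold_locales)
      (simp_all add: T Hom_iff is_functor_idF[OF category_axioms])
qed

section \<open>Left adjoints of strict tangent functors\<close>

text \<open>\<open>R'\<close> is compared with \<open>R\<close> on objects and arrows of the
  category only, which is how two composite functor records agree. The comparison is the arrow that
  carries one unit to the other, and later computations rest on this property.\<close>

lemma left_adjoint_unique:
  assumes a1: "adjunction D C L\<^sub>1 R \<eta>\<^sub>1 \<epsilon>\<^sub>1" and a2: "adjunction D C L\<^sub>2 R' \<eta>\<^sub>2 \<epsilon>\<^sub>2"
    and R: "\<And>A. A \<in> Obj C \<Longrightarrow> ob R' A = ob R A" "\<And>f. f \<in> Arr C \<Longrightarrow> ar R' f = ar R f"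
  obtains \<tau> where "nat_iso D C L\<^sub>1 L\<^sub>2 \<tau>"
    and "\<And>A. A \<in> Obj D \<Longrightarrow> ar R (\<tau> A) \<cdot>\<^bsub>D\<^esub> \<eta>\<^sub>1 A = \<eta>\<^sub>2 A"
proof -
  have F: "is_functor D C L\<^sub>1" "is_functor C D R" "is_functor D C L\<^sub>2"
    and n: "nat_trans D D idF (R \<circ>\<^sub>F L\<^sub>1) \<eta>\<^sub>1" "nat_trans D D idF (R' \<circ>\<^sub>F L\<^sub>2) \<eta>\<^sub>2"
    using a1 a2 unfolding adjunction_def by auto
  interpret C: category C using F(1) by (simp add: is_functor_def)
  interpret D: category D using F(1) by (simp add: is_functor_def)
  note s = F[THEN functor_simps(1)] F[THEN functor_simps(2)] F[THEN functor_simps(3)]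
    F[THEN functor_simps(4)] F[THEN functor_simps(5)] F[THEN functor_simps(6)]
  have e: "\<eta>\<^sub>1 A \<in> Arr D" "Dom D (\<eta>\<^sub>1 A) = A" "Cod D (\<eta>\<^sub>1 A) = ob R (ob L\<^sub>1 A)"
    "\<eta>\<^sub>2 A \<in> Arr D" "Dom D (\<eta>\<^sub>2 A) = A" "Cod D (\<eta>\<^sub>2 A) = ob R (ob L\<^sub>2 A)" if "A \<in> Obj D" for A
    using n[THEN nat_trans_simps(1)] n[THEN nat_trans_simps(2)] n[THEN nat_trans_simps(3)] that
    by (simp_all add: s R)
  have nat: "\<eta>\<^sub>1 (Cod D f) \<cdot>\<^bsub>D\<^esub> f = ar R (ar L\<^sub>1 f) \<cdot>\<^bsub>D\<^esub> \<eta>\<^sub>1 (Dom D f)"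
    "\<eta>\<^sub>2 (Cod D f) \<cdot>\<^bsub>D\<^esub> f = ar R (ar L\<^sub>2 f) \<cdot>\<^bsub>D\<^esub> \<eta>\<^sub>2 (Dom D f)" if "f \<in> Arr D" for f
    using n[THEN nat_trans_natural] that by (simp_all add: s R)
  have "\<exists>t. t \<in> Hom C (ob L\<^sub>1 A) (ob L\<^sub>2 A) \<and> ar R t \<cdot>\<^bsub>D\<^esub> \<eta>\<^sub>1 A = \<eta>\<^sub>2 A" if "A \<in> Obj D" for A
    using adjunction_ex1[OF a1, of "ob L\<^sub>2 A" "\<eta>\<^sub>2 A" A] that by (auto simp: Hom_iff s e)
  then obtain \<tau> where \<tau>: "\<And>A. A \<in> Obj D \<Longrightarrow> \<tau> A \<in> Hom C (ob L\<^sub>1 A) (ob L\<^sub>2 A) \<and> ar R (\<tau> A) \<cdot>\<^bsub>D\<^esub> \<eta>\<^sub>1 A = \<eta>\<^sub>2 A"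
    by metis
  then have t: "\<tau> A \<in> Arr C" "Dom C (\<tau> A) = ob L\<^sub>1 A" "Cod C (\<tau> A) = ob L\<^sub>2 A"
    "ar R (\<tau> A) \<cdot>\<^bsub>D\<^esub> \<eta>\<^sub>1 A = \<eta>\<^sub>2 A" if "A \<in> Obj D" for A
    using that by (simp_all add: Hom_iff)
  have "\<tau> (Cod D f) \<cdot>\<^bsub>C\<^esub> ar L\<^sub>1 f = ar L\<^sub>2 f \<cdot>\<^bsub>C\<^esub> \<tau> (Dom D f)" if f: "f \<in> Arr D" for f
  proof (rule adjunction_inj[OF a1])
    have "ar R (\<tau> (Cod D f) \<cdot>\<^bsub>C\<^esub> ar L\<^sub>1 f) \<cdot>\<^bsub>D\<^esub> \<eta>\<^sub>1 (Dom D f) =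
        ar R (\<tau> (Cod D f)) \<cdot>\<^bsub>D\<^esub> (\<eta>\<^sub>1 (Cod D f) \<cdot>\<^bsub>D\<^esub> f)"
      using f by (simp add: s t e D.assoc nat)
    also have "\<dots> = \<eta>\<^sub>2 (Cod D f) \<cdot>\<^bsub>D\<^esub> f"
      using f by (simp add: s t e D.assoc_left)
    also have "\<dots> = ar R (ar L\<^sub>2 f \<cdot>\<^bsub>C\<^esub> \<tau> (Dom D f)) \<cdot>\<^bsub>D\<^esub> \<eta>\<^sub>1 (Dom D f)"
      using f by (simp add: s t e D.assoc nat)
    finally show "ar R (\<tau> (Cod D f) \<cdot>\<^bsub>C\<^esub> ar L\<^sub>1 f) \<cdot>\<^bsub>D\<^esub> \<eta>\<^sub>1 (Dom D f) =
      ar R (ar L\<^sub>2 f \<cdot>\<^bsub>C\<^esub> \<tau> (Dom D f)) \<cdot>\<^bsub>D\<^esub> \<eta>\<^sub>1 (Dom D f)" .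
  qed (use f in \<open>simp_all add: Hom_iff s t\<close>)
  then have nt: "nat_trans D C L\<^sub>1 L\<^sub>2 \<tau>"
    using F by (simp add: nat_trans_iff t)
  have "is_iso C (\<tau> A)" if A: "A \<in> Obj D" for A
  proof -
    have "\<exists>!h. h \<in> Hom C (ob L\<^sub>2 A) (ob L\<^sub>1 A) \<and> ar R' h \<cdot>\<^bsub>D\<^esub> \<eta>\<^sub>2 A = \<eta>\<^sub>1 A"
      by (rule adjunction_ex1[OF a2]) (use A in \<open>simp_all add: Hom_iff s e R\<close>)
    then obtain h where h: "h \<in> Arr C" "Dom C h = ob L\<^sub>2 A" "Cod C h = ob L\<^sub>1 A" "ar R' h \<cdot>\<^bsub>D\<^esub> \<eta>\<^sub>2 A = \<eta>\<^sub>1 A"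
      by (auto simp: Hom_iff)
    have h4: "ar R h \<cdot>\<^bsub>D\<^esub> \<eta>\<^sub>2 A = \<eta>\<^sub>1 A" using h R by simp
    have "h \<cdot>\<^bsub>C\<^esub> \<tau> A = Ide C (ob L\<^sub>1 A)"
      by (rule adjunction_inj[OF a1 A]) (use A h h4 in \<open>simp_all add: Hom_iff s t e D.assoc\<close>)
    moreover have "\<tau> A \<cdot>\<^bsub>C\<^esub> h = Ide C (ob L\<^sub>2 A)"
      by (rule adjunction_inj[OF a2 A]) (use A h h4 in \<open>simp_all add: Hom_iff s t e D.assoc R\<close>)
    ultimately show ?thesis
      using A h t(1-3)[OF A] unfolding is_iso_def by (auto simp: Hom_iff)
  qed
  then show ?thesis
    using that[of \<tau>] nt t(4) by (simp add: nat_iso_def)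
qed

lemma is_iso_opcat: "is_iso C f \<Longrightarrow> is_iso (opcat C) f"
  by (auto simp: is_iso_def)

text \<open>Because \<open>U T = B U\<close>, the composites \<open>L F\<close> and
  \<open>F P\<close> have right adjoints that agree, and this yields the comparison. The free
  algebra functor is the intended F.\<close>

locale tangent_left_adjoint = strict_tangent_functor C T D B U
  + A: adjoint_tangent_structure C T L \<eta> \<epsilon> + E: adjoint_tangent_structure D B P \<iota> \<kappa>
  for C :: "('o, 'm, 'x) cat_scheme" (structure) and T
    and D :: "('p, 'n, 'y) cat_scheme" and B and U and L \<eta> \<epsilon> and P \<iota> \<kappa> +
  fixes F \<theta> \<phi>
  assumes F_adj: "adjunction D C F U \<theta> \<phi>"
begin

lemma F_functor: "is_functor D C F"
  using F_adj by (simp add: adjunction_def)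

lemma \<theta>_natural: "nat_trans D D idF (U \<circ>\<^sub>F F) \<theta>"
  using F_adj by (simp add: adjunction_def)

lemmas F_simps [simp] = functor_simps[OF F_functor]
lemmas \<theta>_simps [simp] = nat_trans_simps[OF \<theta>_natural, simplified]

lemma \<theta>_comp: "f \<in> Arr D \<Longrightarrow> Cod D f = Y \<Longrightarrow> Dom D f = Z \<Longrightarrow> ar U (ar F f) \<cdot>\<^bsub>D\<^esub> \<theta> Z = \<theta> Y \<cdot>\<^bsub>D\<^esub> f"
  using nat_trans_natural[OF \<theta>_natural, of f Y] by simp

text \<open>The transpose of \<open>L\<^sub>n(F(A)) \<rightarrow> Y\<close> along both adjunctions;
  its target \<open>U(T\<^sub>n(Y))\<close> equals \<open>B\<^sub>n(U(Y))\<close> strictly.\<close>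

definition transp :: "nat \<Rightarrow> 'p \<Rightarrow> 'm \<Rightarrow> 'n" where
  "transp n A h = ar U (A.flat n (ob F A) h) \<cdot>\<^bsub>D\<^esub> \<theta> A"

lemma transp_simps [simp]:
  assumes "1 \<le> n" "A \<in> Obj D" "h \<in> Arr C" "Dom C h = ob (L n) (ob F A)"
  shows "transp n A h \<in> Arr D" "Dom D (transp n A h) = A"
    "Cod D (transp n A h) = ob (tanTn B n) (ob U (Cod C h))"
  using assms by (simp_all add: transp_def)

lemma F_inj:
  assumes "A \<in> Obj D" "h \<in> Arr C" "Dom C h = ob F A" "h' \<in> Arr C" "Dom C h' = ob F A" "Cod C h' = Cod C h"
    "ar U h \<cdot>\<^bsub>D\<^esub> \<theta> A = ar U h' \<cdot>\<^bsub>D\<^esub> \<theta> A"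
  shows "h = h'"
  using adjunction_inj[OF F_adj, of A h "Cod C h" h'] assms by (simp add: Hom_iff)

lemma transp_inj:
  assumes "1 \<le> n" "A \<in> Obj D" "h \<in> Arr C" "Dom C h = ob (L n) (ob F A)" "h' \<in> Arr C"
    "Dom C h' = ob (L n) (ob F A)" "Cod C h' = Cod C h" "transp n A h = transp n A h'"
  shows "h = h'"
proof (rule A.flat_inj[of n "ob F A"])
  show "A.flat n (ob F A) h = A.flat n (ob F A) h'"
    by (rule F_inj[of A]) (use assms in \<open>simp_all add: transp_def\<close>)
qed (use assms in simp_all)

lemma transp_comp:
  assumes "1 \<le> n" "A \<in> Obj D" "h \<in> Arr C" "Dom C h = ob (L n) (ob F A)" "k \<in> Arr C" "Dom C k = Cod C h"
  shows "transp n A (k \<cdot> h) = ar (tanTn B n) (ar U k) \<cdot>\<^bsub>D\<^esub> transp n A h"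
  using assms by (simp add: transp_def A.flat_comp D.assoc)

text \<open>The second property says that \<tau> carries one composite unit to the other, the latter
  being written as a transpose of \<theta> along the adjunction on D.\<close>

lemma obtain_comparison:
  obtains \<tau> where "nat_iso D C (L 1 \<circ>\<^sub>F F) (F \<circ>\<^sub>F P 1) \<tau>"
    and "\<And>A. A \<in> Obj D \<Longrightarrow> transp 1 A (\<tau> A) = E.flat 1 A (\<theta> (ob (P 1) A))"
proof -
  have a1: "adjunction D C (L 1 \<circ>\<^sub>F F) (U \<circ>\<^sub>F tanT T) (\<lambda>A. ar U (\<eta> 1 (ob F A)) \<cdot>\<^bsub>D\<^esub> \<theta> A)
      (\<lambda>B. \<epsilon> 1 B \<cdot> ar (L 1) (\<phi> (ob (tanT T) B)))"
    using adjunction_comp[OF F_adj A.adj[of 1]] by simp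
  have a2: "adjunction D C (F \<circ>\<^sub>F P 1) (tanT B \<circ>\<^sub>F U) (\<lambda>A. ar (tanT B) (\<theta> (ob (P 1) A)) \<cdot>\<^bsub>D\<^esub> \<iota> 1 A)
      (\<lambda>B. \<phi> B \<cdot> ar F (\<kappa> 1 (ob U B)))"
    using adjunction_comp[OF E.adj[of 1] F_adj] by simp
  obtain \<tau> where \<tau>: "nat_iso D C (L 1 \<circ>\<^sub>F F) (F \<circ>\<^sub>F P 1) \<tau>"
    and \<tau>1: "\<And>A. A \<in> Obj D \<Longrightarrow> ar (U \<circ>\<^sub>F tanT T) (\<tau> A) \<cdot>\<^bsub>D\<^esub> (ar U (\<eta> 1 (ob F A)) \<cdot>\<^bsub>D\<^esub> \<theta> A) =
      ar (tanT B) (\<theta> (ob (P 1) A)) \<cdot>\<^bsub>D\<^esub> \<iota> 1 A"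
    by (rule left_adjoint_unique[OF a1 a2]) simp_all
  have "nat_trans D C (L 1 \<circ>\<^sub>F F) (F \<circ>\<^sub>F P 1) \<tau>" using \<tau> by (simp add: nat_iso_def)
  note t = nat_trans_simps[OF this, simplified]
  have "transp 1 A (\<tau> A) = E.flat 1 A (\<theta> (ob (P 1) A))" if "A \<in> Obj D" for A
    using \<tau>1[OF that] that by (simp add: transp_def A.flat_def E.flat_def t D.assoc)
  then show ?thesis using that \<tau> by blast
qed

section \<open>Compatibility of the comparison with the structure maps\<close>

context
  fixes \<tau>
  assumes \<tau>: "nat_iso D C (L 1 \<circ>\<^sub>F F) (F \<circ>\<^sub>F P 1) \<tau>"
    and transp_\<tau>: "\<And>A. A \<in> Obj D \<Longrightarrow> transp 1 A (\<tau> A) = E.flat 1 A (\<theta> (ob (P 1) A))"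
begin

lemma \<tau>_natural: "nat_trans D C (L 1 \<circ>\<^sub>F F) (F \<circ>\<^sub>F P 1) \<tau>"
  using \<tau> by (simp add: nat_iso_def)

lemmas \<tau>_simps [simp] = nat_trans_simps[OF \<tau>_natural, simplified]

text \<open>Trades the transposition upstairs for the one on D. Compatibility of \<tau> with a
  structure map then holds because the transposition rules of both sides produce the same map of
  \<open>B\<close>.\<close>

lemma transp_comp_\<tau>:
  assumes "A \<in> Obj D" "k \<in> Arr C" "Dom C k = ob F (ob (P 1) A)"
  shows "transp 1 A (k \<cdot> \<tau> A) = E.flat 1 A (ar U k \<cdot>\<^bsub>D\<^esub> \<theta> (ob (P 1) A))"
  using assms by (simp add: transp_comp transp_\<tau> E.flat_comp)

lemma transp_F_\<tau>:
  assumes "A \<in> Obj D" "g \<in> Arr D" "Dom D g = ob (P 1) A" "Cod D g = Y"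
  shows "transp 1 A (ar F g \<cdot> \<tau> A) = E.flat 1 A (\<theta> Y \<cdot>\<^bsub>D\<^esub> g)"
  using assms by (simp add: transp_comp_\<tau> \<theta>_comp)

lemma \<tau>_p:
  assumes A: "A \<in> Obj D"
  shows "\<tau> A \<cdot> tp A.Top (ob F A) = ar F (tp E.Top A)"
proof (rule F_inj[OF A])
  have "ar U (\<tau> A \<cdot> tp A.Top (ob F A)) \<cdot>\<^bsub>D\<^esub> \<theta> A = tp B (ob U (ob F (ob (P 1) A))) \<cdot>\<^bsub>D\<^esub> transp 1 A (\<tau> A)"
    using A by (simp add: A.comp_p transp_def D.assoc)
  also have "\<dots> = \<theta> (ob (P 1) A) \<cdot>\<^bsub>D\<^esub> tp E.Top A"
    using A by (simp add: transp_\<tau> E.comp_p)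
  finally show "ar U (\<tau> A \<cdot> tp A.Top (ob F A)) \<cdot>\<^bsub>D\<^esub> \<theta> A = ar U (ar F (tp E.Top A)) \<cdot>\<^bsub>D\<^esub> \<theta> A"
    using A by (simp add: \<theta>_comp)
qed (use A in simp_all)

lemma \<tau>_z:
  assumes A: "A \<in> Obj D"
  shows "ar F (tz E.Top A) \<cdot> \<tau> A = tz A.Top (ob F A)"
proof (rule transp_inj[of 1 A])
  show "transp 1 A (ar F (tz E.Top A) \<cdot> \<tau> A) = transp 1 A (tz A.Top (ob F A))"
    using A by (simp add: transp_F_\<tau> E.flat_z) (simp add: transp_def A.flat_bare(4))
qed (use A in simp_all)

lemma \<tau>_s:
  assumes A: "A \<in> Obj D"
  shows "ar F (ts E.Top A) \<cdot> \<tau> A = pairT2 (opcat C) A.Top (ob F A)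
    (ar F (tq E.Top 2 1 A) \<cdot> \<tau> A) (ar F (tq E.Top 2 2 A) \<cdot> \<tau> A) \<cdot> ts A.Top (ob F A)"
proof (rule transp_inj[of 1 A])
  let ?k = "pairT2 (opcat C) A.Top (ob F A) (ar F (tq E.Top 2 1 A) \<cdot> \<tau> A) (ar F (tq E.Top 2 2 A) \<cdot> \<tau> A)"
  \<comment> \<open>Compatibility of the two injections, on which the copairing out of the pushout
    depends; \<open>\<tau>_p\<close> carries it from the base.\<close>
  have "tq E.Top 2 1 A \<cdot>\<^bsub>D\<^esub> tp E.Top A = tq E.Top 2 2 A \<cdot>\<^bsub>D\<^esub> tp E.Top A"
    using nfold_pullback_simps(4)[OF E.Top_pushout[OF A, of 2], of 1 2] by simp
  then have "(ar F (tq E.Top 2 1 A) \<cdot> \<tau> A) \<cdot> tp A.Top (ob F A) =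
      (ar F (tq E.Top 2 2 A) \<cdot> \<tau> A) \<cdot> tp A.Top (ob F A)"
    using A by (simp add: assoc \<tau>_p flip: F_simps(6))
  note k = A.op_pair_simps[OF _ _ _ _ _ _ this]
  have k': "?k \<in> Arr C" "Dom C ?k = ob (L 2) (ob F A)" "Cod C ?k = ob F (ob (P 2) A)"
    using A k by simp_all
  have q: "tq B 2 j (ob U (ob F (ob (P 2) A))) \<cdot>\<^bsub>D\<^esub> transp 2 A ?k = transp 1 A (?k \<cdot> tq A.Top 2 j (ob F A))"
    if "1 \<le> j" "j \<le> 2" for j
    using A k' that by (simp add: transp_def A.flat_q D.assoc)
  have "transp 2 A ?k = E.flat 2 A (\<theta> (ob (P 2) A))"
  proof (rule D.T2_ext)
    show "tq B 2 1 (ob U (ob F (ob (P 2) A))) \<cdot>\<^bsub>D\<^esub> transp 2 A ?k =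
        tq B 2 1 (ob U (ob F (ob (P 2) A))) \<cdot>\<^bsub>D\<^esub> E.flat 2 A (\<theta> (ob (P 2) A))"
      using A q[of 1] k(4) by (simp add: transp_F_\<tau> E.flat_q)
    show "tq B 2 2 (ob U (ob F (ob (P 2) A))) \<cdot>\<^bsub>D\<^esub> transp 2 A ?k =
        tq B 2 2 (ob U (ob F (ob (P 2) A))) \<cdot>\<^bsub>D\<^esub> E.flat 2 A (\<theta> (ob (P 2) A))"
      using A q[of 2] k(5) by (simp add: transp_F_\<tau> E.flat_q)
  qed (use A k' in simp_all)
  moreover have "transp 1 A (?k \<cdot> ts A.Top (ob F A)) = ts B (ob U (ob F (ob (P 2) A))) \<cdot>\<^bsub>D\<^esub> transp 2 A ?k"
    using A k' by (simp add: transp_def A.flat_s D.assoc)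
  ultimately show "transp 1 A (ar F (ts E.Top A) \<cdot> \<tau> A) = transp 1 A (?k \<cdot> ts A.Top (ob F A))"
    using A by (simp add: transp_F_\<tau> E.flat_s)
  show "?k \<cdot> ts A.Top (ob F A) \<in> Arr C" "Dom C (?k \<cdot> ts A.Top (ob F A)) = ob (L 1) (ob F A)"
    "Cod C (?k \<cdot> ts A.Top (ob F A)) = Cod C (ar F (ts E.Top A) \<cdot> \<tau> A)"
    using A k' by simp_all
qed (use A in simp_all)

text \<open>The comparison for \<open>L L F\<close> is made of \<tau> at \<open>P(A)\<close> and of
  \<open>L(\<tau>)\<close>; two uses of the single rule, at \<open>P(A)\<close> and at
  \<open>A\<close>, turn it into a double transposition on D.\<close>

lemma transp2_comp_\<tau>:
  assumes A: "A \<in> Obj D" and y: "y \<in> Arr C" "Dom C y = ob F (ob (P 1) (ob (P 1) A))"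
  shows "ar U (A.flat 1 (ob F A) (A.flat 1 (ob (L 1) (ob F A)) ((y \<cdot> \<tau> (ob (P 1) A)) \<cdot> ar (L 1) (\<tau> A)))) \<cdot>\<^bsub>D\<^esub> \<theta> A
    = E.flat 1 A (E.flat 1 (ob (P 1) A) (ar U y \<cdot>\<^bsub>D\<^esub> \<theta> (ob (P 1) (ob (P 1) A))))"
proof -
  let ?w = "y \<cdot> \<tau> (ob (P 1) A)"
  let ?x = "A.flat 1 (ob F (ob (P 1) A)) ?w"
  have "A.flat 1 (ob (L 1) (ob F A)) (?w \<cdot> ar (L 1) (\<tau> A)) = ?x \<cdot> \<tau> A"
    using A y by (simp add: A.flat_L)
  then show ?thesis
    using A y transp_comp_\<tau>[OF A, of ?x] transp_comp_\<tau>[of "ob (P 1) A" y]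
    by (simp add: transp_def)
qed

lemma \<tau>_l:
  assumes A: "A \<in> Obj D"
  shows "\<tau> A \<cdot> tl A.Top (ob F A) = (ar F (tl E.Top A) \<cdot> \<tau> (ob (P 1) A)) \<cdot> ar (L 1) (\<tau> A)"
proof (rule A.flat2_inj[of "ob F A"])
  let ?u = "\<tau> A \<cdot> tl A.Top (ob F A)" and ?v = "(ar F (tl E.Top A) \<cdot> \<tau> (ob (P 1) A)) \<cdot> ar (L 1) (\<tau> A)"
  let ?W = "\<lambda>h. A.flat 1 (ob F A) (A.flat 1 (ob (L 1) (ob F A)) h)"
  have "ar U (?W ?u) \<cdot>\<^bsub>D\<^esub> \<theta> A = tl B (ob U (ob F (ob (P 1) A))) \<cdot>\<^bsub>D\<^esub> transp 1 A (\<tau> A)"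
    using A by (simp add: A.flat_l transp_def D.assoc)
  also have "\<dots> = ar U (?W ?v) \<cdot>\<^bsub>D\<^esub> \<theta> A"
    using A transp2_comp_\<tau>[OF A, of "ar F (tl E.Top A)"] by (simp add: transp_\<tau> \<theta>_comp E.flat_l)
  finally show "?W ?u = ?W ?v"
    by - (rule F_inj[OF A], use A in simp_all)
qed (use A in simp_all)

lemma \<tau>_c:
  assumes A: "A \<in> Obj D"
  shows "(\<tau> (ob (P 1) A) \<cdot> ar (L 1) (\<tau> A)) \<cdot> tc A.Top (ob F A) =
    (ar F (tc E.Top A) \<cdot> \<tau> (ob (P 1) A)) \<cdot> ar (L 1) (\<tau> A)"
proof (rule A.flat2_inj[of "ob F A"])
  let ?y = "\<tau> (ob (P 1) A) \<cdot> ar (L 1) (\<tau> A)"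
  let ?u = "?y \<cdot> tc A.Top (ob F A)" and ?v = "(ar F (tc E.Top A) \<cdot> \<tau> (ob (P 1) A)) \<cdot> ar (L 1) (\<tau> A)"
  let ?W = "\<lambda>h. A.flat 1 (ob F A) (A.flat 1 (ob (L 1) (ob F A)) h)"
  let ?PP = "ob (P 1) (ob (P 1) A)"
  have "ar U (?W ?u) \<cdot>\<^bsub>D\<^esub> \<theta> A = tc B (ob U (ob F ?PP)) \<cdot>\<^bsub>D\<^esub> (ar U (?W ?y) \<cdot>\<^bsub>D\<^esub> \<theta> A)"
    using A by (simp add: A.flat_c D.assoc)
  also have "ar U (?W ?y) \<cdot>\<^bsub>D\<^esub> \<theta> A = E.flat 1 A (E.flat 1 (ob (P 1) A) (\<theta> ?PP))"
    using A transp2_comp_\<tau>[OF A, of "Ide C (ob F ?PP)"] by simp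
  also have "tc B (ob U (ob F ?PP)) \<cdot>\<^bsub>D\<^esub> \<dots> = E.flat 1 A (E.flat 1 (ob (P 1) A) (\<theta> ?PP \<cdot>\<^bsub>D\<^esub> tc E.Top A))"
    using A by (simp add: E.flat_c)
  also have "\<dots> = ar U (?W ?v) \<cdot>\<^bsub>D\<^esub> \<theta> A"
    using A transp2_comp_\<tau>[OF A, of "ar F (tc E.Top A)"] by (simp add: \<theta>_comp)
  finally show "?W ?u = ?W ?v"
    by - (rule F_inj[OF A], use A in simp_all)
qed (use A in simp_all)

text \<open>Between opposite categories F is a right adjoint, so it preserves the pushouts and the
  coequalizer required of a strong morphism.\<close>

lemma \<tau>_strong:
  "strong_tangent_morphism (opcat D) E.Top (opcat C) A.Top F \<tau>"
proof -
  have "tangent_morphism (opcat D) E.Top (opcat C) A.Top F \<tau>"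
    unfolding tangent_morphism_def opcat_simps A.tanTn_Top E.tanTn_Top
    using A.tangent_category_Top E.tangent_category_Top nat_trans_opcat[OF \<tau>_natural] is_functor_opcat[OF F_functor]
      \<tau>_p \<tau>_s \<tau>_z \<tau>_l \<tau>_c by blast
  moreover have "is_iso (opcat C) (\<tau> A)" if "A \<in> Obj D" for A
    using \<tau> that by (simp add: nat_iso_def is_iso_opcat)
  moreover have "is_nfold_pullback (opcat C) n (ar F (tp E.Top A)) (ob F (ob (P n) A)) (\<lambda>j. ar F (tq E.Top n j A))"
    if "A \<in> Obj D" "1 \<le> n" for A n
    using right_adjoint_nfold_pullback[OF adjunction_opcat[OF F_adj] E.Top_pushout[OF that]] .
  moreover have "is_equalizer (opcat C) (ar F (ar (P 1) (tp E.Top A)))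
          (ar F (tz E.Top A \<cdot>\<^bsub>opcat D\<^esub> tp E.Top A \<cdot>\<^bsub>opcat D\<^esub> tp E.Top (ob (P 1) A))) (ar F (univ_lift (opcat D) E.Top A))"
    if "A \<in> Obj D" for A
    using right_adjoint_equalizer[OF adjunction_opcat[OF F_adj] E.Top_universality[OF that]] by simp
  ultimately show ?thesis
    unfolding strong_tangent_morphism_def by simp
qed

text \<open>Transposition turns the two mates back into n and N, and U carries n to N.\<close>

lemma \<tau>_n:
  assumes N: "rosicky_tangent_category C T n" "rosicky_tangent_category D B N"
    and n: "\<And>A. A \<in> Obj C \<Longrightarrow> ar U (n A) = N (ob U A)" and A: "A \<in> Obj D"
  shows "\<tau> A \<cdot> adjoint_neg C L \<eta> \<epsilon> n (ob F A) = ar F (adjoint_neg D P \<iota> \<kappa> N A) \<cdot> \<tau> A"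
proof (rule transp_inj[of 1 A])
  interpret n: rosicky_tangent_category C T n by fact
  interpret N: rosicky_tangent_category D B N by fact
  note ns = nat_trans_simps[OF n.n_natural] nat_trans_simps[OF N.n_natural]
  have nat: "nat_trans C C (L 1) (L 1) (adjoint_neg C L \<eta> \<epsilon> n)"
    unfolding adjoint_neg_def using mate_natural[OF A.adj[of 1] A.adj[of 1] n.n_natural] by simp
  have natE: "nat_trans D D (P 1) (P 1) (adjoint_neg D P \<iota> \<kappa> N)"
    unfolding adjoint_neg_def using mate_natural[OF E.adj[of 1] E.adj[of 1] N.n_natural] by simp
  note s = nat_trans_simps[OF nat] nat_trans_simps[OF natE]
  note fn = A.rosicky_tangent_category_Top(2)[OF N(1)] and fN = E.rosicky_tangent_category_Top(2)[OF N(2)]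
  have "transp 1 A (\<tau> A \<cdot> adjoint_neg C L \<eta> \<epsilon> n (ob F A)) = N (ob U (ob F (ob (P 1) A))) \<cdot>\<^bsub>D\<^esub> transp 1 A (\<tau> A)"
    using A by (simp add: transp_def fn n ns D.assoc)
  also have "\<dots> = transp 1 A (ar F (adjoint_neg D P \<iota> \<kappa> N A) \<cdot> \<tau> A)"
    using A by (simp add: transp_F_\<tau> transp_\<tau> s fN)
  finally show "transp 1 A (\<tau> A \<cdot> adjoint_neg C L \<eta> \<epsilon> n (ob F A)) =
    transp 1 A (ar F (adjoint_neg D P \<iota> \<kappa> N A) \<cdot> \<tau> A)" .
qed (use A N mate_transpose(1)[OF A.adj[of 1] A.adj[of 1] rosicky_tangent_category.n_natural[OF N(1)], of "ob F A"]
    mate_transpose(1)[OF E.adj[of 1] E.adj[of 1] rosicky_tangent_category.n_natural[OF N(2)] A]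
   in \<open>simp_all add: Hom_iff adjoint_neg_def\<close>)

end

end

section \<open>Semi-additive categories\<close>

lemma ex1_eqI: "\<exists>!x. P x \<Longrightarrow> P a \<Longrightarrow> P b \<Longrightarrow> a = b"
  by blast

section \<open>Powers and their universal properties\<close>

context semiadditive_category
begin

definition inc :: "nat \<Rightarrow> 'o \<Rightarrow> nat \<Rightarrow> 'm" where
  "inc n A j = Inj X (replicate n A) j"

lemma replicate_Obj: "A \<in> Obj X \<Longrightarrow> set (replicate n A) \<subseteq> Obj X"
  by auto

lemma pw_simps [simp]:
  assumes "A \<in> Obj X"
  shows "pw X n A \<in> Obj X"
    and "1 \<le> j \<Longrightarrow> j \<le> n \<Longrightarrow> pj X n A j \<in> Arr X"
    and "1 \<le> j \<Longrightarrow> j \<le> n \<Longrightarrow> Dom X (pj X n A j) = pw X n A"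
    and "1 \<le> j \<Longrightarrow> j \<le> n \<Longrightarrow> Cod X (pj X n A j) = A"
    and "1 \<le> j \<Longrightarrow> j \<le> n \<Longrightarrow> inc n A j \<in> Arr X"
    and "1 \<le> j \<Longrightarrow> j \<le> n \<Longrightarrow> Dom X (inc n A j) = A"
    and "1 \<le> j \<Longrightarrow> j \<le> n \<Longrightarrow> Cod X (inc n A j) = pw X n A"
proof -
  note p = biproduct_product[OF replicate_Obj[OF assms], of n]
    and c = biproduct_coproduct[OF replicate_Obj[OF assms], of n]
  show "pw X n A \<in> Obj X" using p by (simp add: is_product_def pw_def)
  assume "1 \<le> j" "j \<le> n"
  then have j: "j \<in> {1..length (replicate n A)}" "replicate n A ! (j - 1) = A" by auto
  have "Prj X (replicate n A) j \<in> Hom X (Bip X (replicate n A)) (replicate n A ! (j - 1))"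
    using p j(1) unfolding is_product_def by blast
  moreover have "Inj X (replicate n A) j \<in> Hom (opcat X) (Bip X (replicate n A)) (replicate n A ! (j - 1))"
    using c j(1) unfolding is_coproduct_def is_product_def by blast
  ultimately show "pj X n A j \<in> Arr X" "Dom X (pj X n A j) = pw X n A" "Cod X (pj X n A j) = A"
    "inc n A j \<in> Arr X" "Dom X (inc n A j) = A" "Cod X (inc n A j) = pw X n A"
    using j(2) by (simp_all add: Hom_iff pj_def pw_def inc_def)
qed

lemma pw_ex1:
  assumes A: "A \<in> Obj X" and Z: "Z \<in> Obj X"
    and g: "\<And>j. 1 \<le> j \<Longrightarrow> j \<le> n \<Longrightarrow> g j \<in> Hom X Z A"
  shows "\<exists>!h. h \<in> Hom X Z (pw X n A) \<and> (\<forall>j\<in>{1..n}. pj X n A j \<cdot> h = g j)"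
proof -
  have "\<forall>i\<in>{1..length (replicate n A)}. g i \<in> Hom X Z (replicate n A ! (i - 1))"
    using g by auto
  then show ?thesis
    using biproduct_product[OF replicate_Obj[OF A], of n] Z
    unfolding is_product_def length_replicate pw_def pj_def by blast
qed

lemma pw_coex1:
  assumes A: "A \<in> Obj X" and Z: "Z \<in> Obj X"
    and g: "\<And>j. 1 \<le> j \<Longrightarrow> j \<le> n \<Longrightarrow> g j \<in> Hom X A Z"
  shows "\<exists>!h. h \<in> Hom X (pw X n A) Z \<and> (\<forall>j\<in>{1..n}. h \<cdot> inc n A j = g j)"
proof -
  have "\<forall>i\<in>{1..length (replicate n A)}. g i \<in> Hom (opcat X) Z (replicate n A ! (i - 1))"
    using g by auto
  then have "\<exists>!h. h \<in> Hom (opcat X) Z (Bip X (replicate n A)) \<and>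
      (\<forall>i\<in>{1..length (replicate n A)}. Inj X (replicate n A) i \<cdot>\<^bsub>opcat X\<^esub> h = g i)"
    using biproduct_coproduct[OF replicate_Obj[OF A], of n] Z
    unfolding is_coproduct_def is_product_def by (simp only: opcat_simps)
  then show ?thesis
    by (simp only: opcat_simps length_replicate pw_def inc_def)
qed

lemma pw_ext:
  assumes "A \<in> Obj X" "u \<in> Arr X" "Cod X u = pw X n A" "v \<in> Arr X" "Dom X v = Dom X u" "Cod X v = pw X n A"
    and "\<And>j. 1 \<le> j \<Longrightarrow> j \<le> n \<Longrightarrow> pj X n A j \<cdot> u = pj X n A j \<cdot> v"
  shows "u = v"
proof -
  have ex: "\<exists>!h. h \<in> Hom X (Dom X u) (pw X n A) \<and> (\<forall>j\<in>{1..n}. pj X n A j \<cdot> h = pj X n A j \<cdot> u)"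
    by (rule pw_ex1) (use assms in \<open>simp_all add: Hom_iff\<close>)
  show ?thesis
    by (rule ex1_eqI[OF ex]) (use assms in \<open>simp_all add: Hom_iff\<close>)
qed

lemma pw_coext:
  assumes "A \<in> Obj X" "u \<in> Arr X" "Dom X u = pw X n A" "v \<in> Arr X" "Cod X v = Cod X u" "Dom X v = pw X n A"
    and "\<And>j. 1 \<le> j \<Longrightarrow> j \<le> n \<Longrightarrow> u \<cdot> inc n A j = v \<cdot> inc n A j"
  shows "u = v"
proof -
  have ex: "\<exists>!h. h \<in> Hom X (pw X n A) (Cod X u) \<and> (\<forall>j\<in>{1..n}. h \<cdot> inc n A j = u \<cdot> inc n A j)"
    by (rule pw_coex1) (use assms in \<open>simp_all add: Hom_iff\<close>)
  show ?thesis
    by (rule ex1_eqI[OF ex]) (use assms in \<open>simp_all add: Hom_iff\<close>)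
qed

lemma nat_le_2_cases: "1 \<le> j \<Longrightarrow> j \<le> 2 \<Longrightarrow> (j = 1 \<Longrightarrow> Q) \<Longrightarrow> (j = 2 \<Longrightarrow> Q) \<Longrightarrow> Q" for j :: nat
  by linarith

lemma nat_le_3_cases: "1 \<le> j \<Longrightarrow> j \<le> 3 \<Longrightarrow> (j = 1 \<Longrightarrow> Q) \<Longrightarrow> (j = 2 \<Longrightarrow> Q) \<Longrightarrow> (j = 3 \<Longrightarrow> Q) \<Longrightarrow> Q" for j :: nat
  by linarith

lemma pw2_ext:
  assumes "A \<in> Obj X" "u \<in> Arr X" "Cod X u = pw X 2 A" "v \<in> Arr X" "Dom X v = Dom X u" "Cod X v = pw X 2 A"
    and "pj X 2 A 1 \<cdot> u = pj X 2 A 1 \<cdot> v" "pj X 2 A 2 \<cdot> u = pj X 2 A 2 \<cdot> v"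
  shows "u = v"
  by (rule pw_ext[OF assms(1-6)]) (erule nat_le_2_cases, assumption; simp add: assms)

lemma pw3_ext:
  assumes "A \<in> Obj X" "u \<in> Arr X" "Cod X u = pw X 3 A" "v \<in> Arr X" "Dom X v = Dom X u" "Cod X v = pw X 3 A"
    and "pj X 3 A 1 \<cdot> u = pj X 3 A 1 \<cdot> v" "pj X 3 A 2 \<cdot> u = pj X 3 A 2 \<cdot> v" "pj X 3 A 3 \<cdot> u = pj X 3 A 3 \<cdot> v"
  shows "u = v"
  by (rule pw_ext[OF assms(1-6)]) (erule nat_le_3_cases, assumption; simp add: assms)

lemma pw22_ext:
  assumes A: "A \<in> Obj X" "u \<in> Arr X" "Cod X u = pw X 2 (pw X 2 A)" "v \<in> Arr X" "Dom X v = Dom X u"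
      "Cod X v = pw X 2 (pw X 2 A)"
    and "pj X 2 A 1 \<cdot> (pj X 2 (pw X 2 A) 1 \<cdot> u) = pj X 2 A 1 \<cdot> (pj X 2 (pw X 2 A) 1 \<cdot> v)"
      "pj X 2 A 2 \<cdot> (pj X 2 (pw X 2 A) 1 \<cdot> u) = pj X 2 A 2 \<cdot> (pj X 2 (pw X 2 A) 1 \<cdot> v)"
      "pj X 2 A 1 \<cdot> (pj X 2 (pw X 2 A) 2 \<cdot> u) = pj X 2 A 1 \<cdot> (pj X 2 (pw X 2 A) 2 \<cdot> v)"
      "pj X 2 A 2 \<cdot> (pj X 2 (pw X 2 A) 2 \<cdot> u) = pj X 2 A 2 \<cdot> (pj X 2 (pw X 2 A) 2 \<cdot> v)"
  shows "u = v"
proof (rule pw2_ext)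
  show "pj X 2 (pw X 2 A) 1 \<cdot> u = pj X 2 (pw X 2 A) 1 \<cdot> v"
    by (rule pw2_ext[of A]) (use assms in simp_all)
  show "pj X 2 (pw X 2 A) 2 \<cdot> u = pj X 2 (pw X 2 A) 2 \<cdot> v"
    by (rule pw2_ext[of A]) (use assms in simp_all)
qed (use assms in simp_all)

lemma pw2_coext:
  assumes "A \<in> Obj X" "u \<in> Arr X" "Dom X u = pw X 2 A" "v \<in> Arr X" "Cod X v = Cod X u" "Dom X v = pw X 2 A"
    and "u \<cdot> inc 2 A 1 = v \<cdot> inc 2 A 1" "u \<cdot> inc 2 A 2 = v \<cdot> inc 2 A 2"
  shows "u = v"
  by (rule pw_coext[OF assms(1-6)]) (erule nat_le_2_cases, assumption; simp add: assms)

lemma pw3_coext: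
  assumes "A \<in> Obj X" "u \<in> Arr X" "Dom X u = pw X 3 A" "v \<in> Arr X" "Cod X v = Cod X u" "Dom X v = pw X 3 A"
    and "u \<cdot> inc 3 A 1 = v \<cdot> inc 3 A 1" "u \<cdot> inc 3 A 2 = v \<cdot> inc 3 A 2" "u \<cdot> inc 3 A 3 = v \<cdot> inc 3 A 3"
  shows "u = v"
  by (rule pw_coext[OF assms(1-6)]) (erule nat_le_3_cases, assumption; simp add: assms)

lemma zero_ex1:
  assumes "Z \<in> Obj X"
  shows "Bip X [] \<in> Obj X" "\<exists>!h. h \<in> Hom X Z (Bip X [])" "\<exists>!h. h \<in> Hom X (Bip X []) Z"
  using biproduct_product[of "[]"] biproduct_coproduct[of "[]"] assms
  by (simp_all add: is_product_def is_coproduct_def)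

section \<open>Zero arrows and tuples\<close>

lemma zero_simps [simp]:
  assumes "A \<in> Obj X" "B \<in> Obj X"
  shows "zero X A B \<in> Arr X" "Dom X (zero X A B) = A" "Cod X (zero X A B) = B"
  using theI'[OF zero_ex1(2)[OF assms(1)]] theI'[OF zero_ex1(3)[OF assms(2)]]
  unfolding zero_def by (simp_all add: Hom_iff)

lemma comp_zero [simp]:
  assumes f: "f \<in> Arr X" "Dom X f = B" and A: "A \<in> Obj X"
  shows "f \<cdot> zero X A B = zero X A (Cod X f)"
proof -
  have B: "B \<in> Obj X" using f by auto
  let ?t = "THE h. h \<in> Hom X A (Bip X [])"
  have t: "?t \<in> Arr X" "Dom X ?t = A" "Cod X ?t = Bip X []"
    using theI'[OF zero_ex1(2)[OF A]] by (simp_all add: Hom_iff)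
  let ?i = "\<lambda>B. THE h. h \<in> Hom X (Bip X []) B"
  have i: "?i B \<in> Arr X" "Dom X (?i B) = Bip X []" "Cod X (?i B) = B" if "B \<in> Obj X" for B
    using theI'[OF zero_ex1(3)[OF that]] by (simp_all add: Hom_iff)
  have "f \<cdot> ?i B = ?i (Cod X f)"
    by (rule the1_equality[OF zero_ex1(3), symmetric]) (use f i[OF B] in \<open>simp_all add: Hom_iff\<close>)
  then show ?thesis
    using f B t i unfolding zero_def by (simp add: assoc_left)
qed

lemma zero_comp [simp]:
  assumes f: "f \<in> Arr X" "Cod X f = A" and B: "B \<in> Obj X"
  shows "zero X A B \<cdot> f = zero X (Dom X f) B"
proof -
  have A: "A \<in> Obj X" using f by auto
  let ?t = "\<lambda>A. THE h. h \<in> Hom X A (Bip X [])"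
  have t: "?t A \<in> Arr X" "Dom X (?t A) = A" "Cod X (?t A) = Bip X []" if "A \<in> Obj X" for A
    using theI'[OF zero_ex1(2)[OF that]] by (simp_all add: Hom_iff)
  let ?i = "THE h. h \<in> Hom X (Bip X []) B"
  have i: "?i \<in> Arr X" "Dom X ?i = Bip X []" "Cod X ?i = B"
    using theI'[OF zero_ex1(3)[OF B]] by (simp_all add: Hom_iff)
  have "?t A \<cdot> f = ?t (Dom X f)"
    by (rule the1_equality[OF zero_ex1(2), symmetric]) (use f t[OF A] in \<open>simp_all add: Hom_iff\<close>)
  then show ?thesis
    using f A t i unfolding zero_def by (simp add: assoc)
qed

lemma pj_inc [simp]:
  assumes "A \<in> Obj X" "1 \<le> i" "i \<le> n" "1 \<le> j" "j \<le> n"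
  shows "pj X n A j \<cdot> inc n A i = (if i = j then Ide X A else zero X A A)"
  using biproduct_delta[OF replicate_Obj[OF assms(1)], of i n j] assms
  by (simp add: pj_def inc_def)

lemma pj_inc_comp [simp]:
  assumes "A \<in> Obj X" "1 \<le> i" "i \<le> n" "1 \<le> j" "j \<le> n" "h \<in> Arr X" "Cod X h = A"
  shows "pj X n A j \<cdot> (inc n A i \<cdot> h) = (if i = j then h else zero X (Dom X h) A)"
  using assms by (simp add: assoc_left)

lemma tup_simps:
  assumes "fs \<noteq> []" and fs: "\<And>f. f \<in> set fs \<Longrightarrow> f \<in> Arr X \<and> Dom X f = Z \<and> Cod X f = A"
  shows "tup X fs \<in> Arr X" "Dom X (tup X fs) = Z" "Cod X (tup X fs) = pw X (length fs) A"
    "1 \<le> i \<Longrightarrow> i \<le> length fs \<Longrightarrow> pj X (length fs) A i \<cdot> tup X fs = fs ! (i - 1)"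
proof -
  have hd: "Dom X (hd fs) = Z" and Z: "Z \<in> Obj X" "A \<in> Obj X"
    using assms(1) fs[of "hd fs"] by auto
  \<comment> \<open>\<open>tup\<close> reads its target off the list of codomains; with a common
    codomain that list is a \<open>replicate\<close>, and the target is a power.\<close>
  have m: "map (Cod X) fs = replicate (length fs) A"
    using fs by (simp add: map_eq_conv flip: map_replicate_const)
  have "\<exists>!h. h \<in> Hom X Z (pw X (length fs) A) \<and> (\<forall>i\<in>{1..length fs}. pj X (length fs) A i \<cdot> h = fs ! (i - 1))"
    by (rule pw_ex1[OF Z(2,1)]) (use fs in \<open>simp add: Hom_iff\<close>)
  from theI'[OF this]
  have "tup X fs \<in> Hom X Z (pw X (length fs) A) \<and> (\<forall>i\<in>{1..length fs}. pj X (length fs) A i \<cdot> tup X fs = fs ! (i - 1))"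
    unfolding tup_def hd m pw_def pj_def .
  then show "tup X fs \<in> Arr X" "Dom X (tup X fs) = Z" "Cod X (tup X fs) = pw X (length fs) A"
    "1 \<le> i \<Longrightarrow> i \<le> length fs \<Longrightarrow> pj X (length fs) A i \<cdot> tup X fs = fs ! (i - 1)"
    by (simp_all add: Hom_iff)
qed

lemma tup2 [simp]:
  assumes "f \<in> Arr X" "g \<in> Arr X" "Dom X g = Dom X f" "Cod X g = Cod X f"
  shows "tup X [f, g] \<in> Arr X" "Dom X (tup X [f, g]) = Dom X f" "Cod X (tup X [f, g]) = pw X 2 (Cod X f)"
    "Cod X f = A \<Longrightarrow> pj X 2 A 1 \<cdot> tup X [f, g] = f" "Cod X f = A \<Longrightarrow> pj X 2 A 2 \<cdot> tup X [f, g] = g"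
proof -
  have fs: "h \<in> Arr X \<and> Dom X h = Dom X f \<and> Cod X h = Cod X f" if "h \<in> set [f, g]" for h
    using that assms by auto
  have l: "length [f, g] = 2" "[f, g] \<noteq> []" by (simp_all add: numeral_2_eq_2)
  note t = tup_simps[OF l(2) fs, unfolded l(1)]
  show "tup X [f, g] \<in> Arr X" "Dom X (tup X [f, g]) = Dom X f" "Cod X (tup X [f, g]) = pw X 2 (Cod X f)"
    using t(1-3) by simp_all
  show "pj X 2 A 1 \<cdot> tup X [f, g] = f" "pj X 2 A 2 \<cdot> tup X [f, g] = g" if "Cod X f = A"
    using t(4)[of 1] t(4)[of 2] that by simp_all
qed

lemma tup2_comp [simp]:
  assumes "f \<in> Arr X" "g \<in> Arr X" "Dom X g = Dom X f" "Cod X g = Cod X f" "Cod X f = A"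
    "h \<in> Arr X" "Cod X h = Dom X f"
  shows "pj X 2 A 1 \<cdot> (tup X [f, g] \<cdot> h) = f \<cdot> h" "pj X 2 A 2 \<cdot> (tup X [f, g] \<cdot> h) = g \<cdot> h"
proof -
  have "A \<in> Obj X" using assms by auto
  then show "pj X 2 A 1 \<cdot> (tup X [f, g] \<cdot> h) = f \<cdot> h" "pj X 2 A 2 \<cdot> (tup X [f, g] \<cdot> h) = g \<cdot> h"
    using assms by (simp_all add: assoc_left)
qed

lemma tup3 [simp]:
  assumes "f \<in> Arr X" "g \<in> Arr X" "k \<in> Arr X" "Dom X g = Dom X f" "Cod X g = Cod X f"
    "Dom X k = Dom X f" "Cod X k = Cod X f"
  shows "tup X [f, g, k] \<in> Arr X" "Dom X (tup X [f, g, k]) = Dom X f" "Cod X (tup X [f, g, k]) = pw X 3 (Cod X f)"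
    "Cod X f = A \<Longrightarrow> pj X 3 A 1 \<cdot> tup X [f, g, k] = f" "Cod X f = A \<Longrightarrow> pj X 3 A 2 \<cdot> tup X [f, g, k] = g"
    "Cod X f = A \<Longrightarrow> pj X 3 A 3 \<cdot> tup X [f, g, k] = k"
proof -
  have fs: "h \<in> Arr X \<and> Dom X h = Dom X f \<and> Cod X h = Cod X f" if "h \<in> set [f, g, k]" for h
    using that assms by auto
  have l: "length [f, g, k] = 3" "[f, g, k] \<noteq> []" by (simp_all add: numeral_3_eq_3)
  note t = tup_simps[OF l(2) fs, unfolded l(1)]
  show "tup X [f, g, k] \<in> Arr X" "Dom X (tup X [f, g, k]) = Dom X f" "Cod X (tup X [f, g, k]) = pw X 3 (Cod X f)"
    using t(1-3) by simp_all
  show "pj X 3 A 1 \<cdot> tup X [f, g, k] = f" "pj X 3 A 2 \<cdot> tup X [f, g, k] = g"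
    "pj X 3 A 3 \<cdot> tup X [f, g, k] = k" if "Cod X f = A"
    using t(4)[of 1] t(4)[of 2] t(4)[of 3] that by simp_all
qed

lemma tup3_comp [simp]:
  assumes "f \<in> Arr X" "g \<in> Arr X" "k \<in> Arr X" "Dom X g = Dom X f" "Cod X g = Cod X f"
    "Dom X k = Dom X f" "Cod X k = Cod X f" "Cod X f = A" "h \<in> Arr X" "Cod X h = Dom X f"
  shows "pj X 3 A 1 \<cdot> (tup X [f, g, k] \<cdot> h) = f \<cdot> h" "pj X 3 A 2 \<cdot> (tup X [f, g, k] \<cdot> h) = g \<cdot> h"
    "pj X 3 A 3 \<cdot> (tup X [f, g, k] \<cdot> h) = k \<cdot> h"
proof -
  have "A \<in> Obj X" using assms by auto
  then show "pj X 3 A 1 \<cdot> (tup X [f, g, k] \<cdot> h) = f \<cdot> h" "pj X 3 A 2 \<cdot> (tup X [f, g, k] \<cdot> h) = g \<cdot> h"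
    "pj X 3 A 3 \<cdot> (tup X [f, g, k] \<cdot> h) = k \<cdot> h"
    using assms by (simp_all add: assoc_left)
qed

lemma tup_map:
  assumes "1 \<le> n" and g: "\<And>j. 1 \<le> j \<Longrightarrow> j \<le> n \<Longrightarrow> g j \<in> Arr X \<and> Dom X (g j) = Z \<and> Cod X (g j) = A"
  shows "tup X (map g [1..<Suc n]) \<in> Arr X" "Dom X (tup X (map g [1..<Suc n])) = Z"
    "Cod X (tup X (map g [1..<Suc n])) = pw X n A"
    "1 \<le> i \<Longrightarrow> i \<le> n \<Longrightarrow> pj X n A i \<cdot> tup X (map g [1..<Suc n]) = g i"
proof -
  have fs: "h \<in> Arr X \<and> Dom X h = Z \<and> Cod X h = A" if "h \<in> set (map g [1..<Suc n])" for h
    using that g by (auto simp del: upt_Suc)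
  have l: "length (map g [1..<Suc n]) = n" "map g [1..<Suc n] \<noteq> []"
    using assms(1) by (simp_all add: less_Suc_eq_le del: upt_Suc)
  note t = tup_simps[OF l(2) fs, unfolded l(1)]
  show "tup X (map g [1..<Suc n]) \<in> Arr X" "Dom X (tup X (map g [1..<Suc n])) = Z"
    "Cod X (tup X (map g [1..<Suc n])) = pw X n A"
    using t(1-3) by (simp_all del: upt_Suc)
  show "pj X n A i \<cdot> tup X (map g [1..<Suc n]) = g i" if "1 \<le> i" "i \<le> n"
    using t(4)[of i] that by (simp del: upt_Suc)
qed

lemma pwF_simps [simp]:
  assumes "1 \<le> n" "f \<in> Arr X"
  shows "ob (pwF X n) A = pw X n A" "ar (pwF X n) f \<in> Arr X" "Dom X (ar (pwF X n) f) = pw X n (Dom X f)"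
    "Cod X (ar (pwF X n) f) = pw X n (Cod X f)"
    "1 \<le> j \<Longrightarrow> j \<le> n \<Longrightarrow> Cod X f = B \<Longrightarrow> pj X n B j \<cdot> ar (pwF X n) f = f \<cdot> pj X n (Dom X f) j"
    "1 \<le> j \<Longrightarrow> j \<le> n \<Longrightarrow> Cod X f = B \<Longrightarrow> h \<in> Arr X \<Longrightarrow> Cod X h = pw X n (Dom X f) \<Longrightarrow>
      pj X n B j \<cdot> (ar (pwF X n) f \<cdot> h) = f \<cdot> (pj X n (Dom X f) j \<cdot> h)"
proof -
  note t = tup_map[of n "\<lambda>j. f \<cdot> pj X n (Dom X f) j" "pw X n (Dom X f)" "Cod X f"]
  show "ob (pwF X n) A = pw X n A" by (simp add: pwF_def)
  show s: "ar (pwF X n) f \<in> Arr X" "Dom X (ar (pwF X n) f) = pw X n (Dom X f)"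
    "Cod X (ar (pwF X n) f) = pw X n (Cod X f)"
    using t(1-3) assms by (simp_all add: pwF_def del: upt_Suc)
  show p: "pj X n B j \<cdot> ar (pwF X n) f = f \<cdot> pj X n (Dom X f) j" if "1 \<le> j" "j \<le> n" "Cod X f = B" for j B
    using t(4) assms that by (auto simp: pwF_def simp del: upt_Suc)
  show "pj X n B j \<cdot> (ar (pwF X n) f \<cdot> h) = f \<cdot> (pj X n (Dom X f) j \<cdot> h)"
    if "1 \<le> j" "j \<le> n" "Cod X f = B" "h \<in> Arr X" "Cod X h = pw X n (Dom X f)"
    using that assms s comp_extend[OF p[OF that(1-3)], of h] by (auto simp: assoc)
qed

lemma pwF_ob [simp]: "ob (pwF X n) A = pw X n A"
  by (simp add: pwF_def)

lemma pwF_functor: "1 \<le> n \<Longrightarrow> is_functor X X (pwF X n)"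
  unfolding is_functor_iff
proof (intro conjI ballI impI category_axioms)
  fix A assume n: "1 \<le> n" and A: "A \<in> Obj X"
  show "ar (pwF X n) (Ide X A) = Ide X (ob (pwF X n) A)"
    by (rule pw_ext[of A _ n]) (use n A in simp_all)
next
  fix f g assume n: "1 \<le> n" and f: "f \<in> Arr X" "g \<in> Arr X" "Cod X f = Dom X g"
  show "ar (pwF X n) (g \<cdot> f) = ar (pwF X n) g \<cdot> ar (pwF X n) f"
    by (rule pw_ext[of "Cod X g" _ n]) (use n f in \<open>simp_all add: assoc\<close>)
qed simp_all

lemma codiag:
  assumes B: "B \<in> Obj X"
  shows "codiag X B \<in> Arr X" "Dom X (codiag X B) = pw X 2 B" "Cod X (codiag X B) = B"
    "codiag X B \<cdot> inc 2 B 1 = Ide X B" "codiag X B \<cdot> inc 2 B 2 = Ide X B"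
proof -
  have 12: "{1..2} = {1, 2::nat}" by (auto simp: numeral_2_eq_2 One_nat_def)
  have "\<exists>!h. h \<in> Hom X (pw X 2 B) B \<and> (\<forall>j\<in>{1..2}. h \<cdot> inc 2 B j = Ide X B)"
    by (rule pw_coex1) (use B in \<open>simp_all add: Hom_iff\<close>)
  then have "\<exists>!h. h \<in> Hom X (Bip X [B, B]) B \<and> h \<cdot> Inj X [B, B] 1 = Ide X B \<and> h \<cdot> Inj X [B, B] 2 = Ide X B"
    unfolding 12 by (simp add: pw_def inc_def numeral_2_eq_2)
  from theI'[OF this]
  show "codiag X B \<in> Arr X" "Dom X (codiag X B) = pw X 2 B" "Cod X (codiag X B) = B"
    "codiag X B \<cdot> inc 2 B 1 = Ide X B" "codiag X B \<cdot> inc 2 B 2 = Ide X B"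
    unfolding codiag_def[symmetric] by (simp_all add: Hom_iff pw_def inc_def numeral_2_eq_2)
qed

section \<open>Addition of parallel arrows\<close>

lemma add_simps [simp]:
  assumes "f \<in> Arr X" "g \<in> Arr X" "Dom X g = Dom X f" "Cod X g = Cod X f"
  shows "f \<oplus> g \<in> Arr X" "Dom X (f \<oplus> g) = Dom X f" "Cod X (f \<oplus> g) = Cod X f"
  using assms by (simp_all add: add_def codiag)

lemma add_comp:
  assumes "f \<in> Arr X" "g \<in> Arr X" "Dom X g = Dom X f" "Cod X g = Cod X f" "h \<in> Arr X" "Cod X h = Dom X f"
  shows "(f \<oplus> g) \<cdot> h = (f \<cdot> h) \<oplus> (g \<cdot> h)"
proof -
  have "tup X [f, g] \<cdot> h = tup X [f \<cdot> h, g \<cdot> h]"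
    by (rule pw2_ext[of "Cod X f"]) (use assms in simp_all)
  then show ?thesis using assms by (simp add: add_def codiag assoc)
qed

text \<open>A pair with a zero entry factors through an injection, on which the codiagonal is the
  identity.\<close>

lemma add_zero [simp]:
  assumes f: "f \<in> Arr X" "Dom X f = A" "Cod X f = B"
  shows "f \<oplus> zero X A B = f" "zero X A B \<oplus> f = f"
proof -
  have o: "A \<in> Obj X" "B \<in> Obj X" using f by auto
  have "tup X [f, zero X A B] = inc 2 B 1 \<cdot> f"
    by (rule pw2_ext[of B]) (use f o in simp_all)
  then show "f \<oplus> zero X A B = f" using f o by (simp add: add_def assoc_left codiag)
  have "tup X [zero X A B, f] = inc 2 B 2 \<cdot> f"
    by (rule pw2_ext[of B]) (use f o in simp_all)
  then show "zero X A B \<oplus> f = f" using f o by (simp add: add_def assoc_left codiag)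
qed

text \<open>It suffices to treat the two projections of the square, where both sides agree on the
  injections; precomposing with the pair of f and g gives the general case. Commutativity and
  associativity are proved in the same way.\<close>

lemma comp_add:
  assumes "f \<in> Arr X" "g \<in> Arr X" "Dom X g = Dom X f" "Cod X g = Cod X f" "k \<in> Arr X" "Dom X k = Cod X f"
  shows "k \<cdot> (f \<oplus> g) = (k \<cdot> f) \<oplus> (k \<cdot> g)"
proof -
  let ?A = "Cod X f" and ?B = "Cod X k"
  have o: "?A \<in> Obj X" "?B \<in> Obj X" using assms by auto
  have "k \<cdot> codiag X ?A = (k \<cdot> pj X 2 ?A 1) \<oplus> (k \<cdot> pj X 2 ?A 2)"
    by (rule pw2_coext[of ?A]) (use assms o in \<open>simp_all add: codiag assoc add_comp\<close>)
  then have "k \<cdot> (codiag X ?A \<cdot> tup X [f, g]) = ((k \<cdot> pj X 2 ?A 1) \<oplus> (k \<cdot> pj X 2 ?A 2)) \<cdot> tup X [f, g]"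
    using assms o by (simp add: codiag assoc_left)
  then show ?thesis using assms o by (simp add: add_comp assoc add_def[of _ f g])
qed

lemma add_commute:
  assumes "f \<in> Arr X" "g \<in> Arr X" "Dom X g = Dom X f" "Cod X g = Cod X f"
  shows "f \<oplus> g = g \<oplus> f"
proof -
  let ?A = "Cod X f"
  have o: "?A \<in> Obj X" using assms by auto
  have "pj X 2 ?A 1 \<oplus> pj X 2 ?A 2 = pj X 2 ?A 2 \<oplus> pj X 2 ?A 1"
    by (rule pw2_coext[of ?A]) (use o in \<open>simp_all add: add_comp\<close>)
  then have "(pj X 2 ?A 1 \<oplus> pj X 2 ?A 2) \<cdot> tup X [f, g] = (pj X 2 ?A 2 \<oplus> pj X 2 ?A 1) \<cdot> tup X [f, g]" by simp
  then show ?thesis using assms o by (simp add: add_comp)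
qed

lemma add_assoc:
  assumes "f \<in> Arr X" "g \<in> Arr X" "Dom X g = Dom X f" "Cod X g = Cod X f"
    "k \<in> Arr X" "Dom X k = Dom X f" "Cod X k = Cod X f"
  shows "(f \<oplus> g) \<oplus> k = f \<oplus> (g \<oplus> k)"
proof -
  let ?A = "Cod X f" and ?p = "pj X 3 (Cod X f)"
  have o: "?A \<in> Obj X" using assms by auto
  have "(?p 1 \<oplus> ?p 2) \<oplus> ?p 3 = ?p 1 \<oplus> (?p 2 \<oplus> ?p 3)"
    by (rule pw3_coext[of ?A]) (use o in \<open>simp_all add: add_comp\<close>)
  then have "((?p 1 \<oplus> ?p 2) \<oplus> ?p 3) \<cdot> tup X [f, g, k] = (?p 1 \<oplus> (?p 2 \<oplus> ?p 3)) \<cdot> tup X [f, g, k]" by simp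
  then show ?thesis using assms o by (simp add: add_comp)
qed

lemma add_left_commute:
  assumes "f \<in> Arr X" "g \<in> Arr X" "Dom X g = Dom X f" "Cod X g = Cod X f"
    "k \<in> Arr X" "Dom X k = Dom X f" "Cod X k = Cod X f"
  shows "f \<oplus> (g \<oplus> k) = g \<oplus> (f \<oplus> k)"
  using assms add_assoc[of f g k] add_assoc[of g f k] add_commute[of f g] by simp

end

context additive_category
begin

text \<open>Inverses in a commutative monoid are unique, so the definite description denotes the
  inverse that additivity provides.\<close>

lemma neg:
  assumes f: "f \<in> Arr X"
  shows "neg X f \<in> Arr X" "Dom X (neg X f) = Dom X f" "Cod X (neg X f) = Cod X f"
    "f \<oplus> neg X f = zero X (Dom X f) (Cod X f)"
    "g \<in> Arr X \<Longrightarrow> Dom X g = Dom X f \<Longrightarrow> Cod X g = Cod X f \<Longrightarrow> f \<oplus> g = zero X (Dom X f) (Cod X f) \<Longrightarrow> neg X f = g"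
proof -
  let ?P = "\<lambda>g. g \<in> Hom X (Dom X f) (Cod X f) \<and> f \<oplus> g = zero X (Dom X f) (Cod X f)"
  have u: "g = g'" if "?P g" "?P g'" for g g'
  proof -
    have "g = g \<oplus> (f \<oplus> g')" using that f by (simp add: Hom_iff)
    also have "\<dots> = (f \<oplus> g) \<oplus> g'"
      using that f add_assoc[of g f g'] add_commute[of g f] by (simp add: Hom_iff)
    also have "\<dots> = g'" using that f by (simp add: Hom_iff)
    finally show ?thesis .
  qed
  have "\<exists>g. ?P g" using additive_inverse[of f "Dom X f" "Cod X f"] f by (auto simp: Hom_iff)
  then have ex: "\<exists>!g. ?P g" using u by blast
  from theI'[OF ex]
  show "neg X f \<in> Arr X" "Dom X (neg X f) = Dom X f" "Cod X (neg X f) = Cod X f"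
    "f \<oplus> neg X f = zero X (Dom X f) (Cod X f)"
    unfolding neg_def[symmetric] by (simp_all add: Hom_iff)
  show "neg X f = g" if "g \<in> Arr X" "Dom X g = Dom X f" "Cod X g = Cod X f" "f \<oplus> g = zero X (Dom X f) (Cod X f)"
    unfolding neg_def by (rule the1_equality[OF ex]) (use that in \<open>simp add: Hom_iff\<close>)
qed

lemmas neg_simps [simp] = neg(1-4)

lemma neg_comp:
  assumes "f \<in> Arr X" "h \<in> Arr X" "Cod X h = Dom X f"
  shows "neg X f \<cdot> h = neg X (f \<cdot> h)"
  by (rule neg(5)[symmetric]) (use assms in \<open>simp_all flip: add_comp\<close>)

lemma comp_neg:
  assumes "f \<in> Arr X" "k \<in> Arr X" "Dom X k = Cod X f"
  shows "k \<cdot> neg X f = neg X (k \<cdot> f)"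
  by (rule neg(5)[symmetric]) (use assms in \<open>simp_all flip: comp_add\<close>)

lemma neg_zero [simp]: "A \<in> Obj X \<Longrightarrow> B \<in> Obj X \<Longrightarrow> neg X (zero X A B) = zero X A B"
  by (rule neg(5)) simp_all

end

section \<open>The tangent structure of a semi-additive category\<close>

context semiadditive_category
begin

text \<open>\<open>T\<^sub>n(A)\<close> is the power with exponent \<open>Suc n\<close>: component 1
  is the base point and component \<open>Suc j\<close> the jth tangent vector.\<close>

definition biT :: "('o, 'm) tangent" where
  "biT = \<lparr> tanTn = (\<lambda>n. pwF X (Suc n)),
     tp = (\<lambda>A. pj X 2 A 1),
     tq = (\<lambda>n j A. tup X [pj X (Suc n) A 1, pj X (Suc n) A (Suc j)]),
     ts = (\<lambda>A. tup X [pj X 3 A 1, pj X 3 A 2 \<oplus> pj X 3 A 3]),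
     tz = (\<lambda>A. tup X [Ide X A, zero X A A]),
     tl = (\<lambda>A. tup X [tup X [pj X 2 A 1, zero X (pw X 2 A) A], tup X [zero X (pw X 2 A) A, pj X 2 A 2]]),
     tc = (\<lambda>A. tup X [tup X [pj4 X A 1, pj4 X A 3], tup X [pj4 X A 2, pj4 X A 4]]) \<rparr>"

lemma biT_simps [simp]:
  "tanTn biT n = pwF X (Suc n)" "tp biT A = pj X 2 A 1"
  "tq biT n j A = tup X [pj X (Suc n) A 1, pj X (Suc n) A (Suc j)]"
  "ts biT A = tup X [pj X 3 A 1, pj X 3 A 2 \<oplus> pj X 3 A 3]"
  "tz biT A = tup X [Ide X A, zero X A A]"
  "tl biT A = tup X [tup X [pj X 2 A 1, zero X (pw X 2 A) A], tup X [zero X (pw X 2 A) A, pj X 2 A 2]]"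
  "tc biT A = tup X [tup X [pj4 X A 1, pj4 X A 3], tup X [pj4 X A 2, pj4 X A 4]]"
  by (simp_all add: biT_def)

lemma pj4_simps [simp]:
  "pj4 X A 1 = pj X 2 A 1 \<cdot> pj X 2 (pw X 2 A) 1" "pj4 X A 2 = pj X 2 A 2 \<cdot> pj X 2 (pw X 2 A) 1"
  "pj4 X A 3 = pj X 2 A 1 \<cdot> pj X 2 (pw X 2 A) 2" "pj4 X A 4 = pj X 2 A 2 \<cdot> pj X 2 (pw X 2 A) 2"
  by (simp_all add: pj4_def)

text \<open>With \<open>(A\<^sup>n)\<^sup>n\<close> read as n by n matrices over A, this places its
  argument on the diagonal.\<close>

definition pw_unit :: "nat \<Rightarrow> 'o \<Rightarrow> 'm" where
  "pw_unit n A = tup X (map (inc n A) [1..<Suc n])"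

text \<open>The trace of such a matrix, given by its restrictions to the injections.\<close>

definition pw_counit :: "nat \<Rightarrow> 'o \<Rightarrow> 'm" where
  "pw_counit n A = (THE h. h \<in> Hom X (pw X n (pw X n A)) A \<and> (\<forall>j\<in>{1..n}. h \<cdot> inc n (pw X n A) j = pj X n A j))"

lemma pw_unit_simps [simp]:
  assumes "1 \<le> n" "A \<in> Obj X"
  shows "pw_unit n A \<in> Arr X" "Dom X (pw_unit n A) = A" "Cod X (pw_unit n A) = pw X n (pw X n A)"
    "1 \<le> i \<Longrightarrow> i \<le> n \<Longrightarrow> pj X n (pw X n A) i \<cdot> pw_unit n A = inc n A i"
    "1 \<le> i \<Longrightarrow> i \<le> n \<Longrightarrow> h \<in> Arr X \<Longrightarrow> Cod X h = A \<Longrightarrow>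
      pj X n (pw X n A) i \<cdot> (pw_unit n A \<cdot> h) = inc n A i \<cdot> h"
proof -
  have "inc n A j \<in> Arr X \<and> Dom X (inc n A j) = A \<and> Cod X (inc n A j) = pw X n A" if "1 \<le> j" "j \<le> n" for j
    using assms that by simp
  note t = tup_map[of n "inc n A" A "pw X n A", OF assms(1) this]
  show s: "pw_unit n A \<in> Arr X" "Dom X (pw_unit n A) = A" "Cod X (pw_unit n A) = pw X n (pw X n A)"
    and p: "1 \<le> i \<Longrightarrow> i \<le> n \<Longrightarrow> pj X n (pw X n A) i \<cdot> pw_unit n A = inc n A i"
    using t unfolding pw_unit_def by blast+
  show "pj X n (pw X n A) i \<cdot> (pw_unit n A \<cdot> h) = inc n A i \<cdot> h"
    if "1 \<le> i" "i \<le> n" "h \<in> Arr X" "Cod X h = A"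
    using s p that assms by (simp add: assoc_left)
qed

lemma pw_counit_simps [simp]:
  assumes "1 \<le> n" "A \<in> Obj X"
  shows "pw_counit n A \<in> Arr X" "Dom X (pw_counit n A) = pw X n (pw X n A)" "Cod X (pw_counit n A) = A"
    "1 \<le> i \<Longrightarrow> i \<le> n \<Longrightarrow> pw_counit n A \<cdot> inc n (pw X n A) i = pj X n A i"
    "1 \<le> i \<Longrightarrow> i \<le> n \<Longrightarrow> h \<in> Arr X \<Longrightarrow> Cod X h = pw X n A \<Longrightarrow>
      pw_counit n A \<cdot> (inc n (pw X n A) i \<cdot> h) = pj X n A i \<cdot> h"
proof -
  have "\<exists>!h. h \<in> Hom X (pw X n (pw X n A)) A \<and> (\<forall>j\<in>{1..n}. h \<cdot> inc n (pw X n A) j = pj X n A j)"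
    by (rule pw_coex1) (use assms in \<open>simp_all add: Hom_iff\<close>)
  note t = theI'[OF this, folded pw_counit_def]
  show s: "pw_counit n A \<in> Arr X" "Dom X (pw_counit n A) = pw X n (pw X n A)" "Cod X (pw_counit n A) = A"
    and p: "1 \<le> i \<Longrightarrow> i \<le> n \<Longrightarrow> pw_counit n A \<cdot> inc n (pw X n A) i = pj X n A i"
    using t by (simp_all add: Hom_iff)
  show "pw_counit n A \<cdot> (inc n (pw X n A) i \<cdot> h) = pj X n A i \<cdot> h"
    if "1 \<le> i" "i \<le> n" "h \<in> Arr X" "Cod X h = pw X n A"
    using s p that assms by (simp add: assoc_left)
qed

lemma pwF_inc:
  assumes "1 \<le> i" "i \<le> n" "f \<in> Arr X" "Dom X f = A"
  shows "ar (pwF X n) f \<cdot> inc n A i = inc n (Cod X f) i \<cdot> f"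
proof -
  have o: "A \<in> Obj X" and n: "1 \<le> n" using assms by auto
  show ?thesis
    by (rule pw_ext[of "Cod X f" _ n]) (use assms o n in simp_all)
qed

text \<open>A finite power is also a copower, so arrows \<open>A\<^sup>n \<rightarrow> B\<close> and
  arrows \<open>A \<rightarrow> B\<^sup>n\<close> are both n-tuples of arrows
  \<open>A \<rightarrow> B\<close>. Equations out of a power are checked on injections, equations
  into one on projections.\<close>

lemma pw_adjunction:
  assumes n: "1 \<le> n"
  shows "adjunction X X (pwF X n) (pwF X n) (pw_unit n) (pw_counit n)"
proof -
  note F = pwF_functor[OF n]
  have u: "pw_unit n (Cod X f) \<cdot> f = ar (pwF X n) (ar (pwF X n) f) \<cdot> pw_unit n (Dom X f)" if f: "f \<in> Arr X" for f
    by (rule pw_ext[of "pw X n (Cod X f)" _ n]) (use f n in \<open>simp_all add: pwF_inc\<close>)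
  have c: "pw_counit n (Cod X f) \<cdot> ar (pwF X n) (ar (pwF X n) f) = f \<cdot> pw_counit n (Dom X f)" if f: "f \<in> Arr X" for f
    by (rule pw_coext[of "pw X n (Dom X f)" _ n]) (use f n in \<open>simp_all add: pwF_inc assoc\<close>)
  have t1: "pw_counit n (pw X n A) \<cdot> ar (pwF X n) (pw_unit n A) = Ide X (pw X n A)" if A: "A \<in> Obj X" for A
    by (rule pw_coext[of A _ n]) (use A n in \<open>simp_all add: pwF_inc assoc\<close>)
  have t2: "ar (pwF X n) (pw_counit n A) \<cdot> pw_unit n (pw X n A) = Ide X (pw X n A)" if A: "A \<in> Obj X" for A
    by (rule pw_ext[of A _ n]) (use A n in \<open>simp_all add: assoc\<close>)
  show ?thesis
    unfolding adjunction_def nat_trans_iff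
    using F is_functor_compF[OF F F] is_functor_idF[OF category_axioms] n
    by (simp add: u c t1 t2)
qed

lemma bi_pullback:
  assumes A: "A \<in> Obj X" and n: "1 \<le> n"
  shows "is_nfold_pullback X n (pj X 2 A 1) (pw X (Suc n) A)
    (\<lambda>j. tup X [pj X (Suc n) A 1, pj X (Suc n) A (Suc j)])"
proof (rule nfold_pullbackI)
  let ?q = "\<lambda>j. tup X [pj X (Suc n) A 1, pj X (Suc n) A (Suc j)]"
  show "pj X 2 A 1 \<in> Arr X" "pw X (Suc n) A \<in> Obj X"
    using A by simp_all
  show "?q j \<in> Hom X (pw X (Suc n) A) (Dom X (pj X 2 A 1))" if "j \<in> {1..n}" for j
    using A that by (simp_all add: Hom_iff)
  show "pj X 2 A 1 \<cdot> ?q j = pj X 2 A 1 \<cdot> ?q k" if "j \<in> {1..n}" "k \<in> {1..n}" for j k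
    using A that by simp
  fix Z g
  assume Z: "Z \<in> Obj X" and "\<And>j. j \<in> {1..n} \<Longrightarrow> g j \<in> Hom X Z (Dom X (pj X 2 A 1))"
    and eq: "\<And>j k. j \<in> {1..n} \<Longrightarrow> k \<in> {1..n} \<Longrightarrow> pj X 2 A 1 \<cdot> g j = pj X 2 A 1 \<cdot> g k"
  then have g: "g j \<in> Arr X" "Dom X (g j) = Z" "Cod X (g j) = pw X 2 A" if "1 \<le> j" "j \<le> n" for j
    using that A by (simp_all add: Hom_iff)
  \<comment> \<open>All \<open>g j\<close> share their first component, so it is taken from
    \<open>g 1\<close>; position i of the power holds the vector of
    \<open>g (i - 1)\<close>.\<close>
  define c where "c i = (if i = 1 then pj X 2 A 1 \<cdot> g 1 else pj X 2 A 2 \<cdot> g (i - 1))" for i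
  have c: "c i \<in> Hom X Z A" if "1 \<le> i" "i \<le> Suc n" for i
    using A n that g[of 1] g[of "i - 1"] by (simp add: c_def Hom_iff le_diff_conv)
  obtain h where h0: "h \<in> Hom X Z (pw X (Suc n) A)" "\<forall>j\<in>{1..Suc n}. pj X (Suc n) A j \<cdot> h = c j"
    using ex1_implies_ex[OF pw_ex1[OF A Z, of "Suc n" c]] c by blast
  have h: "h \<in> Arr X" "Dom X h = Z" "Cod X h = pw X (Suc n) A"
    and hp: "pj X (Suc n) A j \<cdot> h = c j" if "1 \<le> j" "j \<le> Suc n" for j
    using h0 that by (simp_all add: Hom_iff)
  have h: "h \<in> Arr X" "Dom X h = Z" "Cod X h = pw X (Suc n) A"
    using h0 by (simp_all add: Hom_iff)
  show "\<exists>!h. h \<in> Hom X Z (pw X (Suc n) A) \<and> (\<forall>j\<in>{1..n}. ?q j \<cdot> h = g j)"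
  proof (rule ex1I[of _ h], intro conjI ballI)
    show "h \<in> Hom X Z (pw X (Suc n) A)" by fact
    show "?q j \<cdot> h = g j" if j: "j \<in> {1..n}" for j
      by (rule pw2_ext[of A]) (use A n h hp[of 1] hp[of "Suc j"] g[of j] j eq[of 1 j] in \<open>simp_all add: c_def\<close>)
    fix h' assume h': "h' \<in> Hom X Z (pw X (Suc n) A) \<and> (\<forall>j\<in>{1..n}. ?q j \<cdot> h' = g j)"
    then have h1: "h' \<in> Arr X" "Dom X h' = Z" "Cod X h' = pw X (Suc n) A"
      by (simp_all add: Hom_iff)
    have h2: "?q j \<cdot> h' = g j" if "1 \<le> j" "j \<le> n" for j using h' that by simp
    show "h' = h"
    proof (rule pw_ext[of A _ "Suc n"])
      fix i assume i: "1 \<le> i" "i \<le> Suc n"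
      show "pj X (Suc n) A i \<cdot> h' = pj X (Suc n) A i \<cdot> h"
      proof (cases "i = 1")
        case True
        then show ?thesis
          using arg_cong[OF h2[of 1], of "\<lambda>x. pj X 2 A 1 \<cdot> x"] n A h1 hp[of 1] by (simp add: c_def)
      next
        case False
        then obtain j where j: "i = Suc j" "1 \<le> j" "j \<le> n" using i by (cases i) auto
        then show ?thesis
          using arg_cong[OF h2[OF j(2,3)], of "\<lambda>x. pj X 2 A 2 \<cdot> x"] A h1 hp[of "Suc j"] by (simp add: c_def)
      qed
    qed (use A h h1 in simp_all)
  qed
qed

text \<open>The squaring functor is a right adjoint by the self-adjunction, hence preserves the
  pullbacks.\<close>

lemma bi_pullbacks:
  assumes A: "A \<in> Obj X" and n: "1 \<le> n"
  shows "is_nfold_pullback X n (ar (powF (pwF X 2) m) (pj X 2 A 1)) (ob (powF (pwF X 2) m) (pw X (Suc n) A))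
    (\<lambda>j. ar (powF (pwF X 2) m) (tup X [pj X (Suc n) A 1, pj X (Suc n) A (Suc j)]))"
proof (induction m)
  case 0
  then show ?case using bi_pullback[OF assms] by simp
next
  case (Suc m)
  then show ?case using right_adjoint_nfold_pullback[OF pw_adjunction[of 2]] by simp
qed

lemma bi_pair:
  assumes A: "A \<in> Obj X" and u: "u \<in> Arr X" "Cod X u = pw X 2 A"
    and v: "v \<in> Arr X" "Dom X v = Dom X u" "Cod X v = pw X 2 A" and eq: "pj X 2 A 1 \<cdot> u = pj X 2 A 1 \<cdot> v"
  shows "pairT2 X biT A u v = tup X [pj X 2 A 1 \<cdot> u, pj X 2 A 2 \<cdot> u, pj X 2 A 2 \<cdot> v]"
proof -
  let ?h = "tup X [pj X 2 A 1 \<cdot> u, pj X 2 A 2 \<cdot> u, pj X 2 A 2 \<cdot> v]"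
  have 3: "Suc 1 = (2::nat)" "Suc 2 = (3::nat)" by simp_all
  have "tup X [pj X 3 A 1, pj X 3 A 2] \<cdot> ?h = u"
    by (rule pw2_ext[of A]) (use A u v in simp_all)
  moreover have "tup X [pj X 3 A 1, pj X 3 A 3] \<cdot> ?h = v"
    by (rule pw2_ext[of A]) (use A u v eq in simp_all)
  ultimately show ?thesis
    unfolding pairT2_def biT_simps 3
    by (intro pb_pair_eq[OF bi_pullback[OF A, of 2], unfolded 3]) (use A u v in simp_all)
qed

lemma bi_pairT:
  assumes A: "A \<in> Obj X" and u: "u \<in> Arr X" "Cod X u = pw X 2 (pw X 2 A)"
    and v: "v \<in> Arr X" "Dom X v = Dom X u" "Cod X v = pw X 2 (pw X 2 A)"
    and eq: "pj X 2 A 1 \<cdot> (pj X 2 (pw X 2 A) 1 \<cdot> u) = pj X 2 A 1 \<cdot> (pj X 2 (pw X 2 A) 1 \<cdot> v)"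
      "pj X 2 A 1 \<cdot> (pj X 2 (pw X 2 A) 2 \<cdot> u) = pj X 2 A 1 \<cdot> (pj X 2 (pw X 2 A) 2 \<cdot> v)"
  shows "pairTT2 X biT A u v =
    tup X [tup X [pj X 2 A 1 \<cdot> (pj X 2 (pw X 2 A) 1 \<cdot> u), pj X 2 A 2 \<cdot> (pj X 2 (pw X 2 A) 1 \<cdot> u),
                  pj X 2 A 2 \<cdot> (pj X 2 (pw X 2 A) 1 \<cdot> v)],
           tup X [pj X 2 A 1 \<cdot> (pj X 2 (pw X 2 A) 2 \<cdot> u), pj X 2 A 2 \<cdot> (pj X 2 (pw X 2 A) 2 \<cdot> u),
                  pj X 2 A 2 \<cdot> (pj X 2 (pw X 2 A) 2 \<cdot> v)]]" (is "_ = ?h")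
proof -
  have 3: "Suc 1 = (2::nat)" "Suc 2 = (3::nat)" by simp_all
  have "ar (pwF X 2) (tup X [pj X 3 A 1, pj X 3 A 2]) \<cdot> ?h = u"
    by (rule pw22_ext[of A]) (use A u v in simp_all)
  moreover have "ar (pwF X 2) (tup X [pj X 3 A 1, pj X 3 A 3]) \<cdot> ?h = v"
    by (rule pw22_ext[of A]) (use A u v eq in simp_all)
  ultimately show ?thesis
    unfolding pairTT2_def biT_simps 3
    by (intro pb_pair_eq[OF bi_pullbacks[OF A, of 2 1, unfolded functor_sel], unfolded 3]) (use A u v in simp_all)
qed

lemma pw222_ext:
  assumes A: "A \<in> Obj X" and u: "u \<in> Arr X" "Cod X u = pw X 2 (pw X 2 (pw X 2 A))"
    and v: "v \<in> Arr X" "Dom X v = Dom X u" "Cod X v = pw X 2 (pw X 2 (pw X 2 A))"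
    and eq: "\<forall>i\<in>{1,2}. \<forall>j\<in>{1,2}. \<forall>k\<in>{1,2}.
      pj X 2 A i \<cdot> (pj X 2 (pw X 2 A) j \<cdot> (pj X 2 (pw X 2 (pw X 2 A)) k \<cdot> u)) =
      pj X 2 A i \<cdot> (pj X 2 (pw X 2 A) j \<cdot> (pj X 2 (pw X 2 (pw X 2 A)) k \<cdot> v))"
  shows "u = v"
proof (rule pw2_ext)
  have "pj X 2 (pw X 2 (pw X 2 A)) k \<cdot> u = pj X 2 (pw X 2 (pw X 2 A)) k \<cdot> v" if "k \<in> {1,2}" for k
    by (rule pw22_ext[of A]) (use that assms in auto)
  then show "pj X 2 (pw X 2 (pw X 2 A)) 1 \<cdot> u = pj X 2 (pw X 2 (pw X 2 A)) 1 \<cdot> v"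
    "pj X 2 (pw X 2 (pw X 2 A)) 2 \<cdot> u = pj X 2 (pw X 2 (pw X 2 A)) 2 \<cdot> v" by simp_all
qed (use assms in simp_all)

lemma bi_ts:
  assumes A: "A \<in> Obj X"
  shows "ts biT A \<in> Arr X" "Dom X (ts biT A) = pw X 3 A" "Cod X (ts biT A) = pw X 2 A"
    "pj X 2 A 1 \<cdot> ts biT A = pj X 3 A 1" "pj X 2 A 2 \<cdot> ts biT A = pj X 3 A 2 \<oplus> pj X 3 A 3"
    "h \<in> Arr X \<Longrightarrow> Cod X h = pw X 3 A \<Longrightarrow> pj X 2 A 1 \<cdot> (ts biT A \<cdot> h) = pj X 3 A 1 \<cdot> h"
    "h \<in> Arr X \<Longrightarrow> Cod X h = pw X 3 A \<Longrightarrow>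
      pj X 2 A 2 \<cdot> (ts biT A \<cdot> h) = (pj X 3 A 2 \<cdot> h) \<oplus> (pj X 3 A 3 \<cdot> h)"
  using A by (simp_all add: add_comp)

text \<open>The flip exchanges the two indices of a component. With these rules \<open>tc\<close>
  can stay folded in computations with iterated powers.\<close>

lemma bi_tc:
  assumes A: "A \<in> Obj X"
  shows "tc biT A \<in> Arr X" "Dom X (tc biT A) = pw X 2 (pw X 2 A)" "Cod X (tc biT A) = pw X 2 (pw X 2 A)"
    and "i \<in> {1,2} \<Longrightarrow> j \<in> {1,2} \<Longrightarrow> h \<in> Arr X \<Longrightarrow> Cod X h = pw X 2 (pw X 2 A) \<Longrightarrow>
      pj X 2 A i \<cdot> (pj X 2 (pw X 2 A) j \<cdot> (tc biT A \<cdot> h)) = pj X 2 A j \<cdot> (pj X 2 (pw X 2 A) i \<cdot> h)"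
    and "i \<in> {1,2} \<Longrightarrow> j \<in> {1,2} \<Longrightarrow>
      pj X 2 A i \<cdot> (pj X 2 (pw X 2 A) j \<cdot> tc biT A) = pj X 2 A j \<cdot> pj X 2 (pw X 2 A) i"
  using A by (auto simp: assoc)

lemma bi_universality:
  assumes A: "A \<in> Obj X"
  shows "is_equalizer X (ar (pwF X 2) (pj X 2 A 1))
    (tup X [Ide X A, zero X A A] \<cdot> pj X 2 A 1 \<cdot> pj X 2 (pw X 2 A) 1) (univ_lift X biT A)"
proof -
  let ?f = "ar (pwF X 2) (pj X 2 A 1)" and ?g = "tup X [Ide X A, zero X A A] \<cdot> pj X 2 A 1 \<cdot> pj X 2 (pw X 2 A) 1"
  \<comment> \<open>The universal lift in components: \<open>(x, u, v)\<close> goes to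
    \<open>((x, v), (0, u))\<close>.\<close>
  let ?e = "tup X [tup X [pj X 3 A 1, pj X 3 A 3], tup X [zero X (pw X 3 A) A, pj X 3 A 2]]"
  have e: "univ_lift X biT A = ?e"
    unfolding univ_lift_def
    by (rule pw22_ext[of A]) (use A in \<open>simp_all add: bi_pairT add_comp assoc\<close>)
  have "?f \<cdot> ?e = ?g \<cdot> ?e"
    by (rule pw2_ext[of A]) (use A in \<open>simp_all add: assoc\<close>)
  moreover have "\<exists>!k. k \<in> Hom X Z (pw X 3 A) \<and> ?e \<cdot> k = h"
    if Z: "Z \<in> Obj X" and h: "h \<in> Hom X Z (Dom X ?f)" and eq: "?f \<cdot> h = ?g \<cdot> h" for Z h
  proof (rule ex1I)
    have h': "h \<in> Arr X" "Dom X h = Z" "Cod X h = pw X 2 (pw X 2 A)"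
      using h A by (simp_all add: Hom_iff)
    let ?k = "tup X [pj X 2 A 1 \<cdot> (pj X 2 (pw X 2 A) 1 \<cdot> h), pj X 2 A 2 \<cdot> (pj X 2 (pw X 2 A) 2 \<cdot> h),
      pj X 2 A 2 \<cdot> (pj X 2 (pw X 2 A) 1 \<cdot> h)]"
    \<comment> \<open>Being equalized forces the third component to vanish; the other three give the
      factorization.\<close>
    have z: "pj X 2 A 1 \<cdot> (pj X 2 (pw X 2 A) 2 \<cdot> h) = zero X Z A"
      using arg_cong[OF eq, of "\<lambda>x. pj X 2 A 2 \<cdot> x"] A h' by (simp add: assoc)
    have "?e \<cdot> ?k = h"
      by (rule pw22_ext[of A]) (use A h' z in simp_all)
    then show "?k \<in> Hom X Z (pw X 3 A) \<and> ?e \<cdot> ?k = h"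
      using A h' by (simp add: Hom_iff)
    fix k assume "k \<in> Hom X Z (pw X 3 A) \<and> ?e \<cdot> k = h"
    then have k: "k \<in> Arr X" "Dom X k = Z" "Cod X k = pw X 3 A" and hk: "h = ?e \<cdot> k"
      by (auto simp: Hom_iff)
    show "k = ?k"
      by (rule pw3_ext[of A]) (use A k in \<open>simp_all add: hk\<close>)
  qed
  ultimately show ?thesis
    unfolding is_equalizer_iff[OF category_axioms] e
    by (intro conjI ballI impI) (use A in \<open>simp_all add: Hom_iff[of ?g]\<close>)
qed

section \<open>Axioms for the tangent structure of powers\<close>

lemma bi_natural:
  "1 \<le> j \<Longrightarrow> j \<le> n \<Longrightarrow> nat_trans X X (tanTn biT n) (tanT biT) (tq biT n j)"
  "nat_trans X X (tanT biT) idF (tp biT)" "nat_trans X X (tanTn biT 2) (tanT biT) (ts biT)"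
  "nat_trans X X idF (tanT biT) (tz biT)" "nat_trans X X (tanT biT) (tanT biT \<circ>\<^sub>F tanT biT) (tl biT)"
  "nat_trans X X (tanT biT \<circ>\<^sub>F tanT biT) (tanT biT \<circ>\<^sub>F tanT biT) (tc biT)"
proof -
  have F: "is_functor X X (tanTn biT n)" for n using pwF_functor[of "Suc n"] by simp
  note F2 = F is_functor_compF[OF F F] is_functor_idF[OF category_axioms]
  show "nat_trans X X (tanTn biT n) (tanT biT) (tq biT n j)" if "1 \<le> j" "j \<le> n"
    unfolding nat_trans_iff
  proof (intro conjI ballI F2)
    fix f assume f: "f \<in> Arr X"
    show "tq biT n j (Cod X f) \<cdot> ar (tanTn biT n) f = ar (tanT biT) f \<cdot> tq biT n j (Dom X f)"
      by (rule pw2_ext[of "Cod X f"]) (use f that in simp_all)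
  qed (use that in simp_all)
  show "nat_trans X X (tanT biT) idF (tp biT)"
    unfolding nat_trans_iff by (intro conjI ballI F2) simp_all
  show "nat_trans X X (tanTn biT 2) (tanT biT) (ts biT)"
    unfolding nat_trans_iff
  proof (intro conjI ballI F2)
    fix f assume f: "f \<in> Arr X"
    show "ts biT (Cod X f) \<cdot> ar (tanTn biT 2) f = ar (tanT biT) f \<cdot> ts biT (Dom X f)"
      by (rule pw2_ext[of "Cod X f"]) (use f in \<open>simp_all add: comp_add add_comp\<close>)
  qed simp_all
  show "nat_trans X X idF (tanT biT) (tz biT)"
    unfolding nat_trans_iff
  proof (intro conjI ballI F2)
    fix f assume f: "f \<in> Arr X"
    show "tz biT (Cod X f) \<cdot> ar idF f = ar (tanT biT) f \<cdot> tz biT (Dom X f)"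
      by (rule pw2_ext[of "Cod X f"]) (use f in simp_all)
  qed simp_all
  show "nat_trans X X (tanT biT) (tanT biT \<circ>\<^sub>F tanT biT) (tl biT)"
    unfolding nat_trans_iff
  proof (intro conjI ballI F2)
    fix f assume f: "f \<in> Arr X"
    show "tl biT (Cod X f) \<cdot> ar (tanT biT) f = ar (tanT biT \<circ>\<^sub>F tanT biT) f \<cdot> tl biT (Dom X f)"
      by (rule pw22_ext[of "Cod X f"]) (use f in simp_all)
  qed simp_all
  show "nat_trans X X (tanT biT \<circ>\<^sub>F tanT biT) (tanT biT \<circ>\<^sub>F tanT biT) (tc biT)"
    unfolding nat_trans_iff
  proof (intro conjI ballI F2)
    fix f assume f: "f \<in> Arr X"
    show "tc biT (Cod X f) \<cdot> ar (tanT biT \<circ>\<^sub>F tanT biT) f = ar (tanT biT \<circ>\<^sub>F tanT biT) f \<cdot> tc biT (Dom X f)"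
      by (rule pw22_ext[of "Cod X f"]) (use f in \<open>simp_all add: assoc\<close>)
  qed simp_all
qed

lemma bi_tangent_category: "tangent_category X biT"
proof (rule tangent_category.intro[OF category_axioms], unfold_locales)
  show "is_functor X X (tanTn biT n)" for n using pwF_functor[of "Suc n"] by simp
  show "nat_trans X X (tanTn biT n) (tanT biT) (tq biT n j)" if "j \<in> {1..n}" for j n
    using bi_natural(1)[of j n] that by simp
  fix A assume A: "A \<in> Obj X"
  show "is_nfold_pullback X n (ar (powF (tanT biT) m) (tp biT A))
        (ob (powF (tanT biT) m) (ob (tanTn biT n) A)) (\<lambda>j. ar (powF (tanT biT) m) (tq biT n j A))"
    if "1 \<le> n" for n m
    using bi_pullbacks[OF A that, of m] by simp
  show "tq biT 1 1 A = Ide X (ob (tanT biT) A)"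
    by (rule pw2_ext[of A]) (use A in simp_all)
  show "tp biT A \<cdot> ts biT A = tp biT A \<cdot> tq biT 2 1 A"
    using A by simp
  show "tp biT A \<cdot> tz biT A = Ide X A"
    using A by simp
  show "ts biT A \<cdot> pairT2 X biT A (tz biT A \<cdot> tp biT A) (Ide X (ob (tanT biT) A)) = Ide X (ob (tanT biT) A)"
    by (rule pw2_ext[of A]) (use A in \<open>simp_all add: bi_pair add_comp\<close>)
  show "ts biT A \<cdot> pairT2 X biT A (tq biT 2 2 A) (tq biT 2 1 A) = ts biT A"
    by (rule pw2_ext[of A]) (use A add_commute[of "pj X 3 A 2" "pj X 3 A 3"] in \<open>simp_all add: bi_pair add_comp\<close>)
  show "ts biT A \<cdot> pairT2 X biT A (ts biT A \<cdot> pairT2 X biT A (tq biT 3 1 A) (tq biT 3 2 A)) (tq biT 3 3 A) =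
      ts biT A \<cdot> pairT2 X biT A (tq biT 3 1 A) (ts biT A \<cdot> pairT2 X biT A (tq biT 3 2 A) (tq biT 3 3 A))"
    by (rule pw2_ext[of A]) (use A in \<open>simp_all add: bi_pair add_comp add_assoc\<close>)
  show "ar (tanT biT) (tp biT A) \<cdot> tl biT A = tz biT A \<cdot> tp biT A"
    by (rule pw2_ext[of A]) (use A in simp_all)
  show "tl biT A \<cdot> ts biT A = ar (tanT biT) (ts biT A) \<cdot> pairTT2 X biT A (tl biT A \<cdot> tq biT 2 1 A) (tl biT A \<cdot> tq biT 2 2 A)"
    by (rule pw22_ext[of A]) (use A in \<open>simp_all add: bi_pairT add_comp assoc\<close>)
  show "tl biT A \<cdot> tz biT A = ar (tanT biT) (tz biT A) \<cdot> tz biT A"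
    by (rule pw22_ext[of A]) (use A in simp_all)
  show "tp biT (ob (tanT biT) A) \<cdot> tc biT A = ar (tanT biT) (tp biT A)"
    by (rule pw2_ext[of A]) (use A in simp_all)
  show "tc biT A \<cdot> ar (tanT biT) (ts biT A) = ts biT (ob (tanT biT) A) \<cdot>
    pairT2 X biT (ob (tanT biT) A) (tc biT A \<cdot> ar (tanT biT) (tq biT 2 1 A)) (tc biT A \<cdot> ar (tanT biT) (tq biT 2 2 A))"
  proof -
    have "pj X 2 (pw X 2 A) 1 \<cdot> (tc biT A \<cdot> ar (pwF X 2) (tq biT 2 1 A)) = pj X 2 (pw X 2 A) 1 \<cdot> (tc biT A \<cdot> ar (pwF X 2) (tq biT 2 2 A))"
      by (rule pw2_ext[of A]) (use A in \<open>simp_all add: assoc\<close>)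
    from bi_pair[OF _ _ _ _ _ _ this] show ?thesis
      using A by - (rule pw22_ext[of A],
        simp_all add: bi_ts bi_tc comp_add add_comp del: biT_simps(4,7))
  qed
  show "tc biT A \<cdot> ar (tanT biT) (tz biT A) = tz biT (ob (tanT biT) A)"
    by (rule pw22_ext[of A]) (use A in \<open>simp_all add: assoc\<close>)
  show "tc biT A \<cdot> tc biT A = Ide X (ob (tanT biT) (ob (tanT biT) A))"
    by (rule pw22_ext[of A]) (use A in \<open>simp_all add: assoc\<close>)
  show "tc biT A \<cdot> tl biT A = tl biT A"
    by (rule pw22_ext[of A]) (use A in \<open>simp_all add: assoc\<close>)
  show "ar (tanT biT) (tl biT A) \<cdot> tl biT A = tl biT (ob (tanT biT) A) \<cdot> tl biT A"
    by (rule pw222_ext[of A]) (use A in \<open>simp_all add: assoc\<close>)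
  show "ar (tanT biT) (tc biT A) \<cdot> tc biT (ob (tanT biT) A) \<cdot> ar (tanT biT) (tc biT A) =
      tc biT (ob (tanT biT) A) \<cdot> ar (tanT biT) (tc biT A) \<cdot> tc biT (ob (tanT biT) A)"
    by (rule pw222_ext[of A]) (use A in \<open>simp_all add: bi_tc del: biT_simps(7)\<close>)
  show "tc biT (ob (tanT biT) A) \<cdot> ar (tanT biT) (tc biT A) \<cdot> tl biT (ob (tanT biT) A) = ar (tanT biT) (tl biT A) \<cdot> tc biT A"
    by (rule pw222_ext[of A]) (use A in \<open>simp_all add: bi_tc del: biT_simps(7)\<close>)
  show "is_equalizer X (ar (tanT biT) (tp biT A)) (tz biT A \<cdot> tp biT A \<cdot> tp biT (ob (tanT biT) A)) (univ_lift X biT A)"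
    using bi_universality[OF A] by simp
qed (fact bi_natural)+

abbreviation "bi_op \<equiv> adjoint_tangent X biT (\<lambda>n. pwF X (Suc n)) (\<lambda>n. pw_unit (Suc n)) (\<lambda>n. pw_counit (Suc n))"

lemma bi_adjoint:
  "adjoint_tangent_structure X biT (\<lambda>n. pwF X (Suc n)) (\<lambda>n. pw_unit (Suc n)) (\<lambda>n. pw_counit (Suc n))"
  by (rule adjoint_tangent_structure.intro[OF bi_tangent_category], unfold_locales)
    (simp add: adjoint_data_def pw_adjunction)

section \<open>Identification of the mates with the explicit structure on the opposite
  category\<close>

lemma opB_simps [simp]:
  "tanTn (opB X) n = pwF X (Suc n)" "tp (opB X) A = tup X [Ide X A, zero X A A]"
  "tq (opB X) n j A = tup X (map (\<lambda>i. if i = 1 then pj X 2 A 1 else if i = Suc j then pj X 2 A 2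
     else zero X (pw X 2 A) A) [1..<Suc (Suc n)])"
  "ts (opB X) A = tup X [pj X 2 A 1, pj X 2 A 2, pj X 2 A 2]"
  "tz (opB X) A = pj X 2 A 1" "tl (opB X) A = tup X [pj4 X A 1, pj4 X A 4]"
  "tc (opB X) A = tup X [tup X [pj4 X A 1, pj4 X A 3], tup X [pj4 X A 2, pj4 X A 4]]"
  by (simp_all add: opB_def del: upt_Suc)

text \<open>The ith component of a transpose is the restriction of the arrow to the ith injection.
  Each mate is thus found by comparing restrictions to injections: read as matrices, the structure
  maps of \<open>biT\<close> and of \<open>opB\<close> are transposes of each other.\<close>

lemma bi_op_eq:
  assumes A: "A \<in> Obj X"
  shows "tp bi_op A = tp (opB X) A" "ts bi_op A = ts (opB X) A" "tz bi_op A = tz (opB X) A"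
    "tl bi_op A = tl (opB X) A" "tc bi_op A = tc (opB X) A"
    and "1 \<le> j \<Longrightarrow> j \<le> n \<Longrightarrow> tq bi_op n j A = tq (opB X) n j A"
proof -
  interpret E: adjoint_tangent_structure X biT "\<lambda>n. pwF X (Suc n)" "\<lambda>n. pw_unit (Suc n)" "\<lambda>n. pw_counit (Suc n)"
    by (rule bi_adjoint)
  note Top = E.Top_def[symmetric]
  have pj_flat: "pj X (Suc n) (Cod X h) i \<cdot> E.flat n B h = h \<cdot> inc (Suc n) B i"
    if "1 \<le> n" "1 \<le> i" "i \<le> Suc n" "B \<in> Obj X" "h \<in> Arr X" "Dom X h = pw X (Suc n) B" for n i B h
    using that by (simp add: E.flat_def)
  have pj_flat1: "pj X 2 Y i \<cdot> E.flat 1 B h = h \<cdot> inc 2 B i"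
    if "i \<in> {1,2}" "B \<in> Obj X" "h \<in> Arr X" "Dom X h = pw X 2 B" "Cod X h = Y" for i B h Y
    using pj_flat[of 1 i B h] that by auto
  \<comment> \<open>Nesting reverses under double transposition: the outer projection, with index j,
    belongs to the inner injection.\<close>
  have pj_flat2: "pj X 2 Y i \<cdot> (pj X 2 (pw X 2 Y) j \<cdot> E.flat 1 B (E.flat 1 (pw X 2 B) h)) =
      h \<cdot> (inc 2 (pw X 2 B) i \<cdot> inc 2 B j)"
    if "i \<in> {1,2}" "j \<in> {1,2}" "B \<in> Obj X" "h \<in> Arr X" "Dom X h = pw X 2 (pw X 2 B)" "Cod X h = Y" for i j B h Y
  proof -
    have f: "E.flat 1 (pw X 2 B) h \<in> Arr X" "Dom X (E.flat 1 (pw X 2 B) h) = pw X 2 B"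
      "Cod X (E.flat 1 (pw X 2 B) h) = pw X 2 Y"
      using that by (simp_all add: E.flat_def)
    have "pj X 2 (pw X 2 Y) j \<cdot> E.flat 1 B (E.flat 1 (pw X 2 B) h) = E.flat 1 (pw X 2 B) h \<cdot> inc 2 B j"
      using pj_flat1[OF that(2,3) f(1,2)] f(3) by simp
    moreover have "pj X 2 Y i \<cdot> (E.flat 1 (pw X 2 B) h \<cdot> inc 2 B j) = (h \<cdot> inc 2 (pw X 2 B) i) \<cdot> inc 2 B j"
      using comp_extend[OF pj_flat1[of i "pw X 2 B" h Y], of "inc 2 B j"] that f by auto
    ultimately show ?thesis using that by (auto simp: assoc)
  qed
  have Y: "Cod X h \<in> Obj X" if "h \<in> Arr X" for h using that by simp
  show "tp bi_op A = tp (opB X) A"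
    unfolding Top by (rule pw2_ext[of A]) (use A in \<open>simp_all add: E.flat_bare(1)\<close>)
  show "tz bi_op A = tz (opB X) A"
    unfolding Top
  proof (rule E.flat_inj[of 1 A])
    show "E.flat 1 A (tz E.Top A) = E.flat 1 A (tz (opB X) A)"
      unfolding E.flat_bare(4)[OF A]
      by (rule pw2_ext[of A]) (use A in \<open>simp_all add: pj_flat1 E.flat_def\<close>)
  qed (use A E.Top_simps in \<open>simp_all\<close>)
  show "ts bi_op A = ts (opB X) A"
    unfolding Top
  proof (rule E.flat_inj[of 1 A])
    have 1: "tup X [pj X 2 A 1, pj X 2 A 2, pj X 2 A 2] \<cdot> inc 2 A 1 = inc 3 A 1"
      by (rule pw3_ext[of A]) (use A in simp_all)
    have 2: "tup X [pj X 2 A 1, pj X 2 A 2, pj X 2 A 2] \<cdot> inc 2 A 2 = inc 3 A 2 \<oplus> inc 3 A 3"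
      by (rule pw3_ext[of A]) (use A in \<open>simp_all add: comp_add\<close>)
    show "E.flat 1 A (ts E.Top A) = E.flat 1 A (ts (opB X) A)"
      unfolding E.flat_bare(3)[OF A]
      by (rule pw2_ext[of "pw X 3 A"]) (use A in \<open>simp_all add: pj_flat1 add_comp 1 2\<close>)
  qed (use A in simp_all)
  show "tl bi_op A = tl (opB X) A"
    unfolding Top
  proof (rule E.flat2_inj[OF A])
    \<comment> \<open>The opposite lift kills an injection unless both of its indices agree, which
      matches the zero entries of the lift.\<close>
    have e: "i \<in> {1,2} \<Longrightarrow> j \<in> {1,2} \<Longrightarrow>
        tup X [pj X 2 A 1 \<cdot> pj X 2 (pw X 2 A) 1, pj X 2 A 2 \<cdot> pj X 2 (pw X 2 A) 2] \<cdot> (inc 2 (pw X 2 A) i \<cdot> inc 2 A j) =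
        (if i = j then inc 2 A i else zero X A (pw X 2 A))" for i j
      by (rule pw2_ext[of A]) (use A in \<open>auto simp: assoc\<close>)
    have "E.flat 1 A (E.flat 1 (ob (pwF X (Suc 1)) A) (tl E.Top A)) = E.flat 1 A (E.flat 1 (pw X 2 A) (tup X [pj4 X A 1, pj4 X A 4]))"
      unfolding E.flat_bare(5)[OF A]
      by (rule pw22_ext[of "pw X 2 A"]) (use A in \<open>simp_all add: pj_flat2 e\<close>)
    then show "E.flat 1 A (E.flat 1 (ob (pwF X (Suc 1)) A) (tl E.Top A)) =
      E.flat 1 A (E.flat 1 (ob (pwF X (Suc 1)) A) (tl (opB X) A))" by simp
  qed (use A in simp_all)
  show "tc bi_op A = tc (opB X) A"
    unfolding Top
  proof (rule E.flat2_inj[OF A])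
    have e: "i \<in> {1,2} \<Longrightarrow> j \<in> {1,2} \<Longrightarrow> tc biT A \<cdot> (inc 2 (pw X 2 A) i \<cdot> inc 2 A j) =
        inc 2 (pw X 2 A) j \<cdot> inc 2 A i" for i j
      by (rule pw22_ext[of A]) (use A in \<open>auto simp: bi_tc simp del: biT_simps(7)\<close>)
    let ?B = "pw X 2 (pw X 2 A)"
    have u: "pj X 2 ?B i \<cdot> (pj X 2 (pw X 2 ?B) j \<cdot> E.flat 1 A (pw_unit 2 (pw X 2 A))) =
      inc 2 (pw X 2 A) i \<cdot> inc 2 A j" if "i \<in> {1,2}" "j \<in> {1,2}" for i j
    proof -
      have "E.flat 1 (pw X 2 A) (Ide X ?B) = pw_unit 2 (pw X 2 A)"
        using A functor_simps(2)[OF pwF_functor, of 2 ?B] by (simp add: E.flat_def)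
      then show ?thesis using pj_flat2[OF that A, of "Ide X ?B" ?B] A that by auto
    qed
    have f: "E.flat 1 A (pw_unit 2 (pw X 2 A)) \<in> Arr X" "Dom X (E.flat 1 A (pw_unit 2 (pw X 2 A))) = A"
      "Cod X (E.flat 1 A (pw_unit 2 (pw X 2 A))) = pw X 2 (pw X 2 ?B)"
      using A by (simp_all add: E.flat_def)
    have "E.flat 1 A (E.flat 1 (ob (pwF X (Suc 1)) A) (tc E.Top A)) = tc biT ?B \<cdot> E.flat 1 A (pw_unit 2 (pw X 2 A))"
      unfolding E.flat_bare(6)[OF A] using A by (simp del: biT_simps(7))
    also have "\<dots> = E.flat 1 A (E.flat 1 (pw X 2 A) (tc biT A))"
      by (rule pw22_ext[of ?B]) (use A in \<open>simp_all add: pj_flat2 e u f bi_tc del: biT_simps(7)\<close>)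
    finally show "E.flat 1 A (E.flat 1 (ob (pwF X (Suc 1)) A) (tc E.Top A)) =
      E.flat 1 A (E.flat 1 (ob (pwF X (Suc 1)) A) (tc (opB X) A))" by simp
  qed (use A in simp_all)
  show "tq bi_op n j A = tq (opB X) n j A" if j: "1 \<le> j" "j \<le> n"
    unfolding Top
  proof (rule E.flat_inj[of 1 A])
    let ?g = "\<lambda>i. if i = 1 then pj X 2 A 1 else if i = Suc j then pj X 2 A 2 else zero X (pw X 2 A) A"
    let ?w = "tup X (map ?g [1..<Suc (Suc n)])"
    have g: "?g i \<in> Arr X \<and> Dom X (?g i) = pw X 2 A \<and> Cod X (?g i) = A" for i using A by simp
    note t = tup_map[of "Suc n" ?g, OF _ g]
    have t4: "pj X (Suc n) A i \<cdot> (?w \<cdot> h) = ?g i \<cdot> h"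
      if "1 \<le> i" "i \<le> Suc n" "h \<in> Arr X" "Cod X h = pw X 2 A" for i h
      using t(4)[OF _ that(1,2)] comp_extend[of "pj X (Suc n) A i" ?w "?g i" h] that A t(1-3) by simp
    have 1: "?w \<cdot> inc 2 A 1 = inc (Suc n) A 1"
      by (rule pw_ext[of A _ "Suc n"]) (use A t(1-3) in \<open>simp_all add: t4 del: upt_Suc\<close>)
    have 2: "?w \<cdot> inc 2 A 2 = inc (Suc n) A (Suc j)"
      by (rule pw_ext[of A _ "Suc n"]) (use A j t(1-3) in \<open>simp_all add: t4 del: upt_Suc\<close>)
    have f: "E.flat 1 A ?w \<in> Arr X" "Dom X (E.flat 1 A ?w) = A" "Cod X (E.flat 1 A ?w) = pw X 2 (pw X (Suc n) A)"
      using A t(1-3) by (simp_all add: E.flat_def del: upt_Suc)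
    show "E.flat 1 A (tq E.Top n j A) = E.flat 1 A (tq (opB X) n j A)"
      unfolding E.flat_bare(2)[OF A j] opB_simps
      by (rule pw2_ext[of "pw X (Suc n) A"]) (use A j t(1-3) f in \<open>simp_all add: pj_flat1 1 2 del: upt_Suc\<close>)
    show "tq (opB X) n j A \<in> Arr X" "Dom X (tq (opB X) n j A) = ob (pwF X (Suc 1)) A"
      "Cod X (tq (opB X) n j A) = Cod X (tq E.Top n j A)"
      using A j t(1-3) E.Top_simps by (simp_all del: upt_Suc)
  qed (use A j in simp_all)
qed

text \<open>The identification with the mates holds at objects of X, hence the passage through the
  identity functor.\<close>

lemma opB_strict: "strict_tangent_functor (opcat X) (opB X) (opcat X) bi_op idF"
proof (rule tangent_category_cong)
  interpret E: adjoint_tangent_structure X biT "\<lambda>n. pwF X (Suc n)" "\<lambda>n. pw_unit (Suc n)" "\<lambda>n. pw_counit (Suc n)"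
    by (rule bi_adjoint)
  show "tangent_category (opcat X) bi_op"
    using E.tangent_category_Top by (simp add: E.Top_def)
  show "tanTn (opB X) = tanTn bi_op"
    by (simp add: adjoint_tangent_def Let_def fun_eq_iff)
qed (simp_all only: opcat_simps bi_op_eq)

lemma opB_tangent_category: "tangent_category (opcat X) (opB X)"
  using strict_tangent_functor.tangent_category_lift[OF opB_strict] .

text \<open>Biproducts are coproducts of X, so the general result on opposite structures applies;
  preservation of products concerns only the tangent functor, which \<open>opB\<close> shares with
  the mates.\<close>

lemma opB_cartesian_tangent_category: "cartesian_tangent_category (opcat X) (opB X)"
proof -
  interpret E: adjoint_tangent_structure X biT "\<lambda>n. pwF X (Suc n)" "\<lambda>n. pw_unit (Suc n)" "\<lambda>n. pw_counit (Suc n)"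
    by (rule bi_adjoint)
  have "has_finite_coproducts X"
    using biproduct_coproduct unfolding has_finite_coproducts_def by blast
  from E.cartesian_tangent_category_Top[OF this] show ?thesis
    using opB_tangent_category by (simp add: cartesian_tangent_category_def)
qed

end

section \<open>Negation on powers and on the opposite category\<close>

context additive_category
begin

definition biN :: "'o \<Rightarrow> 'm" where
  "biN A = tup X [pj X 2 A 1, neg X (pj X 2 A 2)]"

lemma bi_rosicky: "rosicky_tangent_category X biT biN"
proof (rule rosicky_tangent_category.intro[OF bi_tangent_category], unfold_locales)
  show "nat_trans X X (tanT biT) (tanT biT) biN"
    unfolding nat_trans_iff
  proof (intro conjI ballI)
    fix f assume f: "f \<in> Arr X"
    show "biN (Cod X f) \<cdot> ar (tanT biT) f = ar (tanT biT) f \<cdot> biN (Dom X f)"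
      by (rule pw2_ext[of "Cod X f"]) (use f in \<open>simp_all add: biN_def neg_comp comp_neg\<close>)
  qed (simp_all add: biN_def pwF_functor)
  fix A assume A: "A \<in> Obj X"
  show "tp biT A \<cdot> biN A = tp biT A"
    using A by (simp add: biN_def)
  show "ts biT A \<cdot> pairT2 X biT A (Ide X (ob (tanT biT) A)) (biN A) = tz biT A \<cdot> tp biT A"
    by (rule pw2_ext[of A]) (use A in \<open>simp_all add: biN_def bi_pair add_comp\<close>)
qed

text \<open>Negation is the diagonal matrix with entries 1 and -1, hence its own transpose.\<close>

lemma opBN_eq:
  assumes A: "A \<in> Obj X"
  shows "opBN X A = adjoint_neg X (\<lambda>n. pwF X (Suc n)) (\<lambda>n. pw_unit (Suc n)) (\<lambda>n. pw_counit (Suc n)) biN A"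
    (is "_ = ?n A")
proof -
  interpret E: adjoint_tangent_structure X biT "\<lambda>n. pwF X (Suc n)" "\<lambda>n. pw_unit (Suc n)" "\<lambda>n. pw_counit (Suc n)"
    by (rule bi_adjoint)
  interpret R: rosicky_tangent_category X biT biN by (rule bi_rosicky)
  have n: "?n A \<in> Arr X" "Dom X (?n A) = pw X 2 A" "Cod X (?n A) = pw X 2 A"
    using mate_transpose(1)[OF E.adj[of 1] E.adj[of 1] R.n_natural A] by (simp_all add: adjoint_neg_def Hom_iff)
  have w: "opBN X A \<in> Arr X" "Dom X (opBN X A) = pw X 2 A" "Cod X (opBN X A) = pw X 2 A"
    using A by (simp_all add: opBN_def)
  have 1: "opBN X A \<cdot> inc 2 A 1 = inc 2 A 1"
    by (rule pw2_ext[of A]) (use A in \<open>simp_all add: opBN_def neg_comp\<close>)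
  have 2: "opBN X A \<cdot> inc 2 A 2 = neg X (inc 2 A 2)"
    by (rule pw2_ext[of A]) (use A in \<open>simp_all add: opBN_def neg_comp comp_neg\<close>)
  have "E.flat 1 A (?n A) = biN (pw X 2 A) \<cdot> pw_unit 2 A"
    using E.rosicky_tangent_category_Top(2)[OF bi_rosicky A, of "Ide X (pw X 2 A)"] A n
      functor_simps(2)[OF pwF_functor, of 2 "pw X 2 A"]
    by (simp add: E.flat_def)
  also have "\<dots> = E.flat 1 A (opBN X A)"
    by (rule pw2_ext[of "pw X 2 A"]) (use A w 1 2 in \<open>simp_all add: biN_def neg_comp E.flat_def\<close>)
  finally show ?thesis
    by - (rule E.flat_inj[of 1 A], use A n w in simp_all)
qed

lemma opB_rosicky: "rosicky_tangent_category (opcat X) (opB X) (opBN X)"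
proof -
  interpret E: adjoint_tangent_structure X biT "\<lambda>n. pwF X (Suc n)" "\<lambda>n. pw_unit (Suc n)" "\<lambda>n. pw_counit (Suc n)"
    by (rule bi_adjoint)
  show ?thesis
    using strict_tangent_functor.rosicky_tangent_category_lift[OF opB_strict
        E.rosicky_tangent_category_Top(1)[OF bi_rosicky, unfolded E.Top_def], of "opBN X"]
    by (simp add: opBN_eq[symmetric]) (simp add: opBN_def Hom_iff)
qed

end

text \<open>All conditions on a strong morphism involve the source structure only at objects of C;
  it therefore passes from the mates to the explicit maps.\<close>

lemma strong_tangent_morphism_cong:
  assumes m: "strong_tangent_morphism C B D T' F \<tau>" and C: "tangent_category C T"
    and T: "tanTn T = tanTn B"
    "\<And>A. A \<in> Obj C \<Longrightarrow> tp T A = tp B A" "\<And>A. A \<in> Obj C \<Longrightarrow> ts T A = ts B A"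
    "\<And>A. A \<in> Obj C \<Longrightarrow> tz T A = tz B A" "\<And>A. A \<in> Obj C \<Longrightarrow> tl T A = tl B A"
    "\<And>A. A \<in> Obj C \<Longrightarrow> tc T A = tc B A"
    "\<And>A n j. A \<in> Obj C \<Longrightarrow> 1 \<le> j \<Longrightarrow> j \<le> n \<Longrightarrow> tq T n j A = tq B n j A"
  shows "strong_tangent_morphism C T D T' F \<tau>"
proof -
  interpret C: tangent_category C T by fact
  have o: "ob (tanT B) A \<in> Obj C" if "A \<in> Obj C" for A
    using C.T_simps(1)[of 1 A] that by (simp add: T)
  have u: "univ_lift C T A = univ_lift C B A" if "A \<in> Obj C" for A
    using that by (simp add: univ_lift_def pairTT2_def T o)
  have q: "is_nfold_pullback D n f P (\<lambda>j. ar F (tq T n j A)) \<longleftrightarrow> is_nfold_pullback D n f P (\<lambda>j. ar F (tq B n j A))"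
    if "A \<in> Obj C" "1 \<le> n" for n f P A
    using that by (simp add: is_nfold_pullback_def T)
  show ?thesis
    using m C unfolding strong_tangent_morphism_def tangent_morphism_def
    by (simp add: T o u q)
qed

section \<open>Algebras of a coCartesian differential monad\<close>

lemma ALG_simps [simp]:
  "Obj (ALG X M) = algebras X M" "Dom (ALG X M) (a, f, b) = a" "Cod (ALG X M) (a, f, b) = b"
  "Ide (ALG X M) a = (a, Ide X (fst a), a)"
  "(b', g, c) \<cdot>\<^bsub>ALG X M\<^esub> (a, f, b) = (a, g \<cdot>\<^bsub>X\<^esub> f, c)"
  by (simp_all add: ALG_def)

lemma ALG_Arr_iff:
  "(a, f, b) \<in> Arr (ALG X M) \<longleftrightarrow> a \<in> algebras X M \<and> b \<in> algebras X M \<and> f \<in> Arr X \<and>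
     Dom X f = fst a \<and> Cod X f = fst b \<and> f \<cdot>\<^bsub>X\<^esub> snd a = snd b \<cdot>\<^bsub>X\<^esub> mar M f"
  by (auto simp: ALG_def Hom_iff)

lemma ALG_ArrE:
  assumes "f \<in> Arr (ALG X M)"
  obtains h where "f = (Dom (ALG X M) f, h, Cod (ALG X M) f)" "Dom (ALG X M) f \<in> algebras X M"
    "Cod (ALG X M) f \<in> algebras X M" "h \<in> Arr X" "Dom X h = fst (Dom (ALG X M) f)"
    "Cod X h = fst (Cod (ALG X M) f)" "h \<cdot>\<^bsub>X\<^esub> snd (Dom (ALG X M) f) = snd (Cod (ALG X M) f) \<cdot>\<^bsub>X\<^esub> mar M h"
  using assms by (cases f) (auto simp: ALG_Arr_iff)

definition forgetF :: "('o \<times> 'm, ('o \<times> 'm) \<times> 'm \<times> ('o \<times> 'm), 'o, 'm) functr" where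
  "forgetF = \<lparr> ob = fst, ar = (\<lambda>(a, f, b). f) \<rparr>"

lemma forgetF_simps [simp]: "ob forgetF a = fst a" "ar forgetF (a, f, b) = f"
  by (simp_all add: forgetF_def)

context coCartesian_differential_monad
begin

section \<open>The category of algebras and its forgetful functor\<close>

lemma S_functor: "is_functor X X (Fun M)"
  using unt_natural by (simp add: nat_trans_def)

lemmas S_simps [simp] = functor_simps(1-5)[OF S_functor]
lemmas S_comp = functor_simps(6)[OF S_functor]

lemmas monad_simps [simp] = nat_trans_simps[OF mul_natural, simplified]
  nat_trans_simps[OF unt_natural, simplified] nat_trans_simps[OF der_natural, simplified]

lemma mul_nat: "f \<in> Arr X \<Longrightarrow> mul M (Cod X f) \<cdot> mar M (mar M f) = mar M f \<cdot> mul M (Dom X f)"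
  using nat_trans_natural[OF mul_natural, of f] by simp

lemma unt_nat: "f \<in> Arr X \<Longrightarrow> unt M (Cod X f) \<cdot> f = mar M f \<cdot> unt M (Dom X f)"
  using nat_trans_natural[OF unt_natural, of f] by simp

lemma der_nat: "f \<in> Arr X \<Longrightarrow> der M (Cod X f) \<cdot> mar M f = mar M (ar (pwF X 2) f) \<cdot> der M (Dom X f)"
  using nat_trans_natural[OF der_natural, of f] by simp

lemma algebraD:
  assumes "(A, \<alpha>) \<in> algebras X M"
  shows "A \<in> Obj X" "\<alpha> \<in> Arr X" "Dom X \<alpha> = mob M A" "Cod X \<alpha> = A"
    "\<alpha> \<cdot> unt M A = Ide X A" "\<alpha> \<cdot> mar M \<alpha> = \<alpha> \<cdot> mul M A"
  using assms by (auto simp: algebras_def Hom_iff)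

lemma algebra_iff:
  "(A, \<alpha>) \<in> algebras X M \<longleftrightarrow> A \<in> Obj X \<and> \<alpha> \<in> Arr X \<and> Dom X \<alpha> = mob M A \<and> Cod X \<alpha> = A \<and>
    \<alpha> \<cdot> unt M A = Ide X A \<and> \<alpha> \<cdot> mar M \<alpha> = \<alpha> \<cdot> mul M A"
  by (auto simp: algebras_def Hom_iff)

lemma ALG_category: "category (ALG X M)"
proof
  fix f assume "f \<in> Arr (ALG X M)"
  then show "Dom (ALG X M) f \<in> Obj (ALG X M)" "Cod (ALG X M) f \<in> Obj (ALG X M)"
    by (auto elim!: ALG_ArrE)
next
  fix a assume "a \<in> Obj (ALG X M)"
  then show "Ide (ALG X M) a \<in> Hom (ALG X M) a a"
    by (cases a) (auto simp: Hom_iff ALG_Arr_iff algebra_iff)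
next
  fix f g a b c
  assume "f \<in> Hom (ALG X M) a b" "g \<in> Hom (ALG X M) b c"
  then obtain f' g' where fg: "f = (a, f', b)" "g = (b, g', c)"
    and f: "f' \<in> Arr X" "Dom X f' = fst a" "Cod X f' = fst b" "f' \<cdot> snd a = snd b \<cdot> mar M f'"
    and g: "g' \<in> Arr X" "Dom X g' = fst b" "Cod X g' = fst c" "g' \<cdot> snd b = snd c \<cdot> mar M g'"
    and abc: "a \<in> algebras X M" "b \<in> algebras X M" "c \<in> algebras X M"
    by (cases f; cases g) (auto simp: Hom_iff ALG_Arr_iff)
  note a' = algebraD[of "fst a" "snd a", simplified, OF abc(1)]
    algebraD[of "fst b" "snd b", simplified, OF abc(2)] algebraD[of "fst c" "snd c", simplified, OF abc(3)]
  have "(g' \<cdot> f') \<cdot> snd a = (g' \<cdot> snd b) \<cdot> mar M f'"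
    using f(1-3) g(1-3) a' by (simp add: assoc f(4))
  also have "\<dots> = snd c \<cdot> mar M (g' \<cdot> f')"
    using f(1-3) g(1-3) a' by (simp add: assoc g(4) S_comp)
  finally show "g \<cdot>\<^bsub>ALG X M\<^esub> f \<in> Hom (ALG X M) a c"
    using fg f(1-3) g(1-3) abc by (simp add: Hom_iff ALG_Arr_iff)
next
  fix f a b assume "f \<in> Hom (ALG X M) a b"
  then show "Ide (ALG X M) b \<cdot>\<^bsub>ALG X M\<^esub> f = f" "f \<cdot>\<^bsub>ALG X M\<^esub> Ide (ALG X M) a = f"
    by (cases f; auto simp: Hom_iff ALG_Arr_iff)+
next
  fix f g h a b c d
  assume "f \<in> Hom (ALG X M) a b" "g \<in> Hom (ALG X M) b c" "h \<in> Hom (ALG X M) c d"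
  then show "(h \<cdot>\<^bsub>ALG X M\<^esub> g) \<cdot>\<^bsub>ALG X M\<^esub> f = h \<cdot>\<^bsub>ALG X M\<^esub> g \<cdot>\<^bsub>ALG X M\<^esub> f"
    by (cases f; cases g; cases h) (auto simp: Hom_iff ALG_Arr_iff assoc)
qed

lemma forgetF_functor: "is_functor (ALG X M) X forgetF"
  unfolding is_functor_iff
proof (intro conjI ballI impI ALG_category category_axioms)
  fix f g assume "f \<in> Arr (ALG X M)" "g \<in> Arr (ALG X M)" "Cod (ALG X M) f = Dom (ALG X M) g"
  then show "ar forgetF (g \<cdot>\<^bsub>ALG X M\<^esub> f) = ar forgetF g \<cdot> ar forgetF f"
    by (cases f; cases g) auto
next
  fix f assume "f \<in> Arr (ALG X M)"
  then show "ar forgetF f \<in> Arr X" "Dom X (ar forgetF f) = ob forgetF (Dom (ALG X M) f)"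
    "Cod X (ar forgetF f) = ob forgetF (Cod (ALG X M) f)"
    by (cases f; auto simp: ALG_Arr_iff)+
next
  fix a assume "a \<in> Obj (ALG X M)"
  then show "ob forgetF a \<in> Obj X" "ar forgetF (Ide (ALG X M) a) = Ide X (ob forgetF a)"
    by (cases a; auto simp: algebra_iff)+
qed

text \<open>
  For \<open>x, y : Z \<rightarrow> A\<close> this is the derivative of \<open>\<alpha> S(x)\<close> in direction \<open>y\<close>; the second component
  of the structure map of \<open>T(A, \<alpha>)\<close> is the case \<open>x = \<pi>\<^sub>1\<close>, \<open>y = \<pi>\<^sub>2\<close>.
\<close>

definition Dl :: "'m \<Rightarrow> 'm \<Rightarrow> 'm \<Rightarrow> 'm" where
  "Dl \<alpha> x y = \<alpha> \<cdot> (mar M ((x \<cdot> pj X 2 (Dom X x) 1) \<oplus> (y \<cdot> pj X 2 (Dom X x) 2)) \<cdot> der M (Dom X x))"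

text \<open>The second derivative: with \<open>(x\<^sub>1, x\<^sub>2)\<close> as point and
  \<open>(y\<^sub>1, y\<^sub>2)\<close> as direction it differentiates \<open>(x\<^sub>1, x\<^sub>2)
  \<mapsto> Dl \<alpha> x\<^sub>1 x\<^sub>2\<close>, as \<open>Dl_Dl\<close> shows.\<close>

definition Dl2 :: "'m \<Rightarrow> 'm \<Rightarrow> 'm \<Rightarrow> 'm \<Rightarrow> 'm \<Rightarrow> 'm" where
  "Dl2 \<alpha> x\<^sub>1 y\<^sub>1 x\<^sub>2 y\<^sub>2 = \<alpha> \<cdot> (mar M (((x\<^sub>1 \<cdot> pj4 X (Dom X x\<^sub>1) 1) \<oplus> (y\<^sub>1 \<cdot> pj4 X (Dom X x\<^sub>1) 2)) \<oplus>
      ((x\<^sub>2 \<cdot> pj4 X (Dom X x\<^sub>1) 3) \<oplus> (y\<^sub>2 \<cdot> pj4 X (Dom X x\<^sub>1) 4))) \<cdot> (der M (pw X 2 (Dom X x\<^sub>1)) \<cdot> der M (Dom X x\<^sub>1)))"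

lemma Dl_simps [simp]:
  assumes "\<alpha> \<in> Arr X" "Dom X \<alpha> = mob M A" "x \<in> Arr X" "Cod X x = A" "y \<in> Arr X" "Dom X y = Dom X x" "Cod X y = A"
  shows "Dl \<alpha> x y \<in> Arr X" "Dom X (Dl \<alpha> x y) = mob M (Dom X x)" "Cod X (Dl \<alpha> x y) = Cod X \<alpha>"
  using assms by (simp_all add: Dl_def)

text \<open>Naturality of \<open>der M\<close> at w: differentiation commutes with
  substitution.\<close>

lemma Dl_comp:
  assumes \<alpha>: "\<alpha> \<in> Arr X" "Dom X \<alpha> = mob M A" and x: "x \<in> Arr X" "Cod X x = A"
    and y: "y \<in> Arr X" "Dom X y = Dom X x" "Cod X y = A" and w: "w \<in> Arr X" "Cod X w = Dom X x"
  shows "Dl \<alpha> x y \<cdot> mar M w = Dl \<alpha> (x \<cdot> w) (y \<cdot> w)"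
proof -
  let ?Z = "Dom X x" and ?W = "Dom X w"
  let ?s = "(x \<cdot> pj X 2 ?Z 1) \<oplus> (y \<cdot> pj X 2 ?Z 2)"
  have "Dl \<alpha> x y \<cdot> mar M w = \<alpha> \<cdot> (mar M ?s \<cdot> (mar M (ar (pwF X 2) w) \<cdot> der M ?W))"
    using assms der_nat[OF w(1)] by (simp add: Dl_def assoc)
  also have "\<dots> = \<alpha> \<cdot> (mar M (?s \<cdot> ar (pwF X 2) w) \<cdot> der M ?W)"
    using assms by (simp add: S_comp assoc)
  also have "?s \<cdot> ar (pwF X 2) w = (x \<cdot> w \<cdot> pj X 2 ?W 1) \<oplus> (y \<cdot> w \<cdot> pj X 2 ?W 2)"
    using assms by (simp add: add_comp assoc)
  finally show ?thesis using assms by (simp add: Dl_def assoc)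
qed

text \<open>A morphism f moves past \<alpha> and is additive, like every arrow of X, so it acts on
  point and direction alike.\<close>

lemma comp_Dl:
  assumes \<alpha>: "\<alpha> \<in> Arr X" "Dom X \<alpha> = mob M A" and x: "x \<in> Arr X" "Cod X x = A"
    and y: "y \<in> Arr X" "Dom X y = Dom X x" "Cod X y = A"
    and f: "f \<in> Arr X" "Dom X f = A" "Cod X \<alpha> = A" "f \<cdot> \<alpha> = \<beta> \<cdot> mar M f"
      "\<beta> \<in> Arr X" "Dom X \<beta> = mob M (Cod X f)"
  shows "f \<cdot> Dl \<alpha> x y = Dl \<beta> (f \<cdot> x) (f \<cdot> y)"
proof -
  let ?Z = "Dom X x"
  let ?s = "(x \<cdot> pj X 2 ?Z 1) \<oplus> (y \<cdot> pj X 2 ?Z 2)"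
  have "f \<cdot> Dl \<alpha> x y = \<beta> \<cdot> (mar M f \<cdot> (mar M ?s \<cdot> der M ?Z))"
    using assms by (simp add: Dl_def comp_extend[OF f(4)] assoc)
  also have "\<dots> = \<beta> \<cdot> (mar M (f \<cdot> ?s) \<cdot> der M ?Z)"
    using assms by (simp add: S_comp assoc)
  finally show ?thesis using assms by (simp add: Dl_def comp_add assoc)
qed

text \<open>By \<open>DC3\<close> the derivative of a generator is the generator in the second slot,
  where the sum only sees y.\<close>

lemma Dl_unit:
  assumes a: "(A, \<alpha>) \<in> algebras X M" and x: "x \<in> Arr X" "Cod X x = A" "Dom X x = Z"
    and y: "y \<in> Arr X" "Dom X y = Z" "Cod X y = A"
  shows "Dl \<alpha> x y \<cdot> unt M Z = y"
proof -
  note a' = algebraD[OF a]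
  have Z: "Z \<in> Obj X" using y by auto
  let ?s = "(x \<cdot> pj X 2 Z 1) \<oplus> (y \<cdot> pj X 2 Z 2)"
  have s: "?s \<in> Arr X" "Dom X ?s = pw X 2 Z" "Cod X ?s = A" using x y Z by simp_all
  have "Dl \<alpha> x y \<cdot> unt M Z = \<alpha> \<cdot> ((mar M ?s \<cdot> unt M (pw X 2 Z)) \<cdot> tup X [zero X Z Z, Ide X Z])"
    using a' x y Z DC3[OF Z] by (simp add: Dl_def assoc)
  also have "mar M ?s \<cdot> unt M (pw X 2 Z) = unt M A \<cdot> ?s"
    using unt_nat[OF s(1)] s by simp
  also have "\<alpha> \<cdot> ((unt M A \<cdot> ?s) \<cdot> tup X [zero X Z Z, Ide X Z]) = (\<alpha> \<cdot> unt M A) \<cdot> (?s \<cdot> tup X [zero X Z Z, Ide X Z])"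
    using a'(1-4) s Z by (simp add: assoc)
  also have "\<dots> = y"
    using a' x y Z by (simp add: add_comp assoc)
  finally show ?thesis .
qed

text \<open>\<open>DC4\<close> is the chain rule. Associativity of \<alpha> turns its outer
  multiplication into an application of \<alpha>, and the two summands of \<open>?K\<close> become
  the point \<open>\<alpha> S(x)\<close> and the direction \<open>Dl \<alpha> x y\<close>.\<close>

lemma Dl_mul:
  assumes a: "(A, \<alpha>) \<in> algebras X M" and x: "x \<in> Arr X" "Cod X x = A" "Dom X x = Z"
    and y: "y \<in> Arr X" "Dom X y = Z" "Cod X y = A"
  shows "Dl \<alpha> (\<alpha> \<cdot> mar M x) (Dl \<alpha> x y) = Dl \<alpha> x y \<cdot> mul M Z"
proof -
  note a' = algebraD[OF a]
  have Z: "Z \<in> Obj X" using y by auto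
  let ?s = "(x \<cdot> pj X 2 Z 1) \<oplus> (y \<cdot> pj X 2 Z 2)" and ?i = "tup X [Ide X Z, zero X Z Z]"
  let ?K = "(mar M ?i \<cdot> pj X 2 (mob M Z) 1) \<oplus> (der M Z \<cdot> pj X 2 (mob M Z) 2)"
  have s: "?s \<in> Arr X" "Dom X ?s = pw X 2 Z" "Cod X ?s = A" using x y Z by simp_all
  have K: "?K \<in> Arr X" "Dom X ?K = pw X 2 (mob M Z)" "Cod X ?K = mob M (pw X 2 Z)" using Z by simp_all
  have "Dl \<alpha> x y \<cdot> mul M Z = \<alpha> \<cdot> ((mar M ?s \<cdot> mul M (pw X 2 Z)) \<cdot> (mar M ?K \<cdot> der M (mob M Z)))"
    using a' x y Z DC4[OF Z] by (simp add: Dl_def assoc)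
  also have "mar M ?s \<cdot> mul M (pw X 2 Z) = mul M A \<cdot> mar M (mar M ?s)"
    using mul_nat[OF s(1)] s by simp
  also have "\<alpha> \<cdot> ((mul M A \<cdot> mar M (mar M ?s)) \<cdot> (mar M ?K \<cdot> der M (mob M Z))) =
      (\<alpha> \<cdot> mul M A) \<cdot> (mar M (mar M ?s) \<cdot> (mar M ?K \<cdot> der M (mob M Z)))"
    using a' s K Z by (simp add: assoc)
  also have "\<dots> = \<alpha> \<cdot> (mar M (\<alpha> \<cdot> (mar M ?s \<cdot> ?K)) \<cdot> der M (mob M Z))"
    using a' s K Z by (simp add: S_comp assoc flip: a'(6))
  also have "\<alpha> \<cdot> (mar M ?s \<cdot> ?K) = ((\<alpha> \<cdot> mar M (?s \<cdot> ?i)) \<cdot> pj X 2 (mob M Z) 1) \<oplus> (Dl \<alpha> x y \<cdot> pj X 2 (mob M Z) 2)"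
    using a' s x Z by (simp add: comp_add S_comp Dl_def assoc)
  also have "?s \<cdot> ?i = x"
    using x y Z by (simp add: add_comp assoc)
  finally show ?thesis
    using a' x Z by (simp add: Dl_def[of \<alpha> "\<alpha> \<cdot> mar M x"])
qed

text \<open>All three derivatives come from one arrow \<open>?s\<close> out of
  \<open>Z\<^sup>3\<close>, preceded by the three tuples of \<open>DC2\<close>; the equation is
  \<open>DC2\<close> followed by \<open>\<alpha> S(?s)\<close>.\<close>

lemma Dl_add:
  assumes \<alpha>: "\<alpha> \<in> Arr X" "Dom X \<alpha> = mob M A" and x: "x \<in> Arr X" "Cod X x = A" "Dom X x = Z"
    and y: "y \<in> Arr X" "Dom X y = Z" "Cod X y = A" "y' \<in> Arr X" "Dom X y' = Z" "Cod X y' = A"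
  shows "Dl \<alpha> x (y \<oplus> y') = Dl \<alpha> x y \<oplus> Dl \<alpha> x y'"
proof -
  have Z: "Z \<in> Obj X" and A: "A \<in> Obj X" using y by auto
  let ?p = "pj X 2 Z" and ?o = "zero X (pw X 2 Z) Z"
  let ?s = "(x \<cdot> pj X 3 Z 1) \<oplus> ((y \<cdot> pj X 3 Z 2) \<oplus> (y' \<cdot> pj X 3 Z 3))"
  have s: "?s \<in> Arr X" "Dom X ?s = pw X 3 Z" "Cod X ?s = A" using x y Z by simp_all
  have t: "?s \<cdot> tup X [?p 1, ?p 2, ?p 2] = (x \<cdot> ?p 1) \<oplus> ((y \<oplus> y') \<cdot> ?p 2)"
    "?s \<cdot> tup X [?p 1, ?p 2, ?o] = (x \<cdot> ?p 1) \<oplus> (y \<cdot> ?p 2)"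
    "?s \<cdot> tup X [?p 1, ?o, ?p 2] = (x \<cdot> ?p 1) \<oplus> (y' \<cdot> ?p 2)"
    using x y Z A by (simp_all add: add_comp assoc)
  have d: "\<alpha> \<cdot> (mar M (?s \<cdot> t) \<cdot> der M Z) = \<alpha> \<cdot> (mar M ?s \<cdot> (mar M t \<cdot> der M Z))"
    if "t \<in> Arr X" "Dom X t = pw X 2 Z" "Cod X t = pw X 3 Z" for t
    using that \<alpha> s Z by (simp add: S_comp assoc)
  have "Dl \<alpha> x (y \<oplus> y') = \<alpha> \<cdot> (mar M (?s \<cdot> tup X [?p 1, ?p 2, ?p 2]) \<cdot> der M Z)"
    using x by (simp only: t Dl_def)
  also have "\<dots> = \<alpha> \<cdot> (mar M ?s \<cdot> ((mar M (tup X [?p 1, ?p 2, ?o]) \<cdot> der M Z) \<oplus> (mar M (tup X [?p 1, ?o, ?p 2]) \<cdot> der M Z)))"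
    using d[of "tup X [?p 1, ?p 2, ?p 2]"] Z DC2[OF Z] by simp
  also have "\<dots> = (\<alpha> \<cdot> (mar M (?s \<cdot> tup X [?p 1, ?p 2, ?o]) \<cdot> der M Z)) \<oplus> (\<alpha> \<cdot> (mar M (?s \<cdot> tup X [?p 1, ?o, ?p 2]) \<cdot> der M Z))"
    using \<alpha> s Z by (simp add: comp_add d)
  also have "\<dots> = Dl \<alpha> x y \<oplus> Dl \<alpha> x y'"
    using x by (simp only: t Dl_def)
  finally show ?thesis .
qed

text \<open>In direction zero the sum factors through the first projection, where \<open>DC1\<close>
  applies.\<close>

lemma Dl_zero:
  assumes \<alpha>: "\<alpha> \<in> Arr X" "Dom X \<alpha> = mob M A" and x: "x \<in> Arr X" "Cod X x = A" "Dom X x = Z"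
  shows "Dl \<alpha> x (zero X Z A) = zero X (mob M Z) (Cod X \<alpha>)"
proof -
  have Z: "Z \<in> Obj X" and A: "A \<in> Obj X" using x by auto
  have "Dl \<alpha> x (zero X Z A) = \<alpha> \<cdot> (mar M x \<cdot> (mar M (pj X 2 Z 1) \<cdot> der M Z))"
    using \<alpha> x Z A by (simp add: Dl_def S_comp assoc)
  then show ?thesis using \<alpha> x Z A by (simp add: DC1)
qed

text \<open>Here f and g stand for the projections of a tangent bundle with structure map \<beta>.
  The second component of \<beta> is a derivative of \<alpha>, so differentiating \<beta> produces a
  second derivative there.\<close>

lemma Dl_Dl:
  assumes \<alpha>: "\<alpha> \<in> Arr X" "Dom X \<alpha> = mob M A" "Cod X \<alpha> = A"
    and f: "f \<in> Arr X" "g \<in> Arr X" "Dom X f = B" "Dom X g = B" "Cod X f = A" "Cod X g = A"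
    and \<beta>: "\<beta> \<in> Arr X" "Dom X \<beta> = mob M B" "Cod X \<beta> = B" "g \<cdot> \<beta> = Dl \<alpha> f g"
    and x: "x \<in> Arr X" "Cod X x = B" "Dom X x = Z" "y \<in> Arr X" "Cod X y = B" "Dom X y = Z"
  shows "g \<cdot> Dl \<beta> x y = Dl2 \<alpha> (f \<cdot> x) (f \<cdot> y) (g \<cdot> x) (g \<cdot> y)"
proof -
  have Z: "Z \<in> Obj X" "B \<in> Obj X" using x by auto
  let ?s = "(x \<cdot> pj X 2 Z 1) \<oplus> (y \<cdot> pj X 2 Z 2)"
  have s: "?s \<in> Arr X" "Dom X ?s = pw X 2 Z" "Cod X ?s = B" using x Z by simp_all
  have "g \<cdot> Dl \<beta> x y = Dl \<alpha> f g \<cdot> (mar M ?s \<cdot> der M Z)"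
    using f \<beta> x Z s by (simp add: Dl_def[of \<beta>] comp_extend[OF \<beta>(4)] )
  also have "\<dots> = Dl \<alpha> (f \<cdot> ?s) (g \<cdot> ?s) \<cdot> der M Z"
    using \<alpha> f s Z by (simp add: Dl_comp[symmetric] assoc)
  also have "\<dots> = Dl2 \<alpha> (f \<cdot> x) (f \<cdot> y) (g \<cdot> x) (g \<cdot> y)"
    using \<alpha> f x Z by (simp add: Dl_def Dl2_def comp_add add_comp assoc)
  finally show ?thesis .
qed

text \<open>With the two middle arguments zero, the sum of four terms factors through
  \<open>\<langle>\<pi>\<^sub>1, \<pi>\<^sub>4\<rangle>\<close>, and \<open>DC5\<close> collapses
  the two derivatives to one.\<close>

lemma Dl2_lift:
  assumes \<alpha>: "\<alpha> \<in> Arr X" "Dom X \<alpha> = mob M A" and x: "x \<in> Arr X" "Cod X x = A" "Dom X x = Z"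
    and y: "y \<in> Arr X" "Dom X y = Z" "Cod X y = A"
  shows "Dl2 \<alpha> x (zero X Z A) (zero X Z A) y = Dl \<alpha> x y"
proof -
  have Z: "Z \<in> Obj X" and A: "A \<in> Obj X" using x by auto
  let ?s = "(x \<cdot> pj X 2 Z 1) \<oplus> (y \<cdot> pj X 2 Z 2)" and ?t = "tup X [pj4 X Z 1, pj4 X Z 4]"
  have "Dl2 \<alpha> x (zero X Z A) (zero X Z A) y = \<alpha> \<cdot> (mar M (?s \<cdot> ?t) \<cdot> (der M (pw X 2 Z) \<cdot> der M Z))"
    using x y Z A by (simp add: Dl2_def add_comp assoc)
  also have "\<dots> = \<alpha> \<cdot> (mar M ?s \<cdot> (mar M ?t \<cdot> (der M (pw X 2 Z) \<cdot> der M Z)))"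
    using \<alpha> x y Z by (simp add: S_comp assoc)
  also have "mar M ?t \<cdot> (der M (pw X 2 Z) \<cdot> der M Z) = der M Z"
    using DC5[OF Z] .
  finally show ?thesis using x by (simp add: Dl_def)
qed

text \<open>Exchanging the middle arguments is precomposition with the flip of
  \<open>(Z\<^sup>2)\<^sup>2\<close>, under which the iterated derivative is invariant by
  \<open>DC6\<close>.\<close>

lemma Dl2_commute:
  assumes \<alpha>: "\<alpha> \<in> Arr X" "Dom X \<alpha> = mob M A"
    and x: "x\<^sub>1 \<in> Arr X" "Cod X x\<^sub>1 = A" "Dom X x\<^sub>1 = Z" "x\<^sub>2 \<in> Arr X" "Cod X x\<^sub>2 = A" "Dom X x\<^sub>2 = Z"
    and y: "y\<^sub>1 \<in> Arr X" "Cod X y\<^sub>1 = A" "Dom X y\<^sub>1 = Z" "y\<^sub>2 \<in> Arr X" "Cod X y\<^sub>2 = A" "Dom X y\<^sub>2 = Z"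
  shows "Dl2 \<alpha> x\<^sub>1 y\<^sub>1 x\<^sub>2 y\<^sub>2 = Dl2 \<alpha> x\<^sub>1 x\<^sub>2 y\<^sub>1 y\<^sub>2"
proof -
  have Z: "Z \<in> Obj X" and A: "A \<in> Obj X" using x by auto
  let ?s = "((x\<^sub>1 \<cdot> pj4 X Z 1) \<oplus> (x\<^sub>2 \<cdot> pj4 X Z 2)) \<oplus> ((y\<^sub>1 \<cdot> pj4 X Z 3) \<oplus> (y\<^sub>2 \<cdot> pj4 X Z 4))"
  let ?t = "tup X [tup X [pj4 X Z 1, pj4 X Z 3], tup X [pj4 X Z 2, pj4 X Z 4]]"
  have "?s \<cdot> ?t = ((x\<^sub>1 \<cdot> pj4 X Z 1) \<oplus> (y\<^sub>1 \<cdot> pj4 X Z 2)) \<oplus> ((x\<^sub>2 \<cdot> pj4 X Z 3) \<oplus> (y\<^sub>2 \<cdot> pj4 X Z 4))"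
    using x y Z A by (simp add: add_comp assoc) (simp add: add_assoc add_left_commute)
  then have "Dl2 \<alpha> x\<^sub>1 y\<^sub>1 x\<^sub>2 y\<^sub>2 = \<alpha> \<cdot> (mar M (?s \<cdot> ?t) \<cdot> (der M (pw X 2 Z) \<cdot> der M Z))"
    using x by (simp only: Dl2_def)
  also have "\<dots> = \<alpha> \<cdot> (mar M ?s \<cdot> (mar M ?t \<cdot> (der M (pw X 2 Z) \<cdot> der M Z)))"
    using \<alpha> x y Z by (simp add: S_comp assoc)
  also have "mar M ?t \<cdot> (der M (pw X 2 Z) \<cdot> der M Z) = der M (pw X 2 Z) \<cdot> der M Z"
    using DC6[OF Z] .
  finally show ?thesis using x by (simp add: Dl2_def)
qed

definition str :: "nat \<Rightarrow> 'o \<Rightarrow> 'm \<Rightarrow> 'm" where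
  "str n A \<alpha> = snd (algTn_ob X M n (A, \<alpha>))"

lemma algTn_ob_eq: "algTn_ob X M n (A, \<alpha>) = (pw X (Suc n) A, str n A \<alpha>)"
  by (simp add: str_def algTn_ob_def)

lemma str_simps [simp]:
  assumes n: "1 \<le> n" and a: "(A, \<alpha>) \<in> algebras X M"
  shows "str n A \<alpha> \<in> Arr X" "Dom X (str n A \<alpha>) = mob M (pw X (Suc n) A)" "Cod X (str n A \<alpha>) = pw X (Suc n) A"
    "pj X (Suc n) A 1 \<cdot> str n A \<alpha> = \<alpha> \<cdot> mar M (pj X (Suc n) A 1)"
    "1 \<le> j \<Longrightarrow> j \<le> n \<Longrightarrow> pj X (Suc n) A (Suc j) \<cdot> str n A \<alpha> =
      Dl \<alpha> (pj X (Suc n) A 1) (pj X (Suc n) A (Suc j))"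
proof -
  note a' = algebraD[OF a]
  let ?P = "pw X (Suc n) A" and ?p = "pj X (Suc n) A"
  let ?d = "\<lambda>j. \<alpha> \<cdot> mar M (pj4 X A 1 \<oplus> pj4 X A 4) \<cdot> der M (pw X 2 A) \<cdot> mar M (tup X [?p 1, ?p (Suc j)])"
  have d: "?d j = Dl \<alpha> (?p 1) (?p (Suc j))" if "1 \<le> j" "j \<le> n" for j
  proof -
    \<comment> \<open>The definition goes through the twofold power; naturality of the derivative
      rewrites it in the projections of the \<open>Suc n\<close>-fold one.\<close>
    have "Dl \<alpha> (pj X 2 A 1) (pj X 2 A 2) \<cdot> mar M (tup X [?p 1, ?p (Suc j)]) = Dl \<alpha> (?p 1) (?p (Suc j))"
      using a' that by (simp add: Dl_comp)
    then show ?thesis using a' that by (simp add: Dl_def[of \<alpha> "pj X 2 A 1"] assoc)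
  qed
  have m: "map ?d [1..<Suc n] = map (\<lambda>j. Dl \<alpha> (?p 1) (?p (Suc j))) [1..<Suc n]"
    by (rule map_cong) (use d in \<open>auto simp del: upt_Suc\<close>)
  let ?fs = "(\<alpha> \<cdot> mar M (?p 1)) # map (\<lambda>j. Dl \<alpha> (?p 1) (?p (Suc j))) [1..<Suc n]"
  have s: "str n A \<alpha> = tup X ?fs"
    unfolding str_def algTn_ob_def split_conv snd_conv m ..
  have fs: "f \<in> Arr X \<and> Dom X f = mob M ?P \<and> Cod X f = A" if "f \<in> set ?fs" for f
    using that a' n by (auto simp del: upt_Suc)
  have l: "length ?fs = Suc n" "?fs \<noteq> []" by simp_all
  note t = tup_simps[OF l(2) fs, unfolded l(1), folded s]
  show "str n A \<alpha> \<in> Arr X" "Dom X (str n A \<alpha>) = mob M ?P" "Cod X (str n A \<alpha>) = ?P"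
    using t(1-3) by blast+
  show "?p 1 \<cdot> str n A \<alpha> = \<alpha> \<cdot> mar M (?p 1)"
    using t(4)[of 1] by simp
  show "?p (Suc j) \<cdot> str n A \<alpha> = Dl \<alpha> (?p 1) (?p (Suc j))" if j: "1 \<le> j" "j \<le> n"
  proof -
    have "?fs ! (Suc j - 1) = Dl \<alpha> (?p 1) (?p (Suc j))"
      using j by (cases j) (simp_all add: One_nat_def del: upt_Suc)
    then show ?thesis using t(4)[of "Suc j"] j by (simp del: upt_Suc)
  qed
qed

text \<open>Projections are jointly monic, and naturality of the derivative evaluates each component
  of the right-hand side. With \<open>mul\<close> for \<zeta> and \<open>str\<close> for h the
  criterion also covers the associativity of \<open>str\<close> itself.\<close>

lemma str_hom:
  assumes n: "1 \<le> n" and a: "(A, \<alpha>) \<in> algebras X M"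
    and \<zeta>: "\<zeta> \<in> Arr X" "Dom X \<zeta> = mob M Z" "Cod X \<zeta> = Z"
    and h: "h \<in> Arr X" "Dom X h = Z" "Cod X h = pw X (Suc n) A"
    and 1: "pj X (Suc n) A 1 \<cdot> (h \<cdot> \<zeta>) = \<alpha> \<cdot> mar M (pj X (Suc n) A 1 \<cdot> h)"
    and 2: "\<And>j. 1 \<le> j \<Longrightarrow> j \<le> n \<Longrightarrow> pj X (Suc n) A (Suc j) \<cdot> (h \<cdot> \<zeta>) =
      Dl \<alpha> (pj X (Suc n) A 1 \<cdot> h) (pj X (Suc n) A (Suc j) \<cdot> h)"
  shows "h \<cdot> \<zeta> = str n A \<alpha> \<cdot> mar M h"
proof (rule pw_ext[of A _ "Suc n"])
  note a' = algebraD[OF a]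
  fix i assume i: "1 \<le> i" "i \<le> Suc n"
  show "pj X (Suc n) A i \<cdot> (h \<cdot> \<zeta>) = pj X (Suc n) A i \<cdot> (str n A \<alpha> \<cdot> mar M h)"
  proof (cases "i = 1")
    case True
    then show ?thesis
      using n a a' h 1 by (simp add: comp_extend[OF str_simps(4)] S_comp assoc)
  next
    case False
    then obtain j where j: "i = Suc j" "1 \<le> j" "j \<le> n" using i by (cases i) auto
    then show ?thesis
      using n a a' h 2 by (simp add: comp_extend[OF str_simps(5)] Dl_comp)
  qed
qed (use assms algebraD[OF a] in simp_all)

text \<open>The laws of \<alpha> give the base component; in the others the unit law is
  \<open>Dl_unit\<close> and associativity is \<open>Dl_mul\<close>.\<close>

lemma str_algebra:
  assumes n: "1 \<le> n" and a: "(A, \<alpha>) \<in> algebras X M"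
  shows "(pw X (Suc n) A, str n A \<alpha>) \<in> algebras X M"
proof -
  note a' = algebraD[OF a]
  let ?P = "pw X (Suc n) A" and ?p = "pj X (Suc n) A"
  have "str n A \<alpha> \<cdot> unt M ?P = Ide X ?P"
  proof (rule pw_ext[of A _ "Suc n"])
    fix i assume i: "1 \<le> i" "i \<le> Suc n"
    have u: "mar M (?p 1) \<cdot> unt M ?P = unt M A \<cdot> ?p 1"
      using unt_nat[of "?p 1"] a' by simp
    show "?p i \<cdot> (str n A \<alpha> \<cdot> unt M ?P) = ?p i \<cdot> Ide X ?P"
    proof (cases "i = 1")
      case True
      then show ?thesis
        using n a a' by (simp add: comp_extend[OF str_simps(4)] assoc u comp_extend[OF a'(5)])
    next
      case False
      then obtain j where j: "i = Suc j" "1 \<le> j" "j \<le> n" using i by (cases i) auto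
      then show ?thesis
        using n a a' by (simp add: comp_extend[OF str_simps(5)] Dl_unit)
    qed
  qed (use n a a' in simp_all)
  moreover have "str n A \<alpha> \<cdot> mul M ?P = str n A \<alpha> \<cdot> mar M (str n A \<alpha>)"
  proof (rule str_hom[OF n a])
    show "?p 1 \<cdot> (str n A \<alpha> \<cdot> mul M ?P) = \<alpha> \<cdot> mar M (?p 1 \<cdot> str n A \<alpha>)"
      using n a a' mul_nat[of "?p 1"]
      by (simp add: comp_extend[OF str_simps(4)] S_comp assoc comp_extend[OF a'(6)])
    show "?p (Suc j) \<cdot> (str n A \<alpha> \<cdot> mul M ?P) = Dl \<alpha> (?p 1 \<cdot> str n A \<alpha>) (?p (Suc j) \<cdot> str n A \<alpha>)"
      if "1 \<le> j" "j \<le> n" for j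
      using n a a' that by (simp add: comp_extend[OF str_simps(5)] Dl_mul)
  qed (use n a a' in simp_all)
  ultimately show ?thesis
    using n a a' by (simp add: algebra_iff)
qed

lemmas str1 = str_simps[of 1, simplified] str_simps(5)[of 1 _ _ 1, simplified]
lemmas str2 = str_simps[of 2, simplified] str_simps(5)[of 2 _ _ 1, simplified] str_simps(5)[of 2 _ _ 2, simplified]

lemma str1_hom:
  assumes a: "(A, \<alpha>) \<in> algebras X M"
    and \<zeta>: "\<zeta> \<in> Arr X" "Dom X \<zeta> = mob M Z" "Cod X \<zeta> = Z"
    and h: "h \<in> Arr X" "Dom X h = Z" "Cod X h = pw X 2 A"
    and 1: "pj X 2 A 1 \<cdot> (h \<cdot> \<zeta>) = \<alpha> \<cdot> mar M (pj X 2 A 1 \<cdot> h)"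
    and 2: "pj X 2 A 2 \<cdot> (h \<cdot> \<zeta>) = Dl \<alpha> (pj X 2 A 1 \<cdot> h) (pj X 2 A 2 \<cdot> h)"
  shows "h \<cdot> \<zeta> = str 1 A \<alpha> \<cdot> mar M h"
proof (rule str_hom[OF _ a \<zeta>])
  fix j :: nat assume "1 \<le> j" "j \<le> 1"
  then have "j = 1" by simp
  then show "pj X (Suc 1) A (Suc j) \<cdot> (h \<cdot> \<zeta>) = Dl \<alpha> (pj X (Suc 1) A 1 \<cdot> h) (pj X (Suc 1) A (Suc j) \<cdot> h)"
    using 2 by simp
qed (use h 1 in simp_all)

section \<open>The structure maps as algebra morphisms\<close>

lemma algT_simps [simp]:
  "ob (tanTn (algT X M) n) (A, \<alpha>) = (pw X (Suc n) A, str n A \<alpha>)"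
  "ar (tanTn (algT X M) n) (a, f, b) = (ob (tanTn (algT X M) n) a, ar (pwF X (Suc n)) f, ob (tanTn (algT X M) n) b)"
  "tp (algT X M) a = (ob (tanT (algT X M)) a, tp biT (fst a), a)"
  "tq (algT X M) n j a = (ob (tanTn (algT X M) n) a, tq biT n j (fst a), ob (tanT (algT X M)) a)"
  "ts (algT X M) a = (ob (tanTn (algT X M) 2) a, ts biT (fst a), ob (tanT (algT X M)) a)"
  "tz (algT X M) a = (a, tz biT (fst a), ob (tanT (algT X M)) a)"
  "tl (algT X M) a = (ob (tanT (algT X M)) a, tl biT (fst a), ob (tanT (algT X M)) (ob (tanT (algT X M)) a))"
  "tc (algT X M) a = (ob (tanT (algT X M)) (ob (tanT (algT X M)) a), tc biT (fst a),
     ob (tanT (algT X M)) (ob (tanT (algT X M)) a))"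
  by (simp_all add: algT_def algTn_def algTn_ob_eq)

lemma T_arrow:
  assumes n: "1 \<le> n" and a: "(A, \<alpha>) \<in> algebras X M" and b: "(B, \<beta>) \<in> algebras X M"
    and f: "f \<in> Arr X" "Dom X f = A" "Cod X f = B" "f \<cdot> \<alpha> = \<beta> \<cdot> mar M f"
  shows "ar (pwF X (Suc n)) f \<cdot> str n A \<alpha> = str n B \<beta> \<cdot> mar M (ar (pwF X (Suc n)) f)"
proof (rule str_hom[OF n b])
  note a' = algebraD[OF a] and b' = algebraD[OF b]
  show "pj X (Suc n) B 1 \<cdot> (ar (pwF X (Suc n)) f \<cdot> str n A \<alpha>) = \<beta> \<cdot> mar M (pj X (Suc n) B 1 \<cdot> ar (pwF X (Suc n)) f)"
    using n a a'(1-4) b'(1-4) f(1-3) by (simp add: comp_extend[OF f(4)] S_comp assoc)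
  show "pj X (Suc n) B (Suc j) \<cdot> (ar (pwF X (Suc n)) f \<cdot> str n A \<alpha>) =
      Dl \<beta> (pj X (Suc n) B 1 \<cdot> ar (pwF X (Suc n)) f) (pj X (Suc n) B (Suc j) \<cdot> ar (pwF X (Suc n)) f)"
    if "1 \<le> j" "j \<le> n" for j
    using n a a'(1-4) b'(1-4) f that comp_Dl[of \<alpha> A "pj X (Suc n) A 1" "pj X (Suc n) A (Suc j)" f \<beta>] by simp
qed (use n a b algebraD[OF a] algebraD[OF b] f in simp_all)

lemma q_arrow:
  assumes a: "(A, \<alpha>) \<in> algebras X M" and j: "1 \<le> j" "j \<le> n"
  shows "tq biT n j A \<cdot> str n A \<alpha> = str 1 A \<alpha> \<cdot> mar M (tq biT n j A)"
  by (rule str1_hom[OF a]) (use a j algebraD[OF a] in simp_all)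

lemma s_arrow:
  assumes a: "(A, \<alpha>) \<in> algebras X M"
  shows "ts biT A \<cdot> str 2 A \<alpha> = str 1 A \<alpha> \<cdot> mar M (ts biT A)"
  by (rule str1_hom[OF a]) (use a algebraD(1-4)[OF a] in \<open>simp_all add: str2 add_comp Dl_add\<close>)

lemma z_arrow:
  assumes a: "(A, \<alpha>) \<in> algebras X M"
  shows "tz biT A \<cdot> \<alpha> = str 1 A \<alpha> \<cdot> mar M (tz biT A)"
  by (rule str1_hom[OF a]) (use a algebraD(1-4)[OF a] in \<open>simp_all add: Dl_zero\<close>)

text \<open>The first projection is an algebra morphism and commutes with derivatives; the second
  component of \<open>str\<close> is itself a derivative and contributes a second one.\<close>

lemma Dl_str:
  assumes a: "(A, \<alpha>) \<in> algebras X M"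
    and x: "x \<in> Arr X" "Cod X x = pw X 2 A" "y \<in> Arr X" "Cod X y = pw X 2 A" "Dom X y = Dom X x"
  shows "pj X 2 A 1 \<cdot> Dl (str 1 A \<alpha>) x y = Dl \<alpha> (pj X 2 A 1 \<cdot> x) (pj X 2 A 1 \<cdot> y)"
    and "pj X 2 A 2 \<cdot> Dl (str 1 A \<alpha>) x y =
      Dl2 \<alpha> (pj X 2 A 1 \<cdot> x) (pj X 2 A 1 \<cdot> y) (pj X 2 A 2 \<cdot> x) (pj X 2 A 2 \<cdot> y)"
  using a x algebraD(1-4)[OF a] comp_Dl[of "str 1 A \<alpha>" "pw X 2 A" x y "pj X 2 A 1" \<alpha>]
    Dl_Dl[of \<alpha> A "pj X 2 A 1" "pj X 2 A 2" "pw X 2 A" "str 1 A \<alpha>" x "Dom X x" y]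
  by (simp_all add: str1)

lemma l_arrow:
  assumes a: "(A, \<alpha>) \<in> algebras X M"
  shows "tl biT A \<cdot> str 1 A \<alpha> = str 1 (pw X 2 A) (str 1 A \<alpha>) \<cdot> mar M (tl biT A)"
proof (rule str1_hom)
  note a' = algebraD(1-4)[OF a]
  show a1: "(pw X 2 A, str 1 A \<alpha>) \<in> algebras X M"
    using str_algebra[OF _ a, of 1] by simp
  let ?h1 = "tup X [pj X 2 A 1, zero X (pw X 2 A) A]" and ?h2 = "tup X [zero X (pw X 2 A) A, pj X 2 A 2]"
  have h: "?h1 \<in> Arr X" "Dom X ?h1 = pw X 2 A" "Cod X ?h1 = pw X 2 A"
    "?h2 \<in> Arr X" "Dom X ?h2 = pw X 2 A" "Cod X ?h2 = pw X 2 A" using a' by simp_all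
  have p: "pj X 2 (pw X 2 A) 1 \<cdot> tl biT A = ?h1" "pj X 2 (pw X 2 A) 2 \<cdot> tl biT A = ?h2"
    using a' by simp_all
  have c1: "?h1 \<cdot> str 1 A \<alpha> = str 1 A \<alpha> \<cdot> mar M ?h1"
    by (rule str1_hom[OF a]) (use a a' in \<open>simp_all add: str1 Dl_zero\<close>)
  \<comment> \<open>Here \<open>DC5\<close> enters: the second derivative along the lift has zero
    middle arguments and collapses to a first derivative.\<close>
  have c2: "?h2 \<cdot> str 1 A \<alpha> = Dl (str 1 A \<alpha>) ?h1 ?h2"
    by (rule pw2_ext[of A]) (use a a' h in \<open>simp_all add: str1 Dl_str Dl_zero Dl2_lift\<close>)
  have t: "tl biT A \<in> Arr X" "Dom X (tl biT A) = pw X 2 A" "Cod X (tl biT A) = pw X 2 (pw X 2 A)"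
    using a' by simp_all
  then show "tl biT A \<in> Arr X" "Dom X (tl biT A) = pw X 2 A" "Cod X (tl biT A) = pw X 2 (pw X 2 A)" .
  show "pj X 2 (pw X 2 A) 1 \<cdot> (tl biT A \<cdot> str 1 A \<alpha>) = str 1 A \<alpha> \<cdot> mar M (pj X 2 (pw X 2 A) 1 \<cdot> tl biT A)"
    using a a' t c1 by (simp only: p comp_extend[OF p(1)] str1 pw_simps le_refl one_le_numeral)
  show "pj X 2 (pw X 2 A) 2 \<cdot> (tl biT A \<cdot> str 1 A \<alpha>) =
      Dl (str 1 A \<alpha>) (pj X 2 (pw X 2 A) 1 \<cdot> tl biT A) (pj X 2 (pw X 2 A) 2 \<cdot> tl biT A)"
    using a a' t c2 by (simp only: p comp_extend[OF p(2)] str1 pw_simps le_refl one_le_numeral)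
qed (use a algebraD[OF a] in \<open>simp_all add: str1\<close>)

lemma c_arrow:
  assumes a: "(A, \<alpha>) \<in> algebras X M"
  defines "\<beta> \<equiv> str 1 (pw X 2 A) (str 1 A \<alpha>)"
  shows "tc biT A \<cdot> \<beta> = \<beta> \<cdot> mar M (tc biT A)"
proof -
  note a' = algebraD(1-4)[OF a]
  let ?B = "pw X 2 A" let ?C = "pw X 2 ?B"
  have a1: "(?B, str 1 A \<alpha>) \<in> algebras X M"
    using str_algebra[OF _ a, of 1] by simp
  have \<beta>: "\<beta> \<in> Arr X" "Dom X \<beta> = mob M ?C" "Cod X \<beta> = ?C"
    "pj X 2 ?B 1 \<cdot> \<beta> = str 1 A \<alpha> \<cdot> mar M (pj X 2 ?B 1)"
    "pj X 2 ?B 2 \<cdot> \<beta> = Dl (str 1 A \<alpha>) (pj X 2 ?B 1) (pj X 2 ?B 2)"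
    unfolding \<beta>_def using str1[OF a1] by simp_all
  let ?p = "\<lambda>i j. pj X 2 A i \<cdot> pj X 2 ?B j"
  let ?h1 = "tup X [?p 1 1, ?p 1 2]" and ?h2 = "tup X [?p 2 1, ?p 2 2]"
  \<comment> \<open>The four components of the structure map of \<open>T(T(A))\<close>. The flip
    exchanges the two middle ones, each a first derivative, and the last one is symmetric by
    \<open>DC6\<close>.\<close>
  have pp: "?p 1 1 \<cdot> \<beta> = \<alpha> \<cdot> mar M (?p 1 1)" "?p 2 1 \<cdot> \<beta> = Dl \<alpha> (?p 1 1) (?p 2 1)"
    "?p 1 2 \<cdot> \<beta> = Dl \<alpha> (?p 1 1) (?p 1 2)"
    "?p 2 2 \<cdot> \<beta> = Dl2 \<alpha> (?p 1 1) (?p 1 2) (?p 2 1) (?p 2 2)"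
    using a a' \<beta> str1[OF a] by (simp_all add: assoc Dl_str S_comp Dl_comp comp_extend[OF str1(4)] comp_extend[OF str1(6)])
  have h: "?h1 \<in> Arr X" "Dom X ?h1 = ?C" "Cod X ?h1 = ?B"
    "?h2 \<in> Arr X" "Dom X ?h2 = ?C" "Cod X ?h2 = ?B" using a' by simp_all
  have p: "pj X 2 ?B 1 \<cdot> tc biT A = ?h1" "pj X 2 ?B 2 \<cdot> tc biT A = ?h2"
    using a' by simp_all
  have c1: "?h1 \<cdot> \<beta> = str 1 A \<alpha> \<cdot> mar M ?h1"
    by (rule str1_hom[OF a]) (use a a' h \<beta>(1-3) in \<open>simp_all only: pp tup2 tup2_comp pw_simps comp_simps le_refl one_le_numeral\<close>)
  have c2: "?h2 \<cdot> \<beta> = Dl (str 1 A \<alpha>) ?h1 ?h2"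
  proof (rule pw2_ext[of A])
    show "pj X 2 A 1 \<cdot> (?h2 \<cdot> \<beta>) = pj X 2 A 1 \<cdot> Dl (str 1 A \<alpha>) ?h1 ?h2"
      using a a' h \<beta>(1-3) pp(2) by (simp add: Dl_str assoc)
    have "pj X 2 A 2 \<cdot> (?h2 \<cdot> \<beta>) = Dl2 \<alpha> (?p 1 1) (?p 1 2) (?p 2 1) (?p 2 2)"
      using a' \<beta>(1-3) pp(4) by simp
    also have "\<dots> = Dl2 \<alpha> (?p 1 1) (?p 2 1) (?p 1 2) (?p 2 2)"
      using a' by (intro Dl2_commute) simp_all
    also have "\<dots> = pj X 2 A 2 \<cdot> Dl (str 1 A \<alpha>) ?h1 ?h2"
      using a a' h by (simp add: Dl_str)
    finally show "pj X 2 A 2 \<cdot> (?h2 \<cdot> \<beta>) = pj X 2 A 2 \<cdot> Dl (str 1 A \<alpha>) ?h1 ?h2" .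
  qed (use a a' h \<beta>(1-3) str1[OF a] in simp_all)
  have t: "tc biT A \<in> Arr X" "Dom X (tc biT A) = ?C" "Cod X (tc biT A) = ?C"
    using bi_tc[OF a'(1)] by simp_all
  have o: "?B \<in> Obj X" using a' by simp
  show ?thesis
    unfolding \<beta>_def[symmetric]
  proof (subst (2) \<beta>_def, rule str1_hom[OF a1 \<beta>(1-3) t])
    show "pj X 2 ?B 1 \<cdot> (tc biT A \<cdot> \<beta>) = str 1 A \<alpha> \<cdot> mar M (pj X 2 ?B 1 \<cdot> tc biT A)"
      using c1 comp_extend[OF p(1) _ t(1) _ \<beta>(1)] o \<beta> t by (simp add: p(1) del: biT_simps)
    show "pj X 2 ?B 2 \<cdot> (tc biT A \<cdot> \<beta>) = Dl (str 1 A \<alpha>) (pj X 2 ?B 1 \<cdot> tc biT A) (pj X 2 ?B 2 \<cdot> tc biT A)"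
      using c2 comp_extend[OF p(2) _ t(1) _ \<beta>(1)] o \<beta> t by (simp add: p del: biT_simps)
  qed
qed

lemma ALG_strict: "strict_tangent_functor (ALG X M) (algT X M) X biT forgetF"
proof (rule strict_tangent_functor.intro[OF ALG_category bi_tangent_category], unfold_locales)
  show "is_functor (ALG X M) X forgetF" by (rule forgetF_functor)
  show "f = g" if "f \<in> Arr (ALG X M)" "g \<in> Arr (ALG X M)" "Dom (ALG X M) f = Dom (ALG X M) g"
    "Cod (ALG X M) f = Cod (ALG X M) g" "ar forgetF f = ar forgetF g" for f g
    using that by (cases f; cases g) simp
  show "\<exists>k \<in> Hom (ALG X M) Z P. ar forgetF k = h"
    if P: "P \<in> Obj (ALG X M)" and Z: "Z \<in> Obj (ALG X M)"
      and q: "\<And>j. j \<in> J \<Longrightarrow> q j \<in> Hom (ALG X M) P Q" and g: "\<And>j. j \<in> J \<Longrightarrow> g j \<in> Hom (ALG X M) Z Q"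
      and h: "h \<in> Hom X (ob forgetF Z) (ob forgetF P)"
      and qg: "\<And>j. j \<in> J \<Longrightarrow> ar forgetF (q j) \<cdot> h = ar forgetF (g j)"
      and mono: "\<And>W x y. x \<in> Hom X W (ob forgetF P) \<Longrightarrow> y \<in> Hom X W (ob forgetF P) \<Longrightarrow>
        (\<And>j. j \<in> J \<Longrightarrow> ar forgetF (q j) \<cdot> x = ar forgetF (q j) \<cdot> y) \<Longrightarrow> x = y"
    for J :: "nat set" and P Q Z q g h
  proof -
    have h': "h \<in> Arr X" "Dom X h = fst Z" "Cod X h = fst P" using h by (simp_all add: Hom_iff)
    note p = algebraD(1-4)[of "fst P" "snd P", simplified, OF P[simplified]]
      and z = algebraD(1-4)[of "fst Z" "snd Z", simplified, OF Z[simplified]]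
    \<comment> \<open>The structure equation for h holds after each member of the family, because
      the members and their composites with h underlie morphisms; joint monicity cancels the
      members.\<close>
    have "h \<cdot> snd Z = snd P \<cdot> mar M h"
    proof (rule mono[of _ "mob M (fst Z)"])
      fix j assume j: "j \<in> J"
      obtain q' where q': "q j = (P, q', Q)" "q' \<in> Arr X" "Dom X q' = fst P" "Cod X q' = fst Q"
          "q' \<cdot> snd P = snd Q \<cdot> mar M q'" and Q: "Q \<in> algebras X M"
        using q[OF j] by (cases "q j") (auto simp: Hom_iff ALG_Arr_iff)
      obtain g' where g': "g j = (Z, g', Q)" "g' \<in> Arr X" "Dom X g' = fst Z" "Cod X g' = fst Q"
          "g' \<cdot> snd Z = snd Q \<cdot> mar M g'"
        using g[OF j] by (cases "g j") (auto simp: Hom_iff ALG_Arr_iff)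
      have e: "q' \<cdot> h = g'" using qg[OF j] q'(1) g'(1) by simp
      note qq = algebraD(1-4)[of "fst Q" "snd Q", simplified, OF Q]
      have "q' \<cdot> (h \<cdot> snd Z) = snd Q \<cdot> mar M g'"
        using comp_extend[OF e, of "snd Z"] q'(2-4) h' z g'(5) by simp
      also have "\<dots> = q' \<cdot> (snd P \<cdot> mar M h)"
        using q'(2-4) h' p z qq by (simp add: comp_extend[OF q'(5)] S_comp assoc flip: e)
      finally show "ar forgetF (q j) \<cdot> (h \<cdot> snd Z) = ar forgetF (q j) \<cdot> (snd P \<cdot> mar M h)"
        using q'(1) by simp
    qed (use h' p z in \<open>simp_all add: Hom_iff\<close>)
    then show ?thesis
      using h' P Z by (intro bexI[of _ "(Z, h, P)"]) (simp_all add: Hom_iff ALG_Arr_iff)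
  qed
  fix n :: nat and a assume a: "a \<in> Obj (ALG X M)"
  obtain A \<alpha> where A: "a = (A, \<alpha>)" "(A, \<alpha>) \<in> algebras X M" using a by (cases a) simp
  note a' = algebraD(1-4)[OF A(2)]
  have a1: "(pw X 2 A, str 1 A \<alpha>) \<in> algebras X M" "(pw X 3 A, str 2 A \<alpha>) \<in> algebras X M"
    using str_algebra[OF _ A(2), of 1] str_algebra[OF _ A(2), of 2] by simp_all
  have a2: "(pw X 2 (pw X 2 A), str 1 (pw X 2 A) (str 1 A \<alpha>)) \<in> algebras X M"
    using str_algebra[OF _ a1(1), of 1] by simp
  show "ob (tanTn (algT X M) n) a \<in> Obj (ALG X M)" if "1 \<le> n"
    using str_algebra[OF that A(2)] by (simp add: A(1))
  show "ob forgetF (ob (tanTn (algT X M) n) a) = ob (tanTn biT n) (ob forgetF a)"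
    by (simp add: A(1))
  show "tq (algT X M) n j a \<in> Hom (ALG X M) (ob (tanTn (algT X M) n) a) (ob (tanT (algT X M)) a)"
    if j: "1 \<le> j" "j \<le> n" for j
    using str_algebra[OF _ A(2), of n] a1(1) q_arrow[OF A(2) j] a' j
    by (simp add: Hom_iff ALG_Arr_iff A(1))
  show "tp (algT X M) a \<in> Hom (ALG X M) (ob (tanT (algT X M)) a) a"
    using a1 A(2) a' str1[OF A(2)] by (simp add: Hom_iff ALG_Arr_iff A(1))
  show "ts (algT X M) a \<in> Hom (ALG X M) (ob (tanTn (algT X M) 2) a) (ob (tanT (algT X M)) a)"
    using a1 A(2) a' s_arrow[OF A(2)] by (simp add: Hom_iff ALG_Arr_iff A(1))
  show "tz (algT X M) a \<in> Hom (ALG X M) a (ob (tanT (algT X M)) a)"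
    using a1 A(2) a' z_arrow[OF A(2)] by (simp add: Hom_iff ALG_Arr_iff A(1))
  show "tl (algT X M) a \<in> Hom (ALG X M) (ob (tanT (algT X M)) a) (ob (tanT (algT X M)) (ob (tanT (algT X M)) a))"
    using a1 a2 A(2) a' l_arrow[OF A(2)] by (simp add: Hom_iff ALG_Arr_iff A(1))
  show "tc (algT X M) a \<in> Hom (ALG X M) (ob (tanT (algT X M)) (ob (tanT (algT X M)) a))
      (ob (tanT (algT X M)) (ob (tanT (algT X M)) a))"
    using a2 bi_tc[OF a'(1)] c_arrow[OF A(2)] by (simp add: Hom_iff ALG_Arr_iff A(1) del: biT_simps(7))
next
  fix n :: nat and f assume n: "1 \<le> n" and f: "f \<in> Arr (ALG X M)"
  obtain A \<alpha> f' B \<beta> where f': "f = ((A, \<alpha>), f', (B, \<beta>))" by (cases f) auto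
  note g = f[unfolded f' ALG_Arr_iff, simplified]
  then have ab: "(A, \<alpha>) \<in> algebras X M" "(B, \<beta>) \<in> algebras X M" by simp_all
  show "ar (tanTn (algT X M) n) f \<in> Hom (ALG X M) (ob (tanTn (algT X M) n) (Dom (ALG X M) f))
      (ob (tanTn (algT X M) n) (Cod (ALG X M) f))"
    using g T_arrow[OF n ab, of f'] str_algebra[OF n ab(1)] str_algebra[OF n ab(2)]
    by (simp add: f' Hom_iff ALG_Arr_iff)
  show "ar forgetF (ar (tanTn (algT X M) n) f) = ar (tanTn biT n) (ar forgetF f)"
    by (simp add: f')
qed simp_all

lemma ALG_rosicky:
  assumes "additive_category X"
  shows "rosicky_tangent_category (ALG X M) (algT X M) (algN X M)"
    and "ar forgetF (algN X M a) = additive_category.biN X (ob forgetF a)"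
proof -
  interpret additive_category X by fact
  show N: "ar forgetF (algN X M a) = biN (ob forgetF a)" for a
    by (simp add: algN_def biN_def)
  show "rosicky_tangent_category (ALG X M) (algT X M) (algN X M)"
  proof (rule strict_tangent_functor.rosicky_tangent_category_lift[OF ALG_strict bi_rosicky _ N])
    fix a assume "a \<in> Obj (ALG X M)"
    then obtain A \<alpha> where A: "a = (A, \<alpha>)" "(A, \<alpha>) \<in> algebras X M" by (cases a) simp
    note a' = algebraD(1-4)[OF A(2)]
    have a1: "(pw X 2 A, str 1 A \<alpha>) \<in> algebras X M"
      using str_algebra[OF _ A(2), of 1] by simp
    \<comment> \<open>Additivity in the direction and the rule for direction zero pull the sign out
      of the derivative.\<close>
    have "Dl \<alpha> (pj X 2 A 1) (pj X 2 A 2) \<oplus> Dl \<alpha> (pj X 2 A 1) (neg X (pj X 2 A 2)) =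
        Dl \<alpha> (pj X 2 A 1) (pj X 2 A 2 \<oplus> neg X (pj X 2 A 2))"
      using a' by (intro Dl_add[symmetric]) simp_all
    also have "\<dots> = zero X (mob M (pw X 2 A)) A"
      using a' by (simp add: Dl_zero)
    finally have "neg X (Dl \<alpha> (pj X 2 A 1) (pj X 2 A 2)) = Dl \<alpha> (pj X 2 A 1) (neg X (pj X 2 A 2))"
      using a' by (intro neg(5)) simp_all
    then have "biN A \<cdot> str 1 A \<alpha> = str 1 A \<alpha> \<cdot> mar M (biN A)"
      by - (rule str1_hom[OF A(2)], use a' A(2) str1[OF A(2)] in \<open>simp_all add: biN_def neg_comp\<close>)
    then show "algN X M a \<in> Hom (ALG X M) (ob (tanT (algT X M)) a) (ob (tanT (algT X M)) a)"
      using a1 a' by (simp add: A(1) algN_def algTn_ob_eq Hom_iff ALG_Arr_iff biN_def)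
  qed
qed

section \<open>Free algebras\<close>

lemma free_algebra: "A \<in> Obj X \<Longrightarrow> (mob M A, mul M A) \<in> algebras X M"
  by (simp add: algebra_iff mul_unt_left mul_assoc)

lemma freeF_simps [simp]:
  "ob (freeF X M) A = (mob M A, mul M A)"
  "ar (freeF X M) f = ((mob M (Dom X f), mul M (Dom X f)), mar M f, (mob M (Cod X f), mul M (Cod X f)))"
  by (simp_all add: freeF_def)

lemma free_adjunction:
  "adjunction X (ALG X M) (freeF X M) forgetF (unt M) (\<lambda>a. ((mob M (fst a), mul M (fst a)), snd a, a))"
proof -
  have F: "is_functor X (ALG X M) (freeF X M)"
    unfolding is_functor_iff
    by (intro conjI ballI impI category_axioms ALG_category)
      (simp_all add: free_algebra ALG_Arr_iff mul_nat S_comp)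
  have 1: "nat_trans X X idF (forgetF \<circ>\<^sub>F freeF X M) (unt M)"
    using F forgetF_functor unfolding nat_trans_iff
    by (simp add: is_functor_idF[OF category_axioms] is_functor_compF unt_nat)
  have 2: "nat_trans (ALG X M) (ALG X M) (freeF X M \<circ>\<^sub>F forgetF) idF (\<lambda>a. ((mob M (fst a), mul M (fst a)), snd a, a))"
    unfolding nat_trans_iff
  proof (intro conjI ballI)
    fix f assume "f \<in> Arr (ALG X M)"
    then show "(\<lambda>a. ((mob M (fst a), mul M (fst a)), snd a, a)) (Cod (ALG X M) f) \<cdot>\<^bsub>ALG X M\<^esub>
        ar (freeF X M \<circ>\<^sub>F forgetF) f =
      ar idF f \<cdot>\<^bsub>ALG X M\<^esub> (\<lambda>a. ((mob M (fst a), mul M (fst a)), snd a, a)) (Dom (ALG X M) f)"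
      by (cases f) (simp add: ALG_Arr_iff)
  next
    fix a assume "a \<in> Obj (ALG X M)"
    then obtain A \<alpha> where A: "a = (A, \<alpha>)" "(A, \<alpha>) \<in> algebras X M" by (cases a) simp
    show "((mob M (fst a), mul M (fst a)), snd a, a) \<in> Arr (ALG X M)"
      using algebraD[OF A(2)] A by (simp add: ALG_Arr_iff free_algebra)
  qed (use is_functor_compF[OF forgetF_functor F] is_functor_idF[OF ALG_category] in simp_all)
  show ?thesis
    unfolding adjunction_def
    using F forgetF_functor 1 2 by (auto simp: mul_unt_right algebraD)
qed

end

section \<open>Adjoint lifting\<close>

context coCartesian_differential_monad
begin

text \<open>Forgetting structure, arrows \<open>A \<rightarrow> B\<^sup>n\<^sup>+\<^sup>1\<close>
  are morphisms to b from the free algebra on \<open>A\<^sup>n\<^sup>+\<^sup>1\<close>. Being a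
  morphism into \<open>T\<^sub>n(b)\<close> is an equation between two arrows out of
  \<open>S(A)\<close>; it transposes to equality of the composites with a parallel pair out of the
  free algebra on \<open>S(A)\<^sup>n\<^sup>+\<^sup>1\<close>, whose coequalizer represents.\<close>

lemma universal_arrow:
  assumes rc: "has_reflexive_coequalizers (ALG X M)" and n: "1 \<le> n" and a: "a \<in> Obj (ALG X M)"
  shows "\<exists>Q w. Q \<in> Obj (ALG X M) \<and> w \<in> Hom (ALG X M) a (ob (tanTn (algT X M) n) Q) \<and>
    (\<forall>b \<in> Obj (ALG X M). \<forall>k \<in> Hom (ALG X M) a (ob (tanTn (algT X M) n) b).
      \<exists>!h. h \<in> Hom (ALG X M) Q b \<and> ar (tanTn (algT X M) n) h \<cdot>\<^bsub>ALG X M\<^esub> w = k)"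
proof -
  let ?C = "ALG X M" and ?T = "tanTn (algT X M) n" and ?R = "pwF X (Suc n)"
  interpret C: category ?C by (rule ALG_category)
  interpret U: strict_tangent_functor ?C "algT X M" X biT forgetF by (rule ALG_strict)
  obtain A \<alpha> where A: "a = (A, \<alpha>)" "(A, \<alpha>) \<in> algebras X M" using a by (cases a) simp
  note a' = algebraD[OF A(2)]
  \<comment> \<open>\<open>J\<close> is the left adjoint, and \<zeta> below its unit, of the functor
    that sends an algebra to the \<open>Suc n\<close>-fold power of its carrier.\<close>
  define J where "J x = (mob M (pw X (Suc n) x), mul M (pw X (Suc n) x))" for x
  define \<zeta> where "\<zeta> x = ar ?R (unt M (pw X (Suc n) x)) \<cdot> pw_unit (Suc n) x" for x
  have R: "is_functor X X ?R" using pwF_functor[of "Suc n"] by simp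
  note Rc = functor_simps(6)[OF R]
  have adjJ: "adjunction X ?C (freeF X M \<circ>\<^sub>F ?R) (?R \<circ>\<^sub>F forgetF) \<zeta>
      (\<lambda>b. ((mob M (fst b), mul M (fst b)), snd b, b) \<cdot>\<^bsub>?C\<^esub> ar (freeF X M) (pw_counit (Suc n) (fst b)))"
    using adjunction_comp[OF pw_adjunction[of "Suc n"] free_adjunction] by (simp add: \<zeta>_def[abs_def])
  have J: "J x \<in> algebras X M" if "x \<in> Obj X" for x
    using that free_algebra by (simp add: J_def)
  have Jx: "ob (freeF X M \<circ>\<^sub>F ?R) x = J x" for x by (simp add: J_def)
  have z: "\<zeta> x \<in> Arr X" "Dom X (\<zeta> x) = x" "Cod X (\<zeta> x) = pw X (Suc n) (fst (J x))" if "x \<in> Obj X" for x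
    using that by (simp_all add: \<zeta>_def J_def)
  have zn: "\<zeta> (Cod X f) \<cdot> f = ar ?R (mar M (ar ?R f)) \<cdot> \<zeta> (Dom X f)" if "f \<in> Arr X" for f
  proof -
    have "nat_trans X X idF ((?R \<circ>\<^sub>F forgetF) \<circ>\<^sub>F (freeF X M \<circ>\<^sub>F ?R)) \<zeta>"
      using adjJ by (simp add: adjunction_def)
    from nat_trans_natural[OF this that refl] show ?thesis by simp
  qed
  have T: "is_functor ?C ?C ?T" using U.T_functor'[OF n] .
  text \<open>The two transposes whose coequalizer represents the algebra morphisms into \<open>T\<^sub>n\<close>.\<close>
  let ?SA = "mob M A"
  have o: "A \<in> Obj X" "?SA \<in> Obj X" using a' by simp_all
  \<comment> \<open>Composition with \<open>?u\<close> is, after transposition, precomposition with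
    \<alpha>.\<close>
  let ?u = "mar M (ar ?R \<alpha>)"
  have u: "(J ?SA, ?u, J A) \<in> Arr ?C"
    using functor_simps(3)[OF is_functor_compF[OF R], of ?C "freeF X M" \<alpha>] free_adjunction a'
    by (simp add: adjunction_def J_def)
  have JA: "(fst (J A), snd (J A)) \<in> algebras X M" using J[OF o(1)] by simp
  note strJ = str_simps[OF n JA]
  have TJ: "ob ?T (J A) = (pw X (Suc n) (fst (J A)), str n (fst (J A)) (snd (J A)))"
    using algT_simps(1)[of n "fst (J A)" "snd (J A)"] by simp
  let ?s = "str n (fst (J A)) (snd (J A))"
  \<comment> \<open>\<open>v\<close> encodes the other side of the equation: S applied to the unit
    \<zeta>, followed by the structure map of \<open>T\<^sub>n\<close> at the free algebra
    \<open>J A\<close>. As \<open>T\<^sub>n\<close> sends morphisms to morphisms, this generic case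
    serves every target algebra.\<close>
  have "\<exists>!h. h \<in> Hom ?C (ob (freeF X M \<circ>\<^sub>F ?R) ?SA) (J A) \<and> ar (?R \<circ>\<^sub>F forgetF) h \<cdot> \<zeta> ?SA = ?s \<cdot> mar M (\<zeta> A)"
    by (rule adjunction_ex1[OF adjJ]) (use J o z[OF o(1)] strJ in \<open>simp_all add: Hom_iff\<close>)
  then obtain v0 where v0: "v0 \<in> Hom ?C (J ?SA) (J A)" "ar ?R (ar forgetF v0) \<cdot> \<zeta> ?SA = ?s \<cdot> mar M (\<zeta> A)"
    unfolding Jx functor_sel(4) by (elim ex1E conjE) (rule that)
  obtain v where v1: "v0 = (J ?SA, v, J A)" using v0(1) by (cases v0) (simp add: Hom_iff)
  have v: "(J ?SA, v, J A) \<in> Arr ?C" and vz: "ar ?R v \<cdot> \<zeta> ?SA = ?s \<cdot> mar M (\<zeta> A)"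
    using v0 by (simp_all add: v1 Hom_iff)
  note v' = v[unfolded ALG_Arr_iff] and u' = u[unfolded ALG_Arr_iff]
  \<comment> \<open>The common section comes from \<open>unt M A\<close>: for \<open>?u\<close> by
    the unit law of \<alpha>, for \<open>v\<close> by the unit law of the algebra
    \<open>T\<^sub>n(J A)\<close>.\<close>
  let ?r = "mar M (ar ?R (unt M A))"
  have r: "(J A, ?r, J ?SA) \<in> Arr ?C"
    using functor_simps(3)[OF is_functor_compF[OF R], of ?C "freeF X M" "unt M A"] free_adjunction o
    by (simp add: adjunction_def J_def)
  note r' = r[unfolded ALG_Arr_iff]
  have "?u \<cdot> ?r = Ide X (fst (J A))"
    using a' functor_simps(2)[OF R, of A] by (simp add: J_def flip: S_comp Rc)
  then have ur: "(J ?SA, ?u, J A) \<cdot>\<^bsub>?C\<^esub> (J A, ?r, J ?SA) = Ide ?C (J A)" by simp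
  have vr: "(J ?SA, v, J A) \<cdot>\<^bsub>?C\<^esub> (J A, ?r, J ?SA) = Ide ?C (J A)"
  proof (rule adjunction_inj[OF adjJ o(1)])
    have "ar ?R (v \<cdot> ?r) \<cdot> \<zeta> A = ar ?R v \<cdot> (ar ?R ?r \<cdot> \<zeta> A)"
      using v' r' z[OF o(1)] by (simp add: Rc assoc)
    also have "ar ?R ?r \<cdot> \<zeta> A = \<zeta> ?SA \<cdot> unt M A"
      using zn[of "unt M A"] o by simp
    also have "ar ?R v \<cdot> (\<zeta> ?SA \<cdot> unt M A) = ?s \<cdot> (mar M (\<zeta> A) \<cdot> unt M A)"
      using v' o z strJ by (simp add: comp_extend[OF vz] assoc)
    also have "mar M (\<zeta> A) \<cdot> unt M A = unt M (pw X (Suc n) (fst (J A))) \<cdot> \<zeta> A"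
      using unt_nat[of "\<zeta> A"] z[OF o(1)] by simp
    also have "?s \<cdot> (unt M (pw X (Suc n) (fst (J A))) \<cdot> \<zeta> A) = \<zeta> A"
      using algebraD[OF str_algebra[OF n JA]] z[OF o(1)]
      by (simp add: comp_extend[OF algebraD(5)[OF str_algebra[OF n JA]]])
    finally have "ar ?R (v \<cdot> ?r) \<cdot> \<zeta> A = \<zeta> A" .
    moreover have "fst (J A) \<in> Obj X" using JA by (rule algebraD)
    ultimately show "ar (?R \<circ>\<^sub>F forgetF) ((J ?SA, v, J A) \<cdot>\<^bsub>?C\<^esub> (J A, ?r, J ?SA)) \<cdot> \<zeta> A =
      ar (?R \<circ>\<^sub>F forgetF) (Ide ?C (J A)) \<cdot> \<zeta> A"
      using functor_simps(2)[OF R, of "fst (J A)"] z[OF o(1)] by simp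
    show "(J ?SA, v, J A) \<cdot>\<^bsub>?C\<^esub> (J A, ?r, J ?SA) \<in> Hom ?C (ob (freeF X M \<circ>\<^sub>F ?R) A) (J A)"
      unfolding Jx by (rule C.comp_hom[of _ _ "J ?SA"]) (use v r in \<open>simp_all add: Hom_iff\<close>)
    show "Ide ?C (J A) \<in> Hom ?C (ob (freeF X M \<circ>\<^sub>F ?R) A) (J A)"
      unfolding Jx by (rule C.ide_hom) (use J o in simp)
  qed
  have uvr: "(J ?SA, ?u, J A) \<in> Hom ?C (J ?SA) (J A)" "(J ?SA, v, J A) \<in> Hom ?C (J ?SA) (J A)"
      "(J A, ?r, J ?SA) \<in> Hom ?C (J A) (J ?SA)"
    using u v r by (simp_all add: Hom_iff)
  have "\<exists>e. is_coequalizer ?C (J ?SA, ?u, J A) (J ?SA, v, J A) e"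
    by (rule rc[unfolded has_reflexive_coequalizers_def, rule_format, OF uvr(1,2)],
      rule bexI[OF _ uvr(3)]) (intro conjI ur vr)
  then obtain e where e: "is_equalizer (opcat ?C) (J ?SA, ?u, J A) (J ?SA, v, J A) e"
    unfolding is_coequalizer_def by blast
  note eq = e[unfolded is_equalizer_iff[OF category_opcat[OF ALG_category]] opcat_simps]
  obtain e' Q where e1: "e = (J A, e', Q)" using eq by (cases e) simp
  have eC: "(J A, e', Q) \<in> Arr ?C" using eq by (simp add: e1)
  note e' = eC[unfolded ALG_Arr_iff]
  have uv: "e' \<cdot> ?u = e' \<cdot> v" using eq by (simp add: e1)
  have fac: "\<exists>!k. k \<in> Hom ?C Q Z \<and> k \<cdot>\<^bsub>?C\<^esub> (J A, e', Q) = h"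
    if "Z \<in> Obj ?C" "h \<in> Hom ?C (J A) Z"
      "h \<cdot>\<^bsub>?C\<^esub> (J ?SA, ?u, J A) = h \<cdot>\<^bsub>?C\<^esub> (J ?SA, v, J A)" for Z h
    using eq that unfolding e1 ALG_simps(2,3) by blast
  have Q: "(fst Q, snd Q) \<in> algebras X M" using e' by simp
  note q = algebraD[OF Q]
  note strQ = str_simps[OF n Q]
  have TQ: "ob ?T Q = (pw X (Suc n) (fst Q), str n (fst Q) (snd Q))"
    using algT_simps(1)[of n "fst Q" "snd Q"] by simp
  let ?w = "ar ?R e' \<cdot> \<zeta> A"
  have w: "?w \<in> Arr X" "Dom X ?w = A" "Cod X ?w = pw X (Suc n) (fst Q)"
    using e' z[OF o(1)] by simp_all
  have Te: "ar ?R e' \<cdot> ?s = str n (fst Q) (snd Q) \<cdot> mar M (ar ?R e')"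
    using T_arrow[OF n JA Q, of e'] e' by simp
  \<comment> \<open>A morphism H out of \<open>J A\<close> coequalizes the pair exactly when its
    transpose is a morphism from a to \<open>T\<^sub>n\<close> of the target; each side is found by
    transposing one composite.\<close>
  have key: "H \<cdot> ?u = H \<cdot> v \<longleftrightarrow> (ar ?R H \<cdot> \<zeta> A) \<cdot> \<alpha> = str n B \<beta> \<cdot> mar M (ar ?R H \<cdot> \<zeta> A)"
    if b: "(B, \<beta>) \<in> algebras X M" and H: "(J A, H, (B, \<beta>)) \<in> Arr ?C" for H B \<beta>
  proof -
    note H' = H[unfolded ALG_Arr_iff] and b' = algebraD[OF b]
    have 1: "ar ?R (H \<cdot> ?u) \<cdot> \<zeta> ?SA = (ar ?R H \<cdot> \<zeta> A) \<cdot> \<alpha>"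
    proof -
      have "ar ?R (H \<cdot> ?u) \<cdot> \<zeta> ?SA = ar ?R H \<cdot> (ar ?R ?u \<cdot> \<zeta> ?SA)"
        using H' u' z[OF o(2)] by (simp add: Rc assoc)
      also have "ar ?R ?u \<cdot> \<zeta> ?SA = \<zeta> A \<cdot> \<alpha>"
        using zn[of \<alpha>] a' by simp
      finally show ?thesis using H' z[OF o(1)] a' by (simp add: assoc)
    qed
    have 2: "ar ?R (H \<cdot> v) \<cdot> \<zeta> ?SA = str n B \<beta> \<cdot> mar M (ar ?R H \<cdot> \<zeta> A)"
    proof -
      have "ar ?R (H \<cdot> v) \<cdot> \<zeta> ?SA = ar ?R H \<cdot> (?s \<cdot> mar M (\<zeta> A))"
        using H' v' z[OF o(2)] by (simp add: Rc assoc vz)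
      also have "\<dots> = str n B \<beta> \<cdot> (mar M (ar ?R H) \<cdot> mar M (\<zeta> A))"
        using H' z[OF o(1)] strJ str_simps[OF n b] b'
        by (simp add: comp_extend[OF T_arrow[OF n JA b, of H]] assoc)
      finally show ?thesis using H' z[OF o(1)] by (simp add: S_comp)
    qed
    have "H \<cdot> ?u = H \<cdot> v" if "ar ?R (H \<cdot> ?u) \<cdot> \<zeta> ?SA = ar ?R (H \<cdot> v) \<cdot> \<zeta> ?SA"
    proof -
      have "(J A, H, (B, \<beta>)) \<cdot>\<^bsub>?C\<^esub> (J ?SA, ?u, J A) = (J A, H, (B, \<beta>)) \<cdot>\<^bsub>?C\<^esub> (J ?SA, v, J A)"
      proof (rule adjunction_inj[OF adjJ o(2)])
        show "(J A, H, (B, \<beta>)) \<cdot>\<^bsub>?C\<^esub> (J ?SA, ?u, J A) \<in> Hom ?C (ob (freeF X M \<circ>\<^sub>F ?R) ?SA) (B, \<beta>)"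
          "(J A, H, (B, \<beta>)) \<cdot>\<^bsub>?C\<^esub> (J ?SA, v, J A) \<in> Hom ?C (ob (freeF X M \<circ>\<^sub>F ?R) ?SA) (B, \<beta>)"
          unfolding Jx using u v H by (auto intro!: C.comp_hom[of _ _ "J A"] simp: Hom_iff simp del: ALG_simps(5))
      qed (use that in simp)
      then show ?thesis by simp
    qed
    then show ?thesis unfolding 1[symmetric] 2[symmetric] by auto
  qed
  have whom: "(a, ?w, ob ?T Q) \<in> Hom ?C a (ob ?T Q)"
    using key[OF Q, of e'] uv eC w str_algebra[OF n Q] A by (simp add: Hom_iff ALG_Arr_iff TQ)
  have "\<exists>!h. h \<in> Hom ?C Q b \<and> ar ?T h \<cdot>\<^bsub>?C\<^esub> (a, ?w, ob ?T Q) = k"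
    if b: "b \<in> Obj ?C" and k: "k \<in> Hom ?C a (ob ?T b)" for b k
  proof -
    obtain B \<beta> where B: "b = (B, \<beta>)" "(B, \<beta>) \<in> algebras X M" using b by (cases b) simp
    obtain k' where k1: "k = (a, k', ob ?T b)" using k by (cases k) (simp add: Hom_iff)
    have k': "k' \<in> Arr X" "Dom X k' = A" "Cod X k' = pw X (Suc n) B" "k' \<cdot> \<alpha> = str n B \<beta> \<cdot> mar M k'"
      using k by (simp_all add: Hom_iff k1 ALG_Arr_iff A B)
    have "\<exists>!h. h \<in> Hom ?C (ob (freeF X M \<circ>\<^sub>F ?R) A) b \<and> ar (?R \<circ>\<^sub>F forgetF) h \<cdot> \<zeta> A = k'"
      by (rule adjunction_ex1[OF adjJ b]) (use k' B in \<open>simp add: Hom_iff\<close>)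
    then obtain h0 where h00: "h0 \<in> Hom ?C (J A) b \<and> ar (?R \<circ>\<^sub>F forgetF) h0 \<cdot> \<zeta> A = k'"
      and h0u: "\<And>h'. h' \<in> Hom ?C (J A) b \<and> ar (?R \<circ>\<^sub>F forgetF) h' \<cdot> \<zeta> A = k' \<Longrightarrow> h' = h0"
      unfolding Jx by (rule ex1E) (rule that, assumption, erule allE, erule mp)
    have h0: "h0 \<in> Hom ?C (J A) b" "ar (?R \<circ>\<^sub>F forgetF) h0 \<cdot> \<zeta> A = k'" using h00 by blast+
    obtain H where H1: "h0 = (J A, H, b)" using h0(1) by (cases h0) (simp add: Hom_iff)
    have H: "(J A, H, (B, \<beta>)) \<in> Arr ?C" "ar ?R H \<cdot> \<zeta> A = k'"
      using h0 by (simp_all add: H1 Hom_iff B)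
    have "H \<cdot> ?u = H \<cdot> v"
      using key[OF B(2) H(1)] H(2) k'(4) by simp
    then have ex: "\<exists>!k. k \<in> Hom ?C Q b \<and> k \<cdot>\<^bsub>?C\<^esub> (J A, e', Q) = h0"
      by (intro fac[OF b h0(1)]) (simp add: H1)
    \<comment> \<open>\<open>h0\<close> has transpose \<open>k'\<close>, so by uniqueness of
      transposes factoring k through \<open>?w\<close> and factoring \<open>h0\<close> through the
      coequalizer are the same condition.\<close>
    have iff: "ar ?T h \<cdot>\<^bsub>?C\<^esub> (a, ?w, ob ?T Q) = k \<longleftrightarrow> h \<cdot>\<^bsub>?C\<^esub> (J A, e', Q) = h0"
      if h: "h \<in> Hom ?C Q b" for h
    proof -
      obtain h' where h1: "h = (Q, h', b)" using h by (cases h) (simp add: Hom_iff)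
      have hC: "(Q, h', b) \<in> Arr ?C" using h by (simp add: h1 Hom_iff)
      note h' = hC[unfolded ALG_Arr_iff]
      have hw: "ar ?R h' \<cdot> ?w = ar ?R (h' \<cdot> e') \<cdot> \<zeta> A"
        using h' e' z[OF o(1)] by (simp add: Rc assoc)
      have "(Q, h', b) \<cdot>\<^bsub>?C\<^esub> (J A, e', Q) \<in> Hom ?C (J A) b"
        by (rule C.comp_hom[of _ _ Q]) (use hC eC in \<open>simp_all add: Hom_iff\<close>)
      then have "ar ?R (h' \<cdot> e') \<cdot> \<zeta> A = k' \<longleftrightarrow> (Q, h', b) \<cdot>\<^bsub>?C\<^esub> (J A, e', Q) = h0"
        using h0u[of "(Q, h', b) \<cdot>\<^bsub>?C\<^esub> (J A, e', Q)"] H(2) by (auto simp: H1)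
      then show ?thesis
        by (simp add: h1 k1 hw)
    qed
    show ?thesis using ex iff by metis
  qed
  moreover have "Q \<in> Obj ?C" using Q by simp
  ultimately show ?thesis using whom by blast
qed

text \<open>Representing objects are chosen for every algebra and every n; the uniqueness of
  factorizations makes the choice functorial.\<close>

lemma ALG_adjoint_data:
  assumes "has_reflexive_coequalizers (ALG X M)"
  shows "\<exists>L \<eta> \<epsilon>. adjoint_data (ALG X M) (algT X M) L \<eta> \<epsilon>"
proof -
  interpret U: strict_tangent_functor "ALG X M" "algT X M" X biT forgetF by (rule ALG_strict)
  have "\<exists>L \<eta> \<epsilon>. adjunction (ALG X M) (ALG X M) L (tanTn (algT X M) n) \<eta> \<epsilon>" if n: "1 \<le> n" for n
  proof -
    obtain l w where lw: "\<And>a. a \<in> Obj (ALG X M) \<Longrightarrow> l a \<in> Obj (ALG X M) \<and>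
        w a \<in> Hom (ALG X M) a (ob (tanTn (algT X M) n) (l a)) \<and>
        (\<forall>b \<in> Obj (ALG X M). \<forall>k \<in> Hom (ALG X M) a (ob (tanTn (algT X M) n) b).
          \<exists>!h. h \<in> Hom (ALG X M) (l a) b \<and> ar (tanTn (algT X M) n) h \<cdot>\<^bsub>ALG X M\<^esub> w a = k)"
      using universal_arrow[OF assms n] by metis
    have "\<exists>L \<epsilon>. adjunction (ALG X M) (ALG X M) L (tanTn (algT X M) n) w \<epsilon>"
    proof (rule adjunction_of_universal_arrows[OF U.T_functor'[OF n], where l = l])
      fix a b k assume b: "b \<in> Obj (ALG X M)" and k: "k \<in> Hom (ALG X M) a (ob (tanTn (algT X M) n) b)"
      show "\<exists>!h. h \<in> Hom (ALG X M) (l a) b \<and> ar (tanTn (algT X M) n) h \<cdot>\<^bsub>ALG X M\<^esub> w a = k"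
        using lw[OF category.hom_obj(1)[OF ALG_category k]] b k by blast
    qed (use lw in blast)+
    then show ?thesis by blast
  qed
  then have "\<forall>n. \<exists>L \<eta> \<epsilon>. 1 \<le> n \<longrightarrow> adjunction (ALG X M) (ALG X M) L (tanTn (algT X M) n) \<eta> \<epsilon>" by blast
  then obtain L \<eta> \<epsilon> where "\<forall>n. 1 \<le> n \<longrightarrow> adjunction (ALG X M) (ALG X M) (L n) (tanTn (algT X M) n) (\<eta> n) (\<epsilon> n)"
    by metis
  then show ?thesis unfolding adjoint_data_def by blast
qed

text \<open>Specializes the comparison to the self-adjunction of powers on the base, and then
  replaces the mates there by the explicit maps of \<open>opB\<close> and
  \<open>opBN\<close>.\<close>

lemma free_comparison:
  assumes data: "adjoint_data (ALG X M) (algT X M) L \<eta> \<epsilon>"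
  obtains \<tau> where "nat_iso X (ALG X M) (L 1 \<circ>\<^sub>F freeF X M) (freeF X M \<circ>\<^sub>F pwF X 2) \<tau>"
    and "strong_tangent_morphism (opcat X) (opB X) (opcat (ALG X M))
      (adjoint_tangent (ALG X M) (algT X M) L \<eta> \<epsilon>) (freeF X M) \<tau>"
    and "\<And>A. additive_category X \<Longrightarrow> A \<in> Obj X \<Longrightarrow>
      \<tau> A \<cdot>\<^bsub>ALG X M\<^esub> adjoint_neg (ALG X M) L \<eta> \<epsilon> (algN X M) (ob (freeF X M) A) =
      ar (freeF X M) (opBN X A) \<cdot>\<^bsub>ALG X M\<^esub> \<tau> A"
proof -
  interpret G: tangent_left_adjoint "ALG X M" "algT X M" X biT forgetF L \<eta> \<epsilon> "\<lambda>n. pwF X (Suc n)"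
    "\<lambda>n. pw_unit (Suc n)" "\<lambda>n. pw_counit (Suc n)" "freeF X M" "unt M" "\<lambda>a. ((mob M (fst a), mul M (fst a)), snd a, a)"
  proof (rule tangent_left_adjoint.intro[OF ALG_strict _ bi_adjoint])
    show "adjoint_tangent_structure (ALG X M) (algT X M) L \<eta> \<epsilon>"
      by (rule adjoint_tangent_structure.intro[OF strict_tangent_functor.tangent_category_lift[OF ALG_strict]],
        unfold_locales) (fact data)
  qed (unfold_locales, fact free_adjunction)
  obtain \<tau> where 1: "nat_iso X (ALG X M) (L 1 \<circ>\<^sub>F freeF X M) (freeF X M \<circ>\<^sub>F pwF X (Suc 1)) \<tau>"
    and 2: "\<And>A. A \<in> Obj X \<Longrightarrow> G.transp 1 A (\<tau> A) = G.E.flat 1 A (unt M (ob (pwF X (Suc 1)) A))"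
    by (rule G.obtain_comparison) (rule that)
  have "strong_tangent_morphism (opcat X) bi_op (opcat (ALG X M))
      (adjoint_tangent (ALG X M) (algT X M) L \<eta> \<epsilon>) (freeF X M) \<tau>"
    using G.\<tau>_strong[OF 1 2] by (simp add: G.A.Top_def G.E.Top_def)
  then have s: "strong_tangent_morphism (opcat X) (opB X) (opcat (ALG X M))
      (adjoint_tangent (ALG X M) (algT X M) L \<eta> \<epsilon>) (freeF X M) \<tau>"
    by (rule strong_tangent_morphism_cong[OF _ opB_tangent_category])
      (simp_all only: opcat_simps bi_op_eq, simp add: adjoint_tangent_def Let_def fun_eq_iff)
  have n: "\<tau> A \<cdot>\<^bsub>ALG X M\<^esub> adjoint_neg (ALG X M) L \<eta> \<epsilon> (algN X M) (ob (freeF X M) A) =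
      ar (freeF X M) (opBN X A) \<cdot>\<^bsub>ALG X M\<^esub> \<tau> A" if "additive_category X" "A \<in> Obj X" for A
    using G.\<tau>_n[OF 1 2 ALG_rosicky(1)[OF that(1)] additive_category.bi_rosicky[OF that(1)] ALG_rosicky(2)[OF that(1)] that(2)]
      additive_category.opBN_eq[OF that] by simp
  show ?thesis
    using that[OF _ s n] 1 by simp
qed

end

theorem theorem3p3p2:
  fixes X :: "('o, 'm) biprod_cat" and M :: "('o, 'm) diff_monad"
  assumes "coCartesian_differential_monad X M"
    and "has_reflexive_coequalizers (ALG X M)"
  shows
    "has_adjoint_tangent_structure (ALG X M) (algT X M) \<and>
     (additive_category X \<longrightarrow> rosicky_tangent_category (ALG X M) (algT X M) (algN X M)) \<and>
     (\<forall>L \<eta> \<epsilon>. adjoint_data (ALG X M) (algT X M) L \<eta> \<epsilon> \<longrightarrow>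
        tangent_category (opcat (ALG X M)) (adjoint_tangent (ALG X M) (algT X M) L \<eta> \<epsilon>) \<and>
        (additive_category X \<longrightarrow>
           rosicky_tangent_category (opcat (ALG X M)) (adjoint_tangent (ALG X M) (algT X M) L \<eta> \<epsilon>)
             (adjoint_neg (ALG X M) L \<eta> \<epsilon> (algN X M))) \<and>
        (has_finite_coproducts (ALG X M) \<longrightarrow>
           cartesian_tangent_category (opcat (ALG X M))
             (adjoint_tangent (ALG X M) (algT X M) L \<eta> \<epsilon>)) \<and>
        (\<exists>\<tau>.
           nat_iso X (ALG X M) (L 1 \<circ>\<^sub>F freeF X M) (freeF X M \<circ>\<^sub>F pwF X 2) \<tau> \<and>
           strong_tangent_morphism (opcat X) (opB X)
             (opcat (ALG X M)) (adjoint_tangent (ALG X M) (algT X M) L \<eta> \<epsilon>) (freeF X M) \<tau> \<and>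
           (additive_category X \<longrightarrow>
              strong_rosicky_tangent_morphism (opcat X) (opB X) (opBN X)
                (opcat (ALG X M)) (adjoint_tangent (ALG X M) (algT X M) L \<eta> \<epsilon>)
                (adjoint_neg (ALG X M) L \<eta> \<epsilon> (algN X M)) (freeF X M) \<tau>) \<and>
           (has_finite_coproducts (ALG X M) \<longrightarrow>
              strong_cartesian_tangent_morphism (opcat X) (opB X)
                (opcat (ALG X M)) (adjoint_tangent (ALG X M) (algT X M) L \<eta> \<epsilon>) (freeF X M) \<tau>)))"
proof -
  interpret coCartesian_differential_monad X M by fact
  let ?C = "ALG X M" and ?T = "algT X M"
  have T: "tangent_category ?C ?T"
    using strict_tangent_functor.tangent_category_lift[OF ALG_strict] .
  \<comment> \<open>The free functor is a left adjoint, so between opposite categories it preserves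
    products.\<close>
  have F: "preserves_finite_products (opcat X) (opcat ?C) (freeF X M)"
    unfolding preserves_finite_products_def
    using right_adjoint_product[OF adjunction_opcat[OF free_adjunction]] by blast
  \<comment> \<open>Stated for arbitrary adjoint data, since left adjoints are determined only up to
    isomorphism; that such data exist is shown separately from the coequalizers.\<close>
  have main: "tangent_category (opcat ?C) (adjoint_tangent ?C ?T L \<eta> \<epsilon>) \<and>
        (additive_category X \<longrightarrow>
           rosicky_tangent_category (opcat ?C) (adjoint_tangent ?C ?T L \<eta> \<epsilon>) (adjoint_neg ?C L \<eta> \<epsilon> (algN X M))) \<and>
        (has_finite_coproducts ?C \<longrightarrow> cartesian_tangent_category (opcat ?C) (adjoint_tangent ?C ?T L \<eta> \<epsilon>)) \<and>
        (\<exists>\<tau>. nat_iso X ?C (L 1 \<circ>\<^sub>F freeF X M) (freeF X M \<circ>\<^sub>F pwF X 2) \<tau> \<and>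
           strong_tangent_morphism (opcat X) (opB X) (opcat ?C) (adjoint_tangent ?C ?T L \<eta> \<epsilon>) (freeF X M) \<tau> \<and>
           (additive_category X \<longrightarrow>
              strong_rosicky_tangent_morphism (opcat X) (opB X) (opBN X) (opcat ?C) (adjoint_tangent ?C ?T L \<eta> \<epsilon>)
                (adjoint_neg ?C L \<eta> \<epsilon> (algN X M)) (freeF X M) \<tau>) \<and>
           (has_finite_coproducts ?C \<longrightarrow>
              strong_cartesian_tangent_morphism (opcat X) (opB X) (opcat ?C) (adjoint_tangent ?C ?T L \<eta> \<epsilon>) (freeF X M) \<tau>))"
    if data: "adjoint_data ?C ?T L \<eta> \<epsilon>" for L \<eta> \<epsilon>
  proof -
    interpret A: adjoint_tangent_structure ?C ?T L \<eta> \<epsilon>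
      by (rule adjoint_tangent_structure.intro[OF T], unfold_locales) (fact data)
    note 1 = A.tangent_category_Top[unfolded A.Top_def]
    have 2: "rosicky_tangent_category (opcat ?C) (adjoint_tangent ?C ?T L \<eta> \<epsilon>) (adjoint_neg ?C L \<eta> \<epsilon> (algN X M))"
      if "additive_category X"
      using A.rosicky_tangent_category_Top(1)[OF ALG_rosicky(1)[OF that], unfolded A.Top_def] .
    have 3: "cartesian_tangent_category (opcat ?C) (adjoint_tangent ?C ?T L \<eta> \<epsilon>)"
      if "has_finite_coproducts ?C"
      using A.cartesian_tangent_category_Top[OF that, unfolded A.Top_def] .
    obtain \<tau> where \<tau>: "nat_iso X ?C (L 1 \<circ>\<^sub>F freeF X M) (freeF X M \<circ>\<^sub>F pwF X 2) \<tau>"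
      and s: "strong_tangent_morphism (opcat X) (opB X) (opcat ?C) (adjoint_tangent ?C ?T L \<eta> \<epsilon>) (freeF X M) \<tau>"
      and n: "\<And>A. additive_category X \<Longrightarrow> A \<in> Obj X \<Longrightarrow>
        \<tau> A \<cdot>\<^bsub>?C\<^esub> adjoint_neg ?C L \<eta> \<epsilon> (algN X M) (ob (freeF X M) A) = ar (freeF X M) (opBN X A) \<cdot>\<^bsub>?C\<^esub> \<tau> A"
      by (rule free_comparison[OF data]) (rule that)
    have "strong_rosicky_tangent_morphism (opcat X) (opB X) (opBN X) (opcat ?C) (adjoint_tangent ?C ?T L \<eta> \<epsilon>)
        (adjoint_neg ?C L \<eta> \<epsilon> (algN X M)) (freeF X M) \<tau>" if "additive_category X"
      unfolding strong_rosicky_tangent_morphism_def opcat_simps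
      using additive_category.opB_rosicky[OF that] 2[OF that] s n[OF that] by blast
    moreover have "strong_cartesian_tangent_morphism (opcat X) (opB X) (opcat ?C) (adjoint_tangent ?C ?T L \<eta> \<epsilon>) (freeF X M) \<tau>"
      if "has_finite_coproducts ?C"
      unfolding strong_cartesian_tangent_morphism_def
      using opB_cartesian_tangent_category 3[OF that] s F by blast
    ultimately show ?thesis
      using 1 2 3 \<tau> s by blast
  qed
  moreover have "has_adjoint_tangent_structure ?C ?T"
    unfolding has_adjoint_tangent_structure_def using T ALG_adjoint_data[OF assms(2)] by blast
  ultimately show ?thesis
    using ALG_rosicky(1) by blast
qed

end
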